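(* Let $\mathcal{D}=(G,\chi,g,0)$ be a group datum of nilpotent type with $n\ge 2$ the order of $\chi(g)$, let $H=H_{\mathcal D}$, $R(\mathbb{K}G)=\mathbb{C}\otimes_{\mathbb Z}r(\mathbb{K}G)$, $a=[V_{\chi^{-1}}]$, and let $F_s$ be the Dickson polynomials and $\tau$, $i^*$, $b_{(i,j)}$, $I$, $\varepsilon$ be as in the context. The quadruple $(R(\mathbb{K}G)[z]/(F_n(a,z)),\phi,t,S)$ forms a bi-Frobenius algebra (with counit $\varepsilon$). The Frobenius homomorphism $\phi$, the comultiplication $\Delta$, the element $t$ and the antipode $S$ are respectively given, on the basis $\{\overline{[V_i]z^j}\mid 1\le i\le m,\ 0\le j\le n-2\}$, by $$\phi(\overline{[V_i]z^j})=\begin{cases}\binom{j}{j/2}\frac{2}{j+2}, & j\text{ is even and }[V_i]=a^{-\frac{j}{2}},\\ 0,&\text{otherwise},\end{cases}$$ $$\Delta(\overline{[V_i]z^j})=\sum_{k=0}^{\lfloor\frac{j}{2}\rfloor}\binom{j}{k}\frac{j+1-2k}{j+1-k}\,\frac{1}{\dim(V_i)F_{j+1-2k}(1,2\cos\frac{\pi}{n})}\ \overline{[V_{\tau^k(i)}]F_{j+1-2k}(a,z)}\otimes\overline{[V_{\tau^k(i)}]F_{j+1-2k}(a,z)},$$ $$t=\sum_{(i,j)\in I}b_{(i,j)}=\sum_{(i,j)\in I}\dim(V_i)F_j(1,2\cos\tfrac{\pi}{n})\,\overline{[V_i]F_j(a,z)},$$ $$S(\overline{[V_i]z^j})=\s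um_{k=0}^{\lfloor\frac{j}{2}\rfloor}\binom{j}{k}\frac{j+1-2k}{j+1-k}\,\overline{[V_{i^*}]a^{k-j}F_{j+1-2k}(a,z)}.$$
   Context: $\mathbb{K}$ is an algebraically closed field of characteristic zero; modules are finite dimensional left modules. Group datum: $G$ is a finite group, $g$ an element of the center of $G$, $\chi:G\to\mathbb{K}^\times$ a linear character, $\chi(g)$ has order $n\ge 2$. $H=H_{\mathcal D}$ is the Hopf algebra generated by $y$ and $G$ (containing $\mathbb{K}G$ as a subalgebra) with $y^n=0$, $yh=\chi(h)hy$, $\Delta(y)=y\otimes g+1\otimes y$, $\Delta(h)=h\otimes h$ ($h\in G$), with basis $\{y^ih\mid h\in G,\ 0\le i\le n-1\}$; its complexified stable Green ring $R_{st}(H)$ is identified with $R(\mathbb{K}G)[z]/(F_n(a,z))$. (The claim itself only involves the latter algebra.) $r(\mathbb{K}G)$ is the Green ring of $\mathbb{K}G$: the free abelian group on isomorphism classes of finite dimensional modules modulo $[M\oplus N]=[M]+[N]$, with product $[M][N]=[M\otimes_{\mathbb K} N]$. $V_1,\dots,V_m$ is a complete set of non-isomorphic simple $\mathbb{K}G$-modules with $V_1$ trivial (so $1=[V_1]$). $V_{\chi^{-1}}$ is the one-dimensional module with character $\chi^{-1}$; $a=[V_{\chi^{-1}}]$, which is invertible. $\tau$ is the permutation of $\{1,\dots,m\}$ with $V_{\chi^{-1}}\otimes V_i\cong V_{\tau(i)}$; $i^*$ is the index with $(V_i)^*\cong V_{i^*}$. Dickson polynomials: $F_1(y,z)=1$,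 $F_2(y,z)=z$, $F_i(y,z)=zF_{i-1}(y,z)-yF_{i-2}(y,z)$ for $i\ge3$. Overlines denote images in $R(\mathbb{K}G)[z]/(F_n(a,z))$. $\varepsilon:R(\mathbb{K}G)[z]/(F_n(a,z))\to\mathbb{C}$ is the algebra morphism with $\varepsilon([V_i])=\dim V_i$, $\varepsilon(z)=2\cos\frac{\pi}{n}$. $I=\{(i,j)\mid1\le i\le m,\ 1\le j\le n-1\}$ and $b_{(i,j)}=\dim(V_i)F_j(1,2\cos\frac{\pi}{n})\,\overline{[V_i]F_j(a,z)}$. Bi-Frobenius algebra (Doi–Takeuchi): a finite dimensional algebra and coalgebra $A$ over a field $F$ with $\phi\in A^*$, $t\in A$ and the map $S:A\to A$, $S(x)=\sum\phi(t_{1}x)t_{2}$ (where $\Delta(t)=\sum t_1\otimes t_2$), such that: the counit $\varepsilon$ is an algebra morphism and $1$ is group-like; $(A,\phi)$ is a Frobenius algebra (the form $(x,y)\mapsto\phi(xy)$ is nondegenerate); $(A,t)$ is a Frobenius coalgebra (the map $A^*\to A$, $f\mapsto\sum f(t_1)t_2$, is bijective); and $S$ is an anti-algebra and anti-coalgebra map (the antipode). *)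

theory Defs
  imports
    Complex_Main
    "HOL-Library.Poly_Mapping"
    "Jordan_Normal_Form.Matrix"
    "Jordan_Normal_Form.VS_Connect"
    "HOL-Algebra.Generated_Groups"
    "HOL-Algebra.Multiplicative_Group"
    "HOL-Algebra.QuotRing"
    "HOL-Algebra.IntRing"
    "HOL-Algebra.UnivPoly"
begin

section \<open>Abelian groups and rings given by generators and relations\<close>

text \<open>The free abelian group on the carrier of \<open>X\<close>, with the bilinear extension of the
  multiplication of \<open>X\<close>. It is the integral monoid ring when \<open>X\<close> is a monoid; otherwise only
  its additive structure is meaningful.\<close>

definition free_ring :: "('x, 'e) monoid_scheme \<Rightarrow> ('x \<Rightarrow>\<^sub>0 int) ring" where
  "free_ring X =
     \<lparr>carrier = {c. Poly_Mapping.keys c \<subseteq> carrier X},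
      monoid.mult = (\<lambda>c d. frag_extend (\<lambda>x. frag_extend (\<lambda>y. frag_of (x \<otimes>\<^bsub>X\<^esub> y)) d) c),
      one = frag_of \<one>\<^bsub>X\<^esub>, zero = 0, add = (+)\<rparr>"

definition rel_subgroup :: "('x, 'e) monoid_scheme \<Rightarrow> ('x \<Rightarrow>\<^sub>0 int) set \<Rightarrow> ('x \<Rightarrow>\<^sub>0 int) set" where
  "rel_subgroup X rels = generate (add_monoid (free_ring X)) rels"

definition presented :: "('x, 'e) monoid_scheme \<Rightarrow> ('x \<Rightarrow>\<^sub>0 int) set \<Rightarrow> ('x \<Rightarrow>\<^sub>0 int) set ring" where
  "presented X rels = free_ring X Quot rel_subgroup X rels"

definition generator ::
  "('x, 'e) monoid_scheme \<Rightarrow> ('x \<Rightarrow>\<^sub>0 int) set \<Rightarrow> 'x \<Rightarrow> ('x \<Rightarrow>\<^sub>0 int) set" where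
  "generator X rels x = rel_subgroup X rels +>\<^bsub>free_ring X\<^esub> frag_of x"

text \<open>The additive map into \<open>Q\<close> determined by its values on the generators (meaningful when
  \<open>f\<close> respects the relations).\<close>

definition presented_lift ::
  "('q, 'e) ring_scheme \<Rightarrow> ('x \<Rightarrow> 'q) \<Rightarrow> ('x \<Rightarrow>\<^sub>0 int) set \<Rightarrow> 'q" where
  "presented_lift Q f T =
     the_elem ((\<lambda>c. \<Oplus>\<^bsub>Q\<^esub>x\<in>Poly_Mapping.keys c. [Poly_Mapping.lookup c x] \<cdot>\<^bsub>Q\<^esub> f x) ` T)"


section \<open>Tensor products\<close>

definition with_smult :: "('a, 'e) ring_scheme \<Rightarrow> ('r \<Rightarrow> 'a \<Rightarrow> 'a) \<Rightarrow> ('r, 'a) module" where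
  "with_smult A s =
     \<lparr>carrier = carrier A, monoid.mult = monoid.mult A, one = one A, zero = zero A, add = add A, smult = s\<rparr>"

definition self_module :: "('a, 'e) ring_scheme \<Rightarrow> ('a, 'a) module" where
  "self_module K = with_smult K (monoid.mult K)"

definition tensor_rels ::
  "('r, 'e) ring_scheme \<Rightarrow> ('r, 'a, 'c) module_scheme \<Rightarrow> ('r, 'b, 'd) module_scheme
    \<Rightarrow> (('a \<times> 'b) \<Rightarrow>\<^sub>0 int) set" where
  "tensor_rels R M N =
     {frag_of (x \<oplus>\<^bsub>M\<^esub> x', y) - frag_of (x, y) - frag_of (x', y) | x x' y.
        x \<in> carrier M \<and> x' \<in> carrier M \<and> y \<in> carrier N}
   \<union> {frag_of (x, y \<oplus>\<^bsub>N\<^esub> y') - frag_of (x, y) - frag_of (x, y') | x y y'.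
        x \<in> carrier M \<and> y \<in> carrier N \<and> y' \<in> carrier N}
   \<union> {frag_of (r \<odot>\<^bsub>M\<^esub> x, y) - frag_of (x, r \<odot>\<^bsub>N\<^esub> y) | r x y.
        r \<in> carrier R \<and> x \<in> carrier M \<and> y \<in> carrier N}"

definition tensor_gen ::
  "('r, 'e) ring_scheme \<Rightarrow> ('r, 'a, 'c) module_scheme \<Rightarrow> ('r, 'b, 'd) module_scheme
    \<Rightarrow> 'a \<Rightarrow> 'b \<Rightarrow> (('a \<times> 'b) \<Rightarrow>\<^sub>0 int) set" where
  "tensor_gen R M N x y = generator (M \<times>\<times> N) (tensor_rels R M N) (x, y)"

definition tensor_lift ::
  "('q, 'e) ring_scheme \<Rightarrow> ('a \<Rightarrow> 'b \<Rightarrow> 'q) \<Rightarrow> (('a \<times> 'b) \<Rightarrow>\<^sub>0 int) set \<Rightarrow> 'q" where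
  "tensor_lift Q f = presented_lift Q (\<lambda>(x, y). f x y)"

text \<open>\<open>M \<otimes>\<^sub>R N\<close> for modules over a commutative ring \<open>R\<close>. If \<open>M\<close> and \<open>N\<close> are \<open>R\<close>-algebras,
  the ring structure is that of the tensor product of algebras,
  \<open>(x \<otimes> y)(x' \<otimes> y') = xx' \<otimes> yy'\<close>.\<close>

definition tensor ::
  "('r, 'e) ring_scheme \<Rightarrow> ('r, 'a, 'c) module_scheme \<Rightarrow> ('r, 'b, 'd) module_scheme
    \<Rightarrow> ('r, (('a \<times> 'b) \<Rightarrow>\<^sub>0 int) set) module" where
  "tensor R M N =
     (let Q = presented (M \<times>\<times> N) (tensor_rels R M N)
      in with_smult Q (\<lambda>r. tensor_lift Q (\<lambda>x y. tensor_gen R M N (r \<odot>\<^bsub>M\<^esub> x) y)))"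


section \<open>Bi-Frobenius algebras\<close>

locale fd_algebra = vectorspace K A + A: ring A
  for K :: "('k, 'e) ring_scheme" and A :: "('k, 'a, 'd) module_scheme" +
  assumes finite_dimensional: "fin_dim"
    and smult_mult_left:
      "\<lbrakk>k \<in> carrier K; x \<in> carrier A; y \<in> carrier A\<rbrakk>
        \<Longrightarrow> (k \<odot>\<^bsub>A\<^esub> x) \<otimes>\<^bsub>A\<^esub> y = k \<odot>\<^bsub>A\<^esub> (x \<otimes>\<^bsub>A\<^esub> y)"
    and smult_mult_right:
      "\<lbrakk>k \<in> carrier K; x \<in> carrier A; y \<in> carrier A\<rbrakk>
        \<Longrightarrow> x \<otimes>\<^bsub>A\<^esub> (k \<odot>\<^bsub>A\<^esub> y) = k \<odot>\<^bsub>A\<^esub> (x \<otimes>\<^bsub>A\<^esub> y)"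

text \<open>Coassociativity compares \<open>(\<Delta> \<otimes> id) \<circ> \<Delta>\<close> and \<open>(id \<otimes> \<Delta>) \<circ> \<Delta>\<close> in \<open>A \<otimes> (A \<otimes> A)\<close>; the
  inner \<open>tensor_lift\<close> on the left-hand side is the associativity isomorphism
  \<open>(u \<otimes> v) \<otimes> y \<mapsto> u \<otimes> (v \<otimes> y)\<close>.\<close>

locale coalgebra = vectorspace K A
  for K :: "('k, 'e) ring_scheme" and A :: "('k, 'a, 'd) module_scheme"
    and \<Delta> :: "'a \<Rightarrow> (('a \<times> 'a) \<Rightarrow>\<^sub>0 int) set" and \<epsilon> :: "'a \<Rightarrow> 'k" +
  assumes comult_hom: "\<Delta> \<in> LinearCombinations.module_hom K A (tensor K A A)"
    and counit_hom: "\<epsilon> \<in> LinearCombinations.module_hom K A (self_module K)"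
    and coassociative:
      "x \<in> carrier A \<Longrightarrow>
        (let AA = tensor K A A; AAA = tensor K A AA in
          tensor_lift AAA
            (\<lambda>x1 x2. tensor_lift AAA
               (\<lambda>u v. tensor_gen K A AA u (tensor_gen K A A v x2)) (\<Delta> x1)) (\<Delta> x)
          = tensor_lift AAA (\<lambda>x1 x2. tensor_gen K A AA x1 (\<Delta> x2)) (\<Delta> x))"
    and counit_left: "x \<in> carrier A \<Longrightarrow> tensor_lift A (\<lambda>x1 x2. \<epsilon> x1 \<odot>\<^bsub>A\<^esub> x2) (\<Delta> x) = x"
    and counit_right: "x \<in> carrier A \<Longrightarrow> tensor_lift A (\<lambda>x1 x2. \<epsilon> x2 \<odot>\<^bsub>A\<^esub> x1) (\<Delta> x) = x"

definition dual_space ::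
  "('k, 'e) ring_scheme \<Rightarrow> ('k, 'a, 'd) module_scheme \<Rightarrow> ('a \<Rightarrow> 'k) set" where
  "dual_space K A = LinearCombinations.module_hom K A (self_module K) \<inter> extensional (carrier A)"

locale bi_frobenius_algebra = fd_algebra K A + coalgebra K A \<Delta> \<epsilon>
  for K :: "('k, 'e) ring_scheme" and A :: "('k, 'a, 'd) module_scheme"
    and \<Delta> :: "'a \<Rightarrow> (('a \<times> 'a) \<Rightarrow>\<^sub>0 int) set" and \<epsilon> :: "'a \<Rightarrow> 'k"
    and \<phi> :: "'a \<Rightarrow> 'k" and t :: 'a and S :: "'a \<Rightarrow> 'a" +
  assumes \<phi>_hom: "\<phi> \<in> LinearCombinations.module_hom K A (self_module K)"
    and t_closed: "t \<in> carrier A"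
    and S_def: "x \<in> carrier A \<Longrightarrow>
      S x = tensor_lift A (\<lambda>t1 t2. \<phi> (t1 \<otimes>\<^bsub>A\<^esub> x) \<odot>\<^bsub>A\<^esub> t2) (\<Delta> t)"
    and counit_algebra_hom: "\<epsilon> \<in> Ring.ring_hom A K"
    and one_group_like: "\<Delta> \<one>\<^bsub>A\<^esub> = tensor_gen K A A \<one>\<^bsub>A\<^esub> \<one>\<^bsub>A\<^esub>"
    and nondegenerate_left:
      "\<lbrakk>x \<in> carrier A; \<And>y. y \<in> carrier A \<Longrightarrow> \<phi> (x \<otimes>\<^bsub>A\<^esub> y) = \<zero>\<^bsub>K\<^esub>\<rbrakk> \<Longrightarrow> x = \<zero>\<^bsub>A\<^esub>"
    and nondegenerate_right:
      "\<lbrakk>y \<in> carrier A; \<And>x. x \<in> carrier A \<Longrightarrow> \<phi> (x \<otimes>\<^bsub>A\<^esub> y) = \<zero>\<^bsub>K\<^esub>\<rbrakk> \<Longrightarrow> y = \<zero>\<^bsub>A\<^esub>"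
    and frobenius_coalgebra:
      "bij_betw (\<lambda>f. tensor_lift A (\<lambda>t1 t2. f t1 \<odot>\<^bsub>A\<^esub> t2) (\<Delta> t)) (dual_space K A) (carrier A)"
    and S_hom: "S \<in> LinearCombinations.module_hom K A A"
    and S_mult: "\<lbrakk>x \<in> carrier A; y \<in> carrier A\<rbrakk> \<Longrightarrow> S (x \<otimes>\<^bsub>A\<^esub> y) = S y \<otimes>\<^bsub>A\<^esub> S x"
    and S_one: "S \<one>\<^bsub>A\<^esub> = \<one>\<^bsub>A\<^esub>"
    and S_comult: "x \<in> carrier A \<Longrightarrow>
      \<Delta> (S x) = tensor_lift (tensor K A A) (\<lambda>x1 x2. tensor_gen K A A (S x2) (S x1)) (\<Delta> x)"
    and S_counit: "x \<in> carrier A \<Longrightarrow> \<epsilon> (S x) = \<epsilon> x"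


section \<open>Representations of a finite group and its Green ring\<close>

text \<open>A finite dimensional \<open>KG\<close>-module of dimension \<open>d\<close> is represented, after a choice of basis,
  by the map sending \<open>h \<in> G\<close> to the \<open>d \<times> d\<close> matrix of its action on \<open>K\<^sup>d\<close>; values outside the
  carrier of \<open>G\<close> are irrelevant. Changing the basis gives an isomorphic module.\<close>

type_synonym ('g, 'k) rep = "'g \<Rightarrow> 'k mat"

definition rep_dim :: "('g, 'e) monoid_scheme \<Rightarrow> ('g, 'k) rep \<Rightarrow> nat" where
  "rep_dim G M = dim_row (M \<one>\<^bsub>G\<^esub>)"

definition is_rep :: "('g, 'e) monoid_scheme \<Rightarrow> ('g, 'k::field) rep \<Rightarrow> bool" where
  "is_rep G M \<longleftrightarrow>
     (\<forall>h\<in>carrier G. M h \<in> carrier_mat (rep_dim G M) (rep_dim G M)) \<and>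
     M \<one>\<^bsub>G\<^esub> = 1\<^sub>m (rep_dim G M) \<and>
     (\<forall>h\<in>carrier G. \<forall>h'\<in>carrier G. M (h \<otimes>\<^bsub>G\<^esub> h') = M h * M h')"

definition rep_iso :: "('g, 'e) monoid_scheme \<Rightarrow> ('g, 'k::field) rep \<Rightarrow> ('g, 'k) rep \<Rightarrow> bool" where
  "rep_iso G M N \<longleftrightarrow>
     (\<exists>T. T \<in> carrier_mat (rep_dim G N) (rep_dim G M) \<and> invertible_mat T \<and>
          (\<forall>h\<in>carrier G. T * M h = N h * T))"

definition irreducible_rep :: "('g, 'e) monoid_scheme \<Rightarrow> ('g, 'k::field) rep \<Rightarrow> bool" where
  "irreducible_rep G M \<longleftrightarrow> is_rep G M \<and> rep_dim G M > 0 \<and>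
     (\<forall>W. VectorSpace.subspace class_ring W (module_vec TYPE('k) (rep_dim G M)) \<and>
          (\<forall>h\<in>carrier G. \<forall>w\<in>W. M h *\<^sub>v w \<in> W)
       \<longrightarrow> W = {0\<^sub>v (rep_dim G M)} \<or> W = carrier_vec (rep_dim G M))"

definition rep_sum :: "('g, 'k::field) rep \<Rightarrow> ('g, 'k) rep \<Rightarrow> ('g, 'k) rep" where
  "rep_sum M N = (\<lambda>h. four_block_mat (M h) (0\<^sub>m (dim_row (M h)) (dim_col (N h)))
                                     (0\<^sub>m (dim_row (N h)) (dim_col (M h))) (N h))"

definition kronecker :: "'k::semiring_1 mat \<Rightarrow> 'k mat \<Rightarrow> 'k mat" where
  "kronecker A B = mat (dim_row A * dim_row B) (dim_col A * dim_col B)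
     (\<lambda>(i, j). A $$ (i div dim_row B, j div dim_col B) * B $$ (i mod dim_row B, j mod dim_col B))"

definition rep_tensor :: "('g, 'k::field) rep \<Rightarrow> ('g, 'k) rep \<Rightarrow> ('g, 'k) rep" where
  "rep_tensor M N = (\<lambda>h. kronecker (M h) (N h))"

definition rep_dual :: "('g, 'e) monoid_scheme \<Rightarrow> ('g, 'k::field) rep \<Rightarrow> ('g, 'k) rep" where
  "rep_dual G M = (\<lambda>h. transpose_mat (M (inv\<^bsub>G\<^esub> h)))"

definition char_rep :: "('g \<Rightarrow> 'k::field) \<Rightarrow> ('g, 'k) rep" where
  "char_rep \<psi> = (\<lambda>h. mat 1 1 (\<lambda>_. \<psi> h))"

definition trivial_rep :: "('g, 'k::field) rep" where
  "trivial_rep = char_rep (\<lambda>_. 1)"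

definition iso_class :: "('g, 'e) monoid_scheme \<Rightarrow> ('g, 'k::field) rep \<Rightarrow> ('g, 'k) rep set" where
  "iso_class G M = {N. is_rep G N \<and> rep_iso G M N}"

definition iso_class_monoid :: "('g, 'e) monoid_scheme \<Rightarrow> ('g, 'k::field) rep set monoid" where
  "iso_class_monoid G =
     \<lparr>carrier = iso_class G ` {M. is_rep G M},
      monoid.mult = (\<lambda>X Y. \<Union>M\<in>X. \<Union>N\<in>Y. iso_class G (rep_tensor M N)),
      one = iso_class G trivial_rep\<rparr>"

definition green_rels :: "('g, 'e) monoid_scheme \<Rightarrow> (('g, 'k::field) rep set \<Rightarrow>\<^sub>0 int) set" where
  "green_rels G =
     {frag_of (iso_class G (rep_sum M N)) - frag_of (iso_class G M) - frag_of (iso_class G N) | M N.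
        is_rep G M \<and> is_rep G N}"

type_synonym ('g, 'k) green = "(('g, 'k) rep set \<Rightarrow>\<^sub>0 int) set"

definition green_ring :: "('g, 'e) monoid_scheme \<Rightarrow> ('g, 'k::field) green ring" where
  "green_ring G = presented (iso_class_monoid G) (green_rels G)"

definition green_class :: "('g, 'e) monoid_scheme \<Rightarrow> ('g, 'k::field) rep \<Rightarrow> ('g, 'k) green" where
  "green_class G M = generator (iso_class_monoid G) (green_rels G) (iso_class G M)"


section \<open>The complexified Green ring and its quotient by a Dickson polynomial\<close>

definition Z_module :: "('a, 'e) ring_scheme \<Rightarrow> (int, 'a) module" where
  "Z_module R = with_smult R (\<lambda>k x. [k] \<cdot>\<^bsub>R\<^esub> x)"

definition complexification ::
  "('a, 'e) ring_scheme \<Rightarrow> (int, ((complex \<times> 'a) \<Rightarrow>\<^sub>0 int) set) module" where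
  "complexification R = tensor \<Z> (Z_module (class_ring :: complex ring)) (Z_module R)"

definition complexification_gen ::
  "('a, 'e) ring_scheme \<Rightarrow> complex \<Rightarrow> 'a \<Rightarrow> ((complex \<times> 'a) \<Rightarrow>\<^sub>0 int) set" where
  "complexification_gen R = tensor_gen \<Z> (Z_module (class_ring :: complex ring)) (Z_module R)"

type_synonym ('g, 'k) cgreen = "((complex \<times> ('g, 'k) green) \<Rightarrow>\<^sub>0 int) set"

definition cgreen_ring :: "('g, 'e) monoid_scheme \<Rightarrow> (int, ('g, 'k::field) cgreen) module" where
  "cgreen_ring G = complexification (green_ring G)"

definition cgreen_class :: "('g, 'e) monoid_scheme \<Rightarrow> ('g, 'k::field) rep \<Rightarrow> ('g, 'k) cgreen" where
  "cgreen_class G M = complexification_gen (green_ring G) 1 (green_class G M)"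

text \<open>The value at \<open>0\<close> is a mere convention; the recursion starts at \<open>F\<^sub>1\<close> and \<open>F\<^sub>2\<close>.\<close>

fun dickson :: "('a, 'e) ring_scheme \<Rightarrow> 'a \<Rightarrow> 'a \<Rightarrow> nat \<Rightarrow> 'a" where
  "dickson R y z 0 = \<zero>\<^bsub>R\<^esub>"
| "dickson R y z (Suc 0) = \<one>\<^bsub>R\<^esub>"
| "dickson R y z (Suc (Suc 0)) = z"
| "dickson R y z (Suc (Suc (Suc i))) =
     (z \<otimes>\<^bsub>R\<^esub> dickson R y z (Suc (Suc i))) \<ominus>\<^bsub>R\<^esub> (y \<otimes>\<^bsub>R\<^esub> dickson R y z (Suc i))"

definition poly_const :: "('a, 'e) ring_scheme \<Rightarrow> 'a \<Rightarrow> (nat \<Rightarrow> 'a)" where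
  "poly_const R r = up_ring.monom (UP R) r 0"

definition poly_var :: "('a, 'e) ring_scheme \<Rightarrow> (nat \<Rightarrow> 'a)" where
  "poly_var R = up_ring.monom (UP R) \<one>\<^bsub>R\<^esub> 1"

definition dickson_poly :: "('a, 'e) ring_scheme \<Rightarrow> 'a \<Rightarrow> nat \<Rightarrow> (nat \<Rightarrow> 'a)" where
  "dickson_poly R a s = dickson (UP R) (poly_const R a) (poly_var R) s"

definition green_char :: "('g, 'e) monoid_scheme \<Rightarrow> ('g \<Rightarrow> 'k::field) \<Rightarrow> ('g, 'k) cgreen" where
  "green_char G \<chi> = cgreen_class G (char_rep (\<lambda>h. inverse (\<chi> h)))"

definition dickson_ideal ::
  "('g, 'e) monoid_scheme \<Rightarrow> ('g \<Rightarrow> 'k::field) \<Rightarrow> nat \<Rightarrow> (nat \<Rightarrow> ('g, 'k) cgreen) set" where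
  "dickson_ideal G \<chi> n = PIdl\<^bsub>UP (cgreen_ring G)\<^esub> (dickson_poly (cgreen_ring G) (green_char G \<chi>) n)"

definition residue_class ::
  "('g, 'e) monoid_scheme \<Rightarrow> ('g \<Rightarrow> 'k::field) \<Rightarrow> nat \<Rightarrow> (nat \<Rightarrow> ('g, 'k) cgreen)
    \<Rightarrow> (nat \<Rightarrow> ('g, 'k) cgreen) set" where
  "residue_class G \<chi> n p = dickson_ideal G \<chi> n +>\<^bsub>UP (cgreen_ring G)\<^esub> p"

definition stable_green_algebra ::
  "('g, 'e) monoid_scheme \<Rightarrow> ('g \<Rightarrow> 'k::field) \<Rightarrow> nat
    \<Rightarrow> (complex, (nat \<Rightarrow> ('g, 'k) cgreen) set) module" where
  "stable_green_algebra G \<chi> n =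
     (let R = cgreen_ring G; Q = UP R Quot dickson_ideal G \<chi> n
      in with_smult Q (\<lambda>c x.
           residue_class G \<chi> n (poly_const R (complexification_gen (green_ring G) c \<one>\<^bsub>green_ring G\<^esub>))
             \<otimes>\<^bsub>Q\<^esub> x))"


section \<open>Group data and simple modules\<close>

locale nilpotent_group_datum = group G
  for G :: "('g, 'e) monoid_scheme"
    and \<chi> :: "'g \<Rightarrow> 'k::{alg_closed_field, field_char_0}" and g :: 'g and n :: nat +
  assumes finite_carrier: "finite (carrier G)"
    and central: "g \<in> carrier G" "\<And>h. h \<in> carrier G \<Longrightarrow> g \<otimes>\<^bsub>G\<^esub> h = h \<otimes>\<^bsub>G\<^esub> g"
    and linear_character: "\<chi> \<in> hom G (units_of (class_ring :: 'k ring))"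
    and order_n: "group.ord (units_of (class_ring :: 'k ring)) (\<chi> g) = n" "n \<ge> 2"

definition complete_simple_reps ::
  "('g, 'e) monoid_scheme \<Rightarrow> nat \<Rightarrow> (nat \<Rightarrow> ('g, 'k::field) rep) \<Rightarrow> bool" where
  "complete_simple_reps G m V \<longleftrightarrow>
     (\<forall>i\<in>{1..m}. irreducible_rep G (V i)) \<and>
     (\<forall>i\<in>{1..m}. \<forall>j\<in>{1..m}. rep_iso G (V i) (V j) \<longrightarrow> i = j) \<and>
     (\<forall>M. irreducible_rep G M \<longrightarrow> (\<exists>i\<in>{1..m}. rep_iso G (V i) M))"

end

theory Submission
  imports Defs "Jordan_Normal_Form.Char_Poly"
begin

text \<open>
Let \<open>R\<close> be the complexified Green ring, with its basis \<open>v i = [V\<^sub>i]\<close> of simple classes, and let \<open>A\<close> be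
the quotient of \<open>R[z]\<close> by \<open>F\<^sub>n(a, z)\<close>. Each \<open>F\<^sub>j(a, z)\<close> is monic in \<open>z\<close> of degree \<open>j - 1\<close>, so division
with remainder by \<open>F\<^sub>n\<close> shows that the classes \<open>x (i, j)\<close> of \<open>v i F\<^sub>j(a, z)\<close> with \<open>1 \<le> i \<le> m\<close> and
\<open>1 \<le> j \<le> n - 1\<close> form a complex basis of \<open>A\<close> (\<open>D_independent\<close>, \<open>A_range\<close>, \<open>x_basis\<close>), and so do the
monomials \<open>v i z^j\<close> with \<open>j \<le> n - 2\<close> (\<open>vz_basis\<close>).

The basis \<open>x\<close> makes \<open>A\<close> look like the Grothendieck ring of a fusion category. Since \<open>a v i = v (\<tau> i)\<close>, the
Dickson recursion reads \<open>z x (i, j) = x (i, j + 1) + x (\<tau> i, j - 1)\<close>, with the convention that \<open>x (i, 0)\<close> and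
\<open>x (i, n)\<close> vanish (\<open>z_wD\<close>), and multiplication by \<open>v k\<close> is given by the fusion numbers of the group (\<open>w_wD\<close>).
There is an involution of the index set, \<open>dual_index (i, j) = (\<tau>\<^bsup>1 - j\<^esup> i\<^sup>*, j)\<close>, and the functional
\<open>\<phi>\<close> that picks the coefficient of \<open>1 = x (1, 1)\<close> satisfies \<open>\<phi> (x p x q) = 1\<close> if \<open>p = dual_index q\<close> and
\<open>0\<close> otherwise (\<open>pairing\<close>). So \<open>x p\<close> and \<open>x (dual_index p)\<close> are dual bases for the Frobenius form.

There is also a character \<open>\<epsilon>\<close> of \<open>A\<close>, with value
\<open>\<epsilon> (x (i, j)) = e (i, j) = dim V\<^sub>i sin (j\<pi>/n) / sin (\<pi>/n)\<close> on the basis. It is well defined because the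
quotient of sines vanishes at \<open>j = n\<close>, it is nonzero at all \<open>1 \<le> j \<le> n - 1\<close> (\<open>Fc_sin\<close>, \<open>Fc_nonzero\<close>), and it is
invariant under \<open>dual_index\<close>. Hence \<open>\<Delta> (x p) = e(p)\<^sup>-\<^sup>1 x p \<otimes> x p\<close> makes sense and turns the elements
\<open>e(p)\<^sup>-\<^sup>1 x p\<close> into a basis of group-like elements, so that the coalgebra axioms are immediate. With
\<open>t = \<Sum> e(p) x p\<close> one gets \<open>\<Delta> t = \<Sum> x p \<otimes> x p\<close>, and the prescribed antipode
\<open>y \<mapsto> \<Sum> \<phi>(x p y) x p\<close> is the linear map \<open>x p \<mapsto> x (dual_index p)\<close> by the duality of bases
(\<open>S_dual_bases\<close>). It is multiplicative because it turns multiplication by \<open>v k\<close> and \<open>z\<close> into multiplication by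
\<open>v (k\<^sup>*)\<close> and \<open>a\<^sup>-\<^sup>1 z\<close> (\<open>S_w\<close>, \<open>S_z\<close>, \<open>S_mult\<close>); it respects \<open>\<Delta>\<close> and \<open>\<epsilon>\<close> because
\<open>e\<close> is invariant. This gives \<open>bi_frobenius\<close>. All identities between linear maps are checked on the basis \<open>x\<close>.

The formulas on monomials come from the expansion
\<open>z^j = \<Sum>\<^sub>k catalan_coef j k a^k F\<^sub>j\<^sub>+\<^sub>1\<^sub>-\<^sub>2\<^sub>k(a, z)\<close>, whose coefficients are the ballot numbers
(\<open>monomial_expansion\<close>).

What remains is classical representation theory of the finite group. Maschke's theorem and Schur's lemma give
orthogonality of irreducible characters; therefore representations are isomorphic iff their characters agree
(\<open>rep_iso_iff_trace\<close>), multiplicities are additive invariants, and the \<open>v i\<close> form a basis (\<open>based_ring_RC\<close>).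
The needed symmetries of the fusion numbers are visible in their expression as sums of products of characters
(\<open>fusion_char\<close>). The Green ring, its complexification and tensor products are all given by generators and
relations: maps out of them are defined by respecting the relations, and compared on generators.
\<close>

section \<open>Additive maps and abelian groups given by generators and relations\<close>

text \<open>Homomorphisms of the underlying abelian groups. Rings, modules and the field of scalars all occur as source
or target, so only the additive parts of the structures are constrained.\<close>

definition additive_map ::
  "('a, 'e) ring_scheme \<Rightarrow> ('b, 'd) ring_scheme \<Rightarrow> ('a \<Rightarrow> 'b) \<Rightarrow> bool" where
  "additive_map P Q f \<longleftrightarrow> f \<in> carrier P \<rightarrow> carrier Q \<and>
     (\<forall>x\<in>carrier P. \<forall>y\<in>carrier P. f (x \<oplus>\<^bsub>P\<^esub> y) = f x \<oplus>\<^bsub>Q\<^esub> f y)"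

lemma additive_mapI:
  assumes "\<And>x. x \<in> carrier P \<Longrightarrow> f x \<in> carrier Q"
    "\<And>x y. x \<in> carrier P \<Longrightarrow> y \<in> carrier P \<Longrightarrow> f (x \<oplus>\<^bsub>P\<^esub> y) = f x \<oplus>\<^bsub>Q\<^esub> f y"
  shows "additive_map P Q f"
  using assms by (auto simp: additive_map_def)

lemma additive_map_closed: "additive_map P Q f \<Longrightarrow> x \<in> carrier P \<Longrightarrow> f x \<in> carrier Q"
  by (auto simp: additive_map_def)

lemma additive_map_add:
  "additive_map P Q f \<Longrightarrow> x \<in> carrier P \<Longrightarrow> y \<in> carrier P \<Longrightarrow> f (x \<oplus>\<^bsub>P\<^esub> y) = f x \<oplus>\<^bsub>Q\<^esub> f y"
  by (auto simp: additive_map_def)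

lemma additive_map_zero:
  assumes "abelian_group P" "abelian_group Q" "additive_map P Q f"
  shows "f \<zero>\<^bsub>P\<^esub> = \<zero>\<^bsub>Q\<^esub>"
proof -
  interpret P: abelian_group P by fact
  interpret Q: abelian_group Q by fact
  have "f \<zero>\<^bsub>P\<^esub> \<oplus>\<^bsub>Q\<^esub> f \<zero>\<^bsub>P\<^esub> = f \<zero>\<^bsub>P\<^esub>"
    using additive_map_add[OF assms(3), of "\<zero>\<^bsub>P\<^esub>" "\<zero>\<^bsub>P\<^esub>"] by simp
  then show ?thesis
    using additive_map_closed[OF assms(3), of "\<zero>\<^bsub>P\<^esub>"] Q.add.r_cancel_one' by fastforce
qed

lemma additive_map_neg:
  assumes "abelian_group P" "abelian_group Q" "additive_map P Q f" "x \<in> carrier P"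
  shows "f (\<ominus>\<^bsub>P\<^esub> x) = \<ominus>\<^bsub>Q\<^esub> f x"
proof -
  interpret P: abelian_group P by fact
  interpret Q: abelian_group Q by fact
  have "f (\<ominus>\<^bsub>P\<^esub> x) \<oplus>\<^bsub>Q\<^esub> f x = \<zero>\<^bsub>Q\<^esub>"
    using additive_map_add[OF assms(3), of "\<ominus>\<^bsub>P\<^esub> x" x] assms
    by (simp add: P.l_neg additive_map_zero)
  then show ?thesis
    using Q.minus_equality[of "f (\<ominus>\<^bsub>P\<^esub> x)" "f x"] additive_map_closed[OF assms(3)] assms(4) by simp
qed

lemma additive_map_minus:
  assumes "abelian_group P" "abelian_group Q" "additive_map P Q f" "x \<in> carrier P" "y \<in> carrier P"
  shows "f (x \<ominus>\<^bsub>P\<^esub> y) = f x \<ominus>\<^bsub>Q\<^esub> f y"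
proof -
  interpret P: abelian_group P by fact
  interpret Q: abelian_group Q by fact
  show ?thesis using assms by (simp add: P.minus_eq Q.minus_eq additive_map_add additive_map_neg)
qed

lemma free_ring_simps [simp]:
  "carrier (free_ring X) = {c. Poly_Mapping.keys c \<subseteq> carrier X}"
  "add (free_ring X) = (+)" "\<zero>\<^bsub>free_ring X\<^esub> = 0" "\<one>\<^bsub>free_ring X\<^esub> = frag_of \<one>\<^bsub>X\<^esub>"
  by (simp_all add: free_ring_def)

lemma abelian_group_free_ring: "abelian_group (free_ring X)"
proof (rule abelian_groupI)
  fix x assume "x \<in> carrier (free_ring X)"
  then show "\<exists>y\<in>carrier (free_ring X). y \<oplus>\<^bsub>free_ring X\<^esub> x = \<zero>\<^bsub>free_ring X\<^esub>"
    by (intro bexI[of _ "- x"]) auto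
next
  fix x y assume "x \<in> carrier (free_ring X)" "y \<in> carrier (free_ring X)"
  then show "x \<oplus>\<^bsub>free_ring X\<^esub> y \<in> carrier (free_ring X)"
    using keys_add[of x y] by auto
qed (simp_all add: add.assoc add.commute)

lemma free_ring_neg:
  assumes "x \<in> carrier (free_ring X)" shows "\<ominus>\<^bsub>free_ring X\<^esub> x = - x"
  using abelian_group.minus_equality[OF abelian_group_free_ring, of X "- x" x] assms by auto

text \<open>The additive extension of \<open>f\<close> from generators to the free abelian group.\<close>

definition lin_ext :: "('q, 'e) ring_scheme \<Rightarrow> ('x \<Rightarrow> 'q) \<Rightarrow> ('x \<Rightarrow>\<^sub>0 int) \<Rightarrow> 'q" where
  "lin_ext Q f c = (\<Oplus>\<^bsub>Q\<^esub>x\<in>Poly_Mapping.keys c. [Poly_Mapping.lookup c x] \<cdot>\<^bsub>Q\<^esub> f x)"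

context abelian_group
begin

lemma lin_ext_superset:
  assumes "f \<in> S \<rightarrow> carrier G" "Poly_Mapping.keys c \<subseteq> T" "T \<subseteq> S" "finite T"
  shows "lin_ext G f c = (\<Oplus>x\<in>T. [Poly_Mapping.lookup c x] \<cdot> f x)"
  unfolding lin_ext_def
proof (rule add.finprod_mono_neutral_cong_left)
  show "(\<lambda>x. [Poly_Mapping.lookup c x] \<cdot> f x) \<in> T \<rightarrow> carrier G"
    using assms(1,3) by (auto intro!: add.int_pow_closed)
  show "[Poly_Mapping.lookup c i] \<cdot> f i = \<zero>" if "i \<in> T - Poly_Mapping.keys c" for i
    using that by (simp add: in_keys_iff add_pow_def)
qed (use assms in auto)

lemma lin_ext_closed:
  assumes "f \<in> S \<rightarrow> carrier G" "Poly_Mapping.keys c \<subseteq> S" shows "lin_ext G f c \<in> carrier G"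
  unfolding lin_ext_def using assms by (auto intro!: finsum_closed)

lemma lin_ext_add:
  assumes f: "f \<in> S \<rightarrow> carrier G" and c: "Poly_Mapping.keys c \<subseteq> S" and d: "Poly_Mapping.keys d \<subseteq> S"
  shows "lin_ext G f (c + d) = lin_ext G f c \<oplus> lin_ext G f d"
proof -
  let ?T = "Poly_Mapping.keys c \<union> Poly_Mapping.keys d"
  have T: "finite ?T" "?T \<subseteq> S" using c d by auto
  have fT: "\<And>x. x \<in> ?T \<Longrightarrow> f x \<in> carrier G" using f T by blast
  have "lin_ext G f (c + d) = (\<Oplus>x\<in>?T. [Poly_Mapping.lookup (c + d) x] \<cdot> f x)"
    by (rule lin_ext_superset[OF f keys_add T(2,1)])
  also have "\<dots> = (\<Oplus>x\<in>?T. [Poly_Mapping.lookup c x] \<cdot> f x \<oplus> [Poly_Mapping.lookup d x] \<cdot> f x)"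
    by (rule finsum_cong') (auto simp: lookup_add add.int_pow_mult fT)
  also have "\<dots> = (\<Oplus>x\<in>?T. [Poly_Mapping.lookup c x] \<cdot> f x) \<oplus> (\<Oplus>x\<in>?T. [Poly_Mapping.lookup d x] \<cdot> f x)"
    by (rule finsum_addf) (auto simp: fT)
  finally show ?thesis using lin_ext_superset[OF f _ T(2,1)] by auto
qed

lemma lin_ext_zero [simp]: "lin_ext G f 0 = \<zero>"
  by (simp add: lin_ext_def)

lemma lin_ext_frag_of:
  assumes "f x \<in> carrier G" shows "lin_ext G f (frag_of x) = f x"
  using assms by (simp add: lin_ext_def)

lemma lin_ext_diff:
  assumes f: "f \<in> S \<rightarrow> carrier G" and c: "Poly_Mapping.keys c \<subseteq> S" and d: "Poly_Mapping.keys d \<subseteq> S"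
  shows "lin_ext G f (c - d) = lin_ext G f c \<ominus> lin_ext G f d"
proof -
  have k: "Poly_Mapping.keys (c - d) \<subseteq> S" using c d keys_diff[of c d] by blast
  have "lin_ext G f c = lin_ext G f (c - d) \<oplus> lin_ext G f d"
    using lin_ext_add[OF f k d] by simp
  then show ?thesis
    using lin_ext_closed[OF f k] lin_ext_closed[OF f d]
    by (simp add: minus_eq a_assoc r_neg)
qed

end

locale presentation =
  fixes X :: "('x, 'e) monoid_scheme" and rels :: "('x \<Rightarrow>\<^sub>0 int) set"
  assumes rels_closed: "rels \<subseteq> carrier (free_ring X)"
begin

abbreviation "F \<equiv> free_ring X"
abbreviation "N \<equiv> rel_subgroup X rels"
abbreviation "P \<equiv> presented X rels"
abbreviation cl where "cl c \<equiv> N +>\<^bsub>F\<^esub> c"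

sublocale F: abelian_group F by (rule abelian_group_free_ring)

sublocale N: abelian_subgroup N F
proof (rule abelian_subgroupI3[OF additive_subgroupI abelian_group_free_ring])
  show "subgroup N (add_monoid F)"
    unfolding rel_subgroup_def
    by (rule F.add.generate_is_subgroup) (use rels_closed in simp)
qed

lemma carrier_presented: "carrier P = cl ` carrier F"
  by (auto simp: presented_def FactRing_def A_RCOSETS_def')

lemma cl_closed: "c \<in> carrier F \<Longrightarrow> cl c \<in> carrier P"
  by (auto simp: carrier_presented)

lemma cl_add:
  assumes "c \<in> carrier F" "d \<in> carrier F" shows "cl c \<oplus>\<^bsub>P\<^esub> cl d = cl (c + d)"
proof -
  have "cl c <+>\<^bsub>F\<^esub> cl d = cl (c \<oplus>\<^bsub>F\<^esub> d)" by (rule N.a_rcos_sum) (use assms in auto)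
  then show ?thesis by (simp add: presented_def FactRing_def)
qed

lemma zero_presented: "\<zero>\<^bsub>P\<^esub> = cl 0"
proof -
  have "cl \<zero>\<^bsub>F\<^esub> = N" by (rule F.a_coset_add_zero) (use N.a_subset in auto)
  then show ?thesis by (simp add: presented_def FactRing_def)
qed

lemma abelian_group_presented: "abelian_group P"
proof (rule abelian_groupI)
  fix x y assume "x \<in> carrier P" "y \<in> carrier P"
  then show "x \<oplus>\<^bsub>P\<^esub> y \<in> carrier P"
    unfolding carrier_presented using cl_add F.a_closed by fastforce
next
  show "\<zero>\<^bsub>P\<^esub> \<in> carrier P" using zero_presented by (auto simp: carrier_presented)
next
  fix x y z assume "x \<in> carrier P" "y \<in> carrier P" "z \<in> carrier P"
  then show "x \<oplus>\<^bsub>P\<^esub> y \<oplus>\<^bsub>P\<^esub> z = x \<oplus>\<^bsub>P\<^esub> (y \<oplus>\<^bsub>P\<^esub> z)"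
    unfolding carrier_presented using F.a_closed by (auto simp: cl_add add.assoc simp del: free_ring_simps(1)) 
next
  fix x y assume "x \<in> carrier P" "y \<in> carrier P"
  then show "x \<oplus>\<^bsub>P\<^esub> y = y \<oplus>\<^bsub>P\<^esub> x"
    unfolding carrier_presented by (auto simp: cl_add add.commute)
next
  fix x assume "x \<in> carrier P"
  then show "\<zero>\<^bsub>P\<^esub> \<oplus>\<^bsub>P\<^esub> x = x"
    unfolding carrier_presented zero_presented by (auto simp: cl_add)
next
  fix x assume "x \<in> carrier P"
  then obtain c where c: "c \<in> carrier F" "x = cl c" unfolding carrier_presented by auto
  then show "\<exists>y\<in>carrier P. y \<oplus>\<^bsub>P\<^esub> x = \<zero>\<^bsub>P\<^esub>"
    by (intro bexI[of _ "cl (- c)"]) (auto simp: cl_add zero_presented carrier_presented)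
qed

sublocale P: abelian_group P by (rule abelian_group_presented)

lemma cl_diff:
  assumes "c \<in> carrier F" "d \<in> carrier F" shows "cl c \<ominus>\<^bsub>P\<^esub> cl d = cl (c - d)"
proof -
  have k: "- d \<in> carrier F" using assms by auto
  have "cl (- d) \<oplus>\<^bsub>P\<^esub> cl d = \<zero>\<^bsub>P\<^esub>"
    using cl_add[OF k assms(2)] by (simp add: zero_presented)
  then have "\<ominus>\<^bsub>P\<^esub> cl d = cl (- d)"
    using P.minus_equality cl_closed k assms by blast
  then show ?thesis using cl_add[OF assms(1) k] by (simp add: P.minus_eq)
qed

lemma cl_eqI:
  assumes "c \<in> carrier F" "d \<in> carrier F" "c - d \<in> N" shows "cl c = cl d"
proof -
  have "c \<in> cl d" unfolding a_r_coset_def' using assms(3) by (auto intro!: bexI[of _ "c - d"])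
  then show ?thesis using N.a_repr_independence' assms(2) by metis
qed

lemma rels_in: "r \<in> rels \<Longrightarrow> r \<in> N"
  unfolding rel_subgroup_def by (rule generate.incl)

lemma generator_closed: "x \<in> carrier X \<Longrightarrow> generator X rels x \<in> carrier P"
  unfolding generator_def by (rule cl_closed) simp

text \<open>Differences suffice here, since every element of the free group is built from generators by subtraction;
this form avoids a separate case for negatives.\<close>

lemma presented_induct [consumes 1, case_names zero diff generator]:
  assumes "u \<in> carrier P" and "Q \<zero>\<^bsub>P\<^esub>"
    and "\<And>u v. u \<in> carrier P \<Longrightarrow> v \<in> carrier P \<Longrightarrow> Q u \<Longrightarrow> Q v \<Longrightarrow> Q (u \<ominus>\<^bsub>P\<^esub> v)"
    and "\<And>x. x \<in> carrier X \<Longrightarrow> Q (generator X rels x)"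
  shows "Q u"
proof -
  obtain c where c: "c \<in> carrier F" "u = cl c" using assms(1) by (auto simp: carrier_presented)
  have "Poly_Mapping.keys c \<subseteq> carrier X" using c by simp
  then have "c \<in> carrier F \<and> Q (cl c)"
  proof (induction c rule: frag_induction)
    case zero
    show ?case using assms(2) by (simp add: zero_presented[symmetric])
  next
    case (one a) then show ?case using assms(4)[of a] by (simp add: generator_def)
  next
    case (diff x y)
    have "x - y \<in> carrier F" using diff keys_diff[of x y] by auto
    then show ?case using assms(3)[of "cl x" "cl y"] diff by (metis cl_diff cl_closed)
  qed
  then show ?thesis using c by simp
qed

text \<open>The uniqueness half of the universal property of a presented group.\<close>

lemma additive_map_eqI:
  assumes "abelian_group Q" "additive_map P Q f" "additive_map P Q h"
    and "\<And>x. x \<in> carrier X \<Longrightarrow> f (generator X rels x) = h (generator X rels x)"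
    and "u \<in> carrier P"
  shows "f u = h u"
  using assms(5)
  by (induction u rule: presented_induct)
    (simp_all add: additive_map_minus[OF abelian_group_presented assms(1)] assms
      additive_map_zero[OF abelian_group_presented assms(1)])

definition compatible :: "('q, 'd) ring_scheme \<Rightarrow> ('x \<Rightarrow> 'q) \<Rightarrow> bool" where
  "compatible Q f \<longleftrightarrow> f \<in> carrier X \<rightarrow> carrier Q \<and> (\<forall>r\<in>rels. lin_ext Q f r = \<zero>\<^bsub>Q\<^esub>)"

context
  fixes Q :: "('q, 'd) ring_scheme" and f :: "'x \<Rightarrow> 'q"
  assumes Q: "abelian_group Q" and f: "compatible Q f"
begin

lemma lin_ext_kills: "r \<in> N \<Longrightarrow> lin_ext Q f r = \<zero>\<^bsub>Q\<^esub>"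
proof -
  interpret Q: abelian_group Q by (rule Q)
  have fX: "f \<in> carrier X \<rightarrow> carrier Q" using f by (simp add: compatible_def)
  have car: "r \<in> carrier F" if "r \<in> N" for r using that N.a_subset by blast
  have neg: "lin_ext Q f (- r) = \<zero>\<^bsub>Q\<^esub>" if "r \<in> carrier F" "lin_ext Q f r = \<zero>\<^bsub>Q\<^esub>" for r
    using Q.lin_ext_diff[OF fX, of 0 r] that by (simp add: Q.minus_eq)
  assume "r \<in> N"
  then have "r \<in> generate (add_monoid F) rels" by (simp add: rel_subgroup_def)
  then show ?thesis
  proof (induction r rule: generate.induct)
    case one then show ?case by simp
  next
    case (incl h) then show ?case using f by (simp add: compatible_def)
  next
    case (inv h)
    then have "inv\<^bsub>add_monoid F\<^esub> h = - h"
      using free_ring_neg[of h X] rels_closed by (auto simp: a_inv_def)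
    then show ?case using neg inv f rels_closed by (auto simp: compatible_def)
  next
    case (eng h1 h2)
    have "h1 \<in> carrier F" "h2 \<in> carrier F" using eng car by (auto simp: rel_subgroup_def)
    then show ?case using eng Q.lin_ext_add[OF fX] by simp
  qed
qed

lemma presented_lift_cl: 
  assumes c: "c \<in> carrier F" shows "presented_lift Q f (cl c) = lin_ext Q f c"
proof -
  interpret Q: abelian_group Q by (rule Q)
  have fX: "f \<in> carrier X \<rightarrow> carrier Q" using f by (simp add: compatible_def)
  have "lin_ext Q f ` cl c = {lin_ext Q f c}"
  proof
    have "lin_ext Q f (r + c) = lin_ext Q f c" if "r \<in> N" for r
    proof -
      have "r \<in> carrier F" using that N.a_subset by blast
      then show ?thesis
        using that c lin_ext_kills Q.lin_ext_add[OF fX, of r c] Q.lin_ext_closed[OF fX, of c] by simp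
    qed
    then show "lin_ext Q f ` cl c \<subseteq> {lin_ext Q f c}"
      unfolding a_r_coset_def' by auto
    show "{lin_ext Q f c} \<subseteq> lin_ext Q f ` cl c"
      using N.a_rcos_self[OF c] by blast
  qed
  then show ?thesis by (simp add: presented_lift_def lin_ext_def[abs_def])
qed

text \<open>The existence half of the universal property: the lift is well defined on cosets because \<open>lin_ext\<close> kills
the subgroup generated by the relations.\<close>

lemma presented_lift_generator:
  "x \<in> carrier X \<Longrightarrow> presented_lift Q f (generator X rels x) = f x"
  using presented_lift_cl[of "frag_of x"] abelian_group.lin_ext_frag_of[OF Q, of f x] f
  by (auto simp: generator_def compatible_def)

lemma additive_presented_lift: "additive_map P Q (presented_lift Q f)"
proof -
  interpret Q: abelian_group Q by (rule Q)
  have fX: "f \<in> carrier X \<rightarrow> carrier Q" using f by (simp add: compatible_def)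
  show ?thesis
  proof (rule additive_mapI)
    fix x assume "x \<in> carrier P"
    then show "presented_lift Q f x \<in> carrier Q"
      unfolding carrier_presented using presented_lift_cl Q.lin_ext_closed[OF fX] by auto
  next
    fix x y assume "x \<in> carrier P" "y \<in> carrier P"
    then obtain c d where cd: "c \<in> carrier F" "d \<in> carrier F" "x = cl c" "y = cl d"
      unfolding carrier_presented by auto
    moreover have "c + d \<in> carrier F" using F.a_closed[OF cd(1,2)] by simp
    ultimately show "presented_lift Q f (x \<oplus>\<^bsub>P\<^esub> y) = presented_lift Q f x \<oplus>\<^bsub>Q\<^esub> presented_lift Q f y"
      using Q.lin_ext_add[OF fX, of c d] cl_add[OF cd(1,2)] presented_lift_cl by simp
  qed
qed

end

end

section \<open>Commutative rings given by generators and relations\<close>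

lemma frag_extend_fun_diff:
  "frag_extend (\<lambda>x. f x - h x) c = frag_extend f c - frag_extend h c"
  using subset_UNIV[of "Poly_Mapping.keys c"]
  by (induction c rule: frag_induction) (simp_all add: frag_extend_diff)

context
  fixes X :: "('x, 'e) monoid_scheme"
begin

abbreviation "fmult \<equiv> monoid.mult (free_ring X)"

lemma fmult_def: "fmult c d = frag_extend (\<lambda>x. frag_extend (\<lambda>y. frag_of (x \<otimes>\<^bsub>X\<^esub> y)) d) c"
  by (simp add: free_ring_def)

lemma fmult_zero [simp]: "fmult 0 d = 0" "fmult c 0 = 0"
  by (simp_all add: fmult_def frag_extend_eq_0)

lemma fmult_diff: "fmult (a - b) d = fmult a d - fmult b d" "fmult c (a - b) = fmult c a - fmult c b"
  by (simp_all add: fmult_def frag_extend_diff frag_extend_fun_diff)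

lemma fmult_add: "fmult (a + b) d = fmult a d + fmult b d" "fmult c (a + b) = fmult c a + fmult c b"
  using fmult_diff(1)[of a "- b" d] fmult_diff(1)[of 0 b d] fmult_diff(2)[of c a "- b"] fmult_diff(2)[of c 0 b]
  by simp_all

lemma fmult_neg: "fmult (- a) d = - fmult a d" "fmult c (- a) = - fmult c a"
  using fmult_diff(1)[of 0 a d] fmult_diff(2)[of c 0 a] by simp_all

lemma fmult_frag_of [simp]: "fmult (frag_of x) (frag_of y) = frag_of (x \<otimes>\<^bsub>X\<^esub> y)"
  by (simp add: fmult_def)

text \<open>Both sides of each ring law are biadditive, so all laws follow from the corresponding laws for the generators by
induction on the free group.\<close>

lemma cring_free_ring:
  assumes "comm_monoid X" shows "cring (free_ring X)"
proof -
  interpret X: comm_monoid X by fact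
  let ?C = "carrier X"
  have closed: "Poly_Mapping.keys (fmult c d) \<subseteq> ?C"
    if "Poly_Mapping.keys c \<subseteq> ?C" "Poly_Mapping.keys d \<subseteq> ?C" for c d
    using that(1)
  proof (induction c rule: frag_induction)
    case (one a)
    show ?case using that(2)
    proof (induction d rule: frag_induction)
      case (diff c d)
      show ?case
        unfolding fmult_diff using keys_diff[of "fmult (frag_of a) c" "fmult (frag_of a) d"] diff
        by blast
    qed (simp_all add: one)
  next
    case (diff a b)
    show ?case unfolding fmult_diff using keys_diff[of "fmult a d" "fmult b d"] diff by blast
  qed simp
  have comm: "fmult c d = fmult d c"
    if "Poly_Mapping.keys c \<subseteq> ?C" "Poly_Mapping.keys d \<subseteq> ?C" for c d
    using that(1)
  proof (induction c rule: frag_induction)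
    case (one a)
    show ?case using that(2)
      by (induction d rule: frag_induction) (simp_all add: fmult_diff one X.m_comm)
  qed (simp_all add: fmult_diff)
  have assoc: "fmult (fmult c d) e = fmult c (fmult d e)"
    if "Poly_Mapping.keys c \<subseteq> ?C" "Poly_Mapping.keys d \<subseteq> ?C" "Poly_Mapping.keys e \<subseteq> ?C" for c d e
    using that(1)
  proof (induction c rule: frag_induction)
    case (one x)
    show ?case using that(2)
    proof (induction d rule: frag_induction)
      case (one y)
      show ?case using that(3)
        by (induction e rule: frag_induction)
          (simp_all add: fmult_diff one \<open>x \<in> carrier X\<close> X.m_assoc)
    qed (simp_all add: fmult_diff)
  qed (simp_all add: fmult_diff)
  have one: "fmult (frag_of \<one>\<^bsub>X\<^esub>) c = c" if "Poly_Mapping.keys c \<subseteq> ?C" for c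
    using that by (induction c rule: frag_induction) (simp_all add: fmult_diff)
  show ?thesis
  proof (rule cringI[OF abelian_group_free_ring])
    show "comm_monoid (free_ring X)"
      by (rule comm_monoidI) (use closed comm assoc one in auto)
  qed (simp add: fmult_add)
qed

end

text \<open>If multiplying a relation by a generator gives a consequence of the relations, then the relations generate an
ideal of the monoid ring and not only a subgroup, so the presented group is a ring.\<close>

locale ring_presentation = presentation + X: comm_monoid X +
  assumes rels_absorb: "\<And>r x. r \<in> rels \<Longrightarrow> x \<in> carrier X \<Longrightarrow>
    frag_of x \<otimes>\<^bsub>free_ring X\<^esub> r \<in> rel_subgroup X rels"
begin

sublocale FR: cring F by (rule cring_free_ring) (rule X.comm_monoid_axioms)

lemma N_absorb:
  assumes c: "c \<in> carrier F" and r: "r \<in> N" shows "c \<otimes>\<^bsub>F\<^esub> r \<in> N"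
proof -
  have neg: "- r \<in> N" if "r \<in> N" for r
  proof -
    have "r \<in> carrier F" using that N.a_subset by blast
    then show ?thesis using N.a_inv_closed[OF that] free_ring_neg[of r X] by simp
  qed
  have diff: "r - s \<in> N" if "r \<in> N" "s \<in> N" for r s
    using N.a_closed[OF that(1) neg[OF that(2)]] by simp
  have gen: "frag_of x \<otimes>\<^bsub>F\<^esub> r \<in> N" if x: "x \<in> carrier X" for x
  proof -
    have "r \<in> generate (add_monoid F) rels" using r by (simp add: rel_subgroup_def)
    then show ?thesis
    proof (induction r rule: generate.induct)
      case one then show ?case using N.zero_closed by simp
    next
      case (incl h) then show ?case using rels_absorb x by simp
    next
      case (inv h)
      then have "inv\<^bsub>add_monoid F\<^esub> h = - h"
        using free_ring_neg[of h X] rels_closed by (auto simp: a_inv_def)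
      then show ?case using rels_absorb[OF inv x] neg by (simp add: fmult_neg)
    next
      case (eng h1 h2)
      then show ?case using N.a_closed by (simp add: fmult_add)
    qed
  qed
  have "Poly_Mapping.keys c \<subseteq> carrier X" using c by simp
  then show ?thesis
    by (induction c rule: frag_induction) (use gen diff N.zero_closed in \<open>simp_all add: fmult_diff\<close>)
qed

sublocale NI: ideal N F
proof (rule idealI)
  show "ring F" by (rule FR.ring_axioms)
  show "subgroup N (add_monoid F)" by (rule N.a_subgroup)
  fix a x assume a: "a \<in> N" "x \<in> carrier F"
  then have "a \<in> carrier F" using N.a_subset by blast
  then have "a \<otimes>\<^bsub>F\<^esub> x = x \<otimes>\<^bsub>F\<^esub> a" using a(2) by (rule FR.m_comm)
  moreover show "x \<otimes>\<^bsub>F\<^esub> a \<in> N" using a by (intro N_absorb)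
  ultimately show "a \<otimes>\<^bsub>F\<^esub> x \<in> N" by simp
qed

lemma cring_presented: "cring P"
  unfolding presented_def using NI.quotient_is_cring FR.is_cring by blast

lemma cl_mult: "c \<in> carrier F \<Longrightarrow> d \<in> carrier F \<Longrightarrow> cl c \<otimes>\<^bsub>P\<^esub> cl d = cl (c \<otimes>\<^bsub>F\<^esub> d)"
  using ring_hom_mult[OF NI.rcos_ring_hom, of c d] unfolding presented_def by presburger

lemma generator_mult:
  "x \<in> carrier X \<Longrightarrow> y \<in> carrier X \<Longrightarrow>
    generator X rels x \<otimes>\<^bsub>P\<^esub> generator X rels y = generator X rels (x \<otimes>\<^bsub>X\<^esub> y)"
  unfolding generator_def using cl_mult[of "frag_of x" "frag_of y"] by (simp only: fmult_frag_of) simp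

lemma one_presented: "\<one>\<^bsub>P\<^esub> = generator X rels \<one>\<^bsub>X\<^esub>"
  by (simp add: presented_def generator_def FactRing_def)

end

lemma with_smult_simps [simp]:
  "carrier (with_smult A s) = carrier A" "monoid.mult (with_smult A s) = monoid.mult A"
  "one (with_smult A s) = one A" "zero (with_smult A s) = zero A"
  "add (with_smult A s) = add A" "module.smult (with_smult A s) = s"
  by (simp_all add: with_smult_def)

lemma a_inv_with_smult [simp]: "a_inv (with_smult A s) = a_inv A"
  by (simp add: a_inv_def[abs_def] m_inv_def[abs_def] fun_eq_iff)

lemma a_minus_with_smult [simp]: "a_minus (with_smult A s) = a_minus A"
  by (simp add: a_minus_def[abs_def])

lemma finsum_with_smult [simp]: "finsum (with_smult A s) = finsum A"
  by (simp add: finsum_def[abs_def] finprod_def[abs_def] cong: if_cong)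

lemma add_pow_with_smult [simp]: "[(k::int)] \<cdot>\<^bsub>with_smult A s\<^esub> x = [k] \<cdot>\<^bsub>A\<^esub> x"
  by (simp add: add_pow_def int_pow_def nat_pow_def m_inv_def cong: if_cong)

lemma abelian_group_with_smult:
  assumes "abelian_group A" shows "abelian_group (with_smult A s)"
proof -
  interpret abelian_group A by fact
  show ?thesis
  proof (rule abelian_groupI)
    fix x assume "x \<in> carrier (with_smult A s)"
    then show "\<exists>y\<in>carrier (with_smult A s). y \<oplus>\<^bsub>with_smult A s\<^esub> x = \<zero>\<^bsub>with_smult A s\<^esub>"
      by (intro bexI[of _ "\<ominus>\<^bsub>A\<^esub> x"]) (simp_all add: l_neg)
  qed (simp_all add: a_assoc, simp add: a_comm)
qed

lemma cring_with_smult: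
  assumes "cring A" shows "cring (with_smult A s)"
proof -
  interpret cring A by fact
  show ?thesis
  proof (rule cringI[OF abelian_group_with_smult])
    show "comm_monoid (with_smult A s)"
      by (rule comm_monoidI) (simp_all add: m_assoc, simp add: m_comm)
  qed (simp_all add: l_distr abelian_group_axioms)
qed

lemma additive_map_with_smult [simp]:
  "additive_map (with_smult A s) Q f = additive_map A Q f"
  "additive_map P (with_smult A s) h = additive_map P A h"
  by (simp_all add: additive_map_def)

section \<open>Tensor products of modules\<close>

locale tensor_modules = R?: cring R + MM: Module.module R M + NN: Module.module R N
  for R :: "('r, 'e) ring_scheme" and M :: "('r, 'a, 'c) module_scheme"
    and N :: "('r, 'b, 'd) module_scheme"
begin

sublocale pres: presentation "M \<times>\<times> N" "tensor_rels R M N"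
proof
  have diff: "a - b \<in> carrier (free_ring (M \<times>\<times> N))"
    if "a \<in> carrier (free_ring (M \<times>\<times> N))" "b \<in> carrier (free_ring (M \<times>\<times> N))" for a b
    using that keys_diff[of a b] by auto
  have f: "frag_of (x, y) \<in> carrier (free_ring (M \<times>\<times> N))" if "x \<in> carrier M" "y \<in> carrier N" for x y
    using that by simp
  show "tensor_rels R M N \<subseteq> carrier (free_ring (M \<times>\<times> N))"
    unfolding tensor_rels_def
    by (intro Un_least subsetI; elim CollectE exE conjE; hypsubst)
      (intro diff f MM.a_closed NN.a_closed MM.smult_closed NN.smult_closed; assumption)+
qed

abbreviation "T \<equiv> tensor R M N"
abbreviation "gen \<equiv> tensor_gen R M N"

lemma tensor_simps:
  "carrier T = carrier pres.P" "add T = add pres.P" "zero T = zero pres.P"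
  "a_minus T = a_minus pres.P" "a_inv T = a_inv pres.P" "monoid.mult T = monoid.mult pres.P"
  "one T = one pres.P"
  by (simp_all add: tensor_def Let_def)

lemma additive_map_tensor:
  "additive_map T Q f = additive_map pres.P Q f" "additive_map Q T h = additive_map Q pres.P h"
  by (simp_all add: tensor_def Let_def)

lemma abelian_group_tensor: "abelian_group T"
  by (simp add: tensor_def Let_def abelian_group_with_smult pres.abelian_group_presented)

lemma gen_closed: "x \<in> carrier M \<Longrightarrow> y \<in> carrier N \<Longrightarrow> gen x y \<in> carrier T"
  by (simp add: tensor_gen_def tensor_simps pres.generator_closed)

text \<open>Pure tensors generate, so an additive map on the tensor product is determined by them.\<close>

lemma tensor_map_eqI:
  assumes "abelian_group Q" "additive_map T Q f" "additive_map T Q h"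
    and "\<And>x y. x \<in> carrier M \<Longrightarrow> y \<in> carrier N \<Longrightarrow> f (gen x y) = h (gen x y)"
    and "u \<in> carrier T"
  shows "f u = h u"
  by (rule pres.additive_map_eqI[OF assms(1)]) (use assms in \<open>simp_all add: tensor_simps tensor_gen_def additive_map_tensor split_paired_all\<close>)

lemma three_term_relation:
  assumes "x \<in> carrier (M \<times>\<times> N)" "y \<in> carrier (M \<times>\<times> N)" "w \<in> carrier (M \<times>\<times> N)"
    "frag_of x - frag_of y - frag_of w \<in> tensor_rels R M N"
  shows "generator (M \<times>\<times> N) (tensor_rels R M N) x =
    generator (M \<times>\<times> N) (tensor_rels R M N) y \<oplus>\<^bsub>pres.P\<^esub> generator (M \<times>\<times> N) (tensor_rels R M N) w"
proof -
  let ?F = "free_ring (M \<times>\<times> N)"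
  have k: "frag_of x \<in> carrier ?F" "frag_of y + frag_of w \<in> carrier ?F"
    "frag_of y \<in> carrier ?F" "frag_of w \<in> carrier ?F"
    using assms keys_add[of "frag_of y" "frag_of w"] by auto
  have "pres.cl (frag_of x) = pres.cl (frag_of y + frag_of w)"
    by (rule pres.cl_eqI[OF k(1,2)]) (use pres.rels_in[OF assms(4)] in \<open>simp add: algebra_simps\<close>)
  then show ?thesis using pres.cl_add[OF k(3,4)] by (simp add: generator_def)
qed

lemma gen_add_left:
  assumes "x \<in> carrier M" "x' \<in> carrier M" "y \<in> carrier N"
  shows "gen (x \<oplus>\<^bsub>M\<^esub> x') y = gen x y \<oplus>\<^bsub>T\<^esub> gen x' y"
  unfolding tensor_gen_def tensor_simps
  by (rule three_term_relation) (use assms in \<open>auto simp: tensor_rels_def\<close>)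

lemma gen_add_right:
  assumes "x \<in> carrier M" "y \<in> carrier N" "y' \<in> carrier N"
  shows "gen x (y \<oplus>\<^bsub>N\<^esub> y') = gen x y \<oplus>\<^bsub>T\<^esub> gen x y'"
  unfolding tensor_gen_def tensor_simps
  by (rule three_term_relation) (use assms in \<open>auto simp: tensor_rels_def\<close>)

lemma gen_middle:
  assumes "r \<in> carrier R" "x \<in> carrier M" "y \<in> carrier N"
  shows "gen (r \<odot>\<^bsub>M\<^esub> x) y = gen x (r \<odot>\<^bsub>N\<^esub> y)"
  unfolding tensor_gen_def generator_def
proof (rule pres.cl_eqI)
  have "frag_of (r \<odot>\<^bsub>M\<^esub> x, y) - frag_of (x, r \<odot>\<^bsub>N\<^esub> y) \<in> tensor_rels R M N"
    using assms by (auto simp: tensor_rels_def)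
  then show "frag_of (r \<odot>\<^bsub>M\<^esub> x, y) - frag_of (x, r \<odot>\<^bsub>N\<^esub> y) \<in> pres.N" by (rule pres.rels_in)
qed (use assms in auto)

text \<open>The maps that factor through the tensor product. The target is an abelian group, so scalars only pass from one
argument to the other.\<close>

definition balanced :: "('q, 'f) ring_scheme \<Rightarrow> ('a \<Rightarrow> 'b \<Rightarrow> 'q) \<Rightarrow> bool" where
  "balanced Q f \<longleftrightarrow>
     (\<forall>x\<in>carrier M. \<forall>y\<in>carrier N. f x y \<in> carrier Q) \<and>
     (\<forall>x\<in>carrier M. \<forall>x'\<in>carrier M. \<forall>y\<in>carrier N. f (x \<oplus>\<^bsub>M\<^esub> x') y = f x y \<oplus>\<^bsub>Q\<^esub> f x' y) \<and>
     (\<forall>x\<in>carrier M. \<forall>y\<in>carrier N. \<forall>y'\<in>carrier N. f x (y \<oplus>\<^bsub>N\<^esub> y') = f x y \<oplus>\<^bsub>Q\<^esub> f x y') \<and>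
     (\<forall>r\<in>carrier R. \<forall>x\<in>carrier M. \<forall>y\<in>carrier N. f (r \<odot>\<^bsub>M\<^esub> x) y = f x (r \<odot>\<^bsub>N\<^esub> y))"

lemma balancedI:
  assumes "\<And>x y. x \<in> carrier M \<Longrightarrow> y \<in> carrier N \<Longrightarrow> f x y \<in> carrier Q"
    "\<And>x x' y. x \<in> carrier M \<Longrightarrow> x' \<in> carrier M \<Longrightarrow> y \<in> carrier N \<Longrightarrow>
      f (x \<oplus>\<^bsub>M\<^esub> x') y = f x y \<oplus>\<^bsub>Q\<^esub> f x' y"
    "\<And>x y y'. x \<in> carrier M \<Longrightarrow> y \<in> carrier N \<Longrightarrow> y' \<in> carrier N \<Longrightarrow>
      f x (y \<oplus>\<^bsub>N\<^esub> y') = f x y \<oplus>\<^bsub>Q\<^esub> f x y'"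
    "\<And>r x y. r \<in> carrier R \<Longrightarrow> x \<in> carrier M \<Longrightarrow> y \<in> carrier N \<Longrightarrow>
      f (r \<odot>\<^bsub>M\<^esub> x) y = f x (r \<odot>\<^bsub>N\<^esub> y)"
  shows "balanced Q f"
  using assms by (simp add: balanced_def)

context
  fixes Q :: "('q, 'f) ring_scheme" and f :: "'a \<Rightarrow> 'b \<Rightarrow> 'q"
  assumes Q: "abelian_group Q" and f: "balanced Q f"
begin

text \<open>The three kinds of defining relations of the tensor product are the three kinds of identities of a balanced map.\<close>

lemma balanced_compatible: "pres.compatible Q (\<lambda>(x, y). f x y)"
proof -
  interpret Q: abelian_group Q by (rule Q)
  let ?f = "\<lambda>(x, y). f x y"
  have fX: "?f \<in> carrier (M \<times>\<times> N) \<rightarrow> carrier Q" using f by (auto simp: balanced_def)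
  have three: "lin_ext Q ?f (frag_of x - frag_of y - frag_of w) = ?f x \<ominus>\<^bsub>Q\<^esub> ?f y \<ominus>\<^bsub>Q\<^esub> ?f w"
    if "x \<in> carrier (M \<times>\<times> N)" "y \<in> carrier (M \<times>\<times> N)" "w \<in> carrier (M \<times>\<times> N)" for x y w
  proof -
    have k: "Poly_Mapping.keys (frag_of x - frag_of y) \<subseteq> carrier (M \<times>\<times> N)"
      "Poly_Mapping.keys (frag_of x) \<subseteq> carrier (M \<times>\<times> N)"
      "Poly_Mapping.keys (frag_of y) \<subseteq> carrier (M \<times>\<times> N)"
      "Poly_Mapping.keys (frag_of w) \<subseteq> carrier (M \<times>\<times> N)"
      using that keys_diff[of "frag_of x" "frag_of y"] by auto
    have "?f x \<in> carrier Q" "?f y \<in> carrier Q" "?f w \<in> carrier Q" using fX that by blast+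
    then show ?thesis
      using Q.lin_ext_diff[OF fX k(1,4)] Q.lin_ext_diff[OF fX k(2,3)] by (simp add: Q.lin_ext_frag_of)
  qed
  have two: "lin_ext Q ?f (frag_of x - frag_of y) = ?f x \<ominus>\<^bsub>Q\<^esub> ?f y"
    if "x \<in> carrier (M \<times>\<times> N)" "y \<in> carrier (M \<times>\<times> N)" for x y
  proof -
    have k: "Poly_Mapping.keys (frag_of x) \<subseteq> carrier (M \<times>\<times> N)"
      "Poly_Mapping.keys (frag_of y) \<subseteq> carrier (M \<times>\<times> N)"
      using that by auto
    have "?f x \<in> carrier Q" "?f y \<in> carrier Q" using fX that by blast+
    then show ?thesis
      using Q.lin_ext_diff[OF fX k] by (simp add: Q.lin_ext_frag_of)
  qed
  have canc: "u \<oplus>\<^bsub>Q\<^esub> w \<ominus>\<^bsub>Q\<^esub> u \<ominus>\<^bsub>Q\<^esub> w = \<zero>\<^bsub>Q\<^esub>" if "u \<in> carrier Q" "w \<in> carrier Q" for u w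
  proof -
    have "u \<oplus>\<^bsub>Q\<^esub> w \<ominus>\<^bsub>Q\<^esub> u = w" using that Q.a_comm[of u w] by (simp add: Q.minus_eq Q.a_assoc Q.r_neg)
    then show ?thesis using that by (simp add: Q.minus_eq Q.r_neg)
  qed
  have "lin_ext Q ?f r = \<zero>\<^bsub>Q\<^esub>" if "r \<in> tensor_rels R M N" for r
    using that unfolding tensor_rels_def
  proof (elim UnE CollectE exE conjE, goal_cases)
    case (1 x x' y)
    then show ?case using f canc[of "f x y" "f x' y"] by (simp add: three balanced_def)
  next
    case (2 x y y')
    then show ?case using f canc[of "f x y" "f x y'"] by (simp add: three balanced_def)
  next
    case (3 s x y)
    then show ?case using f Q.r_neg[of "f x (s \<odot>\<^bsub>N\<^esub> y)"] by (simp add: two balanced_def Q.minus_eq)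
  qed
  then show ?thesis using fX by (simp add: pres.compatible_def)
qed

lemma tensor_lift_gen: "x \<in> carrier M \<Longrightarrow> y \<in> carrier N \<Longrightarrow> tensor_lift Q f (gen x y) = f x y"
  using pres.presented_lift_generator[OF Q balanced_compatible, of "(x, y)"]
  by (simp add: tensor_lift_def tensor_gen_def)

lemma additive_tensor_lift: "additive_map T Q (tensor_lift Q f)"
  using pres.additive_presented_lift[OF Q balanced_compatible]
  by (simp only: tensor_lift_def additive_map_tensor)

end

text \<open>Commutativity of \<open>R\<close> enters here; it is what makes the tensor product an \<open>R\<close>-module.\<close>

lemma smult_balanced:
  assumes "r \<in> carrier R" shows "balanced T (\<lambda>x y. gen (r \<odot>\<^bsub>M\<^esub> x) y)"
proof (rule balancedI)
  fix s x y assume a: "s \<in> carrier R" "x \<in> carrier M" "y \<in> carrier N"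
  have "r \<odot>\<^bsub>M\<^esub> (s \<odot>\<^bsub>M\<^esub> x) = s \<odot>\<^bsub>M\<^esub> (r \<odot>\<^bsub>M\<^esub> x)"
    using a assms by (metis MM.smult_assoc1 R.m_comm)
  then show "gen (r \<odot>\<^bsub>M\<^esub> (s \<odot>\<^bsub>M\<^esub> x)) y = gen (r \<odot>\<^bsub>M\<^esub> x) (s \<odot>\<^bsub>N\<^esub> y)"
    using a assms gen_middle[of s "r \<odot>\<^bsub>M\<^esub> x" y] by simp
qed (use assms in \<open>simp_all add: gen_closed MM.smult_r_distr gen_add_left gen_add_right\<close>)

lemma smult_tensor_lift: "module.smult T r = tensor_lift T (\<lambda>x y. gen (r \<odot>\<^bsub>M\<^esub> x) y)"
  by (simp add: tensor_def Let_def tensor_lift_def presented_lift_def[abs_def])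

lemma smult_gen:
  assumes "r \<in> carrier R" "x \<in> carrier M" "y \<in> carrier N"
  shows "r \<odot>\<^bsub>T\<^esub> gen x y = gen (r \<odot>\<^bsub>M\<^esub> x) y"
  unfolding smult_tensor_lift
  by (rule tensor_lift_gen[OF abelian_group_tensor smult_balanced]) (use assms in auto)

lemma additive_smult: "r \<in> carrier R \<Longrightarrow> additive_map T T (module.smult T r)"
  unfolding smult_tensor_lift by (rule additive_tensor_lift[OF abelian_group_tensor smult_balanced])

lemma module_tensor: "Module.module R T"
proof -
  interpret T: abelian_group T by (rule abelian_group_tensor)
  note A = abelian_group_tensor
  note cl = additive_map_closed[OF additive_smult] additive_map_add[OF additive_smult]
  show ?thesis
  proof (rule Module.moduleI[OF R.is_cring A])
    fix a x assume a: "a \<in> carrier R" and x: "x \<in> carrier T"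
    show "a \<odot>\<^bsub>T\<^esub> x \<in> carrier T" using cl(1) a x by blast
    fix y assume y: "y \<in> carrier T"
    show "a \<odot>\<^bsub>T\<^esub> (x \<oplus>\<^bsub>T\<^esub> y) = a \<odot>\<^bsub>T\<^esub> x \<oplus>\<^bsub>T\<^esub> a \<odot>\<^bsub>T\<^esub> y" using cl(2) a x y by blast
  next
    fix a b x assume ab: "a \<in> carrier R" "b \<in> carrier R" and x: "x \<in> carrier T"
    show "(a \<oplus>\<^bsub>R\<^esub> b) \<odot>\<^bsub>T\<^esub> x = a \<odot>\<^bsub>T\<^esub> x \<oplus>\<^bsub>T\<^esub> b \<odot>\<^bsub>T\<^esub> x"
      by (rule tensor_map_eqI[OF A _ _ _ x])
        (use ab in \<open>auto intro!: additive_smult additive_mapI 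
          simp: cl smult_gen MM.smult_l_distr gen_add_left T.a_ac\<close>)
    show "(a \<otimes>\<^bsub>R\<^esub> b) \<odot>\<^bsub>T\<^esub> x = a \<odot>\<^bsub>T\<^esub> (b \<odot>\<^bsub>T\<^esub> x)"
      by (rule tensor_map_eqI[OF A _ _ _ x])
        (use ab in \<open>auto intro!: additive_smult additive_mapI 
          simp: cl smult_gen MM.smult_assoc1\<close>)
  next
    fix x assume x: "x \<in> carrier T"
    show "\<one>\<^bsub>R\<^esub> \<odot>\<^bsub>T\<^esub> x = x"
      by (rule tensor_map_eqI[OF A _ _ _ x])
        (auto intro!: additive_smult additive_mapI simp: smult_gen)
  qed
qed

lemma tensor_lift_smult:
  assumes Q: "Module.module R Q" and f: "balanced Q f"
    and lin: "\<And>r x y. r \<in> carrier R \<Longrightarrow> x \<in> carrier M \<Longrightarrow> y \<in> carrier N \<Longrightarrow> f (r \<odot>\<^bsub>M\<^esub> x) y = r \<odot>\<^bsub>Q\<^esub> f x y"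
    and r: "r \<in> carrier R" and u: "u \<in> carrier T"
  shows "tensor_lift Q f (r \<odot>\<^bsub>T\<^esub> u) = r \<odot>\<^bsub>Q\<^esub> tensor_lift Q f u"
proof -
  interpret Q: Module.module R Q by (rule Q)
  interpret T: Module.module R T by (rule module_tensor)
  note add = additive_tensor_lift[OF Q.abelian_group_axioms f]
  note cl = additive_map_closed[OF add] additive_map_add[OF add]
  show ?thesis
    by (rule tensor_map_eqI[OF Q.abelian_group_axioms _ _ _ u])
      (use r in \<open>auto intro!: additive_mapI 
        simp: cl Q.smult_r_distr T.smult_r_distr smult_gen tensor_lift_gen[OF Q.abelian_group_axioms f] lin\<close>)
qed

end

section \<open>Traces and sums of matrices\<close>

definition mat_trace :: "'a::comm_ring_1 mat \<Rightarrow> 'a" where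
  "mat_trace A = (\<Sum>i<dim_row A. A $$ (i, i))"

lemma mult_mat_index:
  assumes "A \<in> carrier_mat n k" "B \<in> carrier_mat k m" "i < n" "j < m"
  shows "(A * B) $$ (i, j) = (\<Sum>l<k. A $$ (i, l) * B $$ (l, j))"
  using assms by (simp add: scalar_prod_def lessThan_atLeast0)

lemma mat_trace_comm:
  assumes A: "A \<in> carrier_mat n k" and B: "B \<in> carrier_mat k n"
  shows "mat_trace (A * B) = mat_trace (B * A)"
proof -
  have "mat_trace (A * B) = (\<Sum>i<n. \<Sum>l<k. A $$ (i, l) * B $$ (l, i))"
    unfolding mat_trace_def using A B by (intro sum.cong) (simp_all add: mult_mat_index[OF A B] del: index_mult_mat(1))
  also have "\<dots> = (\<Sum>l<k. \<Sum>i<n. B $$ (l, i) * A $$ (i, l))"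
    by (subst sum.swap) (simp add: mult.commute)
  also have "\<dots> = mat_trace (B * A)"
    unfolding mat_trace_def using A B by (intro sum.cong) (simp_all add: mult_mat_index[OF B A] del: index_mult_mat(1))
  finally show ?thesis .
qed

lemma mat_trace_one [simp]: "mat_trace (1\<^sub>m n) = of_nat n"
  by (simp add: mat_trace_def)

lemma mat_trace_smult: "A \<in> carrier_mat n n \<Longrightarrow> mat_trace (c \<cdot>\<^sub>m A) = c * mat_trace A"
  by (auto simp: mat_trace_def sum_distrib_left)

lemma mat_trace_transpose: "A \<in> carrier_mat n n \<Longrightarrow> mat_trace (transpose_mat A) = mat_trace A"
  by (auto simp: mat_trace_def)

text \<open>The trace of \<open>T S\<close> equals that of \<open>S T\<close>, and in characteristic zero the trace of an identity matrix determines
its size.\<close>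

lemma inverse_mats_square:
  fixes T S :: "'a::field_char_0 mat"
  assumes "T \<in> carrier_mat q p" "S \<in> carrier_mat p q" "T * S = 1\<^sub>m q" "S * T = 1\<^sub>m p"
  shows "p = q"
proof -
  have "(of_nat q :: 'a) = of_nat p" using mat_trace_comm[OF assms(1,2)] assms(3,4) by simp
  then show ?thesis by simp
qed

definition mat_sum :: "nat \<Rightarrow> nat \<Rightarrow> 'h set \<Rightarrow> ('h \<Rightarrow> 'a::comm_ring_1 mat) \<Rightarrow> 'a mat" where
  "mat_sum n m S F = mat n m (\<lambda>(i, j). \<Sum>h\<in>S. F h $$ (i, j))"

lemma mat_sum_carrier [simp]: "mat_sum n m S F \<in> carrier_mat n m"
  by (simp add: mat_sum_def)

lemma mat_sum_cong: "(\<And>h. h \<in> S \<Longrightarrow> F h = F' h) \<Longrightarrow> mat_sum n m S F = mat_sum n m S F'"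
  by (simp add: mat_sum_def)

lemma mult_mat_sum:
  assumes A: "A \<in> carrier_mat k n" and F: "\<And>h. h \<in> S \<Longrightarrow> F h \<in> carrier_mat n m"
  shows "A * mat_sum n m S F = mat_sum k m S (\<lambda>h. A * F h)"
proof (rule eq_matI)
  fix i j assume "i < dim_row (mat_sum k m S (\<lambda>h. A * F h))" "j < dim_col (mat_sum k m S (\<lambda>h. A * F h))"
  then have ij: "i < k" "j < m" by (simp_all add: mat_sum_def)
  have "(A * mat_sum n m S F) $$ (i, j) = (\<Sum>l<n. \<Sum>h\<in>S. A $$ (i, l) * F h $$ (l, j))"
    using ij by (simp add: mult_mat_index[OF A mat_sum_carrier]) (simp add: mat_sum_def sum_distrib_left)
  also have "\<dots> = (\<Sum>h\<in>S. \<Sum>l<n. A $$ (i, l) * F h $$ (l, j))" by (rule sum.swap)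
  also have "\<dots> = (\<Sum>h\<in>S. (A * F h) $$ (i, j))"
    by (intro sum.cong refl mult_mat_index[OF A F ij, symmetric])
  finally show "(A * mat_sum n m S F) $$ (i, j) = mat_sum k m S (\<lambda>h. A * F h) $$ (i, j)"
    using ij by (simp add: mat_sum_def)
qed (use A in \<open>simp_all add: mat_sum_def\<close>)

lemma mat_sum_mult:
  assumes A: "A \<in> carrier_mat m k" and F: "\<And>h. h \<in> S \<Longrightarrow> F h \<in> carrier_mat n m"
  shows "mat_sum n m S F * A = mat_sum n k S (\<lambda>h. F h * A)"
proof (rule eq_matI)
  fix i j assume "i < dim_row (mat_sum n k S (\<lambda>h. F h * A))" "j < dim_col (mat_sum n k S (\<lambda>h. F h * A))"
  then have ij: "i < n" "j < k" by (simp_all add: mat_sum_def)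
  have "(mat_sum n m S F * A) $$ (i, j) = (\<Sum>l<m. \<Sum>h\<in>S. F h $$ (i, l) * A $$ (l, j))"
    using ij by (simp add: mult_mat_index[OF mat_sum_carrier A]) (simp add: mat_sum_def sum_distrib_right)
  also have "\<dots> = (\<Sum>h\<in>S. \<Sum>l<m. F h $$ (i, l) * A $$ (l, j))" by (rule sum.swap)
  also have "\<dots> = (\<Sum>h\<in>S. (F h * A) $$ (i, j))"
    by (intro sum.cong refl mult_mat_index[OF F A ij, symmetric])
  finally show "(mat_sum n m S F * A) $$ (i, j) = mat_sum n k S (\<lambda>h. F h * A) $$ (i, j)"
    using ij by (simp add: mat_sum_def)
qed (use A in \<open>simp_all add: mat_sum_def\<close>)

lemma mat_sum_const:
  assumes "A \<in> carrier_mat n m" shows "mat_sum n m S (\<lambda>_. A) = of_nat (card S) \<cdot>\<^sub>m A"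
  by (rule eq_matI) (use assms in \<open>simp_all add: mat_sum_def\<close>)

lemma mat_sum_reindex:
  assumes "bij_betw f S' S" shows "mat_sum n m S F = mat_sum n m S' (\<lambda>h. F (f h))"
  unfolding mat_sum_def using sum.reindex_bij_betw[OF assms]
  by (intro cong_mat) (simp_all add: sum.reindex_bij_betw[OF assms, symmetric])

lemma mat_trace_mat_sum:
  assumes "\<And>h. h \<in> S \<Longrightarrow> F h \<in> carrier_mat n n"
  shows "mat_trace (mat_sum n n S F) = (\<Sum>h\<in>S. mat_trace (F h))"
proof -
  have "mat_trace (mat_sum n n S F) = (\<Sum>i<n. \<Sum>h\<in>S. F h $$ (i, i))"
    by (simp add: mat_trace_def mat_sum_def)
  also have "\<dots> = (\<Sum>h\<in>S. \<Sum>i<n. F h $$ (i, i))" by (rule sum.swap)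
  also have "\<dots> = (\<Sum>h\<in>S. mat_trace (F h))"
    unfolding mat_trace_def using assms by (intro sum.cong refl) (auto dest: carrier_matD)
  finally show ?thesis .
qed

section \<open>Kronecker products\<close>

text \<open>Division with remainder identifies the index range of a Kronecker product with the product of the two ranges.\<close>

lemma sum_mult_div_mod:
  fixes f :: "nat \<Rightarrow> nat \<Rightarrow> 'a::comm_monoid_add"
  shows "(\<Sum>k<a * c. f (k div c) (k mod c)) = (\<Sum>i<a. \<Sum>j<c. f i j)"
proof -
  have "(\<Sum>k<a * c. f (k div c) (k mod c)) = (\<Sum>i<a. \<Sum>k=i * c..<i * c + c. f (k div c) (k mod c))"
    by (rule sum.nat_group[symmetric])
  also have "\<dots> = (\<Sum>i<a. \<Sum>j<c. f i j)"
  proof (rule sum.cong[OF refl])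
    fix i
    have "(\<Sum>k=i * c..<i * c + c. f (k div c) (k mod c)) = (\<Sum>j=0..<c. f ((j + i * c) div c) ((j + i * c) mod c))"
      using sum.shift_bounds_nat_ivl[of "\<lambda>k. f (k div c) (k mod c)" 0 "i * c" c] by (simp add: add.commute)
    also have "\<dots> = (\<Sum>j<c. f i j)"
      unfolding lessThan_atLeast0 by (intro sum.cong) simp_all
    finally show "(\<Sum>k=i * c..<i * c + c. f (k div c) (k mod c)) = (\<Sum>j<c. f i j)" .
  qed
  finally show ?thesis .
qed

lemma div_less_mult: "i < a * c \<Longrightarrow> i div c < (a::nat)"
  by (simp add: less_mult_imp_div_less)

lemma mod_less_mult: "i < a * c \<Longrightarrow> i mod c < (c::nat)"
  by (cases "c = 0") simp_all

lemma kronecker_carrier: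
  "A \<in> carrier_mat n m \<Longrightarrow> B \<in> carrier_mat p q \<Longrightarrow> kronecker A B \<in> carrier_mat (n * p) (m * q)"
  by (auto simp: kronecker_def)

lemma kronecker_mult:
  fixes A B C D :: "'a::comm_ring_1 mat"
  assumes A: "A \<in> carrier_mat n m" and B: "B \<in> carrier_mat m k"
    and C: "C \<in> carrier_mat p q" and D: "D \<in> carrier_mat q r"
  shows "kronecker (A * B) (C * D) = kronecker A C * kronecker B D"
proof (rule eq_matI)
  note K = kronecker_carrier[OF A C] kronecker_carrier[OF B D]
  fix i j assume "i < dim_row (kronecker A C * kronecker B D)" "j < dim_col (kronecker A C * kronecker B D)"
  then have ij: "i < n * p" "j < k * r" using K by auto
  note b = div_less_mult[OF ij(1)] mod_less_mult[OF ij(1)] div_less_mult[OF ij(2)] mod_less_mult[OF ij(2)]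
  have "(kronecker A C * kronecker B D) $$ (i, j) = (\<Sum>l<m * q. kronecker A C $$ (i, l) * kronecker B D $$ (l, j))"
    by (rule mult_mat_index[OF K ij])
  also have "\<dots> = (\<Sum>l<m * q. (A $$ (i div p, l div q) * C $$ (i mod p, l mod q)) *
      (B $$ (l div q, j div r) * D $$ (l mod q, j mod r)))"
    using A B C D ij by (intro sum.cong) (auto simp: kronecker_def)
  also have "\<dots> = (\<Sum>x<m. \<Sum>y<q. (A $$ (i div p, x) * C $$ (i mod p, y)) *
      (B $$ (x, j div r) * D $$ (y, j mod r)))"
    by (rule sum_mult_div_mod)
  also have "\<dots> = (\<Sum>x<m. A $$ (i div p, x) * B $$ (x, j div r)) * (\<Sum>y<q. C $$ (i mod p, y) * D $$ (y, j mod r))"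
    by (simp add: sum_product mult_ac)
  also have "\<dots> = (A * B) $$ (i div p, j div r) * (C * D) $$ (i mod p, j mod r)"
    by (simp add: mult_mat_index[OF A B b(1,3)] mult_mat_index[OF C D b(2,4)])
  also have "\<dots> = kronecker (A * B) (C * D) $$ (i, j)"
    using A B C D ij by (auto simp: kronecker_def)
  finally show "kronecker (A * B) (C * D) $$ (i, j) = (kronecker A C * kronecker B D) $$ (i, j)" ..
qed (use A B C D in \<open>auto simp: kronecker_def\<close>)

lemma kronecker_one: "kronecker (1\<^sub>m n) (1\<^sub>m p) = (1\<^sub>m (n * p) :: 'a::comm_ring_1 mat)"
proof (rule eq_matI)
  fix i j assume "i < dim_row (1\<^sub>m (n * p) :: 'a mat)" "j < dim_col (1\<^sub>m (n * p) :: 'a mat)"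
  then have ij: "i < n * p" "j < n * p" by simp_all
  have "i = j \<longleftrightarrow> i div p = j div p \<and> i mod p = j mod p"
    by (metis div_mult_mod_eq)
  then show "kronecker (1\<^sub>m n) (1\<^sub>m p) $$ (i, j) = (1\<^sub>m (n * p) :: 'a mat) $$ (i, j)"
    using ij div_less_mult[OF ij(1)] mod_less_mult[OF ij(1)] div_less_mult[OF ij(2)] mod_less_mult[OF ij(2)]
    by (auto simp: kronecker_def)
qed (simp_all add: kronecker_def)

text \<open>The diagonal of a Kronecker product runs through all products of diagonal entries.\<close>

lemma mat_trace_kronecker:
  assumes A: "A \<in> carrier_mat n n" and B: "B \<in> carrier_mat p p"
  shows "mat_trace (kronecker A B) = mat_trace A * mat_trace B"
proof -
  have "mat_trace (kronecker A B) = (\<Sum>k<n * p. A $$ (k div p, k div p) * B $$ (k mod p, k mod p))"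
    unfolding mat_trace_def using A B by (auto simp: kronecker_def)
  also have "\<dots> = (\<Sum>i<n. \<Sum>j<p. A $$ (i, i) * B $$ (j, j))" by (rule sum_mult_div_mod)
  also have "\<dots> = mat_trace A * mat_trace B"
    using A B by (auto simp: mat_trace_def sum_product)
  finally show ?thesis .
qed

section \<open>Idempotent matrices\<close>

lemma factorization_drop_zero_row:
  fixes B C :: "'a::comm_ring_1 mat"
  assumes B: "B \<in> carrier_mat n (Suc r)" and C: "C \<in> carrier_mat (Suc r) m"
    and k: "k < Suc r" and row: "\<And>j. j < m \<Longrightarrow> C $$ (k, j) = 0"
  shows "\<exists>B' C'. B' \<in> carrier_mat n r \<and> C' \<in> carrier_mat r m \<and> B * C = B' * C'"
proof -
  define s where "s = (\<lambda>l. if l < k then l else Suc l)"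
  have bij: "bij_betw s {..<r} ({..<Suc r} - {k})"
  proof (rule bij_betw_byWitness[where f' = "\<lambda>l. if l < k then l else l - 1"])
  qed (use k in \<open>auto simp: s_def\<close>)
  have sl: "l < r \<Longrightarrow> s l < Suc r" for l by (simp add: s_def)
  define B' where "B' = mat n r (\<lambda>(i, l). B $$ (i, s l))"
  define C' where "C' = mat r m (\<lambda>(l, j). C $$ (s l, j))"
  have car: "B' \<in> carrier_mat n r" "C' \<in> carrier_mat r m" by (simp_all add: B'_def C'_def)
  have "B * C = B' * C'"
  proof (rule eq_matI)
    fix i j assume "i < dim_row (B' * C')" "j < dim_col (B' * C')"
    then have ij: "i < n" "j < m" by (simp_all add: B'_def C'_def)
    have "(B * C) $$ (i, j) = (\<Sum>l<Suc r. B $$ (i, l) * C $$ (l, j))"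
      by (rule mult_mat_index[OF B C ij])
    also have "\<dots> = (\<Sum>l\<in>{..<Suc r} - {k}. B $$ (i, l) * C $$ (l, j))"
      using k row[OF ij(2)] by (intro sum.mono_neutral_right) auto
    also have "\<dots> = (\<Sum>l<r. B $$ (i, s l) * C $$ (s l, j))"
      by (rule sum.reindex_bij_betw[OF bij, symmetric])
    also have "\<dots> = (B' * C') $$ (i, j)"
      using ij by (simp add: mult_mat_index[OF car ij]) (simp add: B'_def C'_def)
    finally show "(B * C) $$ (i, j) = (B' * C') $$ (i, j)" .
  qed (use B C in \<open>simp_all add: B'_def C'_def\<close>)
  then show ?thesis using car by blast
qed

text \<open>A rank factorization: \<open>B\<close> embeds the image of \<open>E\<close> in coordinates and \<open>C\<close> is the corresponding projection.
Taking a factorization \<open>E = B C\<close> with the least inner size \<open>r\<close> forces \<open>X = C B\<close> to be invertible, since a kernel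
vector of \<open>X\<close> would allow one row of \<open>C\<close> to be removed; and then \<open>E\<^sup>2 = E\<close> gives \<open>X\<^sup>2 = X\<close>, whence \<open>X = 1\<close>.\<close>

lemma idempotent_splitting:
  fixes E :: "'a::field mat"
  assumes E: "E \<in> carrier_mat n n" and idem: "E * E = E"
  shows "\<exists>r B C. B \<in> carrier_mat n r \<and> C \<in> carrier_mat r n \<and> E = B * C \<and> C * B = 1\<^sub>m r"
proof -
  define fac where "fac = (\<lambda>r. \<exists>B C. B \<in> carrier_mat n r \<and> C \<in> carrier_mat r n \<and> E = B * C)"
  have "fac n" unfolding fac_def using E by (intro exI[of _ E] exI[of _ "1\<^sub>m n"]) simp
  define r where "r = (LEAST r. fac r)"
  have "fac r" unfolding r_def using \<open>fac n\<close> by (rule LeastI)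
  then obtain B C where B: "B \<in> carrier_mat n r" and C: "C \<in> carrier_mat r n" and EBC: "E = B * C"
    unfolding fac_def by blast
  define X where "X = C * B"
  have X: "X \<in> carrier_mat r r" using B C by (simp add: X_def)
  have BXC: "B * (X * C) = E"
  proof -
    have "E * E = B * (C * (B * C))" unfolding EBC by (rule assoc_mult_mat[OF B C mult_carrier_mat[OF B C]])
    also have "C * (B * C) = X * C" unfolding X_def using B C by (simp add: assoc_mult_mat[OF C B C])
    finally show ?thesis using idem by simp
  qed
  \<comment> \<open>A kernel vector of \<open>X\<close> would contradict the minimality of the inner size.\<close>
  have "det X \<noteq> 0"
  proof
    assume "det X = 0"
    then obtain v where v: "v \<in> carrier_vec r" "v \<noteq> 0\<^sub>v r" "X *\<^sub>v v = 0\<^sub>v r"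
      using det_0_iff_vec_prod_zero_field[OF X] by blast
    then obtain k where k: "k < r" "v $ k \<noteq> 0" by (metis carrier_vecD eq_vecI index_zero_vec)
    then obtain r' where r': "r = Suc r'" by (cases r) auto
    \<comment> \<open>\<open>Z\<close> projects along the kernel vector \<open>v\<close> onto the vectors with vanishing \<open>k\<close>-th entry. Hence \<open>X Z = X\<close>, and row \<open>k\<close> of \<open>Z\<close> is zero.\<close>
    define Z where "Z = mat r r (\<lambda>(i, j). (if i = j then 1 else 0) - (if j = k then v $ i / v $ k else 0))"
    have Z: "Z \<in> carrier_mat r r" by (simp add: Z_def)
    have "X * Z = X"
    proof (rule eq_matI)
      fix i j assume "i < dim_row X" "j < dim_col X"
      then have ij: "i < r" "j < r" using X by auto
      have "(\<Sum>l<r. X $$ (i, l) * v $ l) = 0"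
        using arg_cong[OF v(3), of "\<lambda>u. u $ i"] ij X v(1) by (simp add: scalar_prod_def lessThan_atLeast0)
      then have *: "(\<Sum>l<r. X $$ (i, l) * (v $ l / v $ k)) = 0"
        by (simp add: sum_divide_distrib[symmetric])
      have "(X * Z) $$ (i, j) = (\<Sum>l<r. X $$ (i, l) * Z $$ (l, j))" by (rule mult_mat_index[OF X Z ij])
      also have "\<dots> = (\<Sum>l<r. (if l = j then X $$ (i, l) else 0) - (if j = k then X $$ (i, l) * (v $ l / v $ k) else 0))"
        using ij by (intro sum.cong) (auto simp: Z_def algebra_simps)
      also have "\<dots> = X $$ (i, j)"
        using ij * by (cases "j = k") (simp_all add: sum_subtractf)
      finally show "(X * Z) $$ (i, j) = X $$ (i, j)" .
    qed (use X in \<open>simp_all add: Z_def\<close>)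
    then have "E = (B * X) * (Z * C)"
    proof -
      have "(B * X) * (Z * C) = B * ((X * Z) * C)"
        using assoc_mult_mat[OF B X mult_carrier_mat[OF Z C]] assoc_mult_mat[OF X Z C] by simp
      then show ?thesis using BXC \<open>X * Z = X\<close> by simp
    qed
    moreover have "(Z * C) $$ (k, j) = 0" if "j < n" for j
    proof -
      have "Z $$ (k, l) = 0" if "l < r" for l using that k by (simp add: Z_def)
      then show ?thesis by (simp add: mult_mat_index[OF Z C k(1) that])
    qed
    moreover have "B * X \<in> carrier_mat n (Suc r')" "Z * C \<in> carrier_mat (Suc r') n"
      using B X Z C r' by auto
    ultimately obtain B' C' where "B' \<in> carrier_mat n r'" "C' \<in> carrier_mat r' n" "E = B' * C'"
      using factorization_drop_zero_row[of "B * X" n r' "Z * C" n k] k r' by metis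
    then have "fac r'" unfolding fac_def by blast
    then have "r \<le> r'" unfolding r_def by (rule Least_le)
    then show False using r' by simp
  qed
  then obtain Y where Y: "Y \<in> carrier_mat r r" "X * Y = 1\<^sub>m r" "Y * X = 1\<^sub>m r"
    using det_non_zero_imp_unit[OF X] unfolding Units_def by (auto simp: ring_mat_simps)
  have CE: "C * E = X * C" unfolding EBC X_def by (rule assoc_mult_mat[OF C B C, symmetric])
  have "X * (X * C) = X * C"
  proof -
    have "X * (X * C) = X * (C * E)" unfolding CE ..
    also have "\<dots> = (C * E) * E" using assoc_mult_mat[OF X C E] CE by simp
    also have "\<dots> = C * E" using assoc_mult_mat[OF C E E] idem by simp
    finally show ?thesis unfolding CE .
  qed
  then have "(X * (X * C)) * B = (X * C) * B" by simp
  then have "X * (X * X) = X * X"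
    using assoc_mult_mat[OF X mult_carrier_mat[OF X C] B] assoc_mult_mat[OF X C B] X_def by simp
  then have "Y * (X * (X * X)) = Y * (X * X)" by simp
  then have "X * X = X"
    using assoc_mult_mat[OF Y(1) X mult_carrier_mat[OF X X]] assoc_mult_mat[OF Y(1) X X] Y(3) X by simp
  then have "Y * (X * X) = 1\<^sub>m r" using Y(3) by simp
  then have "X = 1\<^sub>m r"
    using assoc_mult_mat[OF Y(1) X X] Y(3) X by simp
  then have "C * B = 1\<^sub>m r" by (simp add: X_def)
  then show ?thesis using B C EBC by (intro exI[of _ r] exI[of _ B] exI[of _ C] conjI)
qed

section \<open>A projection onto a subspace\<close>

text \<open>The identity on \<open>W\<close> extends to a linear map of the whole space into \<open>W\<close>, as every linear map from a subspace
does.\<close>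

lemma exists_projection_mat:
  fixes W :: "'a::field vec set"
  assumes sub: "VectorSpace.subspace class_ring W (module_vec TYPE('a) d)"
  shows "\<exists>E. E \<in> carrier_mat d d \<and> (\<forall>w\<in>W. E *\<^sub>v w = w) \<and> (\<forall>x\<in>carrier_vec d. E *\<^sub>v x \<in> W)"
proof -
  have sm: "submodule class_ring W (module_vec TYPE('a) d)"
    using sub by (simp add: VectorSpace.subspace_def)
  have Wc: "W \<subseteq> carrier_vec d" using submodule.subset[OF sm] by (simp add: module_vec_simps)
  have W0: "0\<^sub>v d \<in> W" using submodule.zero_closed[OF sm] by (simp add: module_vec_simps)
  have Wadd: "\<And>u v. u \<in> W \<Longrightarrow> v \<in> W \<Longrightarrow> u + v \<in> W"
    using submodule.m_closed[OF sm] by (simp add: module_vec_simps)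
  have Wsm: "\<And>c v. v \<in> W \<Longrightarrow> c \<cdot>\<^sub>v v \<in> W"
    using submodule.smult_closed[OF sm] by (simp add: module_vec_simps)
  \<comment> \<open>Coordinate vectors of length \<open>d\<close> embed through \<open>p\<close> into the space of all polynomials, with retraction \<open>q\<close>;
  the extension theorem for linear maps is applied there.\<close>
  interpret ps: vector_space "Polynomial.smult :: 'a \<Rightarrow> 'a poly \<Rightarrow> 'a poly"
    by unfold_locales (simp_all add: smult_add_left smult_add_right)
  interpret pp: vector_space_pair "Polynomial.smult :: 'a \<Rightarrow> 'a poly \<Rightarrow> 'a poly" "Polynomial.smult :: 'a \<Rightarrow> 'a poly \<Rightarrow> 'a poly" ..
  define p :: "'a vec \<Rightarrow> 'a poly" where "p v = Poly (list_of_vec v)" for v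
  define q :: "'a poly \<Rightarrow> 'a vec" where "q f = vec d (Polynomial.coeff f)" for f
  have cp: "Polynomial.coeff (p v) i = (if i < d then v $ i else 0)" if "v \<in> carrier_vec d" for v i
    using that by (auto simp: p_def nth_default_def list_of_vec_index)
  have qp: "q (p v) = v" if "v \<in> carrier_vec d" for v
    by (rule eq_vecI) (use that in \<open>auto simp: q_def cp\<close>)
  have padd: "p (u + v) = p u + p v" if "u \<in> carrier_vec d" "v \<in> carrier_vec d" for u v
    by (rule poly_eqI) (use that in \<open>auto simp: cp\<close>)
  have psm: "p (c \<cdot>\<^sub>v v) = Polynomial.smult c (p v)" if "v \<in> carrier_vec d" for c v
    by (rule poly_eqI) (use that in \<open>auto simp: cp\<close>)
  have "ps.subspace (p ` W)"
    unfolding ps.subspace_def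
  proof (intro conjI ballI allI)
    have "p (0\<^sub>v d) = 0" by (rule poly_eqI) (simp add: cp)
    then show "0 \<in> p ` W" using W0 by (metis imageI)
  next
    fix x y assume "x \<in> p ` W" "y \<in> p ` W"
    then show "x + y \<in> p ` W" using padd Wadd Wc by (smt (verit) imageE imageI subsetD)
  next
    fix c x assume "x \<in> p ` W"
    then show "Polynomial.smult c x \<in> p ` W" using psm Wsm Wc by (smt (verit) imageE imageI subsetD)
  qed
  then obtain g where g: "range g \<subseteq> p ` W" "Vector_Spaces.linear Polynomial.smult Polynomial.smult g" "\<And>v. v \<in> p ` W \<Longrightarrow> g v = v"
    using pp.linear_exists_left_inverse_on[of id "p ` W"] ps.linear_id by auto
  interpret g: Vector_Spaces.linear "Polynomial.smult :: 'a \<Rightarrow> 'a poly \<Rightarrow> 'a poly" "Polynomial.smult :: 'a \<Rightarrow> 'a poly \<Rightarrow> 'a poly" g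
    by (rule g(2))
  define E where "E = mat d d (\<lambda>(i, j). Polynomial.coeff (g (Polynomial.monom 1 j)) i)"
  have E: "E \<in> carrier_mat d d" by (simp add: E_def)
  have Ev: "E *\<^sub>v v = q (g (p v))" if v: "v \<in> carrier_vec d" for v
  proof (rule eq_vecI)
    fix i assume "i < dim_vec (q (g (p v)))"
    then have i: "i < d" by (simp add: q_def)
    have "p v = (\<Sum>j<d. Polynomial.smult (v $ j) (Polynomial.monom 1 j))"
    proof (rule poly_eqI)
      fix k
      have "Polynomial.coeff (\<Sum>j<d. Polynomial.smult (v $ j) (Polynomial.monom 1 j)) k = (\<Sum>j<d. if k = j then v $ j else 0)"
        unfolding coeff_sum by (intro sum.cong) auto
      also have "\<dots> = Polynomial.coeff (p v) k" using cp[OF v] by simp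
      finally show "Polynomial.coeff (p v) k = Polynomial.coeff (\<Sum>j<d. Polynomial.smult (v $ j) (Polynomial.monom 1 j)) k" ..
    qed
    then have "Polynomial.coeff (g (p v)) i = (\<Sum>j<d. v $ j * Polynomial.coeff (g (Polynomial.monom 1 j)) i)"
      by (simp add: g.sum g.scale coeff_sum)
    then show "(E *\<^sub>v v) $ i = q (g (p v)) $ i"
      using i v by (simp add: q_def E_def scalar_prod_def lessThan_atLeast0 mult.commute)
  qed (simp_all add: E_def q_def)
  have "E *\<^sub>v w = w" if "w \<in> W" for w
    using that Ev g(3) qp Wc by (metis imageI subsetD)
  moreover have "E *\<^sub>v x \<in> W" if "x \<in> carrier_vec d" for x
  proof -
    obtain w where "w \<in> W" "g (p x) = p w" using g(1) by blast
    then show ?thesis using Ev[OF that] qp Wc by auto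
  qed
  ultimately show ?thesis using E by blast
qed

lemma subspace_module_vecI:
  fixes W :: "'a::field vec set"
  assumes "W \<subseteq> carrier_vec d" "0\<^sub>v d \<in> W"
    "\<And>u v. u \<in> W \<Longrightarrow> v \<in> W \<Longrightarrow> u + v \<in> W" "\<And>c v. v \<in> W \<Longrightarrow> c \<cdot>\<^sub>v v \<in> W"
  shows "VectorSpace.subspace class_ring W (module_vec TYPE('a) d)"
proof -
  have "submodule class_ring W (module_vec TYPE('a) d)"
    by (rule submodule.intro) (use assms vec_module in \<open>simp_all add: module_vec_simps\<close>)
  then show ?thesis by (simp add: VectorSpace.subspace_def vec_vs)
qed

section \<open>Representations, their sums, tensor products and duals\<close>

definition block_diag :: "'a::zero mat \<Rightarrow> 'a mat \<Rightarrow> 'a mat" where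
  "block_diag A B = four_block_mat A (0\<^sub>m (dim_row A) (dim_col B)) (0\<^sub>m (dim_row B) (dim_col A)) B"

lemma rep_sum_block_diag: "rep_sum M N h = block_diag (M h) (N h)"
  by (simp add: rep_sum_def block_diag_def)

lemma block_diag_carrier [simp]:
  "A \<in> carrier_mat n m \<Longrightarrow> B \<in> carrier_mat p q \<Longrightarrow> block_diag A B \<in> carrier_mat (n + p) (m + q)"
  by (simp add: block_diag_def)

lemma block_diag_mult:
  fixes A B C D :: "'a::comm_ring_1 mat"
  assumes "A \<in> carrier_mat n m" "B \<in> carrier_mat m k" "C \<in> carrier_mat p q" "D \<in> carrier_mat q r"
  shows "block_diag A C * block_diag B D = block_diag (A * B) (C * D)"
  unfolding block_diag_def using assms
  by (subst mult_four_block_mat[of _ n m _ q _ p]) auto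

lemma block_diag_one: "block_diag (1\<^sub>m n) (1\<^sub>m p) = (1\<^sub>m (n + p) :: 'a::comm_ring_1 mat)"
  by (simp add: block_diag_def)

lemma mat_trace_block_diag:
  fixes A B :: "'a::comm_ring_1 mat"
  assumes A: "A \<in> carrier_mat n n" and B: "B \<in> carrier_mat p p"
  shows "mat_trace (block_diag A B) = mat_trace A + mat_trace B"
proof -
  have "mat_trace (block_diag A B) = (\<Sum>i<n + p. if i < n then A $$ (i, i) else B $$ (i - n, i - n))"
    unfolding mat_trace_def block_diag_def using A B by (intro sum.cong) auto
  also have "\<dots> = (\<Sum>i<n. A $$ (i, i)) + (\<Sum>i<p. B $$ (i, i))"
    by (induction p) (simp_all add: add.assoc)
  finally show ?thesis using A B by (auto simp: mat_trace_def)
qed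

lemma rep_sum_assoc: "rep_sum A (rep_sum B C) = rep_sum (rep_sum A B) C"
  unfolding rep_sum_def by (rule ext) (rule assoc_four_block_mat)

locale finite_group = group G for G :: "('g, 'e) monoid_scheme" (structure) +
  assumes finite_carrier: "finite (carrier G)"
begin

abbreviation "dm \<equiv> rep_dim G"

lemma order_pos: "card (carrier G) > 0"
  using finite_carrier one_closed by (auto simp: card_gt_0_iff)

lemma rep_carrier: "is_rep G M \<Longrightarrow> h \<in> carrier G \<Longrightarrow> M h \<in> carrier_mat (dm M) (dm M)"
  by (simp add: is_rep_def)

lemma rep_one: "is_rep G M \<Longrightarrow> M \<one> = 1\<^sub>m (dm M)"
  by (simp add: is_rep_def)

lemma rep_mult: "is_rep G M \<Longrightarrow> h \<in> carrier G \<Longrightarrow> h' \<in> carrier G \<Longrightarrow> M (h \<otimes> h') = M h * M h'"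
  by (simp add: is_rep_def)

lemma is_repI:
  assumes "\<And>h. h \<in> carrier G \<Longrightarrow> M h \<in> carrier_mat d d" "M \<one> = 1\<^sub>m d"
    "\<And>h h'. h \<in> carrier G \<Longrightarrow> h' \<in> carrier G \<Longrightarrow> M (h \<otimes> h') = M h * M h'"
  shows "is_rep G M" "dm M = d"
  using assms by (auto simp: is_rep_def rep_dim_def)

lemma rep_isoI:
  fixes M N :: "('g, 'k::field_char_0) rep"
  assumes T: "T \<in> carrier_mat (dm N) (dm M)" and S: "S \<in> carrier_mat (dm M) (dm N)"
    and inv: "T * S = 1\<^sub>m (dm N)" "S * T = 1\<^sub>m (dm M)"
    and int: "\<And>h. h \<in> carrier G \<Longrightarrow> T * M h = N h * T"
  shows "rep_iso G M N"
proof -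
  have "dm M = dm N" by (rule inverse_mats_square[OF T S inv])
  then have "invertible_mat T"
    unfolding invertible_mat_def inverts_mat_def using T S inv by (auto intro!: exI[of _ S])
  then show ?thesis unfolding rep_iso_def using T int by blast
qed

text \<open>An isomorphism together with its inverse, in a form suitable for matrix calculations; \<open>rep_iso\<close> only asserts that
some inverse exists.\<close>

definition iso_pair where
  "iso_pair M N T S \<longleftrightarrow> T \<in> carrier_mat (dm N) (dm M) \<and> S \<in> carrier_mat (dm M) (dm N) \<and>
    T * S = 1\<^sub>m (dm N) \<and> S * T = 1\<^sub>m (dm M) \<and> (\<forall>h\<in>carrier G. T * M h = N h * T) \<and> dm M = dm N"

lemma iso_pairD:
  assumes "iso_pair M N T S"
  shows "T \<in> carrier_mat (dm N) (dm M)" "S \<in> carrier_mat (dm M) (dm N)"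
    "T * S = 1\<^sub>m (dm N)" "S * T = 1\<^sub>m (dm M)" "\<And>h. h \<in> carrier G \<Longrightarrow> T * M h = N h * T"
    "dm M = dm N"
  using assms unfolding iso_pair_def by blast+

lemma rep_iso_pair:
  assumes "rep_iso G M N" shows "\<exists>T S. iso_pair M N T S"
proof -
  obtain T where T: "T \<in> carrier_mat (dm N) (dm M)" "invertible_mat T"
    "\<And>h. h \<in> carrier G \<Longrightarrow> T * M h = N h * T"
    using assms unfolding rep_iso_def by blast
  from T(2) obtain S where "inverts_mat T S" "inverts_mat S T" and sq: "square_mat T"
    unfolding invertible_mat_def by blast
  then have S: "T * S = 1\<^sub>m (dim_row T)" "S * T = 1\<^sub>m (dim_row S)" "dim_row T = dim_col T"
    by (simp_all add: inverts_mat_def square_mat.simps)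
  have "dim_col S = dim_row T" using arg_cong[OF S(1), of dim_col] by simp
  moreover have "dim_row S = dim_col T" using arg_cong[OF S(2), of dim_col] by simp
  ultimately show ?thesis unfolding iso_pair_def using T S by (intro exI[of _ T] exI[of _ S]) auto
qed

lemma rep_iso_refl: 
  fixes M :: "('g, 'k::field_char_0) rep"
  assumes "is_rep G M" shows "rep_iso G M M"
proof (rule rep_isoI[of "1\<^sub>m (dm M)" _ _ "1\<^sub>m (dm M)"])
  show "1\<^sub>m (dm M) * M h = M h * 1\<^sub>m (dm M)" if "h \<in> carrier G" for h
    using left_mult_one_mat[OF rep_carrier[OF assms that]] right_mult_one_mat[OF rep_carrier[OF assms that]] by simp
qed auto

lemma rep_iso_sym:
  fixes M N :: "('g, 'k::field_char_0) rep"
  assumes M: "is_rep G M" and N: "is_rep G N" and iso: "rep_iso G M N"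
  shows "rep_iso G N M"
proof -
  obtain T S where "iso_pair M N T S"
    using rep_iso_pair[OF iso] by blast
  note TS = iso_pairD[OF this]
  have "S * N h = M h * S" if h: "h \<in> carrier G" for h
  proof -
    note Mh = rep_carrier[OF M h] and Nh = rep_carrier[OF N h]
    have "S * N h = S * (N h * (T * S))" using TS Nh by simp
    also have "\<dots> = S * ((T * M h) * S)" using TS h assoc_mult_mat[OF Nh TS(1,2)] by simp
    also have "\<dots> = (S * T) * (M h * S)"
      using assoc_mult_mat[OF TS(1) Mh TS(2)] assoc_mult_mat[OF TS(2,1) mult_carrier_mat[OF Mh TS(2)]] by simp
    also have "\<dots> = M h * S" using TS(2,4) Mh by simp
    finally show ?thesis .
  qed
  then show ?thesis by (intro rep_isoI[of S _ _ T]) (use TS in auto)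
qed

lemma rep_iso_trans:
  fixes L M N :: "('g, 'k::field_char_0) rep"
  assumes L: "is_rep G L" and M: "is_rep G M" and N: "is_rep G N"
    and iso: "rep_iso G L M" "rep_iso G M N"
  shows "rep_iso G L N"
proof -
  obtain T S where "iso_pair L M T S"
    using rep_iso_pair[OF iso(1)] by blast
  note TS = iso_pairD[OF this]
  obtain T' S' where "iso_pair M N T' S'"
    using rep_iso_pair[OF iso(2)] by blast
  note TS' = iso_pairD[OF this]
  show ?thesis
  proof (rule rep_isoI[of "T' * T" _ _ "S * S'"])
    have "(T' * T) * (S * S') = T' * ((T * S) * S')"
      using assoc_mult_mat[OF TS'(1) TS(1) mult_carrier_mat[OF TS(2) TS'(2)]] assoc_mult_mat[OF TS(1,2) TS'(2)] by simp
    then show "(T' * T) * (S * S') = 1\<^sub>m (dm N)" using TS TS' by simp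
    have "(S * S') * (T' * T) = S * ((S' * T') * T)"
      using assoc_mult_mat[OF TS(2) TS'(2) mult_carrier_mat[OF TS'(1) TS(1)]] assoc_mult_mat[OF TS'(2,1) TS(1)] by simp
    then show "(S * S') * (T' * T) = 1\<^sub>m (dm L)" using TS TS' by simp
    fix h assume h: "h \<in> carrier G"
    note Lh = rep_carrier[OF L h] and Mh = rep_carrier[OF M h] and Nh = rep_carrier[OF N h]
    show "(T' * T) * L h = N h * (T' * T)"
      using assoc_mult_mat[OF TS'(1) TS(1) Lh] assoc_mult_mat[OF TS'(1) Mh TS(1)]
        assoc_mult_mat[OF Nh TS'(1) TS(1)] TS(5)[OF h] TS'(5)[OF h] by simp
  qed (use TS TS' in auto)
qed

lemma rep_iso_trace:
  fixes M N :: "('g, 'k::field_char_0) rep"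
  assumes M: "is_rep G M" and N: "is_rep G N" and iso: "rep_iso G M N" and h: "h \<in> carrier G"
  shows "mat_trace (M h) = mat_trace (N h)"
proof -
  obtain T S where "iso_pair M N T S"
    using rep_iso_pair[OF iso] by blast
  note TS = iso_pairD[OF this]
  note Mh = rep_carrier[OF M h] and Nh = rep_carrier[OF N h]
  have "mat_trace (M h) = mat_trace (S * (T * M h))"
    using assoc_mult_mat[OF TS(2,1) Mh] TS(4) Mh by simp
  also have "\<dots> = mat_trace ((N h * T) * S)"
    unfolding TS(5)[OF h] using TS Nh by (intro mat_trace_comm[of _ "dm M" "dm N"]) auto
  also have "\<dots> = mat_trace (N h)" using assoc_mult_mat[OF Nh TS(1,2)] TS(3) Nh by simp
  finally show ?thesis .
qed

lemma rep_sum_rep: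
  fixes M N :: "('g, 'k::field_char_0) rep"
  assumes M: "is_rep G M" and N: "is_rep G N"
  shows "is_rep G (rep_sum M N)" "dm (rep_sum M N) = dm M + dm N"
proof -
  have 1: "rep_sum M N h \<in> carrier_mat (dm M + dm N) (dm M + dm N)" if "h \<in> carrier G" for h
    unfolding rep_sum_block_diag using rep_carrier[OF M that] rep_carrier[OF N that] by simp
  have 2: "rep_sum M N \<one> = 1\<^sub>m (dm M + dm N)"
    unfolding rep_sum_block_diag rep_one[OF M] rep_one[OF N] by (rule block_diag_one)
  have 3: "rep_sum M N (h \<otimes> h') = rep_sum M N h * rep_sum M N h'" if "h \<in> carrier G" "h' \<in> carrier G" for h h'
    unfolding rep_sum_block_diag
    using block_diag_mult[OF rep_carrier[OF M that(1)] rep_carrier[OF M that(2)] rep_carrier[OF N that(1)] rep_carrier[OF N that(2)]]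
      rep_mult[OF M that] rep_mult[OF N that] by simp
  show "is_rep G (rep_sum M N)" "dm (rep_sum M N) = dm M + dm N" using is_repI[OF 1 2 3] by auto
qed

lemma rep_sum_trace:
  fixes M N :: "('g, 'k::field_char_0) rep"
  assumes "is_rep G M" "is_rep G N" "h \<in> carrier G"
  shows "mat_trace (rep_sum M N h) = mat_trace (M h) + mat_trace (N h)"
  unfolding rep_sum_block_diag
  by (rule mat_trace_block_diag[OF rep_carrier rep_carrier]) (use assms in auto)

lemma rep_tensor_rep:
  fixes M N :: "('g, 'k::field_char_0) rep"
  assumes M: "is_rep G M" and N: "is_rep G N"
  shows "is_rep G (rep_tensor M N)" "dm (rep_tensor M N) = dm M * dm N"
proof -
  have 1: "rep_tensor M N h \<in> carrier_mat (dm M * dm N) (dm M * dm N)" if "h \<in> carrier G" for h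
    unfolding rep_tensor_def by (rule kronecker_carrier[OF rep_carrier[OF M that] rep_carrier[OF N that]])
  have 2: "rep_tensor M N \<one> = 1\<^sub>m (dm M * dm N)"
    unfolding rep_tensor_def rep_one[OF M] rep_one[OF N] by (rule kronecker_one)
  have 3: "rep_tensor M N (h \<otimes> h') = rep_tensor M N h * rep_tensor M N h'" if "h \<in> carrier G" "h' \<in> carrier G" for h h'
    unfolding rep_tensor_def rep_mult[OF M that] rep_mult[OF N that]
    by (rule kronecker_mult[OF rep_carrier[OF M that(1)] rep_carrier[OF M that(2)] rep_carrier[OF N that(1)] rep_carrier[OF N that(2)]])
  show "is_rep G (rep_tensor M N)" "dm (rep_tensor M N) = dm M * dm N" using is_repI[OF 1 2 3] by auto
qed

lemma rep_tensor_trace: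
  fixes M N :: "('g, 'k::field_char_0) rep"
  assumes "is_rep G M" "is_rep G N" "h \<in> carrier G"
  shows "mat_trace (rep_tensor M N h) = mat_trace (M h) * mat_trace (N h)"
  unfolding rep_tensor_def
  by (rule mat_trace_kronecker[OF rep_carrier rep_carrier]) (use assms in auto)

lemma rep_dual_rep:
  fixes M :: "('g, 'k::field_char_0) rep"
  assumes M: "is_rep G M"
  shows "is_rep G (rep_dual G M)" "dm (rep_dual G M) = dm M"
proof -
  have 1: "rep_dual G M h \<in> carrier_mat (dm M) (dm M)" if "h \<in> carrier G" for h
    unfolding rep_dual_def using rep_carrier[OF M, of "inv h"] that by simp
  have 2: "rep_dual G M \<one> = 1\<^sub>m (dm M)"
    unfolding rep_dual_def by (simp add: rep_one[OF M])
  have 3: "rep_dual G M (h \<otimes> h') = rep_dual G M h * rep_dual G M h'" if "h \<in> carrier G" "h' \<in> carrier G" for h h'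
    unfolding rep_dual_def using that inv_mult_group[OF that]
      rep_mult[OF M, of "inv h'" "inv h"] transpose_mult[OF rep_carrier[OF M, of "inv h'"] rep_carrier[OF M, of "inv h"]]
    by simp
  show "is_rep G (rep_dual G M)" "dm (rep_dual G M) = dm M" using is_repI[OF 1 2 3] by auto
qed

lemma rep_dual_trace:
  fixes M :: "('g, 'k::field_char_0) rep"
  assumes "is_rep G M" "h \<in> carrier G"
  shows "mat_trace (rep_dual G M h) = mat_trace (M (inv h))"
  unfolding rep_dual_def
  by (rule mat_trace_transpose[OF rep_carrier]) (use assms in auto)

lemma char_rep_rep:
  fixes \<psi> :: "'g \<Rightarrow> 'k::field_char_0"
  assumes "\<psi> \<one> = 1" "\<And>h h'. h \<in> carrier G \<Longrightarrow> h' \<in> carrier G \<Longrightarrow> \<psi> (h \<otimes> h') = \<psi> h * \<psi> h'"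
  shows "is_rep G (char_rep \<psi>)" "dm (char_rep \<psi>) = 1"
proof -
  have 1: "char_rep \<psi> h \<in> carrier_mat 1 1" for h by (simp add: char_rep_def)
  have 2: "char_rep \<psi> \<one> = 1\<^sub>m 1" by (rule eq_matI) (auto simp: char_rep_def assms(1))
  have 3: "char_rep \<psi> (h \<otimes> h') = char_rep \<psi> h * char_rep \<psi> h'" if "h \<in> carrier G" "h' \<in> carrier G" for h h'
    by (rule eq_matI) (auto simp: char_rep_def assms(2)[OF that] scalar_prod_def)
  show "is_rep G (char_rep \<psi>)" "dm (char_rep \<psi>) = 1" using is_repI[OF 1 2 3] by auto
qed

lemma char_rep_trace: "mat_trace (char_rep \<psi> h) = \<psi> h"
  by (simp add: mat_trace_def char_rep_def)

lemma rep_sum_cong: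
  fixes M N M' N' :: "('g, 'k::field_char_0) rep"
  assumes r: "is_rep G M" "is_rep G N" "is_rep G M'" "is_rep G N'"
    and iso: "rep_iso G M M'" "rep_iso G N N'"
  shows "rep_iso G (rep_sum M N) (rep_sum M' N')"
proof -
  obtain T S where "iso_pair M M' T S"
    using rep_iso_pair[OF iso(1)] by blast
  note TS = iso_pairD[OF this]
  obtain T' S' where "iso_pair N N' T' S'"
    using rep_iso_pair[OF iso(2)] by blast
  note TS' = iso_pairD[OF this]
  note dims = rep_sum_rep(2)[OF r(1,2)] rep_sum_rep(2)[OF r(3,4)]
  show ?thesis
  proof (rule rep_isoI[of "block_diag T T'" _ _ "block_diag S S'"])
    show "block_diag T T' * block_diag S S' = 1\<^sub>m (dm (rep_sum M' N'))"
      using block_diag_mult[OF TS(1,2) TS'(1,2)] TS TS' by (simp add: dims block_diag_one)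
    show "block_diag S S' * block_diag T T' = 1\<^sub>m (dm (rep_sum M N))"
      using block_diag_mult[OF TS(2,1) TS'(2,1)] TS TS' by (simp add: dims block_diag_one)
    fix h assume h: "h \<in> carrier G"
    show "block_diag T T' * rep_sum M N h = rep_sum M' N' h * block_diag T T'"
      unfolding rep_sum_block_diag
      using block_diag_mult[OF TS(1) rep_carrier[OF r(1) h] TS'(1) rep_carrier[OF r(2) h]]
        block_diag_mult[OF rep_carrier[OF r(3) h] TS(1) rep_carrier[OF r(4) h] TS'(1)] TS(5)[OF h] TS'(5)[OF h]
      by simp
  qed (use TS TS' dims in auto)
qed

lemma rep_sum_comm:
  fixes M N :: "('g, 'k::field_char_0) rep"
  assumes r: "is_rep G M" "is_rep G N"
  shows "rep_iso G (rep_sum M N) (rep_sum N M)"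
proof -
  note dims = rep_sum_rep(2)[OF r] rep_sum_rep(2)[OF r(2,1)]
  define sw where "sw = (\<lambda>m n. four_block_mat (0\<^sub>m n m) (1\<^sub>m n) (1\<^sub>m m) (0\<^sub>m m n) :: 'k mat)"
  have sw: "sw m n \<in> carrier_mat (n + m) (n + m)" for m n by (rule carrier_matI) (simp_all add: sw_def)
  have swsw: "sw m n * sw n m = 1\<^sub>m (n + m)" for m n
    unfolding sw_def by (subst mult_four_block_mat[of _ n m _ n _ m]) auto
  show ?thesis
  proof (rule rep_isoI[of "sw (dm M) (dm N)" _ _ "sw (dm N) (dm M)"])
    fix h assume h: "h \<in> carrier G"
    note Mh = rep_carrier[OF r(1) h] and Nh = rep_carrier[OF r(2) h]
    have "sw (dm M) (dm N) * rep_sum M N h = four_block_mat (0\<^sub>m (dm N) (dm M)) (N h) (M h) (0\<^sub>m (dm M) (dm N))"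
      unfolding sw_def rep_sum_block_diag block_diag_def using Mh Nh
      by (subst mult_four_block_mat[of _ "dm N" "dm M" _ "dm N" _ "dm M"]) auto
    also have "\<dots> = rep_sum N M h * sw (dm M) (dm N)"
      unfolding sw_def rep_sum_block_diag block_diag_def using Mh Nh
      by (subst mult_four_block_mat[of _ "dm N" "dm N" _ "dm M" _ "dm M"]) auto
    finally show "sw (dm M) (dm N) * rep_sum M N h = rep_sum N M h * sw (dm M) (dm N)" .
  next
    show "sw (dm M) (dm N) \<in> carrier_mat (dm (rep_sum N M)) (dm (rep_sum M N))"
      "sw (dm N) (dm M) \<in> carrier_mat (dm (rep_sum M N)) (dm (rep_sum N M))"
      using sw[of "dm M" "dm N"] sw[of "dm N" "dm M"] by (simp_all add: dims add.commute)
  qed (use swsw dims in \<open>auto simp: add.commute\<close>)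
qed

text \<open>The inclusions and projections of a direct sum decomposition assemble into an isomorphism.\<close>

lemma rep_sum_isoI:
  fixes M N N' :: "('g, 'k::field_char_0) rep"
  assumes r: "is_rep G M" "is_rep G N" "is_rep G N'"
    and B: "B \<in> carrier_mat (dm M) (dm N)" and C: "C \<in> carrier_mat (dm N) (dm M)"
    and B': "B' \<in> carrier_mat (dm M) (dm N')" and C': "C' \<in> carrier_mat (dm N') (dm M)"
    and inv: "C * B = 1\<^sub>m (dm N)" "C' * B' = 1\<^sub>m (dm N')" "C * B' = 0\<^sub>m (dm N) (dm N')" "C' * B = 0\<^sub>m (dm N') (dm N)"
      "B * C + B' * C' = 1\<^sub>m (dm M)"
    and int: "\<And>h. h \<in> carrier G \<Longrightarrow> C * M h = N h * C" "\<And>h. h \<in> carrier G \<Longrightarrow> C' * M h = N' h * C'"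
  shows "rep_iso G M (rep_sum N N')"
proof -
  let ?d = "dm M" and ?r = "dm N" and ?r' = "dm N'"
  \<comment> \<open>Stacking \<open>C\<close> on \<open>C'\<close>, and \<open>B\<close> beside \<open>B'\<close>, as block matrices with empty further blocks.\<close>
  define T where "T = four_block_mat C (0\<^sub>m ?r 0) C' (0\<^sub>m ?r' 0)"
  define S where "S = four_block_mat B B' (0\<^sub>m 0 ?r) (0\<^sub>m 0 ?r')"
  have pad: "X = four_block_mat X (0\<^sub>m ?d 0) (0\<^sub>m 0 ?d) (0\<^sub>m 0 0)" if "X \<in> carrier_mat ?d ?d" for X :: "'k mat"
    by (rule eq_matI) (use that in auto)
  have T: "T \<in> carrier_mat (?r + ?r') ?d" and S: "S \<in> carrier_mat ?d (?r + ?r')"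
    using B C B' C' four_block_carrier_mat[of C ?r ?d "0\<^sub>m ?r' 0" ?r' 0] four_block_carrier_mat[of B ?d ?r "0\<^sub>m 0 ?r'" 0 ?r']
    by (simp_all add: T_def S_def)
  show ?thesis
  proof (rule rep_isoI[of T _ _ S])
    have "T * S = four_block_mat (1\<^sub>m ?r) (0\<^sub>m ?r ?r') (0\<^sub>m ?r' ?r) (1\<^sub>m ?r')"
      unfolding T_def S_def using B C B' C' inv
      by (subst mult_four_block_mat[of _ ?r ?d _ 0 _ ?r']) auto
    then show "T * S = 1\<^sub>m (dm (rep_sum N N'))" by (simp add: rep_sum_rep(2)[OF r(2,3)])
    have "S * T = four_block_mat (1\<^sub>m ?d) (0\<^sub>m ?d 0) (0\<^sub>m 0 ?d) (0\<^sub>m 0 0)"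
      unfolding T_def S_def using B C B' C' inv
      by (subst mult_four_block_mat[of _ ?d ?r _ ?r' _ 0]) auto
    then show "S * T = 1\<^sub>m ?d" using pad[of "1\<^sub>m ?d"] by simp
    fix h assume h: "h \<in> carrier G"
    note Mh = rep_carrier[OF r(1) h] and Nh = rep_carrier[OF r(2) h] and Nh' = rep_carrier[OF r(3) h]
    have "T * M h = T * four_block_mat (M h) (0\<^sub>m ?d 0) (0\<^sub>m 0 ?d) (0\<^sub>m 0 0)" using pad[OF Mh] by simp
    also have "\<dots> = four_block_mat (C * M h) (0\<^sub>m ?r 0) (C' * M h) (0\<^sub>m ?r' 0)"
      unfolding T_def using C C' Mh by (subst mult_four_block_mat[of _ ?r ?d _ 0 _ ?r']) auto
    also have "\<dots> = rep_sum N N' h * T"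
      unfolding T_def rep_sum_block_diag block_diag_def using C C' Nh Nh' int[OF h]
      by (subst mult_four_block_mat[of _ ?r ?r _ ?r' _ ?r']) auto
    finally show "T * M h = rep_sum N N' h * T" .
  qed (use T S rep_sum_rep(2)[OF r(2,3)] in auto)
qed

text \<open>An idempotent \<open>E\<close> commuting with the action splits the module into the images of \<open>E\<close> and \<open>1 - E\<close>, both
proper when \<open>E\<close> is neither \<open>0\<close> nor \<open>1\<close>.\<close>

lemma idempotent_intertwiner_splits:
  fixes M :: "('g, 'k::field_char_0) rep"
  assumes M: "is_rep G M" and E: "E \<in> carrier_mat (dm M) (dm M)" and idem: "E * E = E"
    and int: "\<And>h. h \<in> carrier G \<Longrightarrow> E * M h = M h * E"
    and nontrivial: "E \<noteq> 0\<^sub>m (dm M) (dm M)" "E \<noteq> 1\<^sub>m (dm M)"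
  shows "\<exists>N N'. is_rep G N \<and> is_rep G N' \<and> dm N < dm M \<and> dm N' < dm M \<and> rep_iso G M (rep_sum N N')"
proof -
  let ?d = "dm M"
  have sub: "\<exists>N B C. is_rep G N \<and> B \<in> carrier_mat ?d (dm N) \<and> C \<in> carrier_mat (dm N) ?d \<and> E = B * C \<and>
      C * B = 1\<^sub>m (dm N) \<and> (\<forall>h\<in>carrier G. C * M h = N h * C)"
    if E: "E \<in> carrier_mat ?d ?d" and idem: "E * E = E"
      and int: "\<And>h. h \<in> carrier G \<Longrightarrow> E * M h = M h * E" for E
  proof -
    obtain r B C where B: "B \<in> carrier_mat ?d r" and C: "C \<in> carrier_mat r ?d"
      and EBC: "E = B * C" and CB: "C * B = 1\<^sub>m r" using idempotent_splitting[OF E idem] by blast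
    have CE: "C * E = C" using assoc_mult_mat[OF C B C] CB C EBC by simp
    define N where "N = (\<lambda>h. C * M h * B)"
    have NC: "C * M h = N h * C" if h: "h \<in> carrier G" for h
    proof -
      note Mh = rep_carrier[OF M h]
      have "N h * C = C * M h * E"
        unfolding N_def EBC using assoc_mult_mat[OF mult_carrier_mat[OF C Mh] B C] .
      also have "\<dots> = C * (E * M h)" using assoc_mult_mat[OF C Mh E] int[OF h] by simp
      also have "\<dots> = C * M h" using assoc_mult_mat[OF C E Mh] CE by simp
      finally show ?thesis ..
    qed
    have 1: "N h \<in> carrier_mat r r" if "h \<in> carrier G" for h
      using rep_carrier[OF M that] B C by (simp add: N_def)
    have 2: "N \<one> = 1\<^sub>m r" using C CB by (simp add: N_def rep_one[OF M])
    have 3: "N (h \<otimes> h') = N h * N h'" if h: "h \<in> carrier G" "h' \<in> carrier G" for h h'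
    proof -
      note Mh = rep_carrier[OF M h(1)] and Mh' = rep_carrier[OF M h(2)]
      have "N h * N h' = (N h * (C * M h')) * B"
        using assoc_mult_mat[OF 1[OF h(1)] mult_carrier_mat[OF C Mh'] B] by (simp add: fun_cong[OF N_def, of h'])
      also have "N h * (C * M h') = C * M h * M h'"
        using assoc_mult_mat[OF 1[OF h(1)] C Mh'] NC[OF h(1)] by simp
      also have "\<dots> = C * M (h \<otimes> h')" using assoc_mult_mat[OF C Mh Mh'] rep_mult[OF M h] by simp
      finally show ?thesis by (simp add: N_def)
    qed
    have "is_rep G N" "dm N = r" using is_repI[OF 1 2 3] by auto
    then show ?thesis using B C EBC CB NC by blast
  qed
  obtain N B C where N: "is_rep G N" and B: "B \<in> carrier_mat ?d (dm N)" and C: "C \<in> carrier_mat (dm N) ?d"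
    and EBC: "E = B * C" and CB: "C * B = 1\<^sub>m (dm N)" and NC: "\<And>h. h \<in> carrier G \<Longrightarrow> C * M h = N h * C"
    using sub[OF E idem int] by blast
  define F where "F = 1\<^sub>m ?d - E"
  have F: "F \<in> carrier_mat ?d ?d" unfolding F_def by (rule minus_carrier_mat[OF E])
  have EF: "E * F = 0\<^sub>m ?d ?d" unfolding F_def
    using mult_minus_distrib_mat[OF E one_carrier_mat E] idem E by simp
  have FE: "F * E = 0\<^sub>m ?d ?d" unfolding F_def
    using minus_mult_distrib_mat[OF one_carrier_mat E E] idem E by simp
  have "F - 0\<^sub>m ?d ?d = F" by (rule eq_matI) (use F in auto)
  then have FF: "F * F = F"
    using minus_mult_distrib_mat[OF one_carrier_mat E F] EF F unfolding F_def[symmetric] by simp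
  have Fint: "F * M h = M h * F" if h: "h \<in> carrier G" for h
    unfolding F_def using minus_mult_distrib_mat[OF one_carrier_mat E rep_carrier[OF M h]]
      mult_minus_distrib_mat[OF rep_carrier[OF M h] one_carrier_mat E] int[OF h] rep_carrier[OF M h] by simp
  obtain N' B' C' where N': "is_rep G N'" and B': "B' \<in> carrier_mat ?d (dm N')" and C': "C' \<in> carrier_mat (dm N') ?d"
    and FBC: "F = B' * C'" and CB': "C' * B' = 1\<^sub>m (dm N')" and NC': "\<And>h. h \<in> carrier G \<Longrightarrow> C' * M h = N' h * C'"
    using sub[OF F FF Fint] by blast
  have zero: "C * B' = 0\<^sub>m (dm N) (dm N')"
    if B: "B \<in> carrier_mat ?d (dm N)" and C: "C \<in> carrier_mat (dm N) ?d" and CB: "C * B = 1\<^sub>m (dm N)"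
      and B': "B' \<in> carrier_mat ?d (dm N')" and C': "C' \<in> carrier_mat (dm N') ?d" and CB': "C' * B' = 1\<^sub>m (dm N')"
      and Z: "(B * C) * (B' * C') = 0\<^sub>m ?d ?d" for N N' :: "('g, 'k) rep" and B C B' C' :: "'k mat"
  proof -
    have "C * ((B * C) * (B' * C')) = (C * B) * (C * (B' * C'))"
      using assoc_mult_mat[OF B C mult_carrier_mat[OF B' C']]
        assoc_mult_mat[OF C B mult_carrier_mat[OF C mult_carrier_mat[OF B' C']]] by simp
    also have "\<dots> = (C * B') * C'" using CB assoc_mult_mat[OF C B' C'] C B' C' by simp
    finally have "(C * B') * C' = C * 0\<^sub>m ?d ?d" using Z by simp
    then have "(C * B') * C' * B' = 0\<^sub>m (dm N) ?d * B'" using C by simp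
    then show ?thesis using assoc_mult_mat[OF mult_carrier_mat[OF C B'] C' B'] CB' C B' by simp
  qed
  have "rep_iso G M (rep_sum N N')"
  proof (rule rep_sum_isoI[OF M N N' B C B' C' CB CB' _ _ _ NC NC'])
    show "C * B' = 0\<^sub>m (dm N) (dm N')" by (rule zero[OF B C CB B' C' CB']) (use EF EBC FBC in simp)
    show "C' * B = 0\<^sub>m (dm N') (dm N)" by (rule zero[OF B' C' CB' B C CB]) (use FE EBC FBC in simp)
    show "B * C + B' * C' = 1\<^sub>m ?d" unfolding EBC[symmetric] FBC[symmetric] F_def
      by (rule eq_matI) (use E in auto)
  qed
  moreover from this have dims: "?d = dm N + dm N'"
    using rep_iso_pair iso_pairD(6) rep_sum_rep(2)[OF N N'] by metis
  moreover have "dm N \<noteq> 0"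
  proof
    assume "dm N = 0"
    then have "E = 0\<^sub>m ?d ?d" unfolding EBC by (intro eq_matI) (use B C in \<open>auto simp: scalar_prod_def\<close>)
    then show False using nontrivial by simp
  qed
  moreover have "dm N' \<noteq> 0"
  proof
    assume "dm N' = 0"
    then have F0: "F = 0\<^sub>m ?d ?d" unfolding FBC by (intro eq_matI) (use B' C' in \<open>auto simp: scalar_prod_def\<close>)
    have "E = 1\<^sub>m ?d"
    proof (rule eq_matI)
      fix i j assume "i < dim_row (1\<^sub>m ?d :: 'k mat)" "j < dim_col (1\<^sub>m ?d :: 'k mat)"
      then show "E $$ (i, j) = (1\<^sub>m ?d :: 'k mat) $$ (i, j)"
        using arg_cong[OF F0, of "\<lambda>A. A $$ (i, j)"] E by (simp add: F_def)
    qed (use E in auto)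
    then show False using nontrivial by simp
  qed
  ultimately show ?thesis using N N' by (intro exI[of _ N] exI[of _ N']) auto
qed

end

section \<open>Maschke's theorem and Schur's lemma\<close>

lemma mult_mat_zero_vec: "A \<in> carrier_mat n m \<Longrightarrow> A *\<^sub>v 0\<^sub>v m = (0\<^sub>v n :: 'a::comm_ring_1 vec)"
  by (rule eq_vecI) auto

lemma mult_mat_unit_vec:
  fixes A :: "'a::comm_ring_1 mat"
  assumes "A \<in> carrier_mat n m" "j < m" shows "A *\<^sub>v unit_vec m j = col A j"
  by (rule eq_vecI) (use assms in auto)

lemma scalar_mult_vec:
  fixes v :: "'a::comm_ring_1 vec"
  assumes "v \<in> carrier_vec n" shows "(c \<cdot>\<^sub>m 1\<^sub>m n) *\<^sub>v v = c \<cdot>\<^sub>v v"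
  by (rule eq_vecI) (use assms in auto)

context finite_group
begin

lemma bij_betw_left_mult:
  assumes "g \<in> carrier G" shows "bij_betw (\<lambda>h. g \<otimes> h) (carrier G) (carrier G)"
  by (rule bij_betw_byWitness[where f' = "\<lambda>h. inv g \<otimes> h"])
    (use assms in \<open>auto simp: m_assoc[symmetric]\<close>)

lemma bij_betw_inv: "bij_betw (\<lambda>h. inv h) (carrier G) (carrier G)"
  by (rule bij_betw_byWitness[where f' = "\<lambda>h. inv h"]) auto

text \<open>Summing the conjugates of an arbitrary matrix over the group produces an intertwiner. The sum is not divided by
the group order, so that it makes sense over any commutative ring.\<close>

definition average :: "('g, 'k::comm_ring_1) rep \<Rightarrow> ('g, 'k) rep \<Rightarrow> 'k mat \<Rightarrow> 'k mat" where
  "average M N X = mat_sum (dm N) (dm M) (carrier G) (\<lambda>h. N h * X * M (inv h))"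

lemma average_carrier [simp]: "average M N X \<in> carrier_mat (dm N) (dm M)"
  by (simp add: average_def)

lemma average_intertwines:
  fixes M N :: "('g, 'k::field_char_0) rep"
  assumes M: "is_rep G M" and N: "is_rep G N" and X: "X \<in> carrier_mat (dm N) (dm M)" and g: "g \<in> carrier G"
  shows "average M N X * M g = N g * average M N X"
proof -
  have car: "N h * X * M (inv h) \<in> carrier_mat (dm N) (dm M)" if "h \<in> carrier G" for h
    using rep_carrier[OF N that] rep_carrier[OF M, of "inv h"] that X by simp
  have "average M N X * M g = mat_sum (dm N) (dm M) (carrier G) (\<lambda>h. N h * X * M (inv h) * M g)"
    unfolding average_def by (rule mat_sum_mult[OF rep_carrier[OF M g] car])
  also have "\<dots> = mat_sum (dm N) (dm M) (carrier G) (\<lambda>h. N (g \<otimes> h) * X * M (inv (g \<otimes> h)) * M g)"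
    by (rule mat_sum_reindex[OF bij_betw_left_mult[OF g]])
  also have "\<dots> = mat_sum (dm N) (dm M) (carrier G) (\<lambda>h. N g * (N h * X * M (inv h)))"
  proof (rule mat_sum_cong)
    fix h assume h: "h \<in> carrier G"
    note Ng = rep_carrier[OF N g] and Nh = rep_carrier[OF N h] and Mg = rep_carrier[OF M g]
    have ih: "inv h \<in> carrier G" "inv (g \<otimes> h) \<in> carrier G" "g \<otimes> h \<in> carrier G" using g h by auto
    note Mh = rep_carrier[OF M ih(1)] and Mgh = rep_carrier[OF M ih(2)] and Ngh = rep_carrier[OF N ih(3)]
    have "inv (g \<otimes> h) \<otimes> g = inv h" using g h by (simp add: inv_mult_group m_assoc)
    then have "M (inv (g \<otimes> h)) * M g = M (inv h)" using rep_mult[OF M ih(2) g] by simp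
    then have "N (g \<otimes> h) * X * M (inv (g \<otimes> h)) * M g = N (g \<otimes> h) * X * M (inv h)"
      using assoc_mult_mat[OF mult_carrier_mat[OF Ngh X] Mgh Mg] by simp
    also have "\<dots> = N g * (N h * X * M (inv h))"
      using assoc_mult_mat[OF Ng Nh X] assoc_mult_mat[OF Ng mult_carrier_mat[OF Nh X] Mh] rep_mult[OF N g h] by simp
    finally show "N (g \<otimes> h) * X * M (inv (g \<otimes> h)) * M g = N g * (N h * X * M (inv h))" .
  qed
  also have "\<dots> = N g * average M N X"
    unfolding average_def by (rule mult_mat_sum[OF rep_carrier[OF N g] car, symmetric])
  finally show ?thesis .
qed

text \<open>Averaging a projection \<open>P\<close> onto the invariant subspace \<open>W\<close> gives \<open>E\<close> with \<open>P E = E\<close> and \<open>E P = P\<close>: the first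
because all conjugates map into \<open>W\<close>, the second because \<open>P\<close> is the identity on \<open>W\<close>. So \<open>E\<close> is an idempotent
intertwiner with image \<open>W\<close>.\<close>

lemma maschke:
  fixes M :: "('g, 'k::field_char_0) rep"
  assumes M: "is_rep G M" and sub: "VectorSpace.subspace class_ring W (module_vec TYPE('k) (dm M))"
    and inv: "\<And>h w. h \<in> carrier G \<Longrightarrow> w \<in> W \<Longrightarrow> M h *\<^sub>v w \<in> W"
    and W: "W \<noteq> {0\<^sub>v (dm M)}" "W \<noteq> carrier_vec (dm M)"
  shows "\<exists>N N'. is_rep G N \<and> is_rep G N' \<and> dm N < dm M \<and> dm N' < dm M \<and> rep_iso G M (rep_sum N N')"
proof -
  let ?d = "dm M" and ?n = "of_nat (card (carrier G)) :: 'k"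
  have n: "?n \<noteq> 0" using order_pos by simp
  obtain P where P: "P \<in> carrier_mat ?d ?d" and Pfix: "\<And>w. w \<in> W \<Longrightarrow> P *\<^sub>v w = w"
    and Pin: "\<And>x. x \<in> carrier_vec ?d \<Longrightarrow> P *\<^sub>v x \<in> W" using exists_projection_mat[OF sub] by blast
  have sm: "submodule class_ring W (module_vec TYPE('k) ?d)"
    using sub by (simp add: VectorSpace.subspace_def)
  have Wc: "W \<subseteq> carrier_vec ?d" using submodule.subset[OF sm] by (simp add: module_vec_simps)
  have W0: "0\<^sub>v ?d \<in> W" using submodule.zero_closed[OF sm] by (simp add: module_vec_simps)
  have PMP: "P * (M h * P) = M h * P" if h: "h \<in> carrier G" for h
  proof (rule eq_matI)
    note Mh = rep_carrier[OF M h]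
    fix i j assume ij: "i < dim_row (M h * P)" "j < dim_col (M h * P)"
    then have j: "j < ?d" using P by auto
    have c: "col (M h * P) j = M h *\<^sub>v (P *\<^sub>v unit_vec ?d j)"
      using Mh P j by (metis assoc_mult_mat_vec col_mult2 mult_mat_unit_vec unit_vec_carrier)
    then have "col (M h * P) j \<in> W" using inv[OF h Pin] by simp
    then have "col (P * (M h * P)) j = col (M h * P) j"
      using Pfix Mh P j by (metis col_mult2 mult_carrier_mat)
    then show "(P * (M h * P)) $$ (i, j) = (M h * P) $$ (i, j)"
      using ij P Mh by (metis (no_types, lifting) carrier_matD index_col index_mult_mat(2,3))
  qed (use P rep_carrier[OF M h] in auto)
  \<comment> \<open>\<open>PMP\<close> expresses the invariance of \<open>W\<close>; at the identity of the group it says that \<open>P\<close> is idempotent.\<close>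
  have PP: "P * P = P" using PMP[OF one_closed] P by (simp add: rep_one[OF M])
  have car: "M h * P * M (inv h) \<in> carrier_mat ?d ?d" if "h \<in> carrier G" for h
    using rep_carrier[OF M that] rep_carrier[OF M, of "inv h"] that P by simp
  let ?A = "average M M P"
  define E where "E = inverse ?n \<cdot>\<^sub>m ?A"
  have A: "?A \<in> carrier_mat ?d ?d" by simp
  have E: "E \<in> carrier_mat ?d ?d" by (simp add: E_def)
  have "P * ?A = mat_sum ?d ?d (carrier G) (\<lambda>h. P * (M h * P * M (inv h)))"
    unfolding average_def by (rule mult_mat_sum[OF P car])
  also have "\<dots> = ?A" unfolding average_def
  proof (rule mat_sum_cong)
    fix h assume h: "h \<in> carrier G"
    then have ih: "inv h \<in> carrier G" by simp
    show "P * (M h * P * M (inv h)) = M h * P * M (inv h)"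
      using assoc_mult_mat[OF P mult_carrier_mat[OF rep_carrier[OF M h] P] rep_carrier[OF M ih]] PMP[OF h] by simp
  qed
  finally have PA: "P * ?A = ?A" .
  have "?A * P = mat_sum ?d ?d (carrier G) (\<lambda>h. M h * P * M (inv h) * P)"
    unfolding average_def by (rule mat_sum_mult[OF P car])
  also have "\<dots> = mat_sum ?d ?d (carrier G) (\<lambda>_. P)"
  proof (rule mat_sum_cong)
    fix h assume h: "h \<in> carrier G"
    then have ih: "inv h \<in> carrier G" by simp
    note Mh = rep_carrier[OF M h] and Mi = rep_carrier[OF M ih]
    have "M h * P * M (inv h) * P = M h * (P * (M (inv h) * P))"
      using assoc_mult_mat[OF mult_carrier_mat[OF Mh P] Mi P] assoc_mult_mat[OF Mh P mult_carrier_mat[OF Mi P]] by simp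
    also have "\<dots> = M (h \<otimes> inv h) * P"
      unfolding PMP[OF ih] rep_mult[OF M h ih] by (rule assoc_mult_mat[OF Mh Mi P, symmetric])
    also have "\<dots> = P" using h P by (simp add: rep_one[OF M])
    finally show "M h * P * M (inv h) * P = P" .
  qed
  also have "\<dots> = ?n \<cdot>\<^sub>m P" by (rule mat_sum_const[OF P])
  finally have AP: "?A * P = ?n \<cdot>\<^sub>m P" .
  have PE: "P * E = E" unfolding E_def using mult_smult_distrib[OF P A] PA by simp
  have "inverse ?n \<cdot>\<^sub>m (?n \<cdot>\<^sub>m P) = P" by (rule eq_matI) (use n in auto)
  then have EP: "E * P = P" unfolding E_def using mult_smult_assoc_mat[OF A P, of "inverse ?n"] AP by simp
  have idem: "E * E = E"
    using assoc_mult_mat[OF E P E] EP PE by simp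
  have int: "E * M h = M h * E" if h: "h \<in> carrier G" for h
    unfolding E_def using mult_smult_distrib[OF rep_carrier[OF M h] A] mult_smult_assoc_mat[OF A rep_carrier[OF M h]]
      average_intertwines[OF M M P h] by simp
  have "E \<noteq> 0\<^sub>m ?d ?d"
  proof
    assume "E = 0\<^sub>m ?d ?d"
    then have "P = 0\<^sub>m ?d ?d" using EP P by simp
    then have "w = 0\<^sub>v ?d" if "w \<in> W" for w
    proof -
      have "w \<in> carrier_vec ?d" using that Wc by blast
      then have "0\<^sub>m ?d ?d *\<^sub>v w = 0\<^sub>v ?d" by (intro eq_vecI) auto
      then show ?thesis using Pfix[OF that] \<open>P = 0\<^sub>m ?d ?d\<close> by simp
    qed
    then show False using W(1) W0 by blast
  qed
  moreover have "E \<noteq> 1\<^sub>m ?d"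
  proof
    assume "E = 1\<^sub>m ?d"
    then have "P = 1\<^sub>m ?d" using PE P by simp
    then have "x \<in> W" if "x \<in> carrier_vec ?d" for x using Pin[OF that] that by simp
    then show False using W(2) Wc by blast
  qed
  ultimately show ?thesis using idempotent_intertwiner_splits[OF M E idem] int by simp
qed

lemma irreducible_subspace:
  fixes M :: "('g, 'k::field_char_0) rep"
  assumes "irreducible_rep G M" "W \<subseteq> carrier_vec (dm M)" "0\<^sub>v (dm M) \<in> W"
    "\<And>u v. u \<in> W \<Longrightarrow> v \<in> W \<Longrightarrow> u + v \<in> W" "\<And>c v. v \<in> W \<Longrightarrow> c \<cdot>\<^sub>v v \<in> W"
    "\<And>h w. h \<in> carrier G \<Longrightarrow> w \<in> W \<Longrightarrow> M h *\<^sub>v w \<in> W"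
  shows "W = {0\<^sub>v (dm M)} \<or> W = carrier_vec (dm M)"
  using assms(1) subspace_module_vecI[OF assms(2,3,4,5)] assms(6) unfolding irreducible_rep_def by blast

text \<open>The kernel is an invariant subspace of a simple module, so a nonzero kernel is everything.\<close>

lemma intertwiner_kernel:
  fixes M N :: "('g, 'k::field_char_0) rep"
  assumes irr: "irreducible_rep G M" and N: "is_rep G N" and T: "T \<in> carrier_mat (dm N) (dm M)"
    and int: "\<And>h. h \<in> carrier G \<Longrightarrow> T * M h = N h * T"
    and v: "v \<in> carrier_vec (dm M)" "v \<noteq> 0\<^sub>v (dm M)" "T *\<^sub>v v = 0\<^sub>v (dm N)"
  shows "T = 0\<^sub>m (dm N) (dm M)"
proof -
  have M: "is_rep G M" using irr by (simp add: irreducible_rep_def)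
  define W where "W = {w \<in> carrier_vec (dm M). T *\<^sub>v w = 0\<^sub>v (dm N)}"
  have "W = {0\<^sub>v (dm M)} \<or> W = carrier_vec (dm M)"
  proof (rule irreducible_subspace[OF irr])
    fix h w assume h: "h \<in> carrier G" and w: "w \<in> W"
    note Mh = rep_carrier[OF M h] and Nh = rep_carrier[OF N h]
    have wc: "w \<in> carrier_vec (dm M)" using w by (simp add: W_def)
    have "T *\<^sub>v (M h *\<^sub>v w) = (T * M h) *\<^sub>v w" using assoc_mult_mat_vec[OF T Mh wc] by simp
    also have "\<dots> = N h *\<^sub>v (T *\<^sub>v w)" unfolding int[OF h] by (rule assoc_mult_mat_vec[OF Nh T wc])
    also have "\<dots> = 0\<^sub>v (dm N)" using w Nh by (simp add: W_def mult_mat_zero_vec)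
    finally show "M h *\<^sub>v w \<in> W" using Mh wc by (simp add: W_def)
  next
    show "0\<^sub>v (dm M) \<in> W" using T by (auto simp: W_def mult_mat_zero_vec)
    show "u + v \<in> W" if "u \<in> W" "v \<in> W" for u v
      using that T by (auto simp: W_def mult_add_distrib_mat_vec[OF T])
    show "c \<cdot>\<^sub>v v \<in> W" if "v \<in> W" for c v
      using that T by (auto simp: W_def mult_mat_vec[OF T])
  qed (auto simp: W_def)
  moreover have "v \<in> W" using v by (simp add: W_def)
  ultimately have "W = carrier_vec (dm M)" using v(2) by auto
  then have all: "T *\<^sub>v w = 0\<^sub>v (dm N)" if "w \<in> carrier_vec (dm M)" for w using that by (auto simp: W_def)
  show ?thesis
  proof (rule eq_matI)
    fix i j assume "i < dim_row (0\<^sub>m (dm N) (dm M) :: 'k mat)" "j < dim_col (0\<^sub>m (dm N) (dm M) :: 'k mat)"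
    then have ij: "i < dm N" "j < dm M" by auto
    have "col T j = 0\<^sub>v (dm N)" using all[of "unit_vec (dm M) j"] mult_mat_unit_vec[OF T ij(2)] ij(2) by simp
    then show "T $$ (i, j) = (0\<^sub>m (dm N) (dm M)) $$ (i, j)"
      using ij T by (metis carrier_matD index_col index_zero_mat(1) index_zero_vec(1))
  qed (use T in auto)
qed

text \<open>The image is an invariant nonzero subspace, so \<open>T\<close> is surjective, and by \<open>intertwiner_kernel\<close> it is injective.\<close>

lemma schur:
  fixes M N :: "('g, 'k::field_char_0) rep"
  assumes irrM: "irreducible_rep G M" and irrN: "irreducible_rep G N" and T: "T \<in> carrier_mat (dm N) (dm M)"
    and int: "\<And>h. h \<in> carrier G \<Longrightarrow> T * M h = N h * T" and nz: "T \<noteq> 0\<^sub>m (dm N) (dm M)"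
  shows "rep_iso G M N"
proof -
  have M: "is_rep G M" and N: "is_rep G N" using irrM irrN by (simp_all add: irreducible_rep_def)
  let ?m = "dm M" and ?n = "dm N"
  define W where "W = (\<lambda>v. T *\<^sub>v v) ` carrier_vec ?m"
  have "W = {0\<^sub>v ?n} \<or> W = carrier_vec ?n"
  proof (rule irreducible_subspace[OF irrN])
    fix h w assume h: "h \<in> carrier G" and w: "w \<in> W"
    note Mh = rep_carrier[OF M h] and Nh = rep_carrier[OF N h]
    obtain v where v: "v \<in> carrier_vec ?m" "w = T *\<^sub>v v" using w by (auto simp: W_def)
    have "N h *\<^sub>v w = (N h * T) *\<^sub>v v" using assoc_mult_mat_vec[OF Nh T v(1)] v by simp
    also have "\<dots> = T *\<^sub>v (M h *\<^sub>v v)" unfolding int[OF h, symmetric] by (rule assoc_mult_mat_vec[OF T Mh v(1)])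
    finally show "N h *\<^sub>v w \<in> W" unfolding W_def using Mh v(1) by auto
  next
    have "T *\<^sub>v 0\<^sub>v ?m = 0\<^sub>v ?n" using T by (auto simp: mult_mat_zero_vec)
    then show "0\<^sub>v ?n \<in> W" unfolding W_def by (metis imageI zero_carrier_vec)
    fix u v assume "u \<in> W" "v \<in> W"
    then obtain u' v' where "u' \<in> carrier_vec ?m" "v' \<in> carrier_vec ?m" "u = T *\<^sub>v u'" "v = T *\<^sub>v v'"
      by (auto simp: W_def)
    then show "u + v \<in> W" unfolding W_def using mult_add_distrib_mat_vec[OF T] by (metis add_carrier_vec imageI)
  next
    fix c v assume "v \<in> W"
    then obtain v' where "v' \<in> carrier_vec ?m" "v = T *\<^sub>v v'" by (auto simp: W_def)
    then show "c \<cdot>\<^sub>v v \<in> W" unfolding W_def using mult_mat_vec[OF T] by (metis smult_carrier_vec imageI)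
  qed (use T in \<open>auto simp: W_def\<close>)
  moreover have "W \<noteq> {0\<^sub>v ?n}"
  proof
    assume W0: "W = {0\<^sub>v ?n}"
    have "unit_vec ?m 0 \<noteq> (0\<^sub>v ?m :: 'k vec)" using irrM
      by (metis index_unit_vec(1) index_zero_vec(1) irreducible_rep_def zero_neq_one)
    moreover have "T *\<^sub>v unit_vec ?m 0 = 0\<^sub>v ?n" using W0 unfolding W_def by (metis imageI singletonD unit_vec_carrier)
    ultimately show False using intertwiner_kernel[OF irrM N T int, of "unit_vec ?m 0"] nz by simp
  qed
  ultimately have W: "W = carrier_vec ?n" by blast
  have "\<exists>s. s \<in> carrier_vec ?m \<and> T *\<^sub>v s = unit_vec ?n j" for j
    using W unfolding W_def by (metis (mono_tags, lifting) imageE unit_vec_carrier)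
  then obtain s where s: "\<And>j. s j \<in> carrier_vec ?m" "\<And>j. T *\<^sub>v s j = unit_vec ?n j" by metis
  define S where "S = mat ?m ?n (\<lambda>(i, j). s j $ i)"
  have S: "S \<in> carrier_mat ?m ?n" by (simp add: S_def)
  have TS: "T * S = 1\<^sub>m ?n"
  proof (rule eq_matI)
    fix i j assume "i < dim_row (1\<^sub>m ?n :: 'k mat)" "j < dim_col (1\<^sub>m ?n :: 'k mat)"
    then have ij: "i < ?n" "j < ?n" by auto
    have "col S j = s j" by (rule eq_vecI) (use s(1)[of j] ij in \<open>auto simp: S_def\<close>)
    then have "(T * S) $$ (i, j) = (T *\<^sub>v s j) $ i" using ij T S by simp
    then show "(T * S) $$ (i, j) = (1\<^sub>m ?n) $$ (i, j)" using ij by (auto simp: s(2) unit_vec_def)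
  qed (use T S in auto)
  have "S * T = 1\<^sub>m ?m"
  proof (rule eq_matI)
    fix i j assume "i < dim_row (1\<^sub>m ?m :: 'k mat)" "j < dim_col (1\<^sub>m ?m :: 'k mat)"
    then have ij: "i < ?m" "j < ?m" by auto
    let ?e = "unit_vec ?m j :: 'k vec"
    define x where "x = S *\<^sub>v (T *\<^sub>v ?e) - ?e"
    have xc: "x \<in> carrier_vec ?m" using S T by (simp add: x_def)
    have "T *\<^sub>v (S *\<^sub>v (T *\<^sub>v ?e)) = (T * S) *\<^sub>v (T *\<^sub>v ?e)"
      by (rule assoc_mult_mat_vec[symmetric]) (use S T in auto)
    also have "\<dots> = T *\<^sub>v ?e" unfolding TS using T by simp
    finally have "T *\<^sub>v x = 0\<^sub>v ?n"
      unfolding x_def using T S by (subst mult_minus_distrib_mat_vec[OF T]) auto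
    then have "x = 0\<^sub>v ?m" using intertwiner_kernel[OF irrM N T int xc] nz by blast
    then have "(S *\<^sub>v (T *\<^sub>v ?e)) $ i = ?e $ i"
    proof -
      have "x $ i = (S *\<^sub>v (T *\<^sub>v ?e)) $ i - ?e $ i"
        unfolding x_def by (rule index_minus_vec) (use ij in simp)
      then show ?thesis using \<open>x = 0\<^sub>v ?m\<close> ij by (simp del: index_unit_vec)
    qed
    moreover have "S *\<^sub>v (T *\<^sub>v ?e) = col (S * T) j"
      using assoc_mult_mat_vec[OF S T unit_vec_carrier[of ?m j]]
        mult_mat_unit_vec[OF mult_carrier_mat[OF S T] ij(2)] by simp
    moreover have "(S * T) $$ (i, j) = col (S * T) j $ i"
      by (rule index_col[symmetric]) (use ij S T in auto)
    ultimately have "(S * T) $$ (i, j) = ?e $ i" by metis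
    then show "(S * T) $$ (i, j) = (1\<^sub>m ?m) $$ (i, j)" using ij by (auto simp: unit_vec_def)
  qed (use T S in auto)
  then show ?thesis by (intro rep_isoI[OF T S TS]) (auto intro: int)
qed

text \<open>Over an algebraically closed field \<open>T\<close> has an eigenvalue \<open>c\<close>, and \<open>T - c\<close> is an intertwiner with nonzero kernel.\<close>

lemma schur_scalar:
  fixes M :: "('g, 'k::{alg_closed_field, field_char_0}) rep"
  assumes irr: "irreducible_rep G M" and T: "T \<in> carrier_mat (dm M) (dm M)"
    and int: "\<And>h. h \<in> carrier G \<Longrightarrow> T * M h = M h * T"
  shows "\<exists>c. T = c \<cdot>\<^sub>m 1\<^sub>m (dm M)"
proof -
  let ?d = "dm M"
  have M: "is_rep G M" and d: "?d > 0" using irr by (simp_all add: irreducible_rep_def)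
  have "degree (char_poly T) = ?d" using degree_monic_char_poly[OF T] by simp
  then obtain c where "poly (char_poly T) c = 0"
    using alg_closed_imp_poly_has_root[of "char_poly T"] d by auto
  then obtain v where v: "v \<in> carrier_vec ?d" "v \<noteq> 0\<^sub>v ?d" "T *\<^sub>v v = c \<cdot>\<^sub>v v"
    using eigenvalue_root_char_poly[OF T] T unfolding eigenvalue_def eigenvector_def by auto
  define U where "U = T - c \<cdot>\<^sub>m 1\<^sub>m ?d"
  have cI: "c \<cdot>\<^sub>m 1\<^sub>m ?d \<in> carrier_mat ?d ?d" by simp
  have U: "U \<in> carrier_mat ?d ?d" unfolding U_def by (rule minus_carrier_mat[OF cI])
  have "U = 0\<^sub>m ?d ?d"
  proof (rule intertwiner_kernel[OF irr M U _ v(1,2)])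
    fix h assume h: "h \<in> carrier G"
    note Mh = rep_carrier[OF M h]
    show "U * M h = M h * U" unfolding U_def
      using minus_mult_distrib_mat[OF T cI Mh] mult_minus_distrib_mat[OF Mh T cI] int[OF h]
        mult_smult_assoc_mat[OF one_carrier_mat Mh, of c] mult_smult_distrib[OF Mh one_carrier_mat, of c] Mh by simp
  next
    have "(c \<cdot>\<^sub>m 1\<^sub>m ?d) *\<^sub>v v = c \<cdot>\<^sub>v v"
      by (rule scalar_mult_vec[OF v(1)])
    then show "U *\<^sub>v v = 0\<^sub>v ?d" unfolding U_def
      using minus_mult_distrib_mat_vec[OF T cI v(1)] v by simp
  qed
  then have "T = c \<cdot>\<^sub>m 1\<^sub>m ?d"
  proof -
    assume U0: "U = 0\<^sub>m ?d ?d"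
    show ?thesis
    proof (rule eq_matI)
      fix i j assume "i < dim_row (c \<cdot>\<^sub>m 1\<^sub>m ?d)" "j < dim_col (c \<cdot>\<^sub>m 1\<^sub>m ?d)"
      then show "T $$ (i, j) = (c \<cdot>\<^sub>m 1\<^sub>m ?d) $$ (i, j)"
        using arg_cong[OF U0, of "\<lambda>A. A $$ (i, j)"] T by (simp add: U_def)
    qed (use T in auto)
  qed
  then show ?thesis by blast
qed

section \<open>Orthogonality of irreducible characters\<close>

text \<open>The unnormalized inner product of characters. Replacing the complex conjugate by the inverse of the group element
makes sense over any field.\<close>

definition char_form :: "('g, 'k::comm_ring_1) rep \<Rightarrow> ('g, 'k) rep \<Rightarrow> 'k" where
  "char_form N M = (\<Sum>h\<in>carrier G. mat_trace (N h) * mat_trace (M (inv h)))"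

definition mat_unit :: "nat \<Rightarrow> nat \<Rightarrow> nat \<Rightarrow> nat \<Rightarrow> 'k::comm_ring_1 mat" where
  "mat_unit n m a b = mat n m (\<lambda>(i, j). if i = a \<and> j = b then 1 else 0)"

text \<open>The entry \<open>(i, j)\<close> of the average of the matrix unit \<open>E\<^sub>i\<^sub>j\<close> is the sum of \<open>N h (i, i) M (h\<^sup>-\<^sup>1) (j, j)\<close>,
which is what the product of the two traces consists of. So Schur's lemma computes the form.\<close>

lemma char_form_average:
  fixes M N :: "('g, 'k::field_char_0) rep"
  assumes M: "is_rep G M" and N: "is_rep G N"
  shows "char_form N M = (\<Sum>i<dm N. \<Sum>j<dm M. average M N (mat_unit (dm N) (dm M) i j) $$ (i, j))"
proof -
  have entry: "average M N (mat_unit (dm N) (dm M) a b) $$ (i, j) =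
      (\<Sum>h\<in>carrier G. N h $$ (i, a) * M (inv h) $$ (b, j))"
    if "a < dm N" "b < dm M" "i < dm N" "j < dm M" for a b i j
  proof -
    have "(N h * mat_unit (dm N) (dm M) a b * M (inv h)) $$ (i, j) = N h $$ (i, a) * M (inv h) $$ (b, j)"
      if h: "h \<in> carrier G" for h
    proof -
      have ih: "inv h \<in> carrier G" using h by simp
      note Nh = rep_carrier[OF N h] and Mh = rep_carrier[OF M ih]
      have U: "mat_unit (dm N) (dm M) a b \<in> carrier_mat (dm N) (dm M)" by (simp add: mat_unit_def)
      have NU: "(N h * mat_unit (dm N) (dm M) a b) $$ (i, l) = (if l = b then N h $$ (i, a) else 0)" if "l < dm M" for l
      proof -
        have "(N h * mat_unit (dm N) (dm M) a b) $$ (i, l) = (\<Sum>r<dm N. if r = a then (if l = b then N h $$ (i, a) else 0) else 0)"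
          unfolding mult_mat_index[OF Nh U \<open>i < dm N\<close> that] using that
          by (intro sum.cong) (auto simp: mat_unit_def)
        then show ?thesis using \<open>a < dm N\<close> by simp
      qed
      have "(N h * mat_unit (dm N) (dm M) a b * M (inv h)) $$ (i, j) =
          (\<Sum>l<dm M. if l = b then N h $$ (i, a) * M (inv h) $$ (b, j) else 0)"
        unfolding mult_mat_index[OF mult_carrier_mat[OF Nh U] Mh \<open>i < dm N\<close> \<open>j < dm M\<close>]
        by (intro sum.cong) (auto simp: NU)
      then show ?thesis using \<open>b < dm M\<close> by simp
    qed
    then show ?thesis using that by (simp add: average_def mat_sum_def)
  qed
  have "char_form N M = (\<Sum>h\<in>carrier G. \<Sum>i<dm N. \<Sum>j<dm M. N h $$ (i, i) * M (inv h) $$ (j, j))"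
    unfolding char_form_def
  proof (rule sum.cong[OF refl])
    fix h assume h: "h \<in> carrier G"
    then have ih: "inv h \<in> carrier G" by simp
    show "mat_trace (N h) * mat_trace (M (inv h)) = (\<Sum>i<dm N. \<Sum>j<dm M. N h $$ (i, i) * M (inv h) $$ (j, j))"
      unfolding mat_trace_def using rep_carrier[OF N h] rep_carrier[OF M ih] by (simp add: sum_product)
  qed
  also have "\<dots> = (\<Sum>i<dm N. \<Sum>j<dm M. \<Sum>h\<in>carrier G. N h $$ (i, i) * M (inv h) $$ (j, j))"
    by (subst sum.swap, intro sum.cong refl) (rule sum.swap)
  also have "\<dots> = (\<Sum>i<dm N. \<Sum>j<dm M. average M N (mat_unit (dm N) (dm M) i j) $$ (i, j))"
    by (intro sum.cong refl) (simp add: entry)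
  finally show ?thesis .
qed

lemma char_form_noniso:
  fixes M N :: "('g, 'k::field_char_0) rep"
  assumes irrM: "irreducible_rep G M" and irrN: "irreducible_rep G N" and non: "\<not> rep_iso G M N"
  shows "char_form N M = 0"
proof -
  have M: "is_rep G M" and N: "is_rep G N" using irrM irrN by (simp_all add: irreducible_rep_def)
  have "average M N (mat_unit (dm N) (dm M) i j) = 0\<^sub>m (dm N) (dm M)" for i j
    using schur[OF irrM irrN average_carrier average_intertwines[OF M N]] non by (metis mat_carrier mat_unit_def)
  then show ?thesis by (simp add: char_form_average[OF M N])
qed

text \<open>Averages of matrix units are scalar by Schur's lemma, and the scalar is found by comparing traces: all conjugates
of \<open>E\<^sub>i\<^sub>j\<close> have the trace of \<open>E\<^sub>i\<^sub>j\<close>.\<close>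

lemma char_form_irreducible:
  fixes M :: "('g, 'k::{alg_closed_field, field_char_0}) rep"
  assumes irr: "irreducible_rep G M"
  shows "char_form M M = of_nat (card (carrier G))"
proof -
  have M: "is_rep G M" and d: "dm M > 0" using irr by (simp_all add: irreducible_rep_def)
  let ?n = "of_nat (card (carrier G)) :: 'k" and ?d = "of_nat (dm M) :: 'k"
  have entry: "average M M (mat_unit (dm M) (dm M) i j) $$ (i, j) = (if i = j then ?n / ?d else 0)"
    if ij: "i < dm M" "j < dm M" for i j
  proof -
    let ?U = "mat_unit (dm M) (dm M) i j :: 'k mat"
    have U: "?U \<in> carrier_mat (dm M) (dm M)" by (simp add: mat_unit_def)
    obtain c where c: "average M M ?U = c \<cdot>\<^sub>m 1\<^sub>m (dm M)"
      using schur_scalar[OF irr average_carrier average_intertwines[OF M M U]] by blast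
    have car: "M h * ?U * M (inv h) \<in> carrier_mat (dm M) (dm M)" if "h \<in> carrier G" for h
      using rep_carrier[OF M that] rep_carrier[OF M, of "inv h"] that U by simp
    have trU: "mat_trace ?U = (if i = j then 1 else 0)"
    proof -
      have "mat_trace ?U = (\<Sum>l<dm M. if l = i then (if i = j then 1 else 0) else 0)"
        unfolding mat_trace_def by (intro sum.cong) (auto simp: mat_unit_def)
      then show ?thesis using ij by simp
    qed
    have "c * ?d = mat_trace (average M M ?U)" by (simp add: c mat_trace_smult[OF one_carrier_mat])
    also have "\<dots> = (\<Sum>h\<in>carrier G. mat_trace (M h * ?U * M (inv h)))"
      unfolding average_def by (rule mat_trace_mat_sum[OF car])
    also have "\<dots> = (\<Sum>h\<in>carrier G. mat_trace ?U)"
    proof (rule sum.cong[OF refl])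
      fix h assume h: "h \<in> carrier G"
      then have ih: "inv h \<in> carrier G" by simp
      note Mh = rep_carrier[OF M h] and Mi = rep_carrier[OF M ih]
      have "mat_trace (M h * ?U * M (inv h)) = mat_trace (M (inv h) * (M h * ?U))"
        by (rule mat_trace_comm[OF mult_carrier_mat[OF Mh U] Mi])
      also have "M (inv h) * (M h * ?U) = M (inv h \<otimes> h) * ?U"
        unfolding rep_mult[OF M ih h] by (rule assoc_mult_mat[OF Mi Mh U, symmetric])
      finally show "mat_trace (M h * ?U * M (inv h)) = mat_trace ?U" using h U by (simp add: rep_one[OF M])
    qed
    finally have "c * ?d = (if i = j then ?n else 0)" by (simp add: trU)
    then have "c = (if i = j then ?n / ?d else 0)" using d by (auto simp: field_simps split: if_splits)
    then show ?thesis using ij by (simp add: c)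
  qed
  have "char_form M M = (\<Sum>i<dm M. \<Sum>j<dm M. if i = j then ?n / ?d else 0)"
    unfolding char_form_average[OF M M] by (intro sum.cong refl entry) auto
  also have "\<dots> = ?n" using d by simp
  finally show ?thesis .
qed

end

section \<open>Decomposition into simple modules\<close>

locale simple_system = finite_group G for G :: "('g, 'e) monoid_scheme" (structure) +
  fixes m :: nat and V :: "nat \<Rightarrow> ('g, 'k::{alg_closed_field, field_char_0}) rep"
  assumes simples: "complete_simple_reps G m V"
begin

lemma V_irreducible: "i \<in> {1..m} \<Longrightarrow> irreducible_rep G (V i)"
  using simples unfolding complete_simple_reps_def by blast

lemma V_rep: "i \<in> {1..m} \<Longrightarrow> is_rep G (V i)"
  using V_irreducible by (simp add: irreducible_rep_def)

lemma V_dim_pos: "i \<in> {1..m} \<Longrightarrow> dm (V i) > 0"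
  using V_irreducible by (simp add: irreducible_rep_def)

lemma V_distinct: "i \<in> {1..m} \<Longrightarrow> j \<in> {1..m} \<Longrightarrow> rep_iso G (V i) (V j) \<Longrightarrow> i = j"
  using simples unfolding complete_simple_reps_def by blast

lemma V_complete: "irreducible_rep G M \<Longrightarrow> \<exists>i\<in>{1..m}. rep_iso G (V i) M"
  using simples unfolding complete_simple_reps_def by blast

definition zero_rep :: "('g, 'k) rep" where "zero_rep = (\<lambda>_. 0\<^sub>m 0 0)"

lemma zero_rep: "is_rep G zero_rep" "dm zero_rep = 0"
proof -
  have one: "zero_rep h = 1\<^sub>m 0" for h :: 'g by (rule eq_matI) (auto simp: zero_rep_def)
  have 3: "zero_rep (h \<otimes> h') = zero_rep h * zero_rep h'" for h h' by (simp add: one)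
  show "is_rep G zero_rep" "dm zero_rep = 0" using is_repI[of zero_rep 0, OF _ one 3] by (simp_all add: one)
qed

lemma zero_rep_trace: "mat_trace (zero_rep h) = 0"
  by (simp add: zero_rep_def mat_trace_def)

lemma zero_dim_iso:
  assumes M: "is_rep G M" and N: "is_rep G (N :: ('g, 'k) rep)" and 0: "dm M = 0" "dm N = 0"
  shows "rep_iso G M N"
proof (rule rep_isoI[of "0\<^sub>m 0 0" _ _ "0\<^sub>m 0 0"])
  show "0\<^sub>m 0 0 * M h = N h * 0\<^sub>m 0 0" if h: "h \<in> carrier G" for h
    by (rule eq_matI) (use 0 rep_carrier[OF M h] rep_carrier[OF N h] in auto)
qed (use 0 in \<open>auto intro!: eq_matI\<close>)

primrec rsum :: "nat list \<Rightarrow> ('g, 'k) rep" where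
  "rsum [] = zero_rep"
| "rsum (x # xs) = rep_sum (V x) (rsum xs)"

lemma rsum_rep: "set xs \<subseteq> {1..m} \<Longrightarrow> is_rep G (rsum xs)"
  by (induction xs) (auto simp: zero_rep V_rep rep_sum_rep)

lemma rsum_dim: "set xs \<subseteq> {1..m} \<Longrightarrow> dm (rsum xs) = (\<Sum>x\<leftarrow>xs. dm (V x))"
  by (induction xs) (auto simp: zero_rep V_rep rep_sum_rep rsum_rep)

lemma rsum_append:
  assumes "set xs \<subseteq> {1..m}" "set ys \<subseteq> {1..m}"
  shows "rep_iso G (rep_sum (rsum xs) (rsum ys)) (rsum (xs @ ys))"
  using assms(1)
proof (induction xs)
  case Nil
  note Y = rsum_rep[OF assms(2)]
  have "rep_iso G (rsum ys) (rep_sum zero_rep (rsum ys))"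
  proof (rule rep_sum_isoI[OF Y zero_rep(1) Y, of "0\<^sub>m (dm (rsum ys)) 0" "0\<^sub>m 0 (dm (rsum ys))" "1\<^sub>m (dm (rsum ys))" "1\<^sub>m (dm (rsum ys))"])
    fix h assume h: "h \<in> carrier G"
    show "0\<^sub>m 0 (dm (rsum ys)) * rsum ys h = zero_rep h * 0\<^sub>m 0 (dm (rsum ys))"
      by (rule eq_matI) (use rep_carrier[OF Y h] in \<open>auto simp: zero_rep_def\<close>)
    show "1\<^sub>m (dm (rsum ys)) * rsum ys h = rsum ys h * 1\<^sub>m (dm (rsum ys))"
      using rep_carrier[OF Y h] by simp
  qed (auto simp: zero_rep intro!: eq_matI simp: scalar_prod_def)
  then show ?case using rep_iso_sym[OF Y rep_sum_rep(1)[OF zero_rep(1) Y]] by simp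
next
  case (Cons x xs)
  note X = rsum_rep[of xs] and Y = rsum_rep[OF assms(2)] and XY = rsum_rep[of "xs @ ys"]
  have x: "is_rep G (V x)" using Cons by (simp add: V_rep)
  show ?case
    using rep_sum_cong[OF x rep_sum_rep(1)[OF X Y] x XY rep_iso_refl[OF x] Cons.IH] Cons.prems assms(2)
    by (simp add: rep_sum_assoc)
qed

text \<open>Complete reducibility, by induction on the dimension: Maschke splits whatever is not irreducible.\<close>

lemma decomposition:
  fixes M :: "('g, 'k) rep"
  assumes "is_rep G M" shows "\<exists>xs. set xs \<subseteq> {1..m} \<and> rep_iso G M (rsum xs)"
  using assms
proof (induction "dm M" arbitrary: M rule: less_induct)
  case less
  note M = less.prems
  consider (zero) "dm M = 0" | (irr) "irreducible_rep G M" | (red) "dm M > 0" "\<not> irreducible_rep G M" by blast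
  then show ?case
  proof cases
    case zero
    then have "rep_iso G M (rsum [])" using zero_dim_iso[OF M zero_rep(1)] zero_rep(2) by simp
    then show ?thesis by (intro exI[of _ "[]"]) simp
  next
    case irr
    then obtain i where i: "i \<in> {1..m}" "rep_iso G (V i) M" using V_complete by blast
    have r: "is_rep G (rep_sum (V i) zero_rep)" using rep_sum_rep(1)[OF V_rep zero_rep(1)] i by blast
    have "rep_iso G (V i) (rep_sum (V i) zero_rep)"
    proof (rule rep_sum_isoI[OF V_rep V_rep zero_rep(1), of i i "1\<^sub>m (dm (V i))" "1\<^sub>m (dm (V i))" "0\<^sub>m (dm (V i)) 0" "0\<^sub>m 0 (dm (V i))"])
      fix h assume h: "h \<in> carrier G"
      show "0\<^sub>m 0 (dm (V i)) * V i h = zero_rep h * 0\<^sub>m 0 (dm (V i))"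
        by (rule eq_matI) (use rep_carrier[OF V_rep[OF i(1)] h] in \<open>auto simp: zero_rep_def\<close>)
      show "1\<^sub>m (dm (V i)) * V i h = V i h * 1\<^sub>m (dm (V i))"
        using rep_carrier[OF V_rep[OF i(1)] h] by simp
    qed (use i in \<open>auto simp: zero_rep intro!: eq_matI simp: scalar_prod_def\<close>)
    then have "rep_iso G M (rep_sum (V i) zero_rep)"
      using rep_iso_trans[OF M V_rep[OF i(1)] r rep_iso_sym[OF V_rep[OF i(1)] M i(2)]] by blast
    then show ?thesis using i(1) by (intro exI[of _ "[i]"]) simp
  next
    case red
    then obtain W where W: "VectorSpace.subspace class_ring W (module_vec TYPE('k) (dm M))"
      "\<forall>h\<in>carrier G. \<forall>w\<in>W. M h *\<^sub>v w \<in> W" "W \<noteq> {0\<^sub>v (dm M)}" "W \<noteq> carrier_vec (dm M)"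
      using M unfolding irreducible_rep_def by blast
    have "\<exists>N N'. is_rep G N \<and> is_rep G N' \<and> dm N < dm M \<and> dm N' < dm M \<and> rep_iso G M (rep_sum N N')"
      by (rule maschke[OF M W(1) _ W(3,4)]) (use W(2) in blast)
    then obtain N N' where N: "is_rep G N" "is_rep G N'" "dm N < dm M" "dm N' < dm M" "rep_iso G M (rep_sum N N')"
      by blast
    obtain xs where xs: "set xs \<subseteq> {1..m}" "rep_iso G N (rsum xs)" using less.hyps[OF N(3,1)] by blast
    obtain ys where ys: "set ys \<subseteq> {1..m}" "rep_iso G N' (rsum ys)" using less.hyps[OF N(4,2)] by blast
    note rx = rsum_rep[OF xs(1)] and ry = rsum_rep[OF ys(1)]
    have xy: "set (xs @ ys) \<subseteq> {1..m}" using xs ys by simp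
    note s1 = rep_sum_rep(1)[OF N(1,2)] and s2 = rep_sum_rep(1)[OF rx ry]
    have "rep_iso G M (rep_sum (rsum xs) (rsum ys))"
      by (rule rep_iso_trans[OF M s1 s2 N(5) rep_sum_cong[OF N(1,2) rx ry xs(2) ys(2)]])
    then have "rep_iso G M (rsum (xs @ ys))"
      by (rule rep_iso_trans[OF M s2 rsum_rep[OF xy] _ rsum_append[OF xs(1) ys(1)]])
    then show ?thesis using xy by blast
  qed
qed

lemma rsum_move:
  assumes "set xs \<subseteq> {1..m}" "x \<in> set xs"
  shows "rep_iso G (rsum xs) (rsum (x # remove1 x xs))"
  using assms
proof (induction xs)
  case Nil then show ?case by simp
next
  case (Cons y ys)
  show ?case
  proof (cases "x = y")
    case True
    then show ?thesis using rep_iso_refl[OF rsum_rep[OF Cons.prems(1)]] by simp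
  next
    case False
    then have x: "x \<in> set ys" using Cons.prems by simp
    have sub: "set (remove1 x ys) \<subseteq> {1..m}" using Cons.prems set_remove1_subset[of x ys] by auto
    have xr: "x \<in> {1..m}" "y \<in> {1..m}" "set ys \<subseteq> {1..m}" using Cons.prems x by auto
    note rx = V_rep[OF xr(1)] and ry = V_rep[OF xr(2)] and rs = rsum_rep[OF xr(3)] and rr = rsum_rep[OF sub]
    note rxr = rep_sum_rep(1)[OF rx rr]
    have 1: "rep_iso G (rsum (y # ys)) (rep_sum (V y) (rep_sum (V x) (rsum (remove1 x ys))))"
      using rep_sum_cong[OF ry rs ry rxr rep_iso_refl[OF ry]] Cons.IH[OF xr(3) x] by simp
    have 2: "rep_iso G (rep_sum (rep_sum (V y) (V x)) (rsum (remove1 x ys))) (rep_sum (rep_sum (V x) (V y)) (rsum (remove1 x ys)))"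
      by (rule rep_sum_cong[OF rep_sum_rep(1)[OF ry rx] rr rep_sum_rep(1)[OF rx ry] rr rep_sum_comm[OF ry rx] rep_iso_refl[OF rr]])
    have "rep_iso G (rsum (y # ys)) (rep_sum (V x) (rep_sum (V y) (rsum (remove1 x ys))))"
      by (rule rep_iso_trans[OF rsum_rep[OF Cons.prems(1)] rep_sum_rep(1)[OF ry rxr] rep_sum_rep(1)[OF rx rep_sum_rep(1)[OF ry rr]] 1])
        (use 2 in \<open>simp add: rep_sum_assoc\<close>)
    then show ?thesis using False by simp
  qed
qed

text \<open>Direct sums do not depend on the order of the summands.\<close>

lemma rsum_mset_cong:
  assumes "set xs \<subseteq> {1..m}" "mset xs = mset ys"
  shows "rep_iso G (rsum xs) (rsum ys)"
  using assms
proof (induction xs arbitrary: ys)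
  case Nil
  then show ?case using rep_iso_refl[OF zero_rep(1)] by simp
next
  case (Cons x xs)
  have x: "x \<in> set ys" using Cons.prems(2) by (metis list.set_intros(1) set_mset_mset)
  have ys: "set ys \<subseteq> {1..m}" using Cons.prems by (metis set_mset_mset)
  have ms: "mset xs = mset (remove1 x ys)" using Cons.prems(2) by (metis add_mset_remove_trivial mset.simps(2) mset_remove1)
  have sub: "set (remove1 x ys) \<subseteq> {1..m}" using ys set_remove1_subset[of x ys] by auto
  have xr: "x \<in> {1..m}" "set xs \<subseteq> {1..m}" using Cons.prems by auto
  note rx = V_rep[OF xr(1)] and rs = rsum_rep[OF xr(2)] and rr = rsum_rep[OF sub]
  have 1: "rep_iso G (rsum (x # xs)) (rsum (x # remove1 x ys))"
    using rep_sum_cong[OF rx rs rx rr rep_iso_refl[OF rx] Cons.IH[OF xr(2) ms]] by simp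
  have sub': "set (x # remove1 x ys) \<subseteq> {1..m}" using sub xr by simp
  show ?case
    by (rule rep_iso_trans[OF rsum_rep[OF Cons.prems(1)] rsum_rep[OF sub'] rsum_rep[OF ys] 1
        rep_iso_sym[OF rsum_rep[OF ys] rsum_rep[OF sub'] rsum_move[OF ys x]]])
qed

abbreviation "gord \<equiv> (of_nat (card (carrier G)) :: 'k)"

lemma gord_nonzero: "gord \<noteq> 0"
  using order_pos by simp

lemma char_form_V:
  assumes "i \<in> {1..m}" "j \<in> {1..m}"
  shows "char_form (V j) (V i) = (if i = j then gord else 0)"
  using char_form_irreducible[OF V_irreducible[OF assms(1)]]
    char_form_noniso[OF V_irreducible[OF assms(1)] V_irreducible[OF assms(2)]] V_distinct[OF assms]
  by auto

lemma char_form_rsum: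
  assumes "set xs \<subseteq> {1..m}" "i \<in> {1..m}"
  shows "char_form (rsum xs) (V i) = of_nat (count_list xs i) * gord"
  using assms(1)
proof (induction xs)
  case Nil then show ?case by (simp add: char_form_def zero_rep_trace)
next
  case (Cons x xs)
  have "char_form (rsum (x # xs)) (V i) = char_form (V x) (V i) + char_form (rsum xs) (V i)"
    unfolding char_form_def sum.distrib[symmetric]
    by (rule sum.cong) (use Cons.prems in \<open>auto simp: rep_sum_trace V_rep rsum_rep distrib_right\<close>)
  then show ?case using Cons char_form_V[OF assms(2), of x] by (auto simp: distrib_right)
qed

lemma char_form_cong:
  "(\<And>h. h \<in> carrier G \<Longrightarrow> mat_trace (M h) = mat_trace (N h)) \<Longrightarrow> char_form M L = char_form N L"
  by (simp add: char_form_def)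

text \<open>The number of copies of \<open>V i\<close> in \<open>M\<close>. Defining it through the character makes its invariance and additivity
evident; that such a natural number exists is \<open>char_form_multiplicity\<close>.\<close>

definition multiplicity :: "nat \<Rightarrow> ('g, 'k) rep \<Rightarrow> nat" where
  "multiplicity i M = (SOME c. char_form M (V i) = of_nat c * gord)"

lemma multiplicity_eqI: "char_form M (V i) = of_nat c * gord \<Longrightarrow> multiplicity i M = c"
  unfolding multiplicity_def using gord_nonzero by (intro some_equality) auto

lemma multiplicity_count:
  assumes M: "is_rep G M" and xs: "set xs \<subseteq> {1..m}" "rep_iso G M (rsum xs)" and i: "i \<in> {1..m}"
  shows "multiplicity i M = count_list xs i"
proof (rule multiplicity_eqI)
  show "char_form M (V i) = of_nat (count_list xs i) * gord"
    using char_form_rsum[OF xs(1) i] char_form_cong[of M "rsum xs" "V i"] rep_iso_trace[OF M rsum_rep[OF xs(1)] xs(2)]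
    by simp
qed

lemma char_form_multiplicity:
  assumes "is_rep G M" "i \<in> {1..m}"
  shows "char_form M (V i) = of_nat (multiplicity i M) * gord"
proof -
  obtain xs where xs: "set xs \<subseteq> {1..m}" "rep_iso G M (rsum xs)" using decomposition[OF assms(1)] by blast
  then show ?thesis
    using char_form_rsum[OF xs(1) assms(2)] char_form_cong[of M "rsum xs" "V i"]
      rep_iso_trace[OF assms(1) rsum_rep[OF xs(1)] xs(2)] multiplicity_count[OF assms(1) xs assms(2)] by simp
qed

lemma multiplicity_cong:
  "(\<And>h. h \<in> carrier G \<Longrightarrow> mat_trace (M h) = mat_trace (N h)) \<Longrightarrow> multiplicity i M = multiplicity i N"
  unfolding multiplicity_def by (simp add: char_form_cong[of M N])

text \<open>Characters determine the multiplicities by orthogonality, and these determine the direct sum of simple modules.\<close>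

lemma rep_iso_iff_trace:
  fixes M N :: "('g, 'k) rep"
  assumes M: "is_rep G M" and N: "is_rep G N"
  shows "rep_iso G M N \<longleftrightarrow> (\<forall>h\<in>carrier G. mat_trace (M h) = mat_trace (N h))"
proof
  assume "rep_iso G M N"
  then show "\<forall>h\<in>carrier G. mat_trace (M h) = mat_trace (N h)" using rep_iso_trace[OF M N] by blast
next
  assume tr: "\<forall>h\<in>carrier G. mat_trace (M h) = mat_trace (N h)"
  obtain xs where xs: "set xs \<subseteq> {1..m}" "rep_iso G M (rsum xs)" using decomposition[OF M] by blast
  obtain ys where ys: "set ys \<subseteq> {1..m}" "rep_iso G N (rsum ys)" using decomposition[OF N] by blast
  have "count_list xs i = count_list ys i" for i
  proof (cases "i \<in> {1..m}")
    case True
    then show ?thesis using multiplicity_count[OF M xs True] multiplicity_count[OF N ys True] multiplicity_cong[of M N i] tr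
      by simp
  next
    case False
    then have "i \<notin> set xs" "i \<notin> set ys" using xs ys by blast+
    then show ?thesis by (simp add: count_list_0_iff)
  qed
  then have ms: "mset xs = mset ys" by (intro multiset_eqI) (simp add: count_mset)
  note rx = rsum_rep[OF xs(1)] and ry = rsum_rep[OF ys(1)]
  have "rep_iso G M (rsum ys)" by (rule rep_iso_trans[OF M rx ry xs(2) rsum_mset_cong[OF xs(1) ms]])
  then show "rep_iso G M N" by (rule rep_iso_trans[OF M ry N _ rep_iso_sym[OF N ry ys(2)]])
qed

lemma multiplicity_V:
  assumes "i \<in> {1..m}" "j \<in> {1..m}" shows "multiplicity i (V j) = (if i = j then 1 else 0)"
  by (rule multiplicity_eqI) (use char_form_V[OF assms] in auto)

lemma multiplicity_sum:
  assumes M: "is_rep G M" and N: "is_rep G N" and i: "i \<in> {1..m}"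
  shows "multiplicity i (rep_sum M N) = multiplicity i M + multiplicity i N"
proof (rule multiplicity_eqI)
  have "char_form (rep_sum M N) (V i) = char_form M (V i) + char_form N (V i)"
    unfolding char_form_def sum.distrib[symmetric]
    by (rule sum.cong) (use M N in \<open>auto simp: rep_sum_trace distrib_right\<close>)
  then show "char_form (rep_sum M N) (V i) = of_nat (multiplicity i M + multiplicity i N) * gord"
    using char_form_multiplicity[OF M i] char_form_multiplicity[OF N i] by (simp add: distrib_right)
qed

lemma dim_multiplicity:
  assumes M: "is_rep G M"
  shows "dm M = (\<Sum>i\<in>{1..m}. multiplicity i M * dm (V i))"
proof -
  obtain xs where xs: "set xs \<subseteq> {1..m}" "rep_iso G M (rsum xs)" using decomposition[OF M] by blast
  have "dm M = dm (rsum xs)" using rep_iso_pair[OF xs(2)] iso_pairD(6) by blast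
  also have "\<dots> = (\<Sum>i\<in>set xs. count_list xs i * dm (V i))"
    unfolding rsum_dim[OF xs(1)] by (rule sum_list_map_eq_sum_count)
  also have "\<dots> = (\<Sum>i\<in>{1..m}. count_list xs i * dm (V i))"
    by (rule sum.mono_neutral_left) (use xs in \<open>auto simp: count_list_0_iff\<close>)
  also have "\<dots> = (\<Sum>i\<in>{1..m}. multiplicity i M * dm (V i))"
    by (rule sum.cong) (auto simp: multiplicity_count[OF M xs])
  finally show ?thesis .
qed

lemma V_eqI:
  assumes "i \<in> {1..m}" "j \<in> {1..m}" "\<And>h. h \<in> carrier G \<Longrightarrow> mat_trace (V i h) = mat_trace (V j h)"
  shows "i = j"
  using V_distinct[OF assms(1,2)] rep_iso_iff_trace[OF V_rep[OF assms(1)] V_rep[OF assms(2)]] assms(3) by blast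

end

section \<open>Fusion numbers\<close>

text \<open>Tensoring with the linear character \<open>\<chi>\<^sup>-\<^sup>1\<close> permutes the simple modules by \<open>\<tau>\<close>, and duality by \<open>star\<close>. All
properties of these permutations are read off from characters.\<close>

locale character_system = simple_system G m V for G :: "('g, 'e) monoid_scheme" (structure)
    and m and V :: "nat \<Rightarrow> ('g, 'k::{alg_closed_field, field_char_0}) rep" +
  fixes \<chi> :: "'g \<Rightarrow> 'k" and \<tau> star :: "nat \<Rightarrow> nat"
  assumes char_hom: "\<chi> \<in> hom G (units_of class_ring)"
    and trivial: "rep_iso G (V 1) trivial_rep"
    and tau_bij: "bij_betw \<tau> {1..m} {1..m}"
    and tau: "\<And>i. i \<in> {1..m} \<Longrightarrow>
        rep_iso G (rep_tensor (char_rep (\<lambda>h. inverse (\<chi> h))) (V i)) (V (\<tau> i))"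
    and star: "\<And>i. i \<in> {1..m} \<Longrightarrow> star i \<in> {1..m} \<and> rep_iso G (rep_dual G (V i)) (V (star i))"
begin

lemma chi_nonzero: "h \<in> carrier G \<Longrightarrow> \<chi> h \<noteq> 0"
  using hom_in_carrier[OF char_hom, of h] by (auto simp: units_of_def Units_def)

lemma chi_mult: "h \<in> carrier G \<Longrightarrow> h' \<in> carrier G \<Longrightarrow> \<chi> (h \<otimes> h') = \<chi> h * \<chi> h'"
  using hom_mult[OF char_hom, of h h'] by (simp add: units_of_def)

lemma chi_one: "\<chi> \<one> = 1"
  using chi_mult[of \<one> \<one>] chi_nonzero[of \<one>] by simp

lemma chi_inv: "h \<in> carrier G \<Longrightarrow> \<chi> (inv h) = inverse (\<chi> h)"
  using chi_mult[of h "inv h"] chi_nonzero[of h] chi_one by (simp add: inverse_unique)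

abbreviation "chi_rep \<equiv> char_rep (\<lambda>h. inverse (\<chi> h))"

lemma chi_rep: "is_rep G chi_rep" "dm chi_rep = 1"
  by (rule char_rep_rep; simp add: chi_one chi_mult)+

lemma trivial_is_rep: "is_rep G (trivial_rep :: ('g, 'k) rep)" "dm (trivial_rep :: ('g, 'k) rep) = 1"
  unfolding trivial_rep_def by (rule char_rep_rep; simp)+

lemma one_in: "1 \<in> {1..m}"
proof -
  obtain xs where xs: "set xs \<subseteq> {1..m}" "rep_iso G trivial_rep (rsum xs)"
    using decomposition[OF trivial_is_rep(1)] by blast
  have "dm (rsum xs) = 1" using rep_iso_pair[OF xs(2)] iso_pairD(6) trivial_is_rep(2) by metis
  then have "xs \<noteq> []" using zero_rep by auto
  then show ?thesis using xs(1) by (cases xs) auto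
qed

lemma V1_trace: "h \<in> carrier G \<Longrightarrow> mat_trace (V 1 h) = 1"
  using rep_iso_trace[OF V_rep[OF one_in] trivial_is_rep(1) trivial] char_rep_trace by (simp add: trivial_rep_def)

lemma tau_in: "i \<in> {1..m} \<Longrightarrow> \<tau> i \<in> {1..m}"
  using bij_betwE[OF tau_bij] by blast

lemma star_in: "i \<in> {1..m} \<Longrightarrow> star i \<in> {1..m}"
  using star by blast

lemma tau_trace:
  assumes "i \<in> {1..m}" "h \<in> carrier G"
  shows "mat_trace (V (\<tau> i) h) = inverse (\<chi> h) * mat_trace (V i h)"
  using rep_iso_trace[OF rep_tensor_rep(1)[OF chi_rep(1) V_rep[OF assms(1)]] V_rep[OF tau_in[OF assms(1)]] tau[OF assms(1)] assms(2)]
    rep_tensor_trace[OF chi_rep(1) V_rep[OF assms(1)] assms(2)] by (simp add: char_rep_trace)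

lemma star_trace:
  assumes "i \<in> {1..m}" "h \<in> carrier G"
  shows "mat_trace (V (star i) h) = mat_trace (V i (inv h))"
  using rep_iso_trace[OF rep_dual_rep(1)[OF V_rep[OF assms(1)]] V_rep[OF star_in[OF assms(1)]] _ assms(2)] star[OF assms(1)]
    rep_dual_trace[OF V_rep[OF assms(1)] assms(2)] by simp

lemma tau_dim: "i \<in> {1..m} \<Longrightarrow> dm (V (\<tau> i)) = dm (V i)"
  using rep_iso_pair[OF tau] iso_pairD(6) rep_tensor_rep(2)[OF chi_rep(1) V_rep] chi_rep(2) by fastforce

lemma star_dim: "i \<in> {1..m} \<Longrightarrow> dm (V (star i)) = dm (V i)"
  using star rep_iso_pair iso_pairD(6) rep_dual_rep(2)[OF V_rep] by metis

lemma dim_V1: "dm (V 1) = 1"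
  using rep_iso_pair[OF trivial] iso_pairD(6) trivial_is_rep(2) by metis

lemma star_star: "i \<in> {1..m} \<Longrightarrow> star (star i) = i"
  by (rule V_eqI) (simp_all add: star_in star_trace del: One_nat_def atLeastAtMost_iff)

lemma star_one: "star 1 = 1"
  by (rule V_eqI) (use one_in star_in in \<open>auto simp: star_trace V1_trace simp del: One_nat_def atLeastAtMost_iff\<close>)

lemma tau_star_tau: "i \<in> {1..m} \<Longrightarrow> \<tau> (star (\<tau> i)) = star i"
  by (rule V_eqI) (simp_all add: tau_in star_in tau_trace star_trace chi_inv chi_nonzero del: One_nat_def atLeastAtMost_iff)

definition fusion :: "nat \<Rightarrow> nat \<Rightarrow> nat \<Rightarrow> nat" where
  "fusion i j k = multiplicity k (rep_tensor (V i) (V j))"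

text \<open>The fusion numbers as a symmetric sum over the group; their behaviour under duality and the value at the trivial
module follow by substituting \<open>h \<mapsto> h\<^sup>-\<^sup>1\<close> and by orthogonality.\<close>

lemma fusion_char:
  assumes "i \<in> {1..m}" "j \<in> {1..m}" "k \<in> {1..m}"
  shows "of_nat (fusion i j k) * gord = (\<Sum>h\<in>carrier G. mat_trace (V i h) * mat_trace (V j h) * mat_trace (V k (inv h)))"
proof -
  have "of_nat (fusion i j k) * gord = char_form (rep_tensor (V i) (V j)) (V k)"
    unfolding fusion_def using char_form_multiplicity[OF rep_tensor_rep(1)[OF V_rep V_rep]] assms by simp
  also have "\<dots> = (\<Sum>h\<in>carrier G. mat_trace (V i h) * mat_trace (V j h) * mat_trace (V k (inv h)))"
    unfolding char_form_def by (rule sum.cong) (use assms in \<open>auto simp: rep_tensor_trace V_rep\<close>)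
  finally show ?thesis .
qed

lemma fusion_eqI:
  assumes "of_nat (fusion i j k) * gord = of_nat c * gord" shows "fusion i j k = c"
  using assms gord_nonzero by simp

text \<open>The trivial module occurs in \<open>V i \<otimes> V j\<close> iff \<open>V j\<close> is dual to \<open>V i\<close>: the sum in \<open>fusion_char\<close> becomes the
character form of \<open>V j\<close> and \<open>V (star i)\<close>.\<close>

lemma fusion_one:
  assumes "i \<in> {1..m}" "j \<in> {1..m}" shows "fusion i j 1 = (if j = star i then 1 else 0)"
proof (rule fusion_eqI)
  have "of_nat (fusion i j 1) * gord = (\<Sum>h\<in>carrier G. mat_trace (V j h) * mat_trace (V (star i) (inv h)))"
    unfolding fusion_char[OF assms one_in]
    by (rule sum.cong) (use assms in \<open>auto simp: star_trace V1_trace simp del: One_nat_def\<close>)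
  also have "\<dots> = char_form (V j) (V (star i))" by (simp add: char_form_def)
  finally show "of_nat (fusion i j 1) * gord = of_nat (if j = star i then 1 else 0) * gord"
    using char_form_V[OF star_in[OF assms(1)] assms(2)] by auto
qed

lemma fusion_star:
  assumes "i \<in> {1..m}" "j \<in> {1..m}" "k \<in> {1..m}"
  shows "fusion (star i) (star j) (star k) = fusion i j k"
proof (rule fusion_eqI)
  have "of_nat (fusion (star i) (star j) (star k)) * gord =
      (\<Sum>h\<in>carrier G. mat_trace (V i (inv h)) * mat_trace (V j (inv h)) * mat_trace (V k (inv (inv h))))"
    unfolding fusion_char[OF star_in[OF assms(1)] star_in[OF assms(2)] star_in[OF assms(3)]]
    by (rule sum.cong) (use assms in \<open>auto simp: star_trace\<close>)
  also have "\<dots> = (\<Sum>h\<in>carrier G. mat_trace (V i h) * mat_trace (V j h) * mat_trace (V k (inv h)))"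
    by (rule sum.reindex_bij_betw[OF bij_betw_inv])
  finally show "of_nat (fusion (star i) (star j) (star k)) * gord = of_nat (fusion i j k) * gord"
    by (simp add: fusion_char[OF assms])
qed

lemma fusion_dim:
  assumes "i \<in> {1..m}" "j \<in> {1..m}"
  shows "dm (V i) * dm (V j) = (\<Sum>k\<in>{1..m}. fusion i j k * dm (V k))"
  unfolding fusion_def
  using dim_multiplicity[OF rep_tensor_rep(1)[OF V_rep[OF assms(1)] V_rep[OF assms(2)]]]
    rep_tensor_rep(2)[OF V_rep[OF assms(1)] V_rep[OF assms(2)]] by simp

end

section \<open>The Green ring\<close>

context simple_system
begin

abbreviation "X \<equiv> iso_class_monoid G :: ('g, 'k) rep set monoid"
abbreviation "cls M \<equiv> iso_class G (M :: ('g, 'k) rep)"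

lemma cls_eqI:
  assumes "is_rep G M" "is_rep G N" "\<And>h. h \<in> carrier G \<Longrightarrow> mat_trace (M h) = mat_trace (N h)"
  shows "cls M = cls N"
  unfolding iso_class_def using assms by (auto simp: rep_iso_iff_trace)

lemma cls_mem: "is_rep G M \<Longrightarrow> N \<in> cls M \<Longrightarrow> is_rep G N"
  "is_rep G M \<Longrightarrow> N \<in> cls M \<Longrightarrow> h \<in> carrier G \<Longrightarrow> mat_trace (N h) = mat_trace (M h)"
  unfolding iso_class_def by (auto simp: rep_iso_iff_trace)

lemma cls_self: "is_rep G M \<Longrightarrow> M \<in> cls M"
  by (simp add: iso_class_def rep_iso_iff_trace)

lemma carrier_X: "carrier X = cls ` {M. is_rep G M}"
  by (simp add: iso_class_monoid_def)

lemma cls_in: "is_rep G M \<Longrightarrow> cls M \<in> carrier X"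
  by (auto simp: carrier_X)

lemma cls_mult:
  assumes M: "is_rep G M" and N: "is_rep G N"
  shows "cls M \<otimes>\<^bsub>X\<^esub> cls N = cls (rep_tensor M N)"
proof -
  have "cls (rep_tensor M' N') = cls (rep_tensor M N)" if "M' \<in> cls M" "N' \<in> cls N" for M' N'
    by (rule cls_eqI) (use that M N cls_mem in \<open>auto simp: rep_tensor_rep rep_tensor_trace\<close>)
  then have "(\<Union>M'\<in>cls M. \<Union>N'\<in>cls N. cls (rep_tensor M' N')) = cls (rep_tensor M N)"
    using cls_self[OF M] cls_self[OF N] by blast
  then show ?thesis by (simp add: iso_class_monoid_def)
qed

lemma triv_rep: "is_rep G (trivial_rep :: ('g, 'k) rep)" "mat_trace ((trivial_rep :: ('g, 'k) rep) h) = 1"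
  unfolding trivial_rep_def by (rule char_rep_rep; simp) (simp add: char_rep_trace)

lemma one_X: "\<one>\<^bsub>X\<^esub> = cls trivial_rep"
  by (simp add: iso_class_monoid_def)

text \<open>Since characters separate isomorphism classes, each law only has to be checked for traces.\<close>

lemma comm_monoid_X: "comm_monoid X"
proof (rule comm_monoidI)
  fix x y assume "x \<in> carrier X" "y \<in> carrier X"
  then obtain M N where MN: "is_rep G M" "is_rep G N" "x = cls M" "y = cls N" by (auto simp: carrier_X)
  then show "x \<otimes>\<^bsub>X\<^esub> y \<in> carrier X" by (simp add: cls_mult cls_in rep_tensor_rep)
  show "x \<otimes>\<^bsub>X\<^esub> y = y \<otimes>\<^bsub>X\<^esub> x"
    unfolding MN(3,4) cls_mult[OF MN(1,2)] cls_mult[OF MN(2,1)]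
    by (rule cls_eqI) (use MN in \<open>auto simp: rep_tensor_rep rep_tensor_trace\<close>)
next
  show "\<one>\<^bsub>X\<^esub> \<in> carrier X" unfolding one_X by (rule cls_in) (rule triv_rep)
next
  fix x y z assume "x \<in> carrier X" "y \<in> carrier X" "z \<in> carrier X"
  then obtain L M N where MN: "is_rep G L" "is_rep G M" "is_rep G N" "x = cls L" "y = cls M" "z = cls N"
    by (auto simp: carrier_X)
  have "x \<otimes>\<^bsub>X\<^esub> y \<otimes>\<^bsub>X\<^esub> z = cls (rep_tensor (rep_tensor L M) N)" using MN by (simp add: cls_mult rep_tensor_rep)
  also have "\<dots> = cls (rep_tensor L (rep_tensor M N))"
    by (rule cls_eqI) (use MN in \<open>auto simp: rep_tensor_rep rep_tensor_trace\<close>)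
  also have "\<dots> = x \<otimes>\<^bsub>X\<^esub> (y \<otimes>\<^bsub>X\<^esub> z)" using MN by (simp add: cls_mult rep_tensor_rep)
  finally show "x \<otimes>\<^bsub>X\<^esub> y \<otimes>\<^bsub>X\<^esub> z = x \<otimes>\<^bsub>X\<^esub> (y \<otimes>\<^bsub>X\<^esub> z)" .
next
  fix x assume "x \<in> carrier X"
  then obtain M where M: "is_rep G M" "x = cls M" by (auto simp: carrier_X)
  show "\<one>\<^bsub>X\<^esub> \<otimes>\<^bsub>X\<^esub> x = x"
    unfolding one_X M(2) cls_mult[OF triv_rep(1) M(1)]
    by (rule cls_eqI) (use M triv_rep in \<open>auto simp: rep_tensor_rep rep_tensor_trace\<close>)
qed

abbreviation "grels \<equiv> green_rels G :: (('g, 'k) rep set \<Rightarrow>\<^sub>0 int) set"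

lemma grels_closed: "grels \<subseteq> carrier (free_ring X)"
proof
  fix r assume "r \<in> grels"
  then obtain M N where MN: "is_rep G M" "is_rep G N"
    "r = frag_of (cls (rep_sum M N)) - frag_of (cls M) - frag_of (cls N)"
    unfolding green_rels_def by blast
  have "cls (rep_sum M N) \<in> carrier X" "cls M \<in> carrier X" "cls N \<in> carrier X"
    using MN by (auto intro!: cls_in rep_sum_rep)
  then show "r \<in> carrier (free_ring X)"
    using keys_diff[of "frag_of (cls (rep_sum M N)) - frag_of (cls M)" "frag_of (cls N)"]
      keys_diff[of "frag_of (cls (rep_sum M N))" "frag_of (cls M)"] MN(3) by auto
qed

sublocale gr: presentation X grels by unfold_locales (rule grels_closed)

sublocale gr: ring_presentation X grels
proof (intro ring_presentation.intro ring_presentation_axioms.intro)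
  show "presentation X grels" by (rule gr.presentation_axioms)
  show "comm_monoid X" by (rule comm_monoid_X)
  fix r x assume "r \<in> grels" "x \<in> carrier X"
  then obtain L M N where MN: "is_rep G L" "is_rep G M" "is_rep G N" "x = cls L"
    "r = frag_of (cls (rep_sum M N)) - frag_of (cls M) - frag_of (cls N)"
    unfolding green_rels_def carrier_X by blast
  have "cls (rep_tensor L (rep_sum M N)) = cls (rep_sum (rep_tensor L M) (rep_tensor L N))"
    by (rule cls_eqI) (use MN in \<open>auto simp: rep_tensor_rep rep_tensor_trace rep_sum_rep rep_sum_trace distrib_left\<close>)
  then have "frag_of x \<otimes>\<^bsub>free_ring X\<^esub> r = frag_of (cls (rep_sum (rep_tensor L M) (rep_tensor L N)))
      - frag_of (cls (rep_tensor L M)) - frag_of (cls (rep_tensor L N))"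
    using MN by (simp add: fmult_diff cls_mult rep_sum_rep)
  then have "frag_of x \<otimes>\<^bsub>free_ring X\<^esub> r \<in> grels"
    unfolding green_rels_def using rep_tensor_rep(1)[OF MN(1,2)] rep_tensor_rep(1)[OF MN(1,3)] by blast
  then show "frag_of x \<otimes>\<^bsub>free_ring X\<^esub> r \<in> rel_subgroup X grels" by (rule gr.rels_in)
qed

abbreviation "RG \<equiv> green_ring G :: ('g, 'k) green ring"
abbreviation "gcls M \<equiv> green_class G (M :: ('g, 'k) rep)"

lemma cring_green: "cring RG"
  unfolding green_ring_def by (rule gr.cring_presented)

lemma gcls_closed: "is_rep G M \<Longrightarrow> gcls M \<in> carrier RG"
  unfolding green_ring_def green_class_def by (rule gr.generator_closed) (rule cls_in)

lemma gcls_eqI: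
  assumes "is_rep G M" "is_rep G N" "\<And>h. h \<in> carrier G \<Longrightarrow> mat_trace (M h) = mat_trace (N h)"
  shows "gcls M = gcls N"
  unfolding green_class_def using cls_eqI[OF assms] by simp

lemma gcls_mult: "is_rep G M \<Longrightarrow> is_rep G N \<Longrightarrow> gcls M \<otimes>\<^bsub>RG\<^esub> gcls N = gcls (rep_tensor M N)"
  unfolding green_ring_def green_class_def by (simp add: gr.generator_mult cls_in cls_mult)

lemma one_green: "\<one>\<^bsub>RG\<^esub> = gcls trivial_rep"
  unfolding green_ring_def green_class_def by (simp add: gr.one_presented one_X)

lemma gcls_sum:
  assumes MN: "is_rep G M" "is_rep G N"
  shows "gcls (rep_sum M N) = gcls M \<oplus>\<^bsub>RG\<^esub> gcls N"
proof -
  have k: "frag_of (cls M) \<in> carrier (free_ring X)" "frag_of (cls N) \<in> carrier (free_ring X)"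
    "frag_of (cls (rep_sum M N)) \<in> carrier (free_ring X)"
    using MN by (auto intro!: cls_in rep_sum_rep)
  have "frag_of (cls (rep_sum M N)) - frag_of (cls M) - frag_of (cls N) \<in> grels"
    unfolding green_rels_def using MN by blast
  then have "gr.cl (frag_of (cls (rep_sum M N))) = gr.cl (frag_of (cls M) + frag_of (cls N))"
    using k(3) gr.F.a_closed[OF k(1,2)] gr.rels_in by (intro gr.cl_eqI) (auto simp: diff_diff_eq)
  then show ?thesis
    unfolding green_ring_def green_class_def generator_def using gr.cl_add[OF k(1,2)] by simp
qed

lemma gcls_zero: "gcls zero_rep = \<zero>\<^bsub>RG\<^esub>"
proof -
  interpret RG: cring RG by (rule cring_green)
  have "gcls zero_rep = gcls (rep_sum zero_rep zero_rep)"
    by (rule gcls_eqI) (simp_all add: zero_rep rep_sum_rep rep_sum_trace zero_rep_trace)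
  also have "\<dots> = gcls zero_rep \<oplus>\<^bsub>RG\<^esub> gcls zero_rep" by (rule gcls_sum[OF zero_rep(1) zero_rep(1)])
  finally show ?thesis using gcls_closed[OF zero_rep(1)] by (metis RG.add.r_cancel_one')
qed

text \<open>The choice of a representative is harmless, since isomorphic modules have equal multiplicities.\<close>

definition coef_fun :: "nat \<Rightarrow> ('g, 'k) rep set \<Rightarrow> int" where
  "coef_fun i Y = int (multiplicity i (SOME M. M \<in> Y))"

lemma coef_fun_cls: "is_rep G M \<Longrightarrow> coef_fun i (cls M) = int (multiplicity i M)"
  unfolding coef_fun_def using cls_mem(2)[of M] someI[of "\<lambda>N. N \<in> cls M", OF cls_self]
  by (metis multiplicity_cong)

definition coef :: "nat \<Rightarrow> ('g, 'k) green \<Rightarrow> int" where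
  "coef i = presented_lift class_ring (coef_fun i)"

lemma coef_compatible:
  assumes i: "i \<in> {1..m}" shows "gr.compatible class_ring (coef_fun i)"
  unfolding gr.compatible_def
proof (intro conjI ballI)
  show "coef_fun i \<in> carrier X \<rightarrow> carrier class_ring" by simp
  have f: "coef_fun i \<in> carrier X \<rightarrow> UNIV" by simp
  fix r assume "r \<in> grels"
  then obtain M N where MN: "is_rep G M" "is_rep G N"
    "r = frag_of (cls (rep_sum M N)) - frag_of (cls M) - frag_of (cls N)"
    unfolding green_rels_def by blast
  have k: "Poly_Mapping.keys (frag_of (cls (rep_sum M N))) \<subseteq> carrier X" "Poly_Mapping.keys (frag_of (cls M)) \<subseteq> carrier X"
    "Poly_Mapping.keys (frag_of (cls N)) \<subseteq> carrier X"
    using MN by (auto intro!: cls_in rep_sum_rep)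
  have k': "Poly_Mapping.keys (frag_of (cls (rep_sum M N)) - frag_of (cls M)) \<subseteq> carrier X"
    using k(1,2) keys_diff[of "frag_of (cls (rep_sum M N))" "frag_of (cls M)"] by blast
  have "lin_ext class_ring (coef_fun i) r = coef_fun i (cls (rep_sum M N)) - coef_fun i (cls M) - coef_fun i (cls N)"
    unfolding MN(3) using class_ring.lin_ext_diff[OF f k' k(3)] class_ring.lin_ext_diff[OF f k(1,2)]
      class_ring.lin_ext_frag_of[of "coef_fun i"] by simp
  then show "lin_ext class_ring (coef_fun i) r = \<zero>\<^bsub>class_ring\<^esub>"
    using MN i by (simp add: coef_fun_cls rep_sum_rep multiplicity_sum del: One_nat_def atLeastAtMost_iff)
qed

lemma coef_additive: "i \<in> {1..m} \<Longrightarrow> additive_map RG class_ring (coef i)"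
  unfolding green_ring_def coef_def
  by (rule gr.additive_presented_lift[OF class_ring.abelian_group_axioms coef_compatible])

lemma coef_gcls: "i \<in> {1..m} \<Longrightarrow> is_rep G M \<Longrightarrow> coef i (gcls M) = int (multiplicity i M)"
  unfolding coef_def green_class_def
  using gr.presented_lift_generator[OF class_ring.abelian_group_axioms coef_compatible cls_in]
  by (simp add: coef_fun_cls del: One_nat_def atLeastAtMost_iff)

lemma green_map_eqI:
  assumes "abelian_group Q" "additive_map RG Q f" "additive_map RG Q h"
    and "\<And>M. is_rep G M \<Longrightarrow> f (gcls M) = h (gcls M)" and "u \<in> carrier RG"
  shows "f u = h u"
proof (rule gr.additive_map_eqI[OF assms(1) assms(2,3)[unfolded green_ring_def] _ assms(5)[unfolded green_ring_def]])
  fix x assume "x \<in> carrier X"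
  then obtain M where "is_rep G M" "x = cls M" by (auto simp: carrier_X)
  then show "f (generator X grels x) = h (generator X grels x)"
    using assms(4)[of M] by (simp add: green_class_def)
qed

end

section \<open>Tensor products of commutative algebras\<close>

text \<open>The multiplication of the tensor product is well defined because multiplying a defining relation by a pure tensor
yields a defining relation again.\<close>

locale tensor_algebras = tensor_modules R M N + MC: cring M + NC: cring N
  for R :: "('r, 'e) ring_scheme" and M :: "('r, 'a, 'c) module_scheme"
    and N :: "('r, 'b, 'd) module_scheme" +
  assumes M_smult: "\<And>r x u. r \<in> carrier R \<Longrightarrow> x \<in> carrier M \<Longrightarrow> u \<in> carrier M \<Longrightarrow>
      u \<otimes>\<^bsub>M\<^esub> (r \<odot>\<^bsub>M\<^esub> x) = r \<odot>\<^bsub>M\<^esub> (u \<otimes>\<^bsub>M\<^esub> x)"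
    and N_smult: "\<And>r x u. r \<in> carrier R \<Longrightarrow> x \<in> carrier N \<Longrightarrow> u \<in> carrier N \<Longrightarrow>
      u \<otimes>\<^bsub>N\<^esub> (r \<odot>\<^bsub>N\<^esub> x) = r \<odot>\<^bsub>N\<^esub> (u \<otimes>\<^bsub>N\<^esub> x)"
begin

sublocale rpres: ring_presentation "M \<times>\<times> N" "tensor_rels R M N"
proof (intro ring_presentation.intro ring_presentation_axioms.intro)
  show "presentation (M \<times>\<times> N) (tensor_rels R M N)" by (rule pres.presentation_axioms)
  show "comm_monoid (M \<times>\<times> N)"
    by (rule comm_monoidI) (auto simp: MC.m_assoc NC.m_assoc intro: MC.m_comm NC.m_comm)
  fix r p assume r: "r \<in> tensor_rels R M N" and p: "p \<in> carrier (M \<times>\<times> N)"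
  obtain u w where uw: "p = (u, w)" "u \<in> carrier M" "w \<in> carrier N" using p by auto
  have "frag_of p \<otimes>\<^bsub>free_ring (M \<times>\<times> N)\<^esub> r \<in> tensor_rels R M N"
    using r unfolding tensor_rels_def
  proof (elim UnE CollectE exE conjE, goal_cases)
    case (1 x x' y)
    have "frag_of p \<otimes>\<^bsub>free_ring (M \<times>\<times> N)\<^esub> r = frag_of ((u \<otimes>\<^bsub>M\<^esub> x) \<oplus>\<^bsub>M\<^esub> (u \<otimes>\<^bsub>M\<^esub> x'), w \<otimes>\<^bsub>N\<^esub> y)
       - frag_of (u \<otimes>\<^bsub>M\<^esub> x, w \<otimes>\<^bsub>N\<^esub> y) - frag_of (u \<otimes>\<^bsub>M\<^esub> x', w \<otimes>\<^bsub>N\<^esub> y)"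
      using 1 uw by (simp add: fmult_diff MC.r_distr)
    then show ?case using 1 uw by (intro UnI1 CollectI exI[of _ "u \<otimes>\<^bsub>M\<^esub> x"] exI[of _ "u \<otimes>\<^bsub>M\<^esub> x'"] exI[of _ "w \<otimes>\<^bsub>N\<^esub> y"]) simp
  next
    case (2 x y y')
    have "frag_of p \<otimes>\<^bsub>free_ring (M \<times>\<times> N)\<^esub> r = frag_of (u \<otimes>\<^bsub>M\<^esub> x, (w \<otimes>\<^bsub>N\<^esub> y) \<oplus>\<^bsub>N\<^esub> (w \<otimes>\<^bsub>N\<^esub> y'))
       - frag_of (u \<otimes>\<^bsub>M\<^esub> x, w \<otimes>\<^bsub>N\<^esub> y) - frag_of (u \<otimes>\<^bsub>M\<^esub> x, w \<otimes>\<^bsub>N\<^esub> y')"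
      using 2 uw by (simp add: fmult_diff NC.r_distr)
    then show ?case using 2 uw by (intro UnI1[OF UnI2] CollectI exI[of _ "u \<otimes>\<^bsub>M\<^esub> x"] exI[of _ "w \<otimes>\<^bsub>N\<^esub> y"] exI[of _ "w \<otimes>\<^bsub>N\<^esub> y'"]) simp
  next
    case (3 s x y)
    have "frag_of p \<otimes>\<^bsub>free_ring (M \<times>\<times> N)\<^esub> r = frag_of (s \<odot>\<^bsub>M\<^esub> (u \<otimes>\<^bsub>M\<^esub> x), w \<otimes>\<^bsub>N\<^esub> y)
       - frag_of (u \<otimes>\<^bsub>M\<^esub> x, s \<odot>\<^bsub>N\<^esub> (w \<otimes>\<^bsub>N\<^esub> y))"
      using 3 uw by (simp add: fmult_diff M_smult N_smult)
    then show ?case using 3 uw by (intro UnI2 CollectI exI[of _ s] exI[of _ "u \<otimes>\<^bsub>M\<^esub> x"] exI[of _ "w \<otimes>\<^bsub>N\<^esub> y"]) simp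
  qed
  then show "frag_of p \<otimes>\<^bsub>free_ring (M \<times>\<times> N)\<^esub> r \<in> rel_subgroup (M \<times>\<times> N) (tensor_rels R M N)"
    by (rule pres.rels_in)
qed

lemma cring_tensor: "cring T"
  unfolding tensor_def Let_def by (rule cring_with_smult[OF rpres.cring_presented])

lemma gen_mult:
  assumes "x \<in> carrier M" "x' \<in> carrier M" "y \<in> carrier N" "y' \<in> carrier N"
  shows "gen x y \<otimes>\<^bsub>T\<^esub> gen x' y' = gen (x \<otimes>\<^bsub>M\<^esub> x') (y \<otimes>\<^bsub>N\<^esub> y')"
  unfolding tensor_simps tensor_gen_def using assms by (subst rpres.generator_mult) auto

lemma one_tensor: "\<one>\<^bsub>T\<^esub> = gen \<one>\<^bsub>M\<^esub> \<one>\<^bsub>N\<^esub>"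
  unfolding tensor_simps tensor_gen_def by (simp add: rpres.one_presented)

end

text \<open>Every abelian group is a module over the integers, so complexification is an instance of the tensor product.\<close>

lemma module_Z_module:
  assumes "abelian_group A" shows "Module.module \<Z> (Z_module A)"
proof -
  interpret abelian_group A by fact
  show ?thesis unfolding Z_module_def
    by (rule Module.moduleI[OF int_is_cring abelian_group_with_smult[OF assms]])
      (auto simp: add.int_pow_mult add.int_pow_distrib add.int_pow_pow mult.commute)
qed

lemma add_pow_class_ring: "[(k::int)] \<cdot>\<^bsub>class_ring\<^esub> (x::'a::comm_ring_1) = of_int k * x"
proof -
  have nat: "[(n::nat)] \<cdot>\<^bsub>class_ring\<^esub> x = of_nat n * x" for n
    by (induction n) (simp_all add: add_pow_def distrib_right)
  show ?thesis
  proof (cases "k \<ge> 0")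
    case True then show ?thesis using nat[of "nat k"] by (simp add: add_pow_int_ge)
  next
    case False then show ?thesis using nat[of "nat (- k)"] by (simp add: add_pow_int_lt class_ring_simps)
  qed
qed

lemma additive_map_add_pow:
  assumes P: "abelian_group P" and Q: "abelian_group Q" and f: "additive_map P Q f" and x: "x \<in> carrier P"
  shows "f ([(k::int)] \<cdot>\<^bsub>P\<^esub> x) = [k] \<cdot>\<^bsub>Q\<^esub> f x"
proof -
  interpret P: abelian_group P by fact
  interpret Q: abelian_group Q by fact
  have nat: "f ([(n::nat)] \<cdot>\<^bsub>P\<^esub> x) = [n] \<cdot>\<^bsub>Q\<^esub> f x" for n
  proof (induction n)
    case 0 show ?case using additive_map_zero[OF P Q f] by (simp add: add_pow_def)
  next
    case (Suc n)
    then show ?case using additive_map_add[OF f P.add.nat_pow_closed[OF x] x] by simp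
  qed
  show ?thesis
  proof (cases "k \<ge> 0")
    case True then show ?thesis using nat by (simp add: add_pow_int_ge)
  next
    case False then show ?thesis
      using nat additive_map_neg[OF P Q f P.add.nat_pow_closed[OF x]] by (simp add: add_pow_int_lt)
  qed
qed

section \<open>The complexified Green ring\<close>

text \<open>A commutative ring containing the complex numbers through \<open>\<iota>\<close>, with a finite basis \<open>v\<close> over them and coordinate
functionals \<open>\<kappa>\<close>. The scalars are given by an embedding and not by a module structure, as the complexified Green
ring is formally only a module over the integers.\<close>

locale based_ring = R?: cring R
  for R :: "('a, 'e) ring_scheme" (structure) and \<iota> :: "complex \<Rightarrow> 'a" and m :: nat
    and v :: "nat \<Rightarrow> 'a" and \<kappa> :: "nat \<Rightarrow> 'a \<Rightarrow> complex" +
  assumes \<iota>_closed [simp]: "\<iota> c \<in> carrier R"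
    and \<iota>_add: "\<iota> (c + d) = \<iota> c \<oplus> \<iota> d"
    and \<iota>_mult: "\<iota> (c * d) = \<iota> c \<otimes> \<iota> d"
    and \<iota>_one: "\<iota> 1 = \<one>"
    and v_closed: "i \<in> {1..m} \<Longrightarrow> v i \<in> carrier R"
    and \<kappa>_add: "i \<in> {1..m} \<Longrightarrow> x \<in> carrier R \<Longrightarrow> y \<in> carrier R \<Longrightarrow> \<kappa> i (x \<oplus> y) = \<kappa> i x + \<kappa> i y"
    and \<kappa>_scale: "i \<in> {1..m} \<Longrightarrow> x \<in> carrier R \<Longrightarrow> \<kappa> i (\<iota> c \<otimes> x) = c * \<kappa> i x"
    and \<kappa>_v: "i \<in> {1..m} \<Longrightarrow> j \<in> {1..m} \<Longrightarrow> \<kappa> i (v j) = (if i = j then 1 else 0)"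
    and expansion: "x \<in> carrier R \<Longrightarrow> x = (\<Oplus>i\<in>{1..m}. \<iota> (\<kappa> i x) \<otimes> v i)"

context simple_system
begin

abbreviation "CZ \<equiv> Z_module (class_ring :: complex ring)"
abbreviation "GZ \<equiv> Z_module RG"
abbreviation "RC \<equiv> cgreen_ring G :: (int, ('g, 'k) cgreen) module"
abbreviation "cg \<equiv> complexification_gen RG"

lemma CZ_simps [simp]:
  "carrier CZ = UNIV" "monoid.mult CZ = (*)" "one CZ = 1" "zero CZ = 0" "add CZ = (+)"
  "k \<odot>\<^bsub>CZ\<^esub> x = of_int k * x"
  by (simp_all add: Z_module_def add_pow_class_ring)

lemma GZ_simps [simp]:
  "carrier GZ = carrier RG" "monoid.mult GZ = monoid.mult RG" "one GZ = one RG" "zero GZ = zero RG"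
  "add GZ = add RG" "k \<odot>\<^bsub>GZ\<^esub> x = [k] \<cdot>\<^bsub>RG\<^esub> x"
  by (simp_all add: Z_module_def)

sublocale gring: cring RG by (rule cring_green)

sublocale cx: tensor_algebras \<Z> CZ GZ
proof (intro tensor_algebras.intro tensor_modules.intro tensor_algebras_axioms.intro)
  show "cring \<Z>" by (rule int_is_cring)
  show "Module.module \<Z> CZ" by (rule module_Z_module) (rule class_ring.abelian_group_axioms)
  show "Module.module \<Z> GZ" by (rule module_Z_module) (rule gring.abelian_group_axioms)
  show "cring CZ" unfolding Z_module_def by (rule cring_with_smult) (rule class_cring.is_cring)
  show "cring GZ" unfolding Z_module_def by (rule cring_with_smult) (rule cring_green)
  show "u \<otimes>\<^bsub>CZ\<^esub> (r \<odot>\<^bsub>CZ\<^esub> x) = r \<odot>\<^bsub>CZ\<^esub> (u \<otimes>\<^bsub>CZ\<^esub> x)" for r x u by simp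
  show "u \<otimes>\<^bsub>GZ\<^esub> (r \<odot>\<^bsub>GZ\<^esub> x) = r \<odot>\<^bsub>GZ\<^esub> (u \<otimes>\<^bsub>GZ\<^esub> x)" if "x \<in> carrier GZ" "u \<in> carrier GZ" for r x u
    using that gring.add_pow_rdistr_int[of u x r] by simp
qed

lemma RC_tensor: "RC = cx.T"
  by (simp add: cgreen_ring_def complexification_def)

lemma cg_gen: "cg = cx.gen"
  by (simp add: complexification_gen_def)

lemma cring_RC: "cring RC"
  unfolding RC_tensor by (rule cx.cring_tensor)

lemma cg_closed: "y \<in> carrier RG \<Longrightarrow> cg c y \<in> carrier RC"
  unfolding RC_tensor cg_gen by (rule cx.gen_closed) simp_all

lemma cg_mult: "y \<in> carrier RG \<Longrightarrow> y' \<in> carrier RG \<Longrightarrow> cg c y \<otimes>\<^bsub>RC\<^esub> cg c' y' = cg (c * c') (y \<otimes>\<^bsub>RG\<^esub> y')"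
  unfolding RC_tensor cg_gen using cx.gen_mult[of c c' y y'] by simp

lemma cg_add_left: "y \<in> carrier RG \<Longrightarrow> cg (c + c') y = cg c y \<oplus>\<^bsub>RC\<^esub> cg c' y"
  unfolding RC_tensor cg_gen using cx.gen_add_left[of c c' y] by simp

lemma cg_add_right: "y \<in> carrier RG \<Longrightarrow> y' \<in> carrier RG \<Longrightarrow> cg c (y \<oplus>\<^bsub>RG\<^esub> y') = cg c y \<oplus>\<^bsub>RC\<^esub> cg c y'"
  unfolding RC_tensor cg_gen using cx.gen_add_right[of c y y'] by simp

lemma one_RC: "\<one>\<^bsub>RC\<^esub> = cg 1 \<one>\<^bsub>RG\<^esub>"
  unfolding RC_tensor cg_gen using cx.one_tensor by simp

abbreviation "scalar c \<equiv> cg c \<one>\<^bsub>RG\<^esub>"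
abbreviation "cclass M \<equiv> cgreen_class G (M :: ('g, 'k) rep)"

lemma cclass_cg: "cclass M = cg 1 (gcls M)"
  by (simp add: cgreen_class_def)

lemma cclass_closed: "is_rep G M \<Longrightarrow> cclass M \<in> carrier RC"
  by (simp add: cclass_cg cg_closed gcls_closed)

lemma cclass_mult: "is_rep G M \<Longrightarrow> is_rep G N \<Longrightarrow> cclass M \<otimes>\<^bsub>RC\<^esub> cclass N = cclass (rep_tensor M N)"
  by (simp add: cclass_cg cg_mult gcls_closed gcls_mult)

lemma cclass_eqI:
  "is_rep G M \<Longrightarrow> is_rep G N \<Longrightarrow> (\<And>h. h \<in> carrier G \<Longrightarrow> mat_trace (M h) = mat_trace (N h)) \<Longrightarrow> cclass M = cclass N"
  by (simp add: cclass_cg gcls_eqI[of M N])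

lemma scalar_cclass: "is_rep G M \<Longrightarrow> scalar c \<otimes>\<^bsub>RC\<^esub> cclass M = cg c (gcls M)"
  by (simp add: cclass_cg cg_mult gcls_closed)

text \<open>The complex-linear extension of the multiplicity of \<open>V i\<close>.\<close>

definition coord :: "nat \<Rightarrow> ('g, 'k) cgreen \<Rightarrow> complex" where
  "coord i = tensor_lift class_ring (\<lambda>c y. c * of_int (coef i y))"

lemma coord_balanced:
  assumes i: "i \<in> {1..m}" shows "cx.balanced class_ring (\<lambda>c y. c * of_int (coef i y))"
proof (rule cx.balancedI)
  fix x y y' assume "y \<in> carrier GZ" "y' \<in> carrier GZ"
  then show "x * of_int (coef i (y \<oplus>\<^bsub>GZ\<^esub> y')) = x * of_int (coef i y) \<oplus>\<^bsub>class_ring\<^esub> x * complex_of_int (coef i y')"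
    using additive_map_add[OF coef_additive[OF i], of y y'] by (simp add: distrib_left)
next
  fix r x y assume "y \<in> carrier GZ"
  then show "(r \<odot>\<^bsub>CZ\<^esub> x) * of_int (coef i y) = x * of_int (coef i (r \<odot>\<^bsub>GZ\<^esub> y))"
    using additive_map_add_pow[OF gring.abelian_group_axioms class_ring.abelian_group_axioms coef_additive[OF i], of y r]
    by (simp add: add_pow_class_ring)
qed (simp_all add: distrib_right)

lemma coord_additive: "i \<in> {1..m} \<Longrightarrow> additive_map RC class_ring (coord i)"
  unfolding RC_tensor coord_def
  by (rule cx.additive_tensor_lift[OF class_ring.abelian_group_axioms coord_balanced])

lemma coord_cg:
  assumes "i \<in> {1..m}" "y \<in> carrier RG" shows "coord i (cg c y) = c * of_int (coef i y)"
  unfolding coord_def cg_gen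
  using cx.tensor_lift_gen[OF class_ring.abelian_group_axioms coord_balanced[OF assms(1)], of c y] assms(2) by simp

lemma RC_map_eqI:
  assumes "abelian_group Q" "additive_map RC Q f" "additive_map RC Q h"
    and "\<And>c M. is_rep G M \<Longrightarrow> f (cg c (gcls M)) = h (cg c (gcls M))" and "u \<in> carrier RC"
  shows "f u = h u"
proof (rule cx.tensor_map_eqI[OF assms(1) assms(2,3)[unfolded RC_tensor] _ assms(5)[unfolded RC_tensor]])
  fix c y assume "c \<in> carrier CZ" "y \<in> carrier GZ"
  then have y: "y \<in> carrier RG" by simp
  have "f (cg c y) = h (cg c y)"
    by (rule green_map_eqI[OF assms(1) _ _ _ y])
      (use assms(4) in \<open>auto intro!: additive_mapI simp: cg_add_right cg_closed
        additive_map_add[OF assms(2)] additive_map_add[OF assms(3)]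
        additive_map_closed[OF assms(2)] additive_map_closed[OF assms(3)]\<close>)
  then show "f (cx.gen c y) = h (cx.gen c y)" by (simp add: cg_gen)
qed

text \<open>Both sides are additive under direct sums and agree on simple modules, so complete reducibility gives the claim.\<close>

lemma cg_expansion:
  assumes M: "is_rep G M"
  shows "cg c (gcls M) = (\<Oplus>\<^bsub>RC\<^esub>i\<in>{1..m}. scalar (c * of_nat (multiplicity i M)) \<otimes>\<^bsub>RC\<^esub> cclass (V i))"
proof -
  interpret RC: cring RC by (rule cring_RC)
  define rhs where "rhs M = (\<Oplus>\<^bsub>RC\<^esub>i\<in>{1..m}. scalar (c * of_nat (multiplicity i M)) \<otimes>\<^bsub>RC\<^esub> cclass (V i))" for M
  have summand: "scalar d \<otimes>\<^bsub>RC\<^esub> cclass (V i) \<in> carrier RC" if "i \<in> {1..m}" for d i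
    using that by (simp add: cg_closed cclass_closed V_rep)
  have s0: "scalar 0 = \<zero>\<^bsub>RC\<^esub>"
    using cg_add_left[of "\<one>\<^bsub>RG\<^esub>" 0 0] cg_closed[of "\<one>\<^bsub>RG\<^esub>" 0]
    by simp
  have rhs_sum: "rhs (rep_sum M N) = rhs M \<oplus>\<^bsub>RC\<^esub> rhs N" if "is_rep G M" "is_rep G N" for M N
  proof -
    have "rhs (rep_sum M N) = (\<Oplus>\<^bsub>RC\<^esub>i\<in>{1..m}. scalar (c * of_nat (multiplicity i M)) \<otimes>\<^bsub>RC\<^esub> cclass (V i)
        \<oplus>\<^bsub>RC\<^esub> scalar (c * of_nat (multiplicity i N)) \<otimes>\<^bsub>RC\<^esub> cclass (V i))"
      unfolding rhs_def
    proof (rule RC.finsum_cong'[OF refl])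
      fix i assume i: "i \<in> {1..m}"
      have "scalar (c * of_nat (multiplicity i (rep_sum M N))) =
          scalar (c * of_nat (multiplicity i M)) \<oplus>\<^bsub>RC\<^esub> scalar (c * of_nat (multiplicity i N))"
        unfolding multiplicity_sum[OF that i] using cg_add_left[of "\<one>\<^bsub>RG\<^esub>"] by (simp add: distrib_left)
      then show "scalar (c * of_nat (multiplicity i (rep_sum M N))) \<otimes>\<^bsub>RC\<^esub> cclass (V i) =
          scalar (c * of_nat (multiplicity i M)) \<otimes>\<^bsub>RC\<^esub> cclass (V i)
        \<oplus>\<^bsub>RC\<^esub> scalar (c * of_nat (multiplicity i N)) \<otimes>\<^bsub>RC\<^esub> cclass (V i)"
        using RC.l_distr[of "scalar (c * of_nat (multiplicity i M))" "scalar (c * of_nat (multiplicity i N))" "cclass (V i)"]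
          i by (simp add: cg_closed cclass_closed V_rep)
    qed (use summand in auto)
    also have "\<dots> = rhs M \<oplus>\<^bsub>RC\<^esub> rhs N"
      unfolding rhs_def by (rule RC.finsum_addf) (use summand in auto)
    finally show ?thesis .
  qed
  have rhs_V: "rhs (V x) = cg c (gcls (V x))" if x: "x \<in> {1..m}" for x
  proof -
    have "rhs (V x) = (\<Oplus>\<^bsub>RC\<^esub>i\<in>{1..m}. if x = i then scalar c \<otimes>\<^bsub>RC\<^esub> cclass (V i) else \<zero>\<^bsub>RC\<^esub>)"
      unfolding rhs_def
      by (rule RC.finsum_cong'[OF refl])
        (use x summand in \<open>auto simp: multiplicity_V s0 cclass_closed V_rep simp del: One_nat_def atLeastAtMost_iff\<close>)
    also have "\<dots> = scalar c \<otimes>\<^bsub>RC\<^esub> cclass (V x)"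
      by (rule RC.add.finprod_singleton) (use x summand in auto)
    finally show ?thesis using scalar_cclass[OF V_rep[OF x]] by simp
  qed
  have rs: "rhs (rsum xs) = cg c (gcls (rsum xs))" if "set xs \<subseteq> {1..m}" for xs
    using that
  proof (induction xs)
    case Nil
    have "multiplicity i zero_rep = 0" for i
      by (rule multiplicity_eqI) (simp add: char_form_def zero_rep_trace)
    then have "rhs zero_rep = (\<Oplus>\<^bsub>RC\<^esub>i\<in>{1..m}. \<zero>\<^bsub>RC\<^esub>)"
      unfolding rhs_def by (intro RC.finsum_cong'[OF refl]) (use s0 in \<open>auto simp: cclass_closed V_rep\<close>)
    moreover have "cg c (gcls zero_rep) = \<zero>\<^bsub>RC\<^esub>"
      using cg_add_right[of "\<zero>\<^bsub>RG\<^esub>" "\<zero>\<^bsub>RG\<^esub>" c] cg_closed[of "\<zero>\<^bsub>RG\<^esub>" c]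
      by (simp add: gcls_zero)
    ultimately show ?case by simp
  next
    case (Cons x xs)
    then have x: "x \<in> {1..m}" and xs: "set xs \<subseteq> {1..m}" by auto
    show ?case
      using rhs_sum[OF V_rep[OF x] rsum_rep[OF xs]] rhs_V[OF x] Cons.IH[OF xs] gcls_sum[OF V_rep[OF x] rsum_rep[OF xs]]
        cg_add_right[OF gcls_closed[OF V_rep[OF x]] gcls_closed[OF rsum_rep[OF xs]]] by simp
  qed
  obtain xs where xs: "set xs \<subseteq> {1..m}" "rep_iso G M (rsum xs)" using decomposition[OF M] by blast
  note tr = rep_iso_trace[OF M rsum_rep[OF xs(1)] xs(2)]
  have "rhs M = rhs (rsum xs)" unfolding rhs_def using multiplicity_cong[of M "rsum xs", OF tr] by simp
  then show ?thesis using rs[OF xs(1)] gcls_eqI[OF M rsum_rep[OF xs(1)] tr] by (simp add: rhs_def)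
qed

lemma based_ring_RC: "based_ring RC scalar m (\<lambda>i. cclass (V i)) coord"
proof -
  interpret RC: cring RC by (rule cring_RC)
  have one: "\<one>\<^bsub>RG\<^esub> \<in> carrier RG" by simp
  have scale: "coord i (scalar c \<otimes>\<^bsub>RC\<^esub> x) = c * coord i x" if i: "i \<in> {1..m}" and x: "x \<in> carrier RC" for i c x
  proof (rule RC_map_eqI[OF class_ring.abelian_group_axioms _ _ _ x])
    show "additive_map RC class_ring (\<lambda>x. coord i (scalar c \<otimes>\<^bsub>RC\<^esub> x))"
      by (rule additive_mapI) (use additive_map_add[OF coord_additive[OF i]] in \<open>simp_all add: RC.r_distr cg_closed\<close>)
    show "additive_map RC class_ring (\<lambda>x. c * coord i x)"
      by (rule additive_mapI) (use additive_map_add[OF coord_additive[OF i]] in \<open>simp_all add: distrib_left\<close>)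
    fix d and M :: "('g, 'k) rep" assume M: "is_rep G M"
    show "coord i (scalar c \<otimes>\<^bsub>RC\<^esub> cg d (gcls M)) = c * coord i (cg d (gcls M))"
      using i M by (simp add: cg_mult gcls_closed coord_cg del: One_nat_def atLeastAtMost_iff)
  qed
  have summand: "scalar d \<otimes>\<^bsub>RC\<^esub> cclass (V i) \<in> carrier RC" if "i \<in> {1..m}" for d i
    using that by (simp add: cg_closed cclass_closed V_rep)
  have exp: "x = (\<Oplus>\<^bsub>RC\<^esub>i\<in>{1..m}. scalar (coord i x) \<otimes>\<^bsub>RC\<^esub> cclass (V i))" if x: "x \<in> carrier RC" for x
  proof (rule RC_map_eqI[OF RC.abelian_group_axioms _ _ _ x])
    show "additive_map RC RC (\<lambda>x. x)" by (rule additive_mapI) auto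
    show "additive_map RC RC (\<lambda>x. \<Oplus>\<^bsub>RC\<^esub>i\<in>{1..m}. scalar (coord i x) \<otimes>\<^bsub>RC\<^esub> cclass (V i))"
    proof (rule additive_mapI)
      fix x y assume xy: "x \<in> carrier RC" "y \<in> carrier RC"
      have "(\<Oplus>\<^bsub>RC\<^esub>i\<in>{1..m}. scalar (coord i (x \<oplus>\<^bsub>RC\<^esub> y)) \<otimes>\<^bsub>RC\<^esub> cclass (V i)) =
        (\<Oplus>\<^bsub>RC\<^esub>i\<in>{1..m}. scalar (coord i x) \<otimes>\<^bsub>RC\<^esub> cclass (V i) \<oplus>\<^bsub>RC\<^esub> scalar (coord i y) \<otimes>\<^bsub>RC\<^esub> cclass (V i))"
      proof (rule RC.finsum_cong'[OF refl])
        fix i assume i: "i \<in> {1..m}"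
        have "coord i (x \<oplus>\<^bsub>RC\<^esub> y) = coord i x + coord i y"
          using additive_map_add[OF coord_additive[OF i] xy] by simp
        then show "scalar (coord i (x \<oplus>\<^bsub>RC\<^esub> y)) \<otimes>\<^bsub>RC\<^esub> cclass (V i) =
           scalar (coord i x) \<otimes>\<^bsub>RC\<^esub> cclass (V i) \<oplus>\<^bsub>RC\<^esub> scalar (coord i y) \<otimes>\<^bsub>RC\<^esub> cclass (V i)"
          using i RC.l_distr[of "scalar (coord i x)" "scalar (coord i y)" "cclass (V i)"]
          by (simp add: cg_add_left cg_closed cclass_closed V_rep)
      qed (use summand in auto)
      also have "\<dots> = (\<Oplus>\<^bsub>RC\<^esub>i\<in>{1..m}. scalar (coord i x) \<otimes>\<^bsub>RC\<^esub> cclass (V i))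
         \<oplus>\<^bsub>RC\<^esub> (\<Oplus>\<^bsub>RC\<^esub>i\<in>{1..m}. scalar (coord i y) \<otimes>\<^bsub>RC\<^esub> cclass (V i))"
        by (rule RC.finsum_addf) (use summand in auto)
      finally show "(\<Oplus>\<^bsub>RC\<^esub>i\<in>{1..m}. scalar (coord i (x \<oplus>\<^bsub>RC\<^esub> y)) \<otimes>\<^bsub>RC\<^esub> cclass (V i)) = (\<Oplus>\<^bsub>RC\<^esub>i\<in>{1..m}. scalar (coord i x) \<otimes>\<^bsub>RC\<^esub> cclass (V i))
         \<oplus>\<^bsub>RC\<^esub> (\<Oplus>\<^bsub>RC\<^esub>i\<in>{1..m}. scalar (coord i y) \<otimes>\<^bsub>RC\<^esub> cclass (V i))" .
    qed (use summand in \<open>auto intro!: RC.finsum_closed\<close>)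
    fix c and M :: "('g, 'k) rep" assume M: "is_rep G M"
    have "cg c (gcls M) = (\<Oplus>\<^bsub>RC\<^esub>i\<in>{1..m}. scalar (c * of_nat (multiplicity i M)) \<otimes>\<^bsub>RC\<^esub> cclass (V i))"
      by (rule cg_expansion[OF M])
    also have "\<dots> = (\<Oplus>\<^bsub>RC\<^esub>i\<in>{1..m}. scalar (coord i (cg c (gcls M))) \<otimes>\<^bsub>RC\<^esub> cclass (V i))"
      by (rule RC.finsum_cong'[OF refl])
        (use M summand in \<open>auto simp: coord_cg gcls_closed coef_gcls simp del: One_nat_def atLeastAtMost_iff\<close>)
    finally show "cg c (gcls M) = (\<Oplus>\<^bsub>RC\<^esub>i\<in>{1..m}. scalar (coord i (cg c (gcls M))) \<otimes>\<^bsub>RC\<^esub> cclass (V i))" .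
  qed
  show ?thesis
  proof (intro based_ring.intro based_ring_axioms.intro)
    show "cring RC" by (rule cring_RC)
    show "scalar (c * d) = scalar c \<otimes>\<^bsub>RC\<^esub> scalar d" for c d by (simp add: cg_mult)
    show "coord i (x \<oplus>\<^bsub>RC\<^esub> y) = coord i x + coord i y" if "i \<in> {1..m}" "x \<in> carrier RC" "y \<in> carrier RC" for i x y
      using additive_map_add[OF coord_additive] that by simp
    show "coord i (cclass (V j)) = (if i = j then 1 else 0)" if "i \<in> {1..m}" "j \<in> {1..m}" for i j
      using that by (simp add: cclass_cg coord_cg gcls_closed V_rep coef_gcls multiplicity_V del: One_nat_def atLeastAtMost_iff)
  qed (use scale exp in \<open>auto simp: cg_closed cg_add_left one_RC cclass_closed V_rep\<close>)
qed

end

context character_system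
begin

abbreviation "cv i \<equiv> cclass (V i)"

lemma cv_one: "cv 1 = \<one>\<^bsub>RC\<^esub>"
proof -
  have "cv 1 = cclass trivial_rep"
    by (rule cclass_eqI[OF V_rep[OF one_in] triv_rep(1)]) (simp only: V1_trace triv_rep(2))
  then show ?thesis by (simp only: cclass_cg one_RC one_green)
qed

lemma cv_mult:
  assumes "i \<in> {1..m}" "j \<in> {1..m}"
  shows "cv i \<otimes>\<^bsub>RC\<^esub> cv j = (\<Oplus>\<^bsub>RC\<^esub>k\<in>{1..m}. scalar (of_nat (fusion i j k)) \<otimes>\<^bsub>RC\<^esub> cv k)"
  using cg_expansion[OF rep_tensor_rep(1)[OF V_rep[OF assms(1)] V_rep[OF assms(2)]], of 1]
  by (simp add: cclass_mult V_rep assms fusion_def cclass_cg[of "rep_tensor _ _"] del: One_nat_def atLeastAtMost_iff)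

text \<open>The trivial module is \<open>V 1\<close>, so \<open>V (\<tau> 1)\<close> is \<open>V\<^bsub>\<chi>\<^sup>-\<^sup>1\<^esub>\<close> itself.\<close>

lemma green_char_cv: "green_char G \<chi> = cv (\<tau> 1)"
  unfolding green_char_def
  by (rule cclass_eqI[OF chi_rep(1) V_rep[OF tau_in[OF one_in]]])
    (simp only: char_rep_trace tau_trace[OF one_in] V1_trace mult_1_right)

lemma green_char_mult: "i \<in> {1..m} \<Longrightarrow> green_char G \<chi> \<otimes>\<^bsub>RC\<^esub> cv i = cv (\<tau> i)"
  unfolding green_char_def
  by (subst cclass_mult[OF chi_rep(1) V_rep], assumption)
    (rule cclass_eqI, auto simp: rep_tensor_rep chi_rep V_rep tau_in rep_tensor_trace tau_trace char_rep_trace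
      simp del: One_nat_def atLeastAtMost_iff)

end

section \<open>The quotient by a Dickson polynomial\<close>

lemma (in abelian_monoid) finsum_single:
  assumes "finite A" "i \<in> A" "f i \<in> carrier G" "\<And>j. j \<in> A \<Longrightarrow> j \<noteq> i \<Longrightarrow> f j = \<zero>"
  shows "finsum G f A = f i"
proof -
  have "finsum G f A = (\<Oplus>j\<in>A. if i = j then f j else \<zero>)"
  proof (rule finsum_cong')
    show "(\<lambda>j. if i = j then f j else \<zero>) \<in> A \<rightarrow> carrier G" using assms by auto
  qed (use assms in auto)
  also have "\<dots> = f i"
  proof (rule add.finprod_singleton)
    show "f \<in> A \<rightarrow> carrier G"
    proof
      show "f j \<in> carrier G" if "j \<in> A" for j using assms(3) assms(4)[OF that] by (cases "j = i") auto
    qed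
  qed (use assms in auto)
  finally show ?thesis .
qed

lemma (in abelian_monoid) finsum_induct:
  assumes "P \<zero>" "\<And>x y. x \<in> carrier G \<Longrightarrow> y \<in> carrier G \<Longrightarrow> P x \<Longrightarrow> P y \<Longrightarrow> P (x \<oplus> y)"
    and "\<And>i. i \<in> A \<Longrightarrow> f i \<in> carrier G" "\<And>i. i \<in> A \<Longrightarrow> P (f i)"
  shows "P (finsum G f A)"
  using assms(3,4)
proof (induction A rule: infinite_finite_induct)
  case (insert i A)
  then show ?case using assms(2)[of "f i" "finsum G f A"] by (simp add: Pi_def)
qed (simp_all add: assms(1))

lemma additive_map_finsum:
  assumes P: "abelian_group P" and Q: "abelian_group Q" and f: "additive_map P Q f"
    and "\<And>i. i \<in> A \<Longrightarrow> g i \<in> carrier P"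
  shows "f (finsum P g A) = finsum Q (\<lambda>i. f (g i)) A"
proof -
  interpret P: abelian_group P by fact
  interpret Q: abelian_group Q by fact
  show ?thesis using assms(4)
  proof (induction A rule: infinite_finite_induct)
    case (insert i A)
    then show ?case
      using additive_map_add[OF f, of "g i" "finsum P g A"] additive_map_closed[OF f] by (simp add: Pi_def)
  qed (simp_all add: additive_map_zero[OF P Q f])
qed

text \<open>The class of \<open>F\<^sub>s(a, z)\<close> is \<open>D s\<close>, that of a constant \<open>r\<close> is \<open>w r\<close>; \<open>A\<close> carries the complex scalars
through \<open>\<iota>\<close>.\<close>

locale dickson_quotient = based_ring R \<iota> m v \<kappa>
  for R :: "('a, 'e) ring_scheme" (structure) and \<iota> :: "complex \<Rightarrow> 'a" and m :: nat
    and v :: "nat \<Rightarrow> 'a" and \<kappa> :: "nat \<Rightarrow> 'a \<Rightarrow> complex" +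
  fixes a :: 'a and n :: nat
  assumes a_closed: "a \<in> carrier R" and n_ge: "n \<ge> 2"
begin

abbreviation "PR \<equiv> UP R"

sublocale U: UP_cring R PR by unfold_locales simp

definition F :: "nat \<Rightarrow> (nat \<Rightarrow> 'a)" where "F s = dickson_poly R a s"
definition qI where "qI = PIdl\<^bsub>PR\<^esub> (F n)"
definition rc where "rc p = qI +>\<^bsub>PR\<^esub> p"
definition A :: "(complex, (nat \<Rightarrow> 'a) set) module" where
  "A = with_smult (PR Quot qI) (\<lambda>c x. rc (poly_const R (\<iota> c)) \<otimes>\<^bsub>PR Quot qI\<^esub> x)"
definition w where "w r = rc (poly_const R r)"
definition z where "z = rc (poly_var R)"
definition D where "D s = rc (F s)"

lemma const_closed: "r \<in> carrier R \<Longrightarrow> poly_const R r \<in> carrier PR"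
  by (simp add: poly_const_def)

lemma var_closed: "poly_var R \<in> carrier PR"
  by (simp add: poly_var_def)

lemma F_simps: "F 0 = \<zero>\<^bsub>PR\<^esub>" "F (Suc 0) = \<one>\<^bsub>PR\<^esub>"
  and F_closed: "F s \<in> carrier PR"
  and F_rec: "F (Suc (Suc s)) = poly_var R \<otimes>\<^bsub>PR\<^esub> F (Suc s) \<ominus>\<^bsub>PR\<^esub> poly_const R a \<otimes>\<^bsub>PR\<^esub> F s"
proof -
  show 0: "F 0 = \<zero>\<^bsub>PR\<^esub>" "F (Suc 0) = \<one>\<^bsub>PR\<^esub>" by (simp_all add: F_def dickson_poly_def)
  have cl: "F s \<in> carrier PR \<and> F (Suc s) \<in> carrier PR" for s
  proof (induction s)
    case (Suc s)
    then show ?case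
      using var_closed const_closed[OF a_closed] by (cases s) (auto simp: F_def dickson_poly_def)
  qed (simp add: 0)
  then show "F s \<in> carrier PR" for s by blast
  show "F (Suc (Suc s)) = poly_var R \<otimes>\<^bsub>PR\<^esub> F (Suc s) \<ominus>\<^bsub>PR\<^esub> poly_const R a \<otimes>\<^bsub>PR\<^esub> F s" for s
    using var_closed const_closed[OF a_closed]
    by (cases s) (auto simp: F_def dickson_poly_def U.P.minus_eq)
qed

text \<open>\<open>F\<^sub>s\<close> has degree at most \<open>s - 1\<close> with coefficient one at \<open>z\<^bsup>s-1\<^esup>\<close>. Two consecutive values are treated together because the
recursion has depth two.\<close>

lemma F_coeff: "(\<forall>k\<ge>s. up_ring.coeff PR (F s) k = \<zero>) \<and> up_ring.coeff PR (F (Suc s)) s = \<one> \<and>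
    (\<forall>k\<ge>Suc s. up_ring.coeff PR (F (Suc s)) k = \<zero>)"
proof (induction s)
  case 0 show ?case by (simp add: F_simps)
next
  case (Suc s)
  have var: "up_ring.coeff PR (poly_var R \<otimes>\<^bsub>PR\<^esub> F (Suc s)) (Suc k) = up_ring.coeff PR (F (Suc s)) k" for k
    unfolding poly_var_def using U.coeff_monom_mult[OF R.one_closed F_closed, of 1 "Suc s" k] F_closed by simp
  have con: "up_ring.coeff PR (poly_const R a \<otimes>\<^bsub>PR\<^esub> F s) k = a \<otimes> up_ring.coeff PR (F s) k" for k
    unfolding poly_const_def using U.coeff_monom_mult[OF a_closed F_closed, of 0 s k] by simp
  have co: "up_ring.coeff PR (F (Suc (Suc s))) (Suc k) = up_ring.coeff PR (F (Suc s)) k \<ominus> a \<otimes> up_ring.coeff PR (F s) (Suc k)" for k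
    unfolding F_rec
    using var[of k] con[of "Suc k"] U.coeff_minus[of "poly_var R \<otimes>\<^bsub>PR\<^esub> F (Suc s)" "poly_const R a \<otimes>\<^bsub>PR\<^esub> F s" "Suc k"]
      var_closed const_closed[OF a_closed] F_closed by (simp del: U.coeff_mult)
  have "up_ring.coeff PR (F (Suc (Suc s))) (Suc s) = \<one>"
    using co[of s] Suc a_closed by (simp add: R.minus_eq del: U.coeff_mult)
  moreover have "up_ring.coeff PR (F (Suc (Suc s))) k = \<zero>" if "k \<ge> Suc (Suc s)" for k
  proof -
    define l where "l = k - 1"
    have l: "k = Suc l" "l \<ge> Suc s" using that by (simp_all add: l_def)
    then show ?thesis using l co[of l] Suc a_closed by (simp add: R.minus_eq del: U.coeff_mult)
  qed
  ultimately show ?case using Suc by simp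
qed

sublocale qI: ideal qI PR
  unfolding qI_def by (rule U.P.cgenideal_ideal[OF F_closed])

lemma ring_A: "cring A"
  unfolding A_def by (rule cring_with_smult[OF qI.quotient_is_cring[OF U.P.is_cring]])

sublocale A: cring A by (rule ring_A)

lemma carrier_A: "carrier A = rc ` carrier PR"
  by (auto simp: A_def FactRing_def A_RCOSETS_def' rc_def)

lemma rc_hom: "rc \<in> Ring.ring_hom PR A"
  using qI.rcos_ring_hom by (simp add: Ring.ring_hom_def A_def rc_def[abs_def])

lemma rc_closed: "p \<in> carrier PR \<Longrightarrow> rc p \<in> carrier A"
  by (auto simp: carrier_A)

lemma rc_mult: "p \<in> carrier PR \<Longrightarrow> q \<in> carrier PR \<Longrightarrow> rc (p \<otimes>\<^bsub>PR\<^esub> q) = rc p \<otimes>\<^bsub>A\<^esub> rc q"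
  using ring_hom_mult[OF rc_hom] .

lemma rc_add: "p \<in> carrier PR \<Longrightarrow> q \<in> carrier PR \<Longrightarrow> rc (p \<oplus>\<^bsub>PR\<^esub> q) = rc p \<oplus>\<^bsub>A\<^esub> rc q"
  using ring_hom_add[OF rc_hom] .

lemma rc_one: "rc \<one>\<^bsub>PR\<^esub> = \<one>\<^bsub>A\<^esub>"
  using ring_hom_one[OF rc_hom] .

lemma rc_additive: "additive_map PR A rc"
  by (rule additive_mapI) (simp_all add: rc_closed rc_add)

lemma rc_zero_iff: "p \<in> carrier PR \<Longrightarrow> rc p = \<zero>\<^bsub>A\<^esub> \<longleftrightarrow> p \<in> qI"
proof -
  assume p: "p \<in> carrier PR"
  have zA: "\<zero>\<^bsub>A\<^esub> = qI" by (simp add: A_def FactRing_def)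
  show ?thesis unfolding zA rc_def
    using qI.a_rcos_self[OF p] qI.a_rcos_const by auto
qed

lemma w_closed: "r \<in> carrier R \<Longrightarrow> w r \<in> carrier A"
  by (simp add: w_def rc_closed const_closed)

lemma w_add: "r \<in> carrier R \<Longrightarrow> s \<in> carrier R \<Longrightarrow> w (r \<oplus> s) = w r \<oplus>\<^bsub>A\<^esub> w s"
  by (simp add: w_def poly_const_def rc_add)

lemma w_mult: "r \<in> carrier R \<Longrightarrow> s \<in> carrier R \<Longrightarrow> w (r \<otimes> s) = w r \<otimes>\<^bsub>A\<^esub> w s"
  using U.monom_mult[of r s 0 0] by (simp add: w_def poly_const_def rc_mult)

lemma w_one: "w \<one> = \<one>\<^bsub>A\<^esub>"
  by (simp add: w_def poly_const_def rc_one)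

lemma w_additive: "additive_map R A w"
  by (rule additive_mapI) (simp_all add: w_closed w_add)

lemma w_zero: "w \<zero> = \<zero>\<^bsub>A\<^esub>"
  by (rule additive_map_zero[OF R.abelian_group_axioms A.abelian_group_axioms w_additive])

lemma z_closed: "z \<in> carrier A"
  by (simp add: z_def rc_closed var_closed)

lemma D_closed: "D s \<in> carrier A"
  by (simp add: D_def rc_closed F_closed)

lemma D_zero: "D 0 = \<zero>\<^bsub>A\<^esub>"
  unfolding D_def F_simps by (rule additive_map_zero[OF U.P.abelian_group_axioms A.abelian_group_axioms rc_additive])

lemma D_one: "D (Suc 0) = \<one>\<^bsub>A\<^esub>"
  by (simp add: D_def F_simps rc_one)

lemma D_rec: "z \<otimes>\<^bsub>A\<^esub> D (Suc s) = D (Suc (Suc s)) \<oplus>\<^bsub>A\<^esub> w a \<otimes>\<^bsub>A\<^esub> D s"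
proof -
  have "D (Suc (Suc s)) = z \<otimes>\<^bsub>A\<^esub> D (Suc s) \<ominus>\<^bsub>A\<^esub> w a \<otimes>\<^bsub>A\<^esub> D s"
    unfolding D_def z_def w_def F_rec
    using additive_map_minus[OF U.P.abelian_group_axioms A.abelian_group_axioms rc_additive,
        of "poly_var R \<otimes>\<^bsub>PR\<^esub> F (Suc s)" "poly_const R a \<otimes>\<^bsub>PR\<^esub> F s"]
      var_closed const_closed[OF a_closed] F_closed
    by (simp add: rc_mult)
  then show ?thesis using z_closed D_closed w_closed[OF a_closed] by (simp add: A.minus_eq A.a_assoc A.l_neg)
qed

lemma D_n: "D n = \<zero>\<^bsub>A\<^esub>"
  using rc_zero_iff[OF F_closed, of n] U.P.cgenideal_self[OF F_closed] by (simp add: D_def qI_def)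

lemma smult_A: "c \<odot>\<^bsub>A\<^esub> x = w (\<iota> c) \<otimes>\<^bsub>A\<^esub> x"
  by (simp add: A_def w_def)

text \<open>A linear combination of \<open>F\<^sub>1, \<dots>, F\<^sub>n\<^sub>-\<^sub>1\<close> has degree below that of \<open>F\<^sub>n\<close>, so it lies in the ideal only if it is zero; and it
is zero only if all coefficients are, since the \<open>F\<^sub>j\<close> are monic of distinct degrees.\<close>

lemma D_independent:
  assumes r: "\<And>j. j \<in> {1..n - 1} \<Longrightarrow> r j \<in> carrier R"
    and zero: "(\<Oplus>\<^bsub>A\<^esub>j\<in>{1..n - 1}. w (r j) \<otimes>\<^bsub>A\<^esub> D j) = \<zero>\<^bsub>A\<^esub>"
    and j: "j \<in> {1..n - 1}"
  shows "r j = \<zero>"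
proof -
  define p where "p = (\<Oplus>\<^bsub>PR\<^esub>j\<in>{1..n - 1}. poly_const R (r j) \<otimes>\<^bsub>PR\<^esub> F j)"
  have t: "poly_const R (r j) \<otimes>\<^bsub>PR\<^esub> F j \<in> carrier PR" if "j \<in> {1..n - 1}" for j
    using const_closed[OF r[OF that]] F_closed by simp
  have p: "p \<in> carrier PR" unfolding p_def using t by (intro U.P.finsum_closed) auto
  have "rc p = (\<Oplus>\<^bsub>A\<^esub>j\<in>{1..n - 1}. rc (poly_const R (r j) \<otimes>\<^bsub>PR\<^esub> F j))"
    unfolding p_def by (rule additive_map_finsum[OF U.P.abelian_group_axioms A.abelian_group_axioms rc_additive t])
  also have "\<dots> = (\<Oplus>\<^bsub>A\<^esub>j\<in>{1..n - 1}. w (r j) \<otimes>\<^bsub>A\<^esub> D j)"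
    by (rule A.finsum_cong'[OF refl])
      (use r const_closed F_closed in \<open>auto simp: w_def D_def rc_mult rc_closed\<close>)
  finally have "p \<in> qI" using zero rc_zero_iff[OF p] by simp
  then obtain q where q: "q \<in> carrier PR" "p = q \<otimes>\<^bsub>PR\<^esub> F n" unfolding qI_def cgenideal_def by auto
  have cc: "up_ring.coeff PR f k \<in> carrier R" if "f \<in> carrier PR" for f k using that by simp
  have coc: "up_ring.coeff PR p k = (\<Oplus>j\<in>{1..n - 1}. r j \<otimes> up_ring.coeff PR (F j) k)" for k
  proof -
    have "up_ring.coeff PR p k = (\<Oplus>j\<in>{1..n - 1}. up_ring.coeff PR (poly_const R (r j) \<otimes>\<^bsub>PR\<^esub> F j) k)"
      unfolding p_def by (rule U.coeff_finsum) (use t in auto)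
    also have "\<dots> = (\<Oplus>j\<in>{1..n - 1}. r j \<otimes> up_ring.coeff PR (F j) k)"
    proof (rule R.finsum_cong'[OF refl])
      show "up_ring.coeff PR (poly_const R (r i) \<otimes>\<^bsub>PR\<^esub> F i) k = r i \<otimes> up_ring.coeff PR (F i) k" if "i \<in> {1..n - 1}" for i
        unfolding poly_const_def using U.coeff_monom_mult[OF r[OF that] F_closed, of 0 i k] by simp
    qed (use r cc F_closed in auto)
    finally show ?thesis .
  qed
  \<comment> \<open>A nonzero multiple of the monic polynomial \<open>F\<^sub>n\<close> has degree at least \<open>n - 1\<close>, but \<open>p\<close> has smaller degree.\<close>
  have high: "up_ring.coeff PR p k = \<zero>" if "k \<ge> n - 1" for k
    unfolding coc
  proof (rule R.add.finprod_one_eqI)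
    fix i assume i: "i \<in> {1..n - 1}"
    then have "up_ring.coeff PR (F i) k = \<zero>" using F_coeff[of i] that by auto
    then show "r i \<otimes> up_ring.coeff PR (F i) k = \<zero>" using r[OF i] by simp
  qed
  have "q = \<zero>\<^bsub>PR\<^esub>"
  proof (rule ccontr)
    assume nz: "q \<noteq> \<zero>\<^bsub>PR\<^esub>"
    define d where "d = deg R q"
    have lc: "up_ring.coeff PR q d \<noteq> \<zero>" unfolding d_def by (rule U.lcoeff_nonzero2[OF q(1) nz])
    obtain n' where n': "n = Suc n'" using n_ge by (cases n) auto
    have "up_ring.coeff PR p (d + n') = (\<Oplus>i\<in>{..d + n'}. up_ring.coeff PR q i \<otimes> up_ring.coeff PR (F n) (d + n' - i))"
      unfolding q(2) by (rule U.coeff_mult[OF q(1) F_closed])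
    also have "\<dots> = up_ring.coeff PR q d \<otimes> up_ring.coeff PR (F n) (d + n' - d)"
    proof (rule R.finsum_single)
      fix i assume i: "i \<in> {..d + n'}" "i \<noteq> d"
      show "up_ring.coeff PR q i \<otimes> up_ring.coeff PR (F n) (d + n' - i) = \<zero>"
      proof (cases "i < d")
        case True
        then have "up_ring.coeff PR (F n) (d + n' - i) = \<zero>" using F_coeff[of n'] n' by auto
        then show ?thesis using cc[OF q(1)] by simp
      next
        case False
        then have "up_ring.coeff PR q i = \<zero>" using U.deg_aboveD[OF _ q(1), of i] i by (simp add: d_def)
        then show ?thesis using cc[OF F_closed] by simp
      qed
    qed (use cc q(1) F_closed in auto)
    also have "\<dots> = up_ring.coeff PR q d" using F_coeff[of n'] n' cc[OF q(1)] by simp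
    finally show False using lc high[of "d + n'"] n' by simp
  qed
  then have "p = \<zero>\<^bsub>PR\<^esub>" using q F_closed by simp
  then have all: "up_ring.coeff PR p k = \<zero>" for k by simp
  show ?thesis
  proof (rule ccontr)
    assume nz: "r j \<noteq> \<zero>"
    \<comment> \<open>At the degree of the last \<open>F\<^sub>l\<close> with nonzero coefficient only that coefficient contributes.\<close>
    define S where "S = {j \<in> {1..n - 1}. r j \<noteq> \<zero>}"
    have S: "finite S" "S \<noteq> {}" using nz j by (auto simp: S_def)
    define l where "l = Max S"
    have l: "l \<in> S" unfolding l_def by (rule Max_in[OF S])
    then obtain l' where l': "l = Suc l'" by (cases l) (auto simp: S_def)
    have lj: "l \<in> {1..n - 1}" using l by (simp add: S_def)
    have "(\<Oplus>j\<in>{1..n - 1}. r j \<otimes> up_ring.coeff PR (F j) l') = r l \<otimes> up_ring.coeff PR (F l) l'"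
    proof (rule R.finsum_single)
      fix i assume i: "i \<in> {1..n - 1}" "i \<noteq> l"
      show "r i \<otimes> up_ring.coeff PR (F i) l' = \<zero>"
      proof (cases "i < l")
        case True
        then have "up_ring.coeff PR (F i) l' = \<zero>" using F_coeff[of i] l' by auto
        then show ?thesis using r[OF i(1)] by simp
      next
        case False
        then have "i \<notin> S" using Max_ge[OF S(1), of i] i(2) by (auto simp: l_def)
        then show ?thesis using i(1) cc[OF F_closed] by (simp add: S_def)
      qed
    qed (use lj r cc F_closed in auto)
    then have "r l = \<zero>" using all[of l'] coc[of l'] F_coeff[of l'] l' r[OF lj] by simp
    then show False using l by (simp add: S_def)
  qed
qed

definition Dsum where "Dsum r = (\<Oplus>\<^bsub>A\<^esub>j\<in>{1..n - 1}. w (r j) \<otimes>\<^bsub>A\<^esub> D j)"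

lemma Dsum_summand: "r \<in> {1..n - 1} \<rightarrow> carrier R \<Longrightarrow> j \<in> {1..n - 1} \<Longrightarrow> w (r j) \<otimes>\<^bsub>A\<^esub> D j \<in> carrier A"
  using Pi_mem[of r "{1..n - 1}" "\<lambda>_. carrier R" j] w_closed[of "r j"] D_closed[of j] by simp

lemma Dsum_closed: "r \<in> {1..n - 1} \<rightarrow> carrier R \<Longrightarrow> Dsum r \<in> carrier A"
  unfolding Dsum_def by (intro A.finsum_closed) (use Dsum_summand in auto)

lemma Dsum_add:
  assumes r: "r \<in> {1..n - 1} \<rightarrow> carrier R" and s: "s \<in> {1..n - 1} \<rightarrow> carrier R"
  shows "Dsum (\<lambda>j. r j \<oplus> s j) = Dsum r \<oplus>\<^bsub>A\<^esub> Dsum s"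
proof -
  have "Dsum (\<lambda>j. r j \<oplus> s j) = (\<Oplus>\<^bsub>A\<^esub>j\<in>{1..n - 1}. w (r j) \<otimes>\<^bsub>A\<^esub> D j \<oplus>\<^bsub>A\<^esub> w (s j) \<otimes>\<^bsub>A\<^esub> D j)"
    unfolding Dsum_def
  proof (rule A.finsum_cong'[OF refl])
    fix j assume j: "j \<in> {1..n - 1}"
    then have "r j \<in> carrier R" "s j \<in> carrier R" using r s by blast+
    then show "w (r j \<oplus> s j) \<otimes>\<^bsub>A\<^esub> D j = w (r j) \<otimes>\<^bsub>A\<^esub> D j \<oplus>\<^bsub>A\<^esub> w (s j) \<otimes>\<^bsub>A\<^esub> D j"
      by (simp add: w_add A.l_distr w_closed D_closed)
  qed (use Dsum_summand r s in auto)
  also have "\<dots> = Dsum r \<oplus>\<^bsub>A\<^esub> Dsum s"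
    unfolding Dsum_def by (rule A.finsum_addf) (use Dsum_summand r s in auto)
  finally show ?thesis .
qed

lemma Dsum_mult:
  assumes r: "r \<in> {1..n - 1} \<rightarrow> carrier R" and s: "s \<in> carrier R"
  shows "Dsum (\<lambda>j. s \<otimes> r j) = w s \<otimes>\<^bsub>A\<^esub> Dsum r"
proof -
  have "w s \<otimes>\<^bsub>A\<^esub> Dsum r = (\<Oplus>\<^bsub>A\<^esub>j\<in>{1..n - 1}. w s \<otimes>\<^bsub>A\<^esub> (w (r j) \<otimes>\<^bsub>A\<^esub> D j))"
    unfolding Dsum_def by (rule A.finsum_rdistr) (use Dsum_summand r w_closed s in auto)
  also have "\<dots> = Dsum (\<lambda>j. s \<otimes> r j)"
    unfolding Dsum_def
  proof (rule A.finsum_cong'[OF refl])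
    fix j assume "j \<in> {1..n - 1}"
    then have "r j \<in> carrier R" using r by blast
    then show "w s \<otimes>\<^bsub>A\<^esub> (w (r j) \<otimes>\<^bsub>A\<^esub> D j) = w (s \<otimes> r j) \<otimes>\<^bsub>A\<^esub> D j"
      using s by (simp add: w_mult A.m_assoc w_closed D_closed)
  next
    show "(\<lambda>j. w (s \<otimes> r j) \<otimes>\<^bsub>A\<^esub> D j) \<in> {1..n - 1} \<rightarrow> carrier A"
    proof
      fix j assume "j \<in> {1..n - 1}"
      then show "w (s \<otimes> r j) \<otimes>\<^bsub>A\<^esub> D j \<in> carrier A"
        using Pi_mem[OF r, of j] s by (simp add: w_closed D_closed)
    qed
  qed
  finally show ?thesis ..
qed

lemma Dsum_inject:
  assumes r: "r \<in> {1..n - 1} \<rightarrow> carrier R" and s: "s \<in> {1..n - 1} \<rightarrow> carrier R"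
    and eq: "Dsum r = Dsum s" and j: "j \<in> {1..n - 1}"
  shows "r j = s j"
proof -
  have ms: "(\<lambda>j. (\<ominus> \<one>) \<otimes> s j) \<in> {1..n - 1} \<rightarrow> carrier R" using s by auto
  have "w (\<ominus> \<one>) = \<ominus>\<^bsub>A\<^esub> \<one>\<^bsub>A\<^esub>"
    using additive_map_neg[OF R.abelian_group_axioms A.abelian_group_axioms w_additive, of \<one>] w_one by simp
  then have "Dsum (\<lambda>j. r j \<oplus> (\<ominus> \<one>) \<otimes> s j) = Dsum r \<oplus>\<^bsub>A\<^esub> (\<ominus>\<^bsub>A\<^esub> \<one>\<^bsub>A\<^esub>) \<otimes>\<^bsub>A\<^esub> Dsum s"
    using Dsum_add[OF r ms] Dsum_mult[OF s, of "\<ominus> \<one>"] by simp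
  also have "\<dots> = \<zero>\<^bsub>A\<^esub>" unfolding eq using Dsum_closed[OF s] by (simp add: A.l_minus A.r_neg)
  finally have *: "Dsum (\<lambda>j. r j \<oplus> (\<ominus> \<one>) \<otimes> s j) = \<zero>\<^bsub>A\<^esub>" .
  have "r j \<oplus> (\<ominus> \<one>) \<otimes> s j = \<zero>"
  proof -
    have cl: "r i \<oplus> (\<ominus> \<one>) \<otimes> s i \<in> carrier R" if "i \<in> {1..n - 1}" for i
      using Pi_mem[OF r that] Pi_mem[OF s that] by simp
    show ?thesis using D_independent[of "\<lambda>j. r j \<oplus> (\<ominus> \<one>) \<otimes> s j", OF cl _ j] *
      unfolding Dsum_def by simp
  qed
  moreover have "r j \<in> carrier R" "s j \<in> carrier R" using r s j by blast+
  ultimately show ?thesis by (simp add: R.l_minus) (metis R.minus_equality R.minus_minus R.a_inv_closed R.a_comm)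
qed

lemma w_mult_D_Dsum:
  assumes r: "r \<in> carrier R" and j: "j \<in> {1..n - 1}"
  shows "Dsum (\<lambda>i. if i = j then r else \<zero>) = w r \<otimes>\<^bsub>A\<^esub> D j"
  unfolding Dsum_def
  by (subst A.finsum_single[of _ j]) (use j r in \<open>auto simp: w_zero w_closed D_closed\<close>)

text \<open>The \<open>R\<close>-span of \<open>D 1, \<dots>, D (n - 1)\<close>, which turns out to be everything.\<close>

definition Drange where "Drange = Dsum ` ({1..n - 1} \<rightarrow> carrier R)"

lemma Drange_basic: "r \<in> carrier R \<Longrightarrow> j \<le> n \<Longrightarrow> w r \<otimes>\<^bsub>A\<^esub> D j \<in> Drange"
proof -
  assume r: "r \<in> carrier R" and j: "j \<le> n"
  have zero: "\<zero>\<^bsub>A\<^esub> \<in> Drange"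
  proof -
    have "Dsum (\<lambda>_. \<zero>) = \<zero>\<^bsub>A\<^esub>"
      unfolding Dsum_def by (rule A.add.finprod_one_eqI) (simp add: w_zero D_closed)
    moreover have "(\<lambda>_. \<zero>) \<in> {1..n - 1} \<rightarrow> carrier R" by simp
    ultimately show ?thesis unfolding Drange_def by (intro image_eqI[OF sym])
  qed
  show ?thesis
  proof (cases "j \<in> {1..n - 1}")
    case True
    have "(\<lambda>i. if i = j then r else \<zero>) \<in> {1..n - 1} \<rightarrow> carrier R" using r by auto
    then show ?thesis unfolding Drange_def using w_mult_D_Dsum[OF r True, symmetric] by (intro image_eqI)
  next
    case False
    then have "j = 0 \<or> j = n" using j by auto
    then show ?thesis using zero D_zero D_n w_closed[OF r] by auto
  qed
qed

lemma Drange_add: "x \<in> Drange \<Longrightarrow> y \<in> Drange \<Longrightarrow> x \<oplus>\<^bsub>A\<^esub> y \<in> Drange"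
proof -
  assume "x \<in> Drange" "y \<in> Drange"
  then obtain r s where rs: "r \<in> {1..n - 1} \<rightarrow> carrier R" "x = Dsum r" "s \<in> {1..n - 1} \<rightarrow> carrier R" "y = Dsum s"
    by (auto simp: Drange_def)
  have "(\<lambda>j. r j \<oplus> s j) \<in> {1..n - 1} \<rightarrow> carrier R" using rs(1,3) by auto
  moreover have "x \<oplus>\<^bsub>A\<^esub> y = Dsum (\<lambda>j. r j \<oplus> s j)" using Dsum_add[OF rs(1,3)] rs(2,4) by simp
  ultimately show ?thesis unfolding Drange_def by (intro image_eqI)
qed

lemma Drange_z: "x \<in> Drange \<Longrightarrow> z \<otimes>\<^bsub>A\<^esub> x \<in> Drange"
proof -
  assume "x \<in> Drange"
  then obtain r where r: "r \<in> {1..n - 1} \<rightarrow> carrier R" "x = Dsum r" by (auto simp: Drange_def)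
  have "z \<otimes>\<^bsub>A\<^esub> x = (\<Oplus>\<^bsub>A\<^esub>j\<in>{1..n - 1}. z \<otimes>\<^bsub>A\<^esub> (w (r j) \<otimes>\<^bsub>A\<^esub> D j))"
    unfolding r(2) Dsum_def by (rule A.finsum_rdistr) (use Dsum_summand r z_closed in auto)
  also have "\<dots> \<in> Drange"
  proof (rule A.finsum_induct)
    show "\<zero>\<^bsub>A\<^esub> \<in> Drange" using Drange_basic[of \<zero> 0] D_zero w_zero by simp
    fix i assume i: "i \<in> {1..n - 1}"
    then have ri: "r i \<in> carrier R" using r by blast
    then show "z \<otimes>\<^bsub>A\<^esub> (w (r i) \<otimes>\<^bsub>A\<^esub> D i) \<in> carrier A" by (simp add: z_closed w_closed D_closed)
    obtain i' where i': "i = Suc i'" using i by (cases i) auto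
    have "z \<otimes>\<^bsub>A\<^esub> (w (r i) \<otimes>\<^bsub>A\<^esub> D i) = w (r i) \<otimes>\<^bsub>A\<^esub> (z \<otimes>\<^bsub>A\<^esub> D i)"
      using ri by (simp add: A.m_lcomm z_closed w_closed D_closed)
    also have "\<dots> = w (r i) \<otimes>\<^bsub>A\<^esub> D (Suc i) \<oplus>\<^bsub>A\<^esub> w (r i \<otimes> a) \<otimes>\<^bsub>A\<^esub> D i'"
      unfolding i' D_rec using ri i' a_closed by (simp add: A.r_distr w_mult A.m_assoc w_closed D_closed)
    finally show "z \<otimes>\<^bsub>A\<^esub> (w (r i) \<otimes>\<^bsub>A\<^esub> D i) \<in> Drange"
      using Drange_add Drange_basic[OF ri, of "Suc i"] Drange_basic[of "r i \<otimes> a" i'] ri a_closed i i' by simp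
  qed (rule Drange_add)
  finally show ?thesis .
qed

text \<open>The span contains the constants and is closed under multiplication by \<open>z\<close>, because \<open>D n = 0\<close>.\<close>

lemma A_range: "carrier A = Drange"
proof
  show "Drange \<subseteq> carrier A" using Dsum_closed by (auto simp: Drange_def)
  show "carrier A \<subseteq> Drange"
  proof
    fix x assume "x \<in> carrier A"
    then obtain p where p: "p \<in> carrier PR" "x = rc p" by (auto simp: carrier_A)
    have wz: "rc (up_ring.monom PR r k) \<in> Drange" if "r \<in> carrier R" for r k
      using that
    proof (induction k)
      case 0
      have "rc (up_ring.monom PR r 0) = w r \<otimes>\<^bsub>A\<^esub> D (Suc 0)" using 0 by (simp add: w_def poly_const_def D_one rc_closed)
      then show ?case using Drange_basic[OF 0, of 1] n_ge by simp
    next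
      case (Suc k)
      have "up_ring.monom PR r (Suc k) = poly_var R \<otimes>\<^bsub>PR\<^esub> up_ring.monom PR r k"
        unfolding poly_var_def using U.monom_mult[OF R.one_closed Suc.prems, of 1 k] Suc.prems by simp
      then show ?case using Drange_z[OF Suc.IH[OF Suc.prems]] var_closed Suc.prems by (simp add: rc_mult z_def)
    qed
    have "x = rc (\<Oplus>\<^bsub>PR\<^esub>i\<in>{..deg R p}. up_ring.monom PR (up_ring.coeff PR p i) i)"
      using U.up_repr[OF p(1)] p(2) by simp
    also have "\<dots> = (\<Oplus>\<^bsub>A\<^esub>i\<in>{..deg R p}. rc (up_ring.monom PR (up_ring.coeff PR p i) i))"
      by (rule additive_map_finsum[OF U.P.abelian_group_axioms A.abelian_group_axioms rc_additive]) (use p in simp)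
    also have "\<dots> \<in> Drange"
      by (rule A.finsum_induct)
        (use Drange_basic[of \<zero> 0] Drange_add wz p in \<open>auto simp: D_zero w_zero rc_closed\<close>)
    finally show "x \<in> Drange" .
  qed
qed

text \<open>The coordinate of \<open>x\<close> at \<open>D j\<close>. The sequence chosen is unique on \<open>{1..n - 1}\<close> by \<open>D_independent\<close>.\<close>

definition \<rho> :: "nat \<Rightarrow> (nat \<Rightarrow> 'a) set \<Rightarrow> 'a" where
  "\<rho> j x = (SOME r. r \<in> {1..n - 1} \<rightarrow> carrier R \<and> x = Dsum r) j"

lemma \<rho>_Dsum:
  assumes r: "r \<in> {1..n - 1} \<rightarrow> carrier R" and j: "j \<in> {1..n - 1}"
  shows "\<rho> j (Dsum r) = r j"
proof -
  let ?s = "SOME s. s \<in> {1..n - 1} \<rightarrow> carrier R \<and> Dsum r = Dsum s"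
  have s: "?s \<in> {1..n - 1} \<rightarrow> carrier R \<and> Dsum r = Dsum ?s"
    by (rule someI[of "\<lambda>s. s \<in> {1..n - 1} \<rightarrow> carrier R \<and> Dsum r = Dsum s" r]) (use r in simp)
  have "r j = ?s j" using Dsum_inject[OF r _ _ j, of ?s] s by blast
  then show ?thesis by (simp add: \<rho>_def)
qed

lemma A_Dsum: "x \<in> carrier A \<Longrightarrow> \<exists>r. r \<in> {1..n - 1} \<rightarrow> carrier R \<and> x = Dsum r"
  unfolding A_range Drange_def by blast

lemma \<rho>_closed: "x \<in> carrier A \<Longrightarrow> j \<in> {1..n - 1} \<Longrightarrow> \<rho> j x \<in> carrier R"
  using A_Dsum[of x] \<rho>_Dsum Pi_mem by metis

lemma \<rho>_add:
  assumes "x \<in> carrier A" "y \<in> carrier A" "j \<in> {1..n - 1}"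
  shows "\<rho> j (x \<oplus>\<^bsub>A\<^esub> y) = \<rho> j x \<oplus> \<rho> j y"
proof -
  obtain r s where rs: "r \<in> {1..n - 1} \<rightarrow> carrier R" "x = Dsum r" "s \<in> {1..n - 1} \<rightarrow> carrier R" "y = Dsum s"
    using A_Dsum assms by metis
  have "(\<lambda>j. r j \<oplus> s j) \<in> {1..n - 1} \<rightarrow> carrier R" using rs(1,3) by auto
  then have "\<rho> j (x \<oplus>\<^bsub>A\<^esub> y) = r j \<oplus> s j" using \<rho>_Dsum[of "\<lambda>j. r j \<oplus> s j" j] Dsum_add[OF rs(1,3)] rs(2,4) assms(3) by simp
  then show ?thesis using \<rho>_Dsum[OF rs(1) assms(3)] \<rho>_Dsum[OF rs(3) assms(3)] rs(2,4) by simp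
qed

lemma \<rho>_mult:
  assumes "s \<in> carrier R" "x \<in> carrier A" "j \<in> {1..n - 1}"
  shows "\<rho> j (w s \<otimes>\<^bsub>A\<^esub> x) = s \<otimes> \<rho> j x"
proof -
  obtain r where r: "r \<in> {1..n - 1} \<rightarrow> carrier R" "x = Dsum r" using A_Dsum assms by metis
  have "(\<lambda>j. s \<otimes> r j) \<in> {1..n - 1} \<rightarrow> carrier R" using r(1) assms(1) by auto
  then have "\<rho> j (w s \<otimes>\<^bsub>A\<^esub> x) = s \<otimes> r j" using \<rho>_Dsum[of "\<lambda>j. s \<otimes> r j" j] Dsum_mult[OF r(1) assms(1)] r(2) assms(3) by simp
  then show ?thesis using \<rho>_Dsum[OF r(1) assms(3)] r(2) by simp
qed

lemma \<rho>_D: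
  assumes "i \<in> {1..n - 1}" "j \<in> {1..n - 1}"
  shows "\<rho> j (D i) = (if i = j then \<one> else \<zero>)"
proof -
  have "D i = Dsum (\<lambda>k. if k = i then \<one> else \<zero>)"
    using w_mult_D_Dsum[OF R.one_closed assms(1)] D_closed by (simp add: w_one)
  then show ?thesis using \<rho>_Dsum[of "\<lambda>k. if k = i then \<one> else \<zero>" j] assms by auto
qed

text \<open>Combines \<open>A_range\<close> with the basis of \<open>R\<close> over the complex numbers.\<close>

lemma A_induct [consumes 1, case_names zero add basic]:
  assumes x: "x \<in> carrier A" and zero: "Q \<zero>\<^bsub>A\<^esub>"
    and add: "\<And>x y. x \<in> carrier A \<Longrightarrow> y \<in> carrier A \<Longrightarrow> Q x \<Longrightarrow> Q y \<Longrightarrow> Q (x \<oplus>\<^bsub>A\<^esub> y)"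
    and basic: "\<And>c i j. i \<in> {1..m} \<Longrightarrow> j \<in> {1..n - 1} \<Longrightarrow> Q (c \<odot>\<^bsub>A\<^esub> (w (v i) \<otimes>\<^bsub>A\<^esub> D j))"
  shows "Q x"
proof -
  have 1: "Q (w r \<otimes>\<^bsub>A\<^esub> D j)" if r: "r \<in> carrier R" and j: "j \<in> {1..n - 1}" for r j
  proof -
    have t: "\<iota> (\<kappa> i r) \<otimes> v i \<in> carrier R" if "i \<in> {1..m}" for i using v_closed[OF that] by simp
    have "w r = (\<Oplus>\<^bsub>A\<^esub>i\<in>{1..m}. w (\<iota> (\<kappa> i r) \<otimes> v i))"
      by (subst expansion[OF r]) (rule additive_map_finsum[OF R.abelian_group_axioms A.abelian_group_axioms w_additive t])
    then have "w r \<otimes>\<^bsub>A\<^esub> D j = (\<Oplus>\<^bsub>A\<^esub>i\<in>{1..m}. w (\<iota> (\<kappa> i r) \<otimes> v i)) \<otimes>\<^bsub>A\<^esub> D j" by simp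
    also have "\<dots> = (\<Oplus>\<^bsub>A\<^esub>i\<in>{1..m}. w (\<iota> (\<kappa> i r) \<otimes> v i) \<otimes>\<^bsub>A\<^esub> D j)"
      by (rule A.finsum_ldistr) (use t w_closed D_closed in auto)
    also have "Q \<dots>"
    proof (rule A.finsum_induct[OF zero add])
      fix i assume i: "i \<in> {1..m}"
      show "w (\<iota> (\<kappa> i r) \<otimes> v i) \<otimes>\<^bsub>A\<^esub> D j \<in> carrier A" using w_closed[OF t[OF i]] D_closed by simp
      have "w (\<iota> (\<kappa> i r) \<otimes> v i) \<otimes>\<^bsub>A\<^esub> D j = \<kappa> i r \<odot>\<^bsub>A\<^esub> (w (v i) \<otimes>\<^bsub>A\<^esub> D j)"
        unfolding smult_A using v_closed[OF i] by (simp add: w_mult A.m_assoc w_closed D_closed)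
      then show "Q (w (\<iota> (\<kappa> i r) \<otimes> v i) \<otimes>\<^bsub>A\<^esub> D j)" using basic[OF i j] by simp
    qed
    finally show ?thesis .
  qed
  obtain r where r: "r \<in> {1..n - 1} \<rightarrow> carrier R" "x = Dsum r" using A_Dsum[OF x] by blast
  show ?thesis unfolding r(2) Dsum_def
    by (rule A.finsum_induct[OF zero add]) (use 1[OF Pi_mem[OF r(1)]] Dsum_summand[OF r(1)] in simp_all)
qed

end

section \<open>Linear maps out of the quotient\<close>

context dickson_quotient
begin

lemma module_A: "Module.module class_ring A"
  by (rule Module.moduleI[OF class_cring.is_cring A.abelian_group_axioms])
    (auto simp: smult_A w_closed \<iota>_add w_add \<iota>_mult w_mult \<iota>_one w_one A.l_distr A.r_distr A.m_assoc)

sublocale AM: Module.module class_ring A by (rule module_A)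

lemma smult_mult: "x \<in> carrier A \<Longrightarrow> y \<in> carrier A \<Longrightarrow> (c \<odot>\<^bsub>A\<^esub> x) \<otimes>\<^bsub>A\<^esub> y = c \<odot>\<^bsub>A\<^esub> (x \<otimes>\<^bsub>A\<^esub> y)"
  by (simp add: smult_A A.m_assoc w_closed)

lemma mult_smult: "x \<in> carrier A \<Longrightarrow> y \<in> carrier A \<Longrightarrow> x \<otimes>\<^bsub>A\<^esub> (c \<odot>\<^bsub>A\<^esub> y) = c \<odot>\<^bsub>A\<^esub> (x \<otimes>\<^bsub>A\<^esub> y)"
  by (simp add: smult_A A.m_lcomm w_closed)

lemma smult_closed_A: "x \<in> carrier A \<Longrightarrow> c \<odot>\<^bsub>A\<^esub> x \<in> carrier A"
  by (simp add: smult_A w_closed)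

definition B :: "(nat \<times> nat) set" where "B = {1..m} \<times> {1..n - 1}"

text \<open>The basis in which the algebra becomes a fusion ring; \<open>K\<close> is the family of coordinates.\<close>

definition x :: "nat \<times> nat \<Rightarrow> (nat \<Rightarrow> 'a) set" where "x p = w (v (fst p)) \<otimes>\<^bsub>A\<^esub> D (snd p)"

definition K :: "nat \<times> nat \<Rightarrow> (nat \<Rightarrow> 'a) set \<Rightarrow> complex" where "K p y = \<kappa> (fst p) (\<rho> (snd p) y)"

lemma finite_B: "finite B" by (simp add: B_def)

lemma B_ranges: "p \<in> B \<Longrightarrow> fst p \<in> {1..m}" "p \<in> B \<Longrightarrow> snd p \<in> {1..n - 1}"
  by (auto simp: B_def)

lemma x_closed: "p \<in> B \<Longrightarrow> x p \<in> carrier A"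
  by (simp add: x_def w_closed v_closed D_closed B_ranges del: One_nat_def atLeastAtMost_iff)

lemma K_add: "p \<in> B \<Longrightarrow> y \<in> carrier A \<Longrightarrow> y' \<in> carrier A \<Longrightarrow> K p (y \<oplus>\<^bsub>A\<^esub> y') = K p y + K p y'"
  by (simp add: K_def \<rho>_add \<kappa>_add \<rho>_closed B_ranges del: One_nat_def atLeastAtMost_iff)

lemma K_smult: "p \<in> B \<Longrightarrow> y \<in> carrier A \<Longrightarrow> K p (c \<odot>\<^bsub>A\<^esub> y) = c * K p y"
  by (simp add: K_def smult_A \<rho>_mult \<kappa>_scale \<rho>_closed B_ranges del: One_nat_def atLeastAtMost_iff)

lemma K_x:
  assumes p: "p \<in> B" and q: "q \<in> B" shows "K p (x q) = (if p = q then 1 else 0)"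
proof -
  have k0: "\<kappa> i \<zero> = 0" if "i \<in> {1..m}" for i using \<kappa>_scale[OF that, of \<zero> 0] by simp
  have "K p (x q) = \<kappa> (fst p) (v (fst q) \<otimes> (if snd q = snd p then \<one> else \<zero>))"
    unfolding K_def x_def \<rho>_mult[OF v_closed[OF B_ranges(1)[OF q]] D_closed B_ranges(2)[OF p]] \<rho>_D[OF B_ranges(2)[OF q] B_ranges(2)[OF p]] ..
  also have "\<dots> = (if p = q then 1 else 0)"
    using \<kappa>_v[OF B_ranges(1)[OF p] B_ranges(1)[OF q]] k0[OF B_ranges(1)[OF p]] v_closed[OF B_ranges(1)[OF q]] by (auto simp: prod_eq_iff)
  finally show ?thesis .
qed

text \<open>The linear map with prescribed values \<open>f\<close> on the basis \<open>x\<close>.\<close>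

definition lin :: "(complex, 'q, 'z) module_scheme \<Rightarrow> (nat \<times> nat \<Rightarrow> 'q) \<Rightarrow> (nat \<Rightarrow> 'a) set \<Rightarrow> 'q" where
  "lin Q f y = (\<Oplus>\<^bsub>Q\<^esub>p\<in>B. K p y \<odot>\<^bsub>Q\<^esub> f p)"

context
  fixes Q :: "(complex, 'q, 'z) module_scheme" and f :: "nat \<times> nat \<Rightarrow> 'q"
  assumes Q: "Module.module class_ring Q" and f: "\<And>p. p \<in> B \<Longrightarrow> f p \<in> carrier Q"
begin

interpretation Q: Module.module class_ring Q by (rule Q)

lemma lin_summand: "p \<in> B \<Longrightarrow> c \<odot>\<^bsub>Q\<^esub> f p \<in> carrier Q"
  using f Q.smult_closed by simp

lemma lin_closed: "lin Q f y \<in> carrier Q"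
  unfolding lin_def by (rule Q.finsum_closed) (use lin_summand in auto)

lemma lin_add:
  assumes "y \<in> carrier A" "y' \<in> carrier A" shows "lin Q f (y \<oplus>\<^bsub>A\<^esub> y') = lin Q f y \<oplus>\<^bsub>Q\<^esub> lin Q f y'"
proof -
  have "lin Q f (y \<oplus>\<^bsub>A\<^esub> y') = (\<Oplus>\<^bsub>Q\<^esub>p\<in>B. K p y \<odot>\<^bsub>Q\<^esub> f p \<oplus>\<^bsub>Q\<^esub> K p y' \<odot>\<^bsub>Q\<^esub> f p)"
    unfolding lin_def
  proof (rule Q.finsum_cong'[OF refl])
    fix p assume p: "p \<in> B"
    show "K p (y \<oplus>\<^bsub>A\<^esub> y') \<odot>\<^bsub>Q\<^esub> f p = K p y \<odot>\<^bsub>Q\<^esub> f p \<oplus>\<^bsub>Q\<^esub> K p y' \<odot>\<^bsub>Q\<^esub> f p"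
      using K_add[OF p assms] Q.smult_l_distr[of "K p y" "K p y'" "f p"] f[OF p] by simp
  qed (use lin_summand in auto)
  also have "\<dots> = lin Q f y \<oplus>\<^bsub>Q\<^esub> lin Q f y'"
    unfolding lin_def by (rule Q.finsum_addf) (use lin_summand in auto)
  finally show ?thesis .
qed

lemma lin_smult:
  assumes y: "y \<in> carrier A" shows "lin Q f (c \<odot>\<^bsub>A\<^esub> y) = c \<odot>\<^bsub>Q\<^esub> lin Q f y"
proof -
  have ad: "additive_map Q Q (module.smult Q c)"
    by (rule additive_mapI) (use Q.smult_r_distr Q.smult_closed in auto)
  have "c \<odot>\<^bsub>Q\<^esub> lin Q f y = (\<Oplus>\<^bsub>Q\<^esub>p\<in>B. c \<odot>\<^bsub>Q\<^esub> (K p y \<odot>\<^bsub>Q\<^esub> f p))"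
    unfolding lin_def
    by (rule additive_map_finsum[OF Q.abelian_group_axioms Q.abelian_group_axioms ad lin_summand])
  also have "\<dots> = lin Q f (c \<odot>\<^bsub>A\<^esub> y)"
    unfolding lin_def
  proof (rule Q.finsum_cong'[OF refl])
    fix p assume p: "p \<in> B"
    show "c \<odot>\<^bsub>Q\<^esub> (K p y \<odot>\<^bsub>Q\<^esub> f p) = K p (c \<odot>\<^bsub>A\<^esub> y) \<odot>\<^bsub>Q\<^esub> f p"
      using K_smult[OF p y] Q.smult_assoc1[of c "K p y" "f p"] f[OF p] by simp
  qed (use lin_summand in auto)
  finally show ?thesis ..
qed

lemma lin_hom: "lin Q f \<in> LinearCombinations.module_hom class_ring A Q"
  unfolding LinearCombinations.module_hom_def using lin_closed lin_add lin_smult by auto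

lemma lin_x:
  assumes q: "q \<in> B" shows "lin Q f (x q) = f q"
proof -
  have z: "0 \<odot>\<^bsub>Q\<^esub> u = \<zero>\<^bsub>Q\<^esub>" if "u \<in> carrier Q" for u using Q.smult_l_null[OF that] by simp
  have o: "1 \<odot>\<^bsub>Q\<^esub> u = u" if "u \<in> carrier Q" for u using Q.smult_one[OF that] by simp
  have "lin Q f (x q) = K q (x q) \<odot>\<^bsub>Q\<^esub> f q"
    unfolding lin_def
    by (rule Q.finsum_single[OF finite_B q]) (use q K_x lin_summand f z in auto)
  then show ?thesis using K_x[OF q q] o[OF f[OF q]] by simp
qed

end

text \<open>Equality of linear maps out of \<open>A\<close> is tested on the basis; nearly every identity below is obtained this way.\<close>

lemma linear_ext:
  assumes Q: "Module.module class_ring Q"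
    and f: "f \<in> LinearCombinations.module_hom class_ring A Q" and g: "g \<in> LinearCombinations.module_hom class_ring A Q"
    and eq: "\<And>p. p \<in> B \<Longrightarrow> f (x p) = g (x p)" and y: "y \<in> carrier A"
  shows "f y = g y"
proof -
  interpret Q: Module.module class_ring Q by (rule Q)
  have fa: "additive_map A Q f" "additive_map A Q g"
    using f g by (auto simp: additive_map_def LinearCombinations.module_hom_def)
  show ?thesis using y
  proof (induction y rule: A_induct)
    case zero
    then show ?case using additive_map_zero[OF A.abelian_group_axioms Q.abelian_group_axioms fa(1)]
        additive_map_zero[OF A.abelian_group_axioms Q.abelian_group_axioms fa(2)] by simp
  next
    case (add y y')
    then show ?case using additive_map_add[OF fa(1) add(1,2)] additive_map_add[OF fa(2) add(1,2)] by simp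
  next
    case (basic c i j)
    then have p: "(i, j) \<in> B" by (simp add: B_def)
    have "f (c \<odot>\<^bsub>A\<^esub> x (i, j)) = g (c \<odot>\<^bsub>A\<^esub> x (i, j))"
      using LinearCombinations.module_hom_smult[OF f, of c "x (i, j)"] LinearCombinations.module_hom_smult[OF g, of c "x (i, j)"]
        eq[OF p] x_closed[OF p] by simp
    then show ?case by (simp add: x_def)
  qed
qed

lemma expand:
  assumes "y \<in> carrier A" shows "(\<Oplus>\<^bsub>A\<^esub>p\<in>B. K p y \<odot>\<^bsub>A\<^esub> x p) = y"
proof -
  have "lin A x y = (\<lambda>y. y) y"
    by (rule linear_ext[OF module_A lin_hom[OF module_A x_closed] _ _ assms])
      (use lin_x[OF module_A x_closed] in \<open>auto simp: LinearCombinations.module_hom_def\<close>)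
  then show ?thesis by (simp add: lin_def)
qed

lemma x_inj: "inj_on x B"
  using K_x by (intro inj_onI) (metis zero_neq_one)

sublocale AV: VectorSpace.vectorspace class_ring A
  by (intro vectorspace.intro module_A class_field)

lemma gen_set_if_x_in_span:
  assumes X: "X \<subseteq> carrier A" and gens: "\<And>p. p \<in> B \<Longrightarrow> x p \<in> AM.span X"
  shows "AM.gen_set X"
proof -
  interpret sp: submodule class_ring "AM.span X" A by (rule AM.span_is_submodule[OF X])
  have "y \<in> AM.span X" if "y \<in> carrier A" for y
    using that
  proof (induction y rule: A_induct)
    case (basic c i j)
    then have p: "(i, j) \<in> B" by (simp add: B_def)
    show ?case using sp.smult_closed[OF _ gens[OF p], of c] by (simp add: x_def)
  qed (simp_all add: sp.zero_closed sp.m_closed)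
  then show ?thesis using sp.subset by blast
qed

lemma x_basis: "AV.basis (x ` B)"
proof -
  have X: "x ` B \<subseteq> carrier A" using x_closed by auto
  have gen: "AM.gen_set (x ` B)"
    by (rule gen_set_if_x_in_span[OF X]) (use AM.in_own_span[OF X] in auto)
  have "\<not> AM.lin_dep (x ` B)"
  proof
    assume "AM.lin_dep (x ` B)"
    then obtain T c u where T: "finite T" "T \<subseteq> x ` B" "AM.lincomb c T = \<zero>\<^bsub>A\<^esub>" "u \<in> T" "c u \<noteq> 0"
      unfolding AM.lin_dep_def by auto
    obtain p where p: "p \<in> B" "u = x p" using T by auto
    have ad: "additive_map A class_ring (K p)"
      by (rule additive_mapI) (use K_add[OF p(1)] in auto)
    have "K p (AM.lincomb c T) = (\<Sum>t\<in>T. K p (c t \<odot>\<^bsub>A\<^esub> t))"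
      unfolding AM.lincomb_def
      using additive_map_finsum[OF A.abelian_group_axioms class_ring.abelian_group_axioms ad, of T "\<lambda>t. c t \<odot>\<^bsub>A\<^esub> t"]
        T(2) X smult_closed_A by (force simp: class_ring_simps)
    also have "\<dots> = (\<Sum>t\<in>T. if t = u then c u else 0)"
    proof (rule sum.cong[OF refl])
      fix t assume "t \<in> T"
      then obtain q where q: "q \<in> B" "t = x q" using T(2) by auto
      have "p = q \<longleftrightarrow> u = t" using p q x_inj by (auto dest: inj_onD)
      then show "K p (c t \<odot>\<^bsub>A\<^esub> t) = (if t = u then c u else 0)"
        using K_smult[OF p(1) x_closed[OF q(1)]] K_x[OF p(1) q(1)] q(2) by auto
    qed
    also have "\<dots> = c u" using T by simp
    finally have "K p \<zero>\<^bsub>A\<^esub> = c u" using T(3) by simp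
    then show False
      using additive_map_zero[OF A.abelian_group_axioms class_ring.abelian_group_axioms ad] T(5) by simp
  qed
  then show ?thesis using gen X by (simp add: AV.basis_def)
qed

lemma fin_dim_A: "AV.fin_dim"
  unfolding AV.fin_dim_def using x_basis finite_B by (auto simp: AV.basis_def)

lemma dim_A: "AV.dim = card B"
  using AV.dim_basis[OF _ x_basis] finite_B card_image[OF x_inj] by simp

definition vz :: "nat \<Rightarrow> nat \<Rightarrow> (nat \<Rightarrow> 'a) set" where
  "vz i j = rc (up_ring.monom PR (v i) j)"

lemma vz_power: "i \<in> {1..m} \<Longrightarrow> vz i j = w (v i) \<otimes>\<^bsub>A\<^esub> z [^]\<^bsub>A\<^esub> j"
proof (induction j)
  case 0 then show ?case by (simp add: vz_def w_def poly_const_def rc_closed v_closed)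
next
  case (Suc j)
  have "up_ring.monom PR (v i) (Suc j) = up_ring.monom PR (v i) j \<otimes>\<^bsub>PR\<^esub> poly_var R"
    unfolding poly_var_def using U.monom_mult[OF v_closed[OF Suc.prems] R.one_closed, of j 1] v_closed[OF Suc.prems] by simp
  then show ?case using Suc var_closed v_closed[OF Suc.prems] z_closed w_closed
    by (simp add: vz_def rc_mult z_def[symmetric] A.m_assoc)
qed

text \<open>The Dickson recursion expresses \<open>z^k F\<^sub>j\<close> with \<open>k + j \<le> n - 1\<close> through monomials of degree at most \<open>n - 2\<close>, so these
monomials span. Their number is the dimension.\<close>

lemma vz_basis: "AV.basis ((\<lambda>(i, j). vz i j) ` ({1..m} \<times> {0..n - 2}))"
  and vz_inj: "inj_on (\<lambda>(i, j). vz i j) ({1..m} \<times> {0..n - 2})"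
proof -
  let ?I = "{1..m} \<times> {0..n - 2}" and ?f = "\<lambda>(i, j). vz i j"
  have X: "?f ` ?I \<subseteq> carrier A" by (auto simp: vz_power w_closed v_closed z_closed)
  interpret sp: submodule class_ring "AM.span (?f ` ?I)" A by (rule AM.span_is_submodule[OF X])
  have wz: "w r \<otimes>\<^bsub>A\<^esub> z [^]\<^bsub>A\<^esub> k \<in> AM.span (?f ` ?I)" if r: "r \<in> carrier R" and k: "k \<le> n - 2" for r k
  proof -
    have t: "\<iota> (\<kappa> i r) \<otimes> v i \<in> carrier R" if "i \<in> {1..m}" for i using v_closed[OF that] by simp
    have "w r = (\<Oplus>\<^bsub>A\<^esub>i\<in>{1..m}. w (\<iota> (\<kappa> i r) \<otimes> v i))"
      by (subst expansion[OF r]) (rule additive_map_finsum[OF R.abelian_group_axioms A.abelian_group_axioms w_additive t])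
    then have "w r \<otimes>\<^bsub>A\<^esub> z [^]\<^bsub>A\<^esub> k = (\<Oplus>\<^bsub>A\<^esub>i\<in>{1..m}. w (\<iota> (\<kappa> i r) \<otimes> v i) \<otimes>\<^bsub>A\<^esub> z [^]\<^bsub>A\<^esub> k)"
      using A.finsum_ldistr[of "{1..m}" "z [^]\<^bsub>A\<^esub> k" "\<lambda>i. w (\<iota> (\<kappa> i r) \<otimes> v i)"] t w_closed z_closed by auto
    also have "\<dots> \<in> AM.span (?f ` ?I)"
    proof (rule A.finsum_induct)
      fix i assume i: "i \<in> {1..m}"
      show "w (\<iota> (\<kappa> i r) \<otimes> v i) \<otimes>\<^bsub>A\<^esub> z [^]\<^bsub>A\<^esub> k \<in> carrier A" using w_closed[OF t[OF i]] z_closed by simp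
      have "w (\<iota> (\<kappa> i r) \<otimes> v i) \<otimes>\<^bsub>A\<^esub> z [^]\<^bsub>A\<^esub> k = \<kappa> i r \<odot>\<^bsub>A\<^esub> vz i k"
        unfolding smult_A vz_power[OF i] using v_closed[OF i] by (simp add: w_mult A.m_assoc w_closed z_closed)
      moreover have "vz i k \<in> ?f ` ?I" using i k by force
      ultimately show "w (\<iota> (\<kappa> i r) \<otimes> v i) \<otimes>\<^bsub>A\<^esub> z [^]\<^bsub>A\<^esub> k \<in> AM.span (?f ` ?I)"
        using AM.in_own_span[OF X] sp.smult_closed by auto
    next
      show "\<zero>\<^bsub>A\<^esub> \<in> AM.span (?f ` ?I)" by (rule sp.zero_closed)
    next
      fix u u' assume "u \<in> AM.span (?f ` ?I)" "u' \<in> AM.span (?f ` ?I)"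
      then show "u \<oplus>\<^bsub>A\<^esub> u' \<in> AM.span (?f ` ?I)" by (rule sp.m_closed)
    qed
    finally show ?thesis .
  qed
  have wzD: "w r \<otimes>\<^bsub>A\<^esub> z [^]\<^bsub>A\<^esub> k \<otimes>\<^bsub>A\<^esub> D j \<in> AM.span (?f ` ?I)" if "r \<in> carrier R" "k + j \<le> n - 1" for r k j
    using that
  proof (induction j arbitrary: r k rule: less_induct)
    case (less j)
    note r = less.prems(1)
    have wc: "w r \<in> carrier A" "z [^]\<^bsub>A\<^esub> k \<in> carrier A" using r w_closed z_closed by auto
    consider "j = 0" | "j = 1" | i where "j = Suc (Suc i)" by (metis One_nat_def not0_implies_Suc)
    then show ?case
    proof cases
      case 1 then show ?thesis using wc D_zero sp.zero_closed by simp
    next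
      case 2 then show ?thesis using wc D_one wz[OF r, of k] less.prems(2) by simp
    next
      case 3
      have Dj: "D j = z \<otimes>\<^bsub>A\<^esub> D (Suc i) \<oplus>\<^bsub>A\<^esub> (\<ominus>\<^bsub>A\<^esub> w a) \<otimes>\<^bsub>A\<^esub> D i"
        unfolding D_rec 3 using w_closed[OF a_closed] D_closed by (simp add: A.l_minus A.a_assoc A.r_neg)
      have neg: "\<ominus>\<^bsub>A\<^esub> w a = w (\<ominus> a)"
        using additive_map_neg[OF R.abelian_group_axioms A.abelian_group_axioms w_additive a_closed] by simp
      have "w r \<otimes>\<^bsub>A\<^esub> z [^]\<^bsub>A\<^esub> k \<otimes>\<^bsub>A\<^esub> D j = w r \<otimes>\<^bsub>A\<^esub> z [^]\<^bsub>A\<^esub> Suc k \<otimes>\<^bsub>A\<^esub> D (Suc i)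
          \<oplus>\<^bsub>A\<^esub> w (r \<otimes> \<ominus> a) \<otimes>\<^bsub>A\<^esub> z [^]\<^bsub>A\<^esub> k \<otimes>\<^bsub>A\<^esub> D i"
        unfolding Dj neg using wc r a_closed z_closed D_closed w_closed
        by (simp add: A.r_distr w_mult A.m_ac)
      moreover have "w r \<otimes>\<^bsub>A\<^esub> z [^]\<^bsub>A\<^esub> Suc k \<otimes>\<^bsub>A\<^esub> D (Suc i) \<in> AM.span (?f ` ?I)"
        by (rule less.IH) (use 3 less.prems in auto)
      moreover have "w (r \<otimes> \<ominus> a) \<otimes>\<^bsub>A\<^esub> z [^]\<^bsub>A\<^esub> k \<otimes>\<^bsub>A\<^esub> D i \<in> AM.span (?f ` ?I)"
        by (rule less.IH) (use 3 less.prems a_closed in auto)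
      ultimately show ?thesis using sp.m_closed by simp
    qed
  qed
  have gen: "AM.gen_set (?f ` ?I)"
  proof (rule gen_set_if_x_in_span[OF X])
    fix p assume p: "p \<in> B"
    show "x p \<in> AM.span (?f ` ?I)"
      using wzD[OF v_closed[OF B_ranges(1)[OF p]], of 0 "snd p"] B_ranges(2)[OF p] w_closed[OF v_closed[OF B_ranges(1)[OF p]]] by (simp add: x_def)
  qed
  have "Suc (n - 2) = n - 1" using n_ge by simp
  then have cI: "card ?I = card B" unfolding B_def card_cartesian_product by simp
  have fin: "finite (?f ` ?I)" by simp
  have le: "card (?f ` ?I) \<le> AV.dim" unfolding dim_A cI[symmetric] by (rule card_image_le) simp
  show basis: "AV.basis (?f ` ?I)" by (rule AV.dim_gen_is_basis[OF fin X gen le])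
  have "card (?f ` ?I) = card ?I" using AV.dim_basis[OF fin basis] dim_A cI by simp
  then show "inj_on ?f ?I" by (intro eq_card_imp_inj_on) simp_all
qed

end

section \<open>Multiplication in the quotient\<close>

text \<open>The only facts about the group that the structure of the algebra depends on: fusion numbers \<open>N\<close> of the
basis, the permutation \<open>\<tau>\<close> given by multiplication with \<open>a\<close>, the involution \<open>star\<close> and the dimensions \<open>d\<close>.\<close>

locale fusion_quotient = dickson_quotient R \<iota> m v \<kappa> a n
  for R :: "('a, 'e) ring_scheme" (structure) and \<iota> :: "complex \<Rightarrow> 'a" and m :: nat
    and v :: "nat \<Rightarrow> 'a" and \<kappa> :: "nat \<Rightarrow> 'a \<Rightarrow> complex" and a :: 'a and n :: nat +
  fixes \<tau> star :: "nat \<Rightarrow> nat" and N :: "nat \<Rightarrow> nat \<Rightarrow> nat \<Rightarrow> nat" and d :: "nat \<Rightarrow> nat"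
  assumes one_in: "1 \<in> {1..m}" and v_one: "v 1 = \<one>"
    and a_v: "i \<in> {1..m} \<Longrightarrow> a \<otimes> v i = v (\<tau> i)"
    and v_mult: "i \<in> {1..m} \<Longrightarrow> j \<in> {1..m} \<Longrightarrow>
        v i \<otimes> v j = (\<Oplus>k\<in>{1..m}. \<iota> (of_nat (N i j k)) \<otimes> v k)"
    and tau_bij: "bij_betw \<tau> {1..m} {1..m}"
    and star_in: "i \<in> {1..m} \<Longrightarrow> star i \<in> {1..m}"
    and star_star: "i \<in> {1..m} \<Longrightarrow> star (star i) = i" and star_one: "star 1 = 1"
    and tau_star_tau: "i \<in> {1..m} \<Longrightarrow> \<tau> (star (\<tau> i)) = star i"
    and N_one: "i \<in> {1..m} \<Longrightarrow> j \<in> {1..m} \<Longrightarrow> N i j 1 = (if j = star i then 1 else 0)"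
    and N_star: "i \<in> {1..m} \<Longrightarrow> j \<in> {1..m} \<Longrightarrow> k \<in> {1..m} \<Longrightarrow> N (star i) (star j) (star k) = N i j k"
    and N_dim: "i \<in> {1..m} \<Longrightarrow> j \<in> {1..m} \<Longrightarrow> d i * d j = (\<Sum>k\<in>{1..m}. N i j k * d k)"
    and d_pos: "i \<in> {1..m} \<Longrightarrow> d i > 0" and d_one: "d 1 = 1"
    and d_tau: "i \<in> {1..m} \<Longrightarrow> d (\<tau> i) = d i" and d_star: "i \<in> {1..m} \<Longrightarrow> d (star i) = d i"
begin

lemma tau_in: "i \<in> {1..m} \<Longrightarrow> \<tau> i \<in> {1..m}"
  using bij_betwE[OF tau_bij] by blast

definition \<sigma> where "\<sigma> = inv_into {1..m} \<tau>"

lemma sigma_in: "i \<in> {1..m} \<Longrightarrow> \<sigma> i \<in> {1..m}"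
  unfolding \<sigma>_def using bij_betw_imp_surj_on[OF tau_bij] by (metis inv_into_into)

lemma tau_sigma: "i \<in> {1..m} \<Longrightarrow> \<tau> (\<sigma> i) = i"
  unfolding \<sigma>_def using bij_betw_imp_surj_on[OF tau_bij] by (metis f_inv_into_f)

lemma sigma_tau: "i \<in> {1..m} \<Longrightarrow> \<sigma> (\<tau> i) = i"
  unfolding \<sigma>_def using bij_betw_imp_inj_on[OF tau_bij] by (rule inv_into_f_f)

lemma star_tau: "i \<in> {1..m} \<Longrightarrow> star (\<tau> i) = \<sigma> (star i)"
  using tau_star_tau sigma_tau[of "star (\<tau> i)"] tau_in star_in by metis

lemma star_sigma: "i \<in> {1..m} \<Longrightarrow> star (\<sigma> i) = \<tau> (star i)"
  using tau_star_tau[of "\<sigma> i"] tau_sigma[of i] sigma_in by metis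

lemma tau_pow_in: "i \<in> {1..m} \<Longrightarrow> (\<tau> ^^ k) i \<in> {1..m}"
  by (induction k) (simp_all add: tau_in del: One_nat_def atLeastAtMost_iff)

lemma sigma_pow_in: "i \<in> {1..m} \<Longrightarrow> (\<sigma> ^^ k) i \<in> {1..m}"
  by (induction k) (simp_all add: sigma_in del: One_nat_def atLeastAtMost_iff)

lemma star_sigma_pow: "i \<in> {1..m} \<Longrightarrow> star ((\<sigma> ^^ k) i) = (\<tau> ^^ k) (star i)"
  by (induction k) (simp_all add: star_sigma sigma_pow_in del: One_nat_def atLeastAtMost_iff)

lemma star_tau_pow: "i \<in> {1..m} \<Longrightarrow> star ((\<tau> ^^ k) i) = (\<sigma> ^^ k) (star i)"
  by (induction k) (simp_all add: star_tau tau_pow_in del: One_nat_def atLeastAtMost_iff)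

lemma sigma_tau_pow: "i \<in> {1..m} \<Longrightarrow> (\<sigma> ^^ k) ((\<tau> ^^ k) i) = i"
proof (induction k arbitrary: i)
  case (Suc k)
  have "(\<sigma> ^^ Suc k) ((\<tau> ^^ Suc k) i) = \<sigma> ((\<sigma> ^^ k) ((\<tau> ^^ k) (\<tau> i)))"
    by (simp add: funpow_swap1)
  then show ?case using Suc.IH[OF tau_in[OF Suc.prems]] sigma_tau[OF Suc.prems] by simp
qed simp

lemma d_tau_pow: "i \<in> {1..m} \<Longrightarrow> d ((\<tau> ^^ k) i) = d i"
  by (induction k) (simp_all add: d_tau tau_pow_in del: One_nat_def atLeastAtMost_iff)

lemma d_sigma: "i \<in> {1..m} \<Longrightarrow> d (\<sigma> i) = d i"
  using d_tau[OF sigma_in] tau_sigma by simp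

lemma d_sigma_pow: "i \<in> {1..m} \<Longrightarrow> d ((\<sigma> ^^ k) i) = d i"
  by (induction k) (simp_all add: d_sigma sigma_pow_in del: One_nat_def atLeastAtMost_iff)

definition b where "b = v (\<sigma> 1)"

lemma b_closed: "b \<in> carrier R"
  unfolding b_def by (rule v_closed[OF sigma_in[OF one_in]])

text \<open>So \<open>b\<close> is the inverse of \<open>a\<close>, the class of the linear character \<open>\<chi>\<close>.\<close>

lemma a_b: "a \<otimes> b = \<one>"
  unfolding b_def a_v[OF sigma_in[OF one_in]] tau_sigma[OF one_in] by (rule v_one)

lemma b_v: "i \<in> {1..m} \<Longrightarrow> b \<otimes> v i = v (\<sigma> i)"
proof -
  assume i: "i \<in> {1..m}"
  have s: "v (\<sigma> i) \<in> carrier R" by (rule v_closed[OF sigma_in[OF i]])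
  have "b \<otimes> v i = b \<otimes> (a \<otimes> v (\<sigma> i))" using a_v[OF sigma_in[OF i]] tau_sigma[OF i] by simp
  also have "\<dots> = (a \<otimes> b) \<otimes> v (\<sigma> i)" using b_closed a_closed s by (simp add: R.m_ac)
  finally show ?thesis using a_b s by simp
qed

lemma a_pow_v: "i \<in> {1..m} \<Longrightarrow> a [^] k \<otimes> v i = v ((\<tau> ^^ k) i)"
proof (induction k)
  case (Suc k)
  have "a [^] Suc k \<otimes> v i = a \<otimes> (a [^] k \<otimes> v i)" using Suc.prems v_closed a_closed by (simp add: R.m_ac)
  then show ?case using Suc.IH[OF Suc.prems] a_v[OF tau_pow_in[OF Suc.prems]] by simp
qed (simp add: v_closed)

lemma b_pow_v: "i \<in> {1..m} \<Longrightarrow> b [^] k \<otimes> v i = v ((\<sigma> ^^ k) i)"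
proof (induction k)
  case (Suc k)
  have "b [^] Suc k \<otimes> v i = b \<otimes> (b [^] k \<otimes> v i)" using Suc.prems v_closed b_closed by (simp add: R.m_ac)
  then show ?case using Suc.IH[OF Suc.prems] b_v[OF sigma_pow_in[OF Suc.prems]] by simp
qed (simp add: v_closed)

lemma v_eq_iff: "i \<in> {1..m} \<Longrightarrow> j \<in> {1..m} \<Longrightarrow> v i = v j \<longleftrightarrow> i = j"
  using \<kappa>_v[of i j] \<kappa>_v[of i i] by (metis zero_neq_one)

lemma a_v1: "a = v (\<tau> 1)"
  using a_v[OF one_in] v_one a_closed by simp

text \<open>The elements \<open>x (i, j)\<close>, extended to \<open>j = 0\<close> and \<open>j = n\<close>, where they vanish. With these two boundary values the rule
\<open>z_wD\<close> for multiplication by \<open>z\<close> holds uniformly for the whole basis.\<close>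

definition wD where "wD i j = w (v i) \<otimes>\<^bsub>A\<^esub> D j"

lemma wD_closed: "i \<in> {1..m} \<Longrightarrow> wD i j \<in> carrier A"
  by (simp add: wD_def w_closed v_closed D_closed del: One_nat_def atLeastAtMost_iff)

lemma x_wD: "x (i, j) = wD i j"
  by (simp add: x_def wD_def)

lemma wD_boundary: "i \<in> {1..m} \<Longrightarrow> wD i 0 = \<zero>\<^bsub>A\<^esub>" "i \<in> {1..m} \<Longrightarrow> wD i n = \<zero>\<^bsub>A\<^esub>"
  by (simp_all add: wD_def D_zero D_n w_closed v_closed del: One_nat_def atLeastAtMost_iff)

lemma z_wD: 
  assumes i: "i \<in> {1..m}" shows "z \<otimes>\<^bsub>A\<^esub> wD i (Suc j) = wD i (Suc (Suc j)) \<oplus>\<^bsub>A\<^esub> wD (\<tau> i) j"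
proof -
  have c: "w (v i) \<in> carrier A" "w a \<in> carrier A" using v_closed[OF i] a_closed by (simp_all add: w_closed)
  have "z \<otimes>\<^bsub>A\<^esub> wD i (Suc j) = w (v i) \<otimes>\<^bsub>A\<^esub> (z \<otimes>\<^bsub>A\<^esub> D (Suc j))"
    using c z_closed D_closed by (simp add: wD_def A.m_lcomm)
  also have "\<dots> = w (v i) \<otimes>\<^bsub>A\<^esub> D (Suc (Suc j)) \<oplus>\<^bsub>A\<^esub> (w a \<otimes>\<^bsub>A\<^esub> w (v i)) \<otimes>\<^bsub>A\<^esub> D j"
    unfolding D_rec using c D_closed by (simp add: A.r_distr A.m_ac)
  also have "w a \<otimes>\<^bsub>A\<^esub> w (v i) = w (v (\<tau> i))"
    using w_mult[OF a_closed v_closed[OF i]] a_v[OF i] by simp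
  finally show ?thesis by (simp add: wD_def)
qed

lemma w_wD:
  assumes i: "i \<in> {1..m}" and k: "k \<in> {1..m}"
  shows "w (v k) \<otimes>\<^bsub>A\<^esub> wD i j = (\<Oplus>\<^bsub>A\<^esub>l\<in>{1..m}. of_nat (N k i l) \<odot>\<^bsub>A\<^esub> wD l j)"
proof -
  have t: "\<iota> (of_nat (N k i l)) \<otimes> v l \<in> carrier R" if "l \<in> {1..m}" for l using v_closed[OF that] by simp
  have "w (v k) \<otimes>\<^bsub>A\<^esub> wD i j = w (v k \<otimes> v i) \<otimes>\<^bsub>A\<^esub> D j"
    using w_closed[OF v_closed[OF i]] w_closed[OF v_closed[OF k]] D_closed v_closed i k
    by (simp add: wD_def w_mult A.m_assoc)
  also have "\<dots> = (\<Oplus>\<^bsub>A\<^esub>l\<in>{1..m}. w (\<iota> (of_nat (N k i l)) \<otimes> v l)) \<otimes>\<^bsub>A\<^esub> D j"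
    unfolding v_mult[OF k i]
    by (subst additive_map_finsum[OF R.abelian_group_axioms A.abelian_group_axioms w_additive t]) simp_all
  also have "\<dots> = (\<Oplus>\<^bsub>A\<^esub>l\<in>{1..m}. w (\<iota> (of_nat (N k i l)) \<otimes> v l) \<otimes>\<^bsub>A\<^esub> D j)"
    by (rule A.finsum_ldistr) (use t w_closed D_closed in auto)
  also have "\<dots> = (\<Oplus>\<^bsub>A\<^esub>l\<in>{1..m}. of_nat (N k i l) \<odot>\<^bsub>A\<^esub> wD l j)"
  proof (rule A.finsum_cong'[OF refl])
    fix l assume l: "l \<in> {1..m}"
    show "w (\<iota> (of_nat (N k i l)) \<otimes> v l) \<otimes>\<^bsub>A\<^esub> D j = of_nat (N k i l) \<odot>\<^bsub>A\<^esub> wD l j"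
      using v_closed[OF l] by (simp add: smult_A wD_def w_mult A.m_assoc w_closed D_closed)
  qed (use wD_closed smult_closed_A in auto)
  finally show ?thesis .
qed

text \<open>The elements \<open>y\<close> with \<open>f (y u) = f y f u\<close> for all \<open>u\<close> form a subalgebra, and \<open>A\<close> is generated by the \<open>v k\<close> and
\<open>z\<close>. It applies to the counit and to the antipode.\<close>

lemma mult_if_mult_on_generators:
  assumes Q: "Module.module class_ring Q" "cring Q"
    and Qsm: "\<And>c u u'. u \<in> carrier Q \<Longrightarrow> u' \<in> carrier Q \<Longrightarrow> (c \<odot>\<^bsub>Q\<^esub> u) \<otimes>\<^bsub>Q\<^esub> u' = c \<odot>\<^bsub>Q\<^esub> (u \<otimes>\<^bsub>Q\<^esub> u')"
    and f: "f \<in> LinearCombinations.module_hom class_ring A Q" and one: "f \<one>\<^bsub>A\<^esub> = \<one>\<^bsub>Q\<^esub>"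
    and gw: "\<And>k y. k \<in> {1..m} \<Longrightarrow> y \<in> carrier A \<Longrightarrow> f (w (v k) \<otimes>\<^bsub>A\<^esub> y) = gw k \<otimes>\<^bsub>Q\<^esub> f y"
      "\<And>k. k \<in> {1..m} \<Longrightarrow> gw k \<in> carrier Q"
    and gz: "\<And>y. y \<in> carrier A \<Longrightarrow> f (z \<otimes>\<^bsub>A\<^esub> y) = gz \<otimes>\<^bsub>Q\<^esub> f y" "gz \<in> carrier Q"
    and xy: "y \<in> carrier A" "y' \<in> carrier A"
  shows "f (y \<otimes>\<^bsub>A\<^esub> y') = f y \<otimes>\<^bsub>Q\<^esub> f y'"
proof -
  interpret Q: cring Q by (rule Q(2))
  have fc: "f u \<in> carrier Q" if "u \<in> carrier A" for u using LinearCombinations.module_hom_closed[OF f] that by auto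
  have fadd: "f (u \<oplus>\<^bsub>A\<^esub> u') = f u \<oplus>\<^bsub>Q\<^esub> f u'" if "u \<in> carrier A" "u' \<in> carrier A" for u u'
    using LinearCombinations.module_hom_add[OF f that] .
  have fad: "additive_map A Q f" by (rule additive_mapI) (auto simp: fc fadd)
  have fsm: "f (c \<odot>\<^bsub>A\<^esub> u) = c \<odot>\<^bsub>Q\<^esub> f u" if "u \<in> carrier A" for c u
    using LinearCombinations.module_hom_smult[OF f _ that, of c] by simp
  define M where "M = {y \<in> carrier A. \<forall>u\<in>carrier A. f (y \<otimes>\<^bsub>A\<^esub> u) = f y \<otimes>\<^bsub>Q\<^esub> f u}"
  have Mw: "w (v k) \<in> M" if k: "k \<in> {1..m}" for k
  proof -
    have c: "w (v k) \<in> carrier A" by (rule w_closed[OF v_closed[OF k]])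
    have "f (w (v k)) = gw k" using gw(1)[OF k A.one_closed] gw(2)[OF k] c one by simp
    then show ?thesis using gw(1)[OF k] c by (simp add: M_def)
  qed
  have Mz: "z \<in> M"
  proof -
    have "f z = gz" using gz(1)[OF A.one_closed] gz(2) z_closed one by simp
    then show ?thesis using gz(1) z_closed by (simp add: M_def)
  qed
  have Mm: "y1 \<otimes>\<^bsub>A\<^esub> y2 \<in> M" if "y1 \<in> M" "y2 \<in> M" for y1 y2
    using that fc by (auto simp: M_def A.m_assoc Q.m_assoc)
  have Ma: "y1 \<oplus>\<^bsub>A\<^esub> y2 \<in> M" if "y1 \<in> M" "y2 \<in> M" for y1 y2
    using that fc fadd by (auto simp: M_def A.l_distr Q.l_distr)
  have Ms: "c \<odot>\<^bsub>A\<^esub> y1 \<in> M" if "y1 \<in> M" for y1 c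
    using that fc fsm Qsm by (auto simp: M_def smult_closed_A smult_mult)
  have M0: "\<zero>\<^bsub>A\<^esub> \<in> M"
    using fc additive_map_zero[OF A.abelian_group_axioms Q.abelian_group_axioms fad] by (auto simp: M_def)
  have M1: "\<one>\<^bsub>A\<^esub> \<in> M" using fc one by (auto simp: M_def)
  have Mwa: "w a \<in> M" using Mw[OF tau_in[OF one_in]] a_v1 by simp
  have neg: "\<ominus>\<^bsub>A\<^esub> u \<in> M" if "u \<in> M" for u
  proof -
    have u: "u \<in> carrier A" using that by (simp add: M_def)
    have "(1 + (-1)) \<odot>\<^bsub>A\<^esub> u = u \<oplus>\<^bsub>A\<^esub> (-1) \<odot>\<^bsub>A\<^esub> u"
      using AM.smult_l_distr[of 1 "-1" u] AM.smult_one[OF u] u by simp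
    then have "(-1) \<odot>\<^bsub>A\<^esub> u \<oplus>\<^bsub>A\<^esub> u = \<zero>\<^bsub>A\<^esub>" using AM.smult_l_null[OF u] u smult_closed_A A.a_comm by simp
    then have "\<ominus>\<^bsub>A\<^esub> u = (-1) \<odot>\<^bsub>A\<^esub> u" by (rule A.minus_equality) (use u smult_closed_A in auto)
    then show ?thesis using Ms[OF that] by simp
  qed
  have MD: "D j \<in> M \<and> D (Suc j) \<in> M" for j
  proof (induction j)
    case 0 then show ?case using M0 M1 D_zero D_one by simp
  next
    case (Suc j)
    have "D (Suc (Suc j)) = z \<otimes>\<^bsub>A\<^esub> D (Suc j) \<oplus>\<^bsub>A\<^esub> \<ominus>\<^bsub>A\<^esub> (w a \<otimes>\<^bsub>A\<^esub> D j)"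
      unfolding D_rec using w_closed[OF a_closed] D_closed by (simp add: A.a_assoc A.r_neg)
    then show ?case using Suc Mm Ma Mz Mwa neg by simp
  qed
  have "y \<in> M" using xy(1)
  proof (induction y rule: A_induct)
    case (basic c i j)
    then show ?case using Ms Mm Mw MD by blast
  qed (use M0 Ma in auto)
  then show ?thesis using xy(2) by (simp add: M_def)
qed

section \<open>The counit\<close>

definition two_cos :: complex where "two_cos = complex_of_real (2 * cos (pi / real n))"
text \<open>The value of the counit at \<open>F\<^sub>j(a, z)\<close>: the counit sends \<open>a\<close> to \<open>1\<close>, the dimension of a linear character.\<close>

definition Fc :: "nat \<Rightarrow> complex" where "Fc j = dickson class_ring 1 two_cos j"

lemma Fc_simps: "Fc 0 = 0" "Fc (Suc 0) = 1" and Fc_rec: "two_cos * Fc (Suc j) = Fc (Suc (Suc j)) + Fc j"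
  by (simp_all add: Fc_def) (cases j; simp add: class_ring_simps)

text \<open>The recursion is the addition theorem \<open>sin ((j + 1)\<theta>) + sin ((j - 1)\<theta>) = 2 cos \<theta> sin (j\<theta>)\<close> at
\<open>\<theta> = \<pi>/n\<close>. The vanishing at \<open>j = n\<close> makes the counit well defined, the positivity below \<open>n\<close> makes the comultiplication so.\<close>

lemma Fc_sin: "Fc j = complex_of_real (sin (real j * pi / real n) / sin (pi / real n))"
proof -
  have s: "sin (pi / real n) \<noteq> 0"
    using n_ge by (intro less_imp_neq[THEN not_sym] sin_gt_zero) (auto simp: field_simps)
  have "Fc j = complex_of_real (sin (real j * pi / real n) / sin (pi / real n)) \<and>
      Fc (Suc j) = complex_of_real (sin (real (Suc j) * pi / real n) / sin (pi / real n))"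
  proof (induction j)
    case 0 then show ?case using s by (simp add: Fc_simps)
  next
    case (Suc j)
    let ?t = "pi / real n"
    have trig: "sin (real (Suc (Suc j)) * ?t) + sin (real j * ?t) = 2 * cos ?t * sin (real (Suc j) * ?t)"
    proof -
      have "sin (real (Suc (Suc j)) * ?t) = sin (real (Suc j) * ?t + ?t)" by (simp add: algebra_simps add_divide_distrib)
      moreover have "sin (real j * ?t) = sin (real (Suc j) * ?t - ?t)" by (simp add: algebra_simps add_divide_distrib)
      ultimately show ?thesis by (simp add: sin_add sin_diff)
    qed
    have "Fc (Suc (Suc j)) = two_cos * Fc (Suc j) - Fc j" using Fc_rec[of j] by (simp add: algebra_simps)
    also have "\<dots> = complex_of_real ((2 * cos ?t * sin (real (Suc j) * ?t) - sin (real j * ?t)) / sin ?t)"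
      using Suc by (simp add: two_cos_def diff_divide_distrib)
    also have "2 * cos ?t * sin (real (Suc j) * ?t) - sin (real j * ?t) = sin (real (Suc (Suc j)) * ?t)"
      using trig by simp
    finally show ?case using Suc by simp
  qed
  then show ?thesis by blast
qed

lemma Fc_n: "Fc n = 0"
  using n_ge by (simp add: Fc_sin)

lemma Fc_nonzero: "j \<in> {1..n - 1} \<Longrightarrow> Fc j \<noteq> 0"
proof -
  assume j: "j \<in> {1..n - 1}"
  have "0 < real j * pi / real n" using j n_ge by (auto intro!: divide_pos_pos)
  moreover have "real j * pi / real n < pi" using j n_ge by (auto simp: field_simps)
  ultimately have "sin (real j * pi / real n) > 0" by (rule sin_gt_zero)
  moreover have "sin (pi / real n) > 0" using n_ge by (intro sin_gt_zero) (auto simp: field_simps)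
  ultimately show ?thesis by (simp add: Fc_sin)
qed

text \<open>The value of the counit at \<open>x p\<close>.\<close>

definition e :: "nat \<times> nat \<Rightarrow> complex" where "e p = of_nat (d (fst p)) * Fc (snd p)"

lemma e_nonzero: "p \<in> B \<Longrightarrow> e p \<noteq> 0"
  using d_pos[OF B_ranges(1)] Fc_nonzero[OF B_ranges(2)] by (simp add: e_def)

abbreviation "CC \<equiv> self_module (class_ring :: complex ring)"

lemma CC_simps [simp]:
  "carrier CC = UNIV" "add CC = (+)" "monoid.mult CC = (*)" "zero CC = 0" "one CC = 1" "c \<odot>\<^bsub>CC\<^esub> u = c * u"
  by (simp_all add: self_module_def)

lemma cring_CC: "cring CC"
  unfolding self_module_def by (rule cring_with_smult[OF class_cring.is_cring])

lemma module_CC: "Module.module class_ring CC"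
proof -
  interpret CC: cring CC by (rule cring_CC)
  show ?thesis
    by (rule Module.moduleI[OF class_cring.is_cring CC.abelian_group_axioms]) (auto simp: algebra_simps)
qed

definition \<epsilon> where "\<epsilon> = lin CC e"

lemma \<epsilon>_hom: "\<epsilon> \<in> LinearCombinations.module_hom class_ring A CC"
  unfolding \<epsilon>_def by (rule lin_hom[OF module_CC]) simp

lemma \<epsilon>_add: "y \<in> carrier A \<Longrightarrow> y' \<in> carrier A \<Longrightarrow> \<epsilon> (y \<oplus>\<^bsub>A\<^esub> y') = \<epsilon> y + \<epsilon> y'"
  using LinearCombinations.module_hom_add[OF \<epsilon>_hom] by simp

lemma \<epsilon>_smult: "y \<in> carrier A \<Longrightarrow> \<epsilon> (c \<odot>\<^bsub>A\<^esub> y) = c * \<epsilon> y"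
  using LinearCombinations.module_hom_smult[OF \<epsilon>_hom, of c y] by simp

lemma \<epsilon>_additive: "additive_map A CC \<epsilon>"
  by (rule additive_mapI) (simp_all add: \<epsilon>_add)

lemma \<epsilon>_x: "p \<in> B \<Longrightarrow> \<epsilon> (x p) = e p"
  unfolding \<epsilon>_def by (rule lin_x[OF module_CC]) simp_all

lemma \<epsilon>_wD:
  assumes i: "i \<in> {1..m}" and j: "j \<le> n" shows "\<epsilon> (wD i j) = of_nat (d i) * Fc j"
proof (cases "j \<in> {1..n - 1}")
  case True
  then have "(i, j) \<in> B" using i by (simp add: B_def)
  then show ?thesis using \<epsilon>_x[of "(i, j)"] by (simp add: x_wD e_def)
next
  case False
  then have "j = 0 \<or> j = n" using j by auto
  moreover have "\<epsilon> \<zero>\<^bsub>A\<^esub> = 0"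
    using \<epsilon>_smult[OF A.zero_closed, of 0] AM.smult_l_null[OF A.zero_closed] by simp
  ultimately show ?thesis using wD_boundary[OF i] Fc_simps Fc_n by auto
qed

lemma \<epsilon>_one: "\<epsilon> \<one>\<^bsub>A\<^esub> = 1"
  using \<epsilon>_wD[OF one_in, of 1] n_ge by (simp add: wD_def v_one[simplified] w_one D_one d_one[simplified] Fc_simps)

lemma left_mult_hom:
  assumes Q: "Module.module class_ring Q" and f: "f \<in> LinearCombinations.module_hom class_ring A Q" and u: "u \<in> carrier A"
  shows "(\<lambda>y. f (u \<otimes>\<^bsub>A\<^esub> y)) \<in> LinearCombinations.module_hom class_ring A Q"
  using f u unfolding LinearCombinations.module_hom_def
  by (auto simp: A.r_distr mult_smult)

lemma scale_hom:
  assumes Q: "Module.module class_ring Q" and cr: "cring Q"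
    and Qsm: "\<And>c u u'. u \<in> carrier Q \<Longrightarrow> u' \<in> carrier Q \<Longrightarrow> u' \<otimes>\<^bsub>Q\<^esub> (c \<odot>\<^bsub>Q\<^esub> u) = c \<odot>\<^bsub>Q\<^esub> (u' \<otimes>\<^bsub>Q\<^esub> u)"
    and f: "f \<in> LinearCombinations.module_hom class_ring A Q" and u: "u \<in> carrier Q"
  shows "(\<lambda>y. u \<otimes>\<^bsub>Q\<^esub> f y) \<in> LinearCombinations.module_hom class_ring A Q"
proof -
  interpret Q: cring Q by (rule cr)
  show ?thesis using f u unfolding LinearCombinations.module_hom_def
    by (auto simp: Q.r_distr Qsm Pi_def)
qed

text \<open>On the basis this is the Dickson recursion for \<open>Fc\<close>; the boundary case \<open>j = n - 1\<close> uses \<open>Fc n = 0\<close>.\<close>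

lemma \<epsilon>_z: assumes y: "y \<in> carrier A" shows "\<epsilon> (z \<otimes>\<^bsub>A\<^esub> y) = two_cos * \<epsilon> y"
proof -
  have "\<epsilon> (z \<otimes>\<^bsub>A\<^esub> y) = two_cos \<otimes>\<^bsub>CC\<^esub> \<epsilon> y"
  proof (rule linear_ext[OF module_CC left_mult_hom[OF module_CC \<epsilon>_hom z_closed] scale_hom[OF module_CC cring_CC _ \<epsilon>_hom] _ y])
    fix p assume p: "p \<in> B"
    obtain i j where ij: "p = (i, Suc j)" "i \<in> {1..m}" "Suc j \<in> {1..n - 1}"
      using p by (cases p; cases "snd p") (auto simp: B_def)
    have "\<epsilon> (z \<otimes>\<^bsub>A\<^esub> wD i (Suc j)) = \<epsilon> (wD i (Suc (Suc j))) + \<epsilon> (wD (\<tau> i) j)"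
      unfolding z_wD[OF ij(2)] by (rule \<epsilon>_add[OF wD_closed[OF ij(2)] wD_closed[OF tau_in[OF ij(2)]]])
    also have "\<dots> = of_nat (d i) * (Fc (Suc (Suc j)) + Fc j)"
      using \<epsilon>_wD[OF ij(2), of "Suc (Suc j)"] \<epsilon>_wD[OF tau_in[OF ij(2)], of j] d_tau[OF ij(2)] ij(3) n_ge
      by (simp add: distrib_left)
    also have "\<dots> = two_cos * \<epsilon> (wD i (Suc j))"
      using \<epsilon>_wD[OF ij(2), of "Suc j"] ij(3) by (simp add: Fc_rec[symmetric])
    finally show "\<epsilon> (z \<otimes>\<^bsub>A\<^esub> x p) = two_cos \<otimes>\<^bsub>CC\<^esub> \<epsilon> (x p)" by (simp add: ij(1) x_wD)
  qed simp_all
  then show ?thesis by simp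
qed

text \<open>On the basis this says that dimensions multiply under tensor products.\<close>

lemma \<epsilon>_w: assumes k: "k \<in> {1..m}" and y: "y \<in> carrier A" shows "\<epsilon> (w (v k) \<otimes>\<^bsub>A\<^esub> y) = of_nat (d k) * \<epsilon> y"
proof -
  interpret CC: cring CC by (rule cring_CC)
  have fs: "finsum CC f S = sum f S" for f :: "nat \<Rightarrow> complex" and S
    by (simp add: self_module_def class_ring_simps)
  have "\<epsilon> (w (v k) \<otimes>\<^bsub>A\<^esub> y) = of_nat (d k) \<otimes>\<^bsub>CC\<^esub> \<epsilon> y"
  proof (rule linear_ext[OF module_CC left_mult_hom[OF module_CC \<epsilon>_hom w_closed[OF v_closed[OF k]]] scale_hom[OF module_CC cring_CC _ \<epsilon>_hom] _ y])
    fix p assume p: "p \<in> B"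
    obtain i j where ij: "p = (i, j)" "i \<in> {1..m}" "j \<le> n" using p by (cases p) (auto simp: B_def)
    have "\<epsilon> (w (v k) \<otimes>\<^bsub>A\<^esub> wD i j) = (\<Sum>l\<in>{1..m}. \<epsilon> (of_nat (N k i l) \<odot>\<^bsub>A\<^esub> wD l j))"
      unfolding w_wD[OF ij(2) k] fs[symmetric]
      by (rule additive_map_finsum[OF A.abelian_group_axioms CC.abelian_group_axioms \<epsilon>_additive])
        (rule smult_closed_A[OF wD_closed])
    also have "\<dots> = (\<Sum>l\<in>{1..m}. of_nat (N k i l * d l) * Fc j)"
      by (rule sum.cong) (use ij(3) \<epsilon>_wD in \<open>auto simp: \<epsilon>_smult wD_closed\<close>)
    also have "\<dots> = of_nat (d k) * \<epsilon> (wD i j)"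
      unfolding \<epsilon>_wD[OF ij(2,3)] sum_distrib_right[symmetric] of_nat_sum[symmetric] N_dim[OF k ij(2), symmetric] by simp
    finally show "\<epsilon> (w (v k) \<otimes>\<^bsub>A\<^esub> x p) = of_nat (d k) \<otimes>\<^bsub>CC\<^esub> \<epsilon> (x p)" by (simp add: ij(1) x_wD)
  qed simp_all
  then show ?thesis by simp
qed

lemma \<epsilon>_mult: "y \<in> carrier A \<Longrightarrow> y' \<in> carrier A \<Longrightarrow> \<epsilon> (y \<otimes>\<^bsub>A\<^esub> y') = \<epsilon> y * \<epsilon> y'"
  using mult_if_mult_on_generators[OF module_CC cring_CC _ \<epsilon>_hom, of "\<lambda>k. of_nat (d k)" two_cos y y'] \<epsilon>_w \<epsilon>_z \<epsilon>_one
  by (simp del: One_nat_def atLeastAtMost_iff)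

section \<open>The antipode\<close>

text \<open>The index of the basis element dual to \<open>x p\<close>. As \<open>F\<^sub>j(a, z)\<close> pairs with \<open>F\<^sub>j(a, z)\<close> to \<open>a\<^bsup>j-1\<^esup>\<close>, the dual of
\<open>v i F\<^sub>j\<close> must compensate for this power by a power of \<open>\<sigma> = \<tau>\<^sup>-\<^sup>1\<close>.\<close>

definition dual_index :: "nat \<times> nat \<Rightarrow> nat \<times> nat" where
  "dual_index p = ((\<sigma> ^^ (snd p - 1)) (star (fst p)), snd p)"

lemma dual_index_B: "p \<in> B \<Longrightarrow> dual_index p \<in> B"
  using sigma_pow_in[OF star_in[OF B_ranges(1)], of p "snd p - 1"] B_ranges(2)[of p] by (simp add: dual_index_def B_def)

lemma dual_index_dual_index: "p \<in> B \<Longrightarrow> dual_index (dual_index p) = p"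
  using star_sigma_pow[OF star_in[OF B_ranges(1)], of p "snd p - 1"] star_star[OF B_ranges(1), of p] sigma_tau_pow[OF B_ranges(1), of p]
  by (simp add: dual_index_def del: One_nat_def)

lemma e_dual_index: "p \<in> B \<Longrightarrow> e (dual_index p) = e p"
  using d_sigma_pow[OF star_in[OF B_ranges(1)], of p] d_star[OF B_ranges(1), of p] by (simp add: dual_index_def e_def)

definition S where "S = lin A (\<lambda>p. x (dual_index p))"

lemma S_cl: "p \<in> B \<Longrightarrow> x (dual_index p) \<in> carrier A" by (rule x_closed[OF dual_index_B])

lemma S_hom: "S \<in> LinearCombinations.module_hom class_ring A A"
  unfolding S_def by (rule lin_hom[OF module_A S_cl])

lemma S_closed: "S y \<in> carrier A"
  unfolding S_def by (rule lin_closed[OF module_A S_cl])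

lemma S_add: "y \<in> carrier A \<Longrightarrow> y' \<in> carrier A \<Longrightarrow> S (y \<oplus>\<^bsub>A\<^esub> y') = S y \<oplus>\<^bsub>A\<^esub> S y'"
  unfolding S_def by (rule lin_add[OF module_A S_cl])

lemma S_smult: "y \<in> carrier A \<Longrightarrow> S (c \<odot>\<^bsub>A\<^esub> y) = c \<odot>\<^bsub>A\<^esub> S y"
  unfolding S_def by (rule lin_smult[OF module_A S_cl])

lemma S_x: "p \<in> B \<Longrightarrow> S (x p) = x (dual_index p)"
  unfolding S_def by (rule lin_x[OF module_A S_cl])

lemma S_additive: "additive_map A A S"
  by (rule additive_mapI) (simp_all add: S_add S_closed)

text \<open>At \<open>j = 0\<close> the truncated exponent \<open>j - 1\<close> is irrelevant, because both sides vanish.\<close>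

lemma S_wD:
  assumes i: "i \<in> {1..m}" and j: "j \<le> n" shows "S (wD i j) = w (b [^] (j - 1)) \<otimes>\<^bsub>A\<^esub> wD (star i) j"
proof (cases "j \<in> {1..n - 1}")
  case True
  then have p: "(i, j) \<in> B" using i by (simp add: B_def)
  have c: "b [^] (j - 1) \<in> carrier R" "v (star i) \<in> carrier R" using b_closed v_closed[OF star_in[OF i]] by auto
  have "w (b [^] (j - 1)) \<otimes>\<^bsub>A\<^esub> wD (star i) j = w (b [^] (j - 1) \<otimes> v (star i)) \<otimes>\<^bsub>A\<^esub> D j"
    using c by (simp add: wD_def w_mult A.m_assoc w_closed D_closed)
  then show ?thesis using S_x[OF p] b_pow_v[OF star_in[OF i], of "j - 1"]
    by (simp add: x_wD dual_index_def) (simp add: wD_def)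
next
  case False
  then have "j = 0 \<or> j = n" using j by auto
  moreover have "S \<zero>\<^bsub>A\<^esub> = \<zero>\<^bsub>A\<^esub>" by (rule additive_map_zero[OF A.abelian_group_axioms A.abelian_group_axioms S_additive])
  moreover have "w (b [^] (j - 1)) \<in> carrier A" using b_closed w_closed by simp
  ultimately show ?thesis using wD_boundary[OF i] wD_boundary[OF star_in[OF i]] by auto
qed

lemma S_one: "S \<one>\<^bsub>A\<^esub> = \<one>\<^bsub>A\<^esub>"
proof -
  have "wD 1 1 = \<one>\<^bsub>A\<^esub>" using v_one D_one w_one by (simp add: wD_def)
  then show ?thesis using S_wD[OF one_in, of 1] n_ge star_one w_one by simp
qed

text \<open>Since \<open>S\<close> multiplies \<open>F\<^sub>j\<close> by \<open>a\<^bsup>1-j\<^esup>\<close>, the two terms \<open>x (i, j + 1)\<close> and \<open>x (\<tau> i, j - 1)\<close> of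
\<open>z x (i, j)\<close> acquire the same extra factor \<open>a\<^sup>-\<^sup>1\<close>: in the second one the lower index gains a factor \<open>a\<close>, and
duality turns \<open>\<tau>\<close> into its inverse, which costs \<open>a\<^sup>-\<^sup>2\<close>.\<close>

lemma S_z: assumes y: "y \<in> carrier A" shows "S (z \<otimes>\<^bsub>A\<^esub> y) = (w b \<otimes>\<^bsub>A\<^esub> z) \<otimes>\<^bsub>A\<^esub> S y"
proof -
  have wz: "w b \<otimes>\<^bsub>A\<^esub> z \<in> carrier A" using w_closed[OF b_closed] z_closed by simp
  have h: "(\<lambda>y. (w b \<otimes>\<^bsub>A\<^esub> z) \<otimes>\<^bsub>A\<^esub> S y) \<in> LinearCombinations.module_hom class_ring A A"
    by (rule scale_hom[OF module_A ring_A mult_smult S_hom wz])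
  show ?thesis
  proof (rule linear_ext[OF module_A left_mult_hom[OF module_A S_hom z_closed] h _ y])
    fix p assume p: "p \<in> B"
    obtain i j where ij: "p = (i, Suc j)" "i \<in> {1..m}" "Suc j \<in> {1..n - 1}"
      using p by (cases p; cases "snd p") (auto simp: B_def)
    note si = star_in[OF ij(2)]
    have c: "w b \<in> carrier A" "w (b [^] j) \<in> carrier A" "\<And>l. wD (star i) l \<in> carrier A" "w (b [^] Suc j) \<in> carrier A"
      "w (b [^] (j - 1)) \<in> carrier A" "wD (\<tau> (star i)) j \<in> carrier A"
      using b_closed w_closed wD_closed[OF si] wD_closed[OF tau_in[OF si]] by auto
    have "S (z \<otimes>\<^bsub>A\<^esub> wD i (Suc j)) = S (wD i (Suc (Suc j))) \<oplus>\<^bsub>A\<^esub> S (wD (\<tau> i) j)"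
      unfolding z_wD[OF ij(2)] by (rule S_add[OF wD_closed[OF ij(2)] wD_closed[OF tau_in[OF ij(2)]]])
    also have "\<dots> = w (b [^] Suc j) \<otimes>\<^bsub>A\<^esub> wD (star i) (Suc (Suc j)) \<oplus>\<^bsub>A\<^esub> w (b [^] (j - 1)) \<otimes>\<^bsub>A\<^esub> wD (star (\<tau> i)) j"
      using S_wD[OF ij(2), of "Suc (Suc j)"] S_wD[OF tau_in[OF ij(2)], of j] ij(3) n_ge by auto
    also have "w (b [^] (j - 1)) \<otimes>\<^bsub>A\<^esub> wD (star (\<tau> i)) j = w (b [^] Suc j) \<otimes>\<^bsub>A\<^esub> wD (\<tau> (star i)) j"
    proof (cases j)
      case 0
      then show ?thesis using wD_boundary(1)[OF star_in[OF tau_in[OF ij(2)]]] wD_boundary(1)[OF tau_in[OF si]] c by simp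
    next
      case (Suc j')
      have vs: "v (star i) \<in> carrier R" by (rule v_closed[OF si])
      have 1: "v (star (\<tau> i)) = b \<otimes> v (star i)" using b_v[OF si] star_tau[OF ij(2)] by simp
      have 2: "v (\<tau> (star i)) = a \<otimes> v (star i)" using a_v[OF si] by simp
      have "b [^] (j - 1) \<otimes> (b \<otimes> v (star i)) = b [^] j \<otimes> v (star i)"
        using Suc b_closed vs by (simp add: R.m_assoc)
      also have "\<dots> = b [^] j \<otimes> (a \<otimes> b) \<otimes> v (star i)" using a_b b_closed vs by simp
      also have "\<dots> = b [^] Suc j \<otimes> (a \<otimes> v (star i))" using a_closed b_closed vs by (simp add: R.m_ac)
      finally have eq: "b [^] (j - 1) \<otimes> v (star (\<tau> i)) = b [^] Suc j \<otimes> v (\<tau> (star i))" unfolding 1 2 .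
      have cl: "b [^] (j - 1) \<in> carrier R" "b [^] Suc j \<in> carrier R" "v (star (\<tau> i)) \<in> carrier R" "v (\<tau> (star i)) \<in> carrier R"
        using b_closed v_closed[OF star_in[OF tau_in[OF ij(2)]]] v_closed[OF tau_in[OF si]] by auto
      have "w (b [^] (j - 1)) \<otimes>\<^bsub>A\<^esub> wD (star (\<tau> i)) j = w (b [^] (j - 1) \<otimes> v (star (\<tau> i))) \<otimes>\<^bsub>A\<^esub> D j"
        unfolding wD_def w_mult[OF cl(1,3)] by (rule A.m_assoc[symmetric]) (use cl w_closed D_closed in auto)
      also have "\<dots> = w (b [^] Suc j) \<otimes>\<^bsub>A\<^esub> wD (\<tau> (star i)) j"
        unfolding eq wD_def w_mult[OF cl(2,4)] by (rule A.m_assoc) (use cl w_closed D_closed in auto)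
      finally show ?thesis .
    qed
    also have "w (b [^] Suc j) \<otimes>\<^bsub>A\<^esub> wD (star i) (Suc (Suc j)) \<oplus>\<^bsub>A\<^esub> w (b [^] Suc j) \<otimes>\<^bsub>A\<^esub> wD (\<tau> (star i)) j
        = w (b [^] Suc j) \<otimes>\<^bsub>A\<^esub> (z \<otimes>\<^bsub>A\<^esub> wD (star i) (Suc j))"
      unfolding z_wD[OF si] using c by (simp add: A.r_distr)
    also have "w (b [^] Suc j) = w b \<otimes>\<^bsub>A\<^esub> w (b [^] j)"
      using b_closed R.m_comm[of b "b [^] j"] by (simp add: w_mult[symmetric])
    also have "w b \<otimes>\<^bsub>A\<^esub> w (b [^] j) \<otimes>\<^bsub>A\<^esub> (z \<otimes>\<^bsub>A\<^esub> wD (star i) (Suc j)) = (w b \<otimes>\<^bsub>A\<^esub> z) \<otimes>\<^bsub>A\<^esub> (w (b [^] j) \<otimes>\<^bsub>A\<^esub> wD (star i) (Suc j))"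
      using c z_closed by (simp add: A.m_ac)
    also have "w (b [^] j) \<otimes>\<^bsub>A\<^esub> wD (star i) (Suc j) = S (wD i (Suc j))"
      using S_wD[OF ij(2), of "Suc j"] ij(3) by simp
    finally show "S (z \<otimes>\<^bsub>A\<^esub> x p) = (w b \<otimes>\<^bsub>A\<^esub> z) \<otimes>\<^bsub>A\<^esub> S (x p)" by (simp add: ij(1) x_wD)
  qed
qed

lemma star_bij: "inj_on star {1..m}" "star ` {1..m} = {1..m}"
proof -
  show "inj_on star {1..m}" using star_star by (intro inj_onI) metis
  show "star ` {1..m} = {1..m}" using star_star star_in by (force simp del: One_nat_def atLeastAtMost_iff)
qed

text \<open>Duality is compatible with the fusion numbers, \<open>N (k\<^sup>*) (i\<^sup>*) (l\<^sup>*) = N k i l\<close>; the sum is reindexed by \<open>star\<close>.\<close>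

lemma S_w:
  assumes k: "k \<in> {1..m}" and y: "y \<in> carrier A" shows "S (w (v k) \<otimes>\<^bsub>A\<^esub> y) = w (v (star k)) \<otimes>\<^bsub>A\<^esub> S y"
proof -
  have ws: "w (v (star k)) \<in> carrier A" by (rule w_closed[OF v_closed[OF star_in[OF k]]])
  have h: "(\<lambda>y. w (v (star k)) \<otimes>\<^bsub>A\<^esub> S y) \<in> LinearCombinations.module_hom class_ring A A"
    by (rule scale_hom[OF module_A ring_A mult_smult S_hom ws])
  show ?thesis
  proof (rule linear_ext[OF module_A left_mult_hom[OF module_A S_hom w_closed[OF v_closed[OF k]]] h _ y])
    fix p assume p: "p \<in> B"
    obtain i j where ij: "p = (i, j)" "i \<in> {1..m}" "j \<le> n" using p by (cases p) (auto simp: B_def)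
    note si = star_in[OF ij(2)]
    let ?b = "w (b [^] (j - 1))"
    have bc: "?b \<in> carrier A" using b_closed w_closed by simp
    have "S (w (v k) \<otimes>\<^bsub>A\<^esub> wD i j) = (\<Oplus>\<^bsub>A\<^esub>l\<in>{1..m}. S (of_nat (N k i l) \<odot>\<^bsub>A\<^esub> wD l j))"
      unfolding w_wD[OF ij(2) k]
      by (rule additive_map_finsum[OF A.abelian_group_axioms A.abelian_group_axioms S_additive])
        (rule smult_closed_A[OF wD_closed])
    also have "\<dots> = (\<Oplus>\<^bsub>A\<^esub>l\<in>{1..m}. ?b \<otimes>\<^bsub>A\<^esub> (of_nat (N (star k) (star i) (star l)) \<odot>\<^bsub>A\<^esub> wD (star l) j))"
    proof (rule A.finsum_cong'[OF refl])
      fix l assume l: "l \<in> {1..m}"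
      show "S (of_nat (N k i l) \<odot>\<^bsub>A\<^esub> wD l j) = ?b \<otimes>\<^bsub>A\<^esub> (of_nat (N (star k) (star i) (star l)) \<odot>\<^bsub>A\<^esub> wD (star l) j)"
        using S_wD[OF l ij(3)] N_star[OF k ij(2) l] mult_smult[OF bc wD_closed[OF star_in[OF l]]] by (simp add: S_smult[OF wD_closed[OF l]])
    qed (use bc wD_closed star_in smult_closed_A in auto)
    also have "\<dots> = ?b \<otimes>\<^bsub>A\<^esub> (\<Oplus>\<^bsub>A\<^esub>l\<in>{1..m}. of_nat (N (star k) (star i) (star l)) \<odot>\<^bsub>A\<^esub> wD (star l) j)"
      by (rule A.finsum_rdistr[symmetric]) (use bc wD_closed star_in smult_closed_A in auto)
    also have "(\<Oplus>\<^bsub>A\<^esub>l\<in>{1..m}. of_nat (N (star k) (star i) (star l)) \<odot>\<^bsub>A\<^esub> wD (star l) j) =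
        (\<Oplus>\<^bsub>A\<^esub>l\<in>star ` {1..m}. of_nat (N (star k) (star i) l) \<odot>\<^bsub>A\<^esub> wD l j)"
      by (rule A.finsum_reindex[symmetric]) (use star_bij wD_closed smult_closed_A in auto)
    also have "\<dots> = w (v (star k)) \<otimes>\<^bsub>A\<^esub> wD (star i) j"
      unfolding star_bij(2) w_wD[OF si star_in[OF k]] ..
    also have "?b \<otimes>\<^bsub>A\<^esub> (w (v (star k)) \<otimes>\<^bsub>A\<^esub> wD (star i) j) = w (v (star k)) \<otimes>\<^bsub>A\<^esub> (?b \<otimes>\<^bsub>A\<^esub> wD (star i) j)"
      by (rule A.m_lcomm[OF bc ws wD_closed[OF si]])
    also have "?b \<otimes>\<^bsub>A\<^esub> wD (star i) j = S (wD i j)" by (rule S_wD[OF ij(2,3), symmetric])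
    finally show "S (w (v k) \<otimes>\<^bsub>A\<^esub> x p) = w (v (star k)) \<otimes>\<^bsub>A\<^esub> S (x p)" by (simp add: ij(1) x_wD)
  qed
qed

lemma S_mult: "y \<in> carrier A \<Longrightarrow> y' \<in> carrier A \<Longrightarrow> S (y \<otimes>\<^bsub>A\<^esub> y') = S y \<otimes>\<^bsub>A\<^esub> S y'"
  by (rule mult_if_mult_on_generators[OF module_A ring_A smult_mult S_hom S_one S_w _ S_z])
    (use w_closed[OF v_closed[OF star_in]] w_closed[OF b_closed] z_closed in auto)

section \<open>The Frobenius form\<close>

lemma \<rho>_one_zero: "\<rho> 1 \<zero>\<^bsub>A\<^esub> = \<zero>"
proof -
  have 1: "1 \<in> {1..n - 1}" using n_ge by simp
  show ?thesis using \<rho>_mult[OF R.zero_closed A.zero_closed 1] \<rho>_closed[OF A.zero_closed 1] w_zero by simp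
qed

text \<open>The coefficient at \<open>F\<^sub>1 = 1\<close> of \<open>F\<^sub>i F\<^sub>j\<close>. The bound is \<open>j \<le> n\<close> and not \<open>j < n\<close> so that the induction on \<open>i\<close> can
trade \<open>F\<^sub>i F\<^sub>j\<close> against \<open>F\<^sub>i\<^sub>-\<^sub>1 F\<^sub>j\<^sub>+\<^sub>1\<close>.\<close>

lemma rho_one_mult_D:
  assumes "i \<le> n - 1" "j \<le> n"
  shows "\<rho> 1 (D i \<otimes>\<^bsub>A\<^esub> D j) = (if i = j \<and> 1 \<le> i then a [^] (i - 1) else \<zero>)"
  using assms
proof (induction i arbitrary: j rule: less_induct)
  case (less i)
  have one: "1 \<in> {1..n - 1}" using n_ge by simp
  consider "i = 0" | "i = 1" | s where "i = Suc (Suc s)" by (metis One_nat_def not0_implies_Suc)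
  then show ?case
  proof cases
    case 1 then show ?thesis using \<rho>_one_zero D_zero D_closed by simp
  next
    case 2
    consider "j = 0" | "j = n" | "j \<in> {1..n - 1}" using less.prems(2) by fastforce
    then show ?thesis
    proof cases
      case 1 then show ?thesis using 2 \<rho>_one_zero D_zero D_closed by simp
    next
      case b: 2 then show ?thesis using 2 \<rho>_one_zero D_n D_closed n_ge by simp
    next
      case 3 then show ?thesis using 2 \<rho>_D[OF 3 one] D_closed D_one by auto
    qed
  next
    case 3
    consider (zero) "j = 0" | (n) "j = n" | (mid) j' where "j = Suc j'" "j \<le> n - 1"
      using less.prems(2) by (metis Suc_pred diff_Suc_1 le_SucE le_antisym neq0_conv not_less_eq_eq diff_is_0_eq nat_le_linear)
    then show ?thesis
    proof cases
      case zero then show ?thesis using 3 \<rho>_one_zero D_zero D_closed by simp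
    next
      case n then show ?thesis using 3 \<rho>_one_zero D_n D_closed less.prems by auto
    next
      case mid
      have wa: "w a \<in> carrier A" by (rule w_closed[OF a_closed])
      have t: "D (Suc s) \<otimes>\<^bsub>A\<^esub> D (Suc j) \<in> carrier A" "D (Suc s) \<otimes>\<^bsub>A\<^esub> D j' \<in> carrier A" "D s \<otimes>\<^bsub>A\<^esub> D j \<in> carrier A" "D i \<otimes>\<^bsub>A\<^esub> D j \<in> carrier A"
        using D_closed by auto
      \<comment> \<open>The product \<open>z D (i - 1) D j\<close> is expanded in two ways, by letting \<open>z\<close> act on either factor.\<close>
      have "D i \<otimes>\<^bsub>A\<^esub> D j \<oplus>\<^bsub>A\<^esub> w a \<otimes>\<^bsub>A\<^esub> (D s \<otimes>\<^bsub>A\<^esub> D j) = (z \<otimes>\<^bsub>A\<^esub> D (Suc s)) \<otimes>\<^bsub>A\<^esub> D j"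
        unfolding D_rec 3 using wa D_closed by (simp add: A.l_distr A.m_assoc)
      also have "\<dots> = D (Suc s) \<otimes>\<^bsub>A\<^esub> (z \<otimes>\<^bsub>A\<^esub> D (Suc j'))" unfolding mid(1) using z_closed D_closed by (simp add: A.m_ac)
      also have "\<dots> = D (Suc s) \<otimes>\<^bsub>A\<^esub> D (Suc j) \<oplus>\<^bsub>A\<^esub> w a \<otimes>\<^bsub>A\<^esub> (D (Suc s) \<otimes>\<^bsub>A\<^esub> D j')"
        unfolding D_rec mid(1) using wa D_closed by (simp add: A.r_distr A.m_lcomm)
      finally have "\<rho> 1 (D i \<otimes>\<^bsub>A\<^esub> D j \<oplus>\<^bsub>A\<^esub> w a \<otimes>\<^bsub>A\<^esub> (D s \<otimes>\<^bsub>A\<^esub> D j)) =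
          \<rho> 1 (D (Suc s) \<otimes>\<^bsub>A\<^esub> D (Suc j) \<oplus>\<^bsub>A\<^esub> w a \<otimes>\<^bsub>A\<^esub> (D (Suc s) \<otimes>\<^bsub>A\<^esub> D j'))" by simp
      then have main: "\<rho> 1 (D i \<otimes>\<^bsub>A\<^esub> D j) \<oplus> a \<otimes> \<rho> 1 (D s \<otimes>\<^bsub>A\<^esub> D j) = \<rho> 1 (D (Suc s) \<otimes>\<^bsub>A\<^esub> D (Suc j)) \<oplus> a \<otimes> \<rho> 1 (D (Suc s) \<otimes>\<^bsub>A\<^esub> D j')"
        using t wa by (simp add: \<rho>_add[OF _ _ one] \<rho>_mult[OF a_closed _ one] del: One_nat_def)
      have ih1: "\<rho> 1 (D s \<otimes>\<^bsub>A\<^esub> D j) = (if s = j \<and> 1 \<le> s then a [^] (s - 1) else \<zero>)"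
        by (rule less.IH) (use 3 less.prems in auto)
      have ih2: "\<rho> 1 (D (Suc s) \<otimes>\<^bsub>A\<^esub> D (Suc j)) = (if Suc s = Suc j \<and> 1 \<le> Suc s then a [^] (Suc s - 1) else \<zero>)"
        by (rule less.IH) (use 3 mid less.prems n_ge in auto)
      have ih3: "\<rho> 1 (D (Suc s) \<otimes>\<^bsub>A\<^esub> D j') = (if Suc s = j' \<and> 1 \<le> Suc s then a [^] (Suc s - 1) else \<zero>)"
        by (rule less.IH) (use 3 mid less.prems in auto)
      have c: "\<rho> 1 (D i \<otimes>\<^bsub>A\<^esub> D j) \<in> carrier R" using \<rho>_closed[OF t(4) one] .
      show ?thesis
      proof (cases "s = j")
        case True
        have "a \<otimes> a [^] (s - 1) = a [^] s" using True mid a_closed by (cases s) (auto simp: R.m_comm)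
        then have "\<rho> 1 (D i \<otimes>\<^bsub>A\<^esub> D j) \<oplus> a [^] s = \<zero> \<oplus> a [^] s"
          using main ih1 ih2 ih3 True mid a_closed by simp
        then have "\<rho> 1 (D i \<otimes>\<^bsub>A\<^esub> D j) = \<zero>" using c a_closed by (metis R.add.right_cancel R.nat_pow_closed R.zero_closed)
        then show ?thesis using True 3 by simp
      next
        case False
        have "\<rho> 1 (D i \<otimes>\<^bsub>A\<^esub> D j) = a \<otimes> (if Suc s = j' then a [^] s else \<zero>)"
          using main ih1 ih2 ih3 False a_closed c by (cases "Suc s = j'") auto
        then show ?thesis using 3 mid a_closed R.m_comm[of a "a [^] s"] by (auto simp del: One_nat_def)
      qed
    qed
  qed
qed

text \<open>The coefficient of the unit element \<open>x (1, 1)\<close>.\<close>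

definition \<phi> where "\<phi> y = K (1, 1) y"

lemma one_one_in_B: "(1, 1) \<in> B"
  using one_in n_ge by (auto simp: B_def)

text \<open>The coefficient of \<open>F\<^sub>1\<close> forces equal second indices and leaves a power of \<open>a\<close>; then the coefficient of \<open>v 1\<close> in a product
\<open>v k v l\<close> detects duality by \<open>N_one\<close>.\<close>

lemma pairing:
  assumes p: "p \<in> B" and q: "q \<in> B" shows "\<phi> (x p \<otimes>\<^bsub>A\<^esub> x q) = (if p = dual_index q then 1 else 0)"
proof -
  obtain k i where p': "p = (k, i)" "k \<in> {1..m}" "i \<in> {1..n - 1}" using p by (auto simp: B_def)
  obtain l j where q': "q = (l, j)" "l \<in> {1..m}" "j \<in> {1..n - 1}" using q by (auto simp: B_def)
  have one: "1 \<in> {1..n - 1}" using n_ge by simp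
  have vc: "v k \<in> carrier R" "v l \<in> carrier R" using v_closed p' q' by auto
  have "x p \<otimes>\<^bsub>A\<^esub> x q = w (v k \<otimes> v l) \<otimes>\<^bsub>A\<^esub> (D i \<otimes>\<^bsub>A\<^esub> D j)"
    using vc by (simp add: p' q' x_def w_mult A.m_ac w_closed D_closed)
  then have "\<rho> 1 (x p \<otimes>\<^bsub>A\<^esub> x q) = v k \<otimes> v l \<otimes> (if i = j then a [^] (j - 1) else \<zero>)"
    using \<rho>_mult[OF _ _ one, of "v k \<otimes> v l" "D i \<otimes>\<^bsub>A\<^esub> D j"] rho_one_mult_D[of i j] vc D_closed p' q' by auto
  also have "\<dots> = (if i = j then v k \<otimes> v ((\<tau> ^^ (j - 1)) l) else \<zero>)"
    using a_pow_v[OF q'(2), of "j - 1"] vc a_closed by (auto simp: R.m_assoc R.m_comm[of "v l"])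
  finally have r: "\<rho> 1 (x p \<otimes>\<^bsub>A\<^esub> x q) = (if i = j then v k \<otimes> v ((\<tau> ^^ (j - 1)) l) else \<zero>)" .
  have k0: "\<kappa> 1 \<zero> = 0" using \<kappa>_scale[OF one_in, of \<zero> 0] by simp
  have tl: "(\<tau> ^^ (j - 1)) l \<in> {1..m}" by (rule tau_pow_in[OF q'(2)])
  have kad: "additive_map R class_ring (\<kappa> 1)" by (rule additive_mapI) (use \<kappa>_add[OF one_in] in auto)
  have "\<kappa> 1 (v k \<otimes> v ((\<tau> ^^ (j - 1)) l)) = (\<Sum>r\<in>{1..m}. \<kappa> 1 (\<iota> (of_nat (N k ((\<tau> ^^ (j - 1)) l) r)) \<otimes> v r))"
    unfolding v_mult[OF p'(2) tl]
    using additive_map_finsum[OF R.abelian_group_axioms class_ring.abelian_group_axioms kad, of "{1..m}" "\<lambda>r. \<iota> (of_nat (N k ((\<tau> ^^ (j - 1)) l) r)) \<otimes> v r"]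
      v_closed by (simp add: class_ring_simps del: One_nat_def)
  also have "\<dots> = (\<Sum>r\<in>{1..m}. if r = 1 then of_nat (N k ((\<tau> ^^ (j - 1)) l) 1) else 0)"
  proof (rule sum.cong[OF refl])
    fix r assume r: "r \<in> {1..m}"
    show "\<kappa> 1 (\<iota> (of_nat (N k ((\<tau> ^^ (j - 1)) l) r)) \<otimes> v r) = (if r = 1 then of_nat (N k ((\<tau> ^^ (j - 1)) l) 1) else 0)"
      using \<kappa>_scale[OF one_in v_closed[OF r], of "of_nat (N k ((\<tau> ^^ (j - 1)) l) r)"] \<kappa>_v[OF one_in r] by auto
  qed
  also have "\<dots> = of_nat (N k ((\<tau> ^^ (j - 1)) l) 1)" using one_in by simp
  also have "\<dots> = (if (\<tau> ^^ (j - 1)) l = star k then 1 else 0)" using N_one[OF p'(2) tl] by auto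
  finally have "\<phi> (x p \<otimes>\<^bsub>A\<^esub> x q) = (if i = j \<and> (\<tau> ^^ (j - 1)) l = star k then 1 else 0)"
    using r k0 by (auto simp: \<phi>_def K_def)
  moreover have "(\<tau> ^^ (j - 1)) l = star k \<longleftrightarrow> k = (\<sigma> ^^ (j - 1)) (star l)"
    using star_sigma_pow[OF star_in[OF q'(2)], of "j - 1"] star_star[OF q'(2)] star_star[OF p'(2)]
      star_tau_pow[OF q'(2), of "j - 1"] by metis
  ultimately show ?thesis by (auto simp: p' q' dual_index_def)
qed

end

section \<open>Bilinear maps on tensor products\<close>

lemma module_hom_comp:
  "f \<in> LinearCombinations.module_hom R M N \<Longrightarrow> g \<in> LinearCombinations.module_hom R N Q \<Longrightarrow>
    (\<lambda>y. g (f y)) \<in> LinearCombinations.module_hom R M Q"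
  by (auto simp: LinearCombinations.module_hom_def Pi_def)

lemma module_hom_additive: "f \<in> LinearCombinations.module_hom R M N \<Longrightarrow> additive_map M N f"
  by (auto simp: LinearCombinations.module_hom_def intro!: additive_mapI)

context tensor_modules
begin

definition bilinear :: "('r, 'q, 'f) module_scheme \<Rightarrow> ('a \<Rightarrow> 'b \<Rightarrow> 'q) \<Rightarrow> bool" where
  "bilinear Q f \<longleftrightarrow> (\<forall>y\<in>carrier N. (\<lambda>x. f x y) \<in> LinearCombinations.module_hom R M Q) \<and>
     (\<forall>x\<in>carrier M. f x \<in> LinearCombinations.module_hom R N Q)"

lemma bilinearI:
  assumes "\<And>y. y \<in> carrier N \<Longrightarrow> (\<lambda>x. f x y) \<in> LinearCombinations.module_hom R M Q"
    and "\<And>x. x \<in> carrier M \<Longrightarrow> f x \<in> LinearCombinations.module_hom R N Q"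
  shows "bilinear Q f"
  using assms by (simp add: bilinear_def)

lemma bilinear_simps:
  assumes "bilinear Q f" "x \<in> carrier M" "y \<in> carrier N"
  shows "f x y \<in> carrier Q"
    and "x' \<in> carrier M \<Longrightarrow> f (x \<oplus>\<^bsub>M\<^esub> x') y = f x y \<oplus>\<^bsub>Q\<^esub> f x' y"
    and "y' \<in> carrier N \<Longrightarrow> f x (y \<oplus>\<^bsub>N\<^esub> y') = f x y \<oplus>\<^bsub>Q\<^esub> f x y'"
    and "r \<in> carrier R \<Longrightarrow> f (r \<odot>\<^bsub>M\<^esub> x) y = r \<odot>\<^bsub>Q\<^esub> f x y"
    and "r \<in> carrier R \<Longrightarrow> f x (r \<odot>\<^bsub>N\<^esub> y) = r \<odot>\<^bsub>Q\<^esub> f x y"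
  using assms by (auto simp: bilinear_def LinearCombinations.module_hom_def)

lemma bilinear_balanced: "bilinear Q f \<Longrightarrow> balanced Q f"
  by (rule balancedI) (simp_all add: bilinear_simps)

lemma lift_gen:
  assumes "Module.module R Q" "bilinear Q f" "x \<in> carrier M" "y \<in> carrier N"
  shows "tensor_lift Q f (gen x y) = f x y"
proof -
  interpret Q: Module.module R Q by (rule assms(1))
  show ?thesis by (rule tensor_lift_gen[OF Q.abelian_group_axioms bilinear_balanced]) (use assms in auto)
qed

lemma lift_hom:
  assumes Q: "Module.module R Q" and f: "bilinear Q f"
  shows "tensor_lift Q f \<in> LinearCombinations.module_hom R T Q"
proof -
  interpret Q: Module.module R Q by (rule Q)
  note ad = additive_tensor_lift[OF Q.abelian_group_axioms bilinear_balanced[OF f]]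
  have "tensor_lift Q f (r \<odot>\<^bsub>T\<^esub> u) = r \<odot>\<^bsub>Q\<^esub> tensor_lift Q f u" if "r \<in> carrier R" "u \<in> carrier T" for r u
    by (rule tensor_lift_smult[OF Q bilinear_balanced[OF f] bilinear_simps(4)[OF f] that]) auto
  then show ?thesis unfolding LinearCombinations.module_hom_def
    using additive_map_closed[OF ad] additive_map_add[OF ad] by auto
qed

lemma gen_smult_right:
  assumes "r \<in> carrier R" "x \<in> carrier M" "y \<in> carrier N"
  shows "gen x (r \<odot>\<^bsub>N\<^esub> y) = r \<odot>\<^bsub>T\<^esub> gen x y"
  using smult_gen[OF assms] gen_middle[OF assms] by simp

lemma gen_bilinear: "bilinear T gen"
  by (rule bilinearI) (auto simp: LinearCombinations.module_hom_def gen_closed gen_add_left gen_add_right smult_gen gen_smult_right)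

text \<open>Tensoring with a third, fixed factor: the map induced by a family of bilinear maps depends linearly on the parameter.
Coassociativity needs this, since the left-hand side lifts twice.\<close>

lemma lift_parameter:
  assumes Q: "Module.module R Q" and P: "Module.module R P" and bil: "\<And>s. s \<in> carrier P \<Longrightarrow> bilinear Q (f s)"
    and hom: "\<And>x y. x \<in> carrier M \<Longrightarrow> y \<in> carrier N \<Longrightarrow> (\<lambda>s. f s x y) \<in> LinearCombinations.module_hom R P Q"
    and u: "u \<in> carrier T"
  shows "(\<lambda>s. tensor_lift Q (f s) u) \<in> LinearCombinations.module_hom R P Q"
proof -
  interpret Q: Module.module R Q by (rule Q)
  interpret P: Module.module R P by (rule P)
  have ad: "additive_map T Q (tensor_lift Q (f s))" if "s \<in> carrier P" for s
    by (rule module_hom_additive[OF lift_hom[OF Q bil[OF that]]])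
  note cl = additive_map_closed[OF ad] and add = additive_map_add[OF ad]
  have fc: "f s x y \<in> carrier Q" if "s \<in> carrier P" "x \<in> carrier M" "y \<in> carrier N" for s x y
    using bilinear_simps(1)[OF bil] that .
  have 1: "tensor_lift Q (f (s \<oplus>\<^bsub>P\<^esub> s')) u = tensor_lift Q (f s) u \<oplus>\<^bsub>Q\<^esub> tensor_lift Q (f s') u"
    if s: "s \<in> carrier P" "s' \<in> carrier P" for s s'
  proof (rule tensor_map_eqI[OF Q.abelian_group_axioms ad _ _ u])
    show "additive_map T Q (\<lambda>u. tensor_lift Q (f s) u \<oplus>\<^bsub>Q\<^esub> tensor_lift Q (f s') u)"
      by (rule additive_mapI) (use s cl add Q.a_ac in auto)
    fix x y assume "x \<in> carrier M" "y \<in> carrier N"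
    then show "tensor_lift Q (f (s \<oplus>\<^bsub>P\<^esub> s')) (gen x y) = tensor_lift Q (f s) (gen x y) \<oplus>\<^bsub>Q\<^esub> tensor_lift Q (f s') (gen x y)"
      using s lift_gen[OF Q bil] LinearCombinations.module_hom_add[OF hom] by simp
  qed (use s in auto)
  have 2: "tensor_lift Q (f (r \<odot>\<^bsub>P\<^esub> s)) u = r \<odot>\<^bsub>Q\<^esub> tensor_lift Q (f s) u"
    if s: "s \<in> carrier P" and r: "r \<in> carrier R" for s r
  proof (rule tensor_map_eqI[OF Q.abelian_group_axioms ad _ _ u])
    show "additive_map T Q (\<lambda>u. r \<odot>\<^bsub>Q\<^esub> tensor_lift Q (f s) u)"
      by (rule additive_mapI) (use s r cl add Q.smult_r_distr in auto)
    fix x y assume "x \<in> carrier M" "y \<in> carrier N"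
    then show "tensor_lift Q (f (r \<odot>\<^bsub>P\<^esub> s)) (gen x y) = r \<odot>\<^bsub>Q\<^esub> tensor_lift Q (f s) (gen x y)"
      using s r lift_gen[OF Q bil] LinearCombinations.module_hom_smult[OF hom] by simp
  qed (use s r in auto)
  show ?thesis unfolding LinearCombinations.module_hom_def using 1 2 cl[OF _ u] by auto
qed

end

section \<open>The bi-Frobenius structure\<close>

context fusion_quotient
begin

abbreviation "lhom P Q \<equiv> LinearCombinations.module_hom class_ring P Q"

interpretation TA: tensor_modules class_ring A A
  by (intro tensor_modules.intro module_A class_cring.is_cring)

interpretation TAA: tensor_modules class_ring A "tensor class_ring A A"
  by (intro tensor_modules.intro module_A TA.module_tensor class_cring.is_cring)

abbreviation "AA \<equiv> tensor class_ring A A"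
abbreviation "AAA \<equiv> tensor class_ring A AA"
abbreviation "g2 \<equiv> tensor_gen class_ring A A"
abbreviation "g3 \<equiv> tensor_gen class_ring A AA"

lemma hom_smult: "f \<in> lhom P Q \<Longrightarrow> y \<in> carrier P \<Longrightarrow> f (c \<odot>\<^bsub>P\<^esub> y) = c \<odot>\<^bsub>Q\<^esub> f y"
  for c :: complex
  using LinearCombinations.module_hom_smult[of f class_ring P Q c y] by simp

lemma hom_closed: "f \<in> lhom P Q \<Longrightarrow> y \<in> carrier P \<Longrightarrow> f y \<in> carrier Q"
  by (auto simp: LinearCombinations.module_hom_def)

lemma id_hom: "(\<lambda>y. y) \<in> lhom P P"
  by (auto simp: LinearCombinations.module_hom_def)

text \<open>Each \<open>e(p)\<^sup>-\<^sup>1 x p\<close> is made group-like.\<close>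

definition \<Delta> where "\<Delta> = lin AA (\<lambda>p. inverse (e p) \<odot>\<^bsub>AA\<^esub> g2 (x p) (x p))"

lemma g2_closed: "y \<in> carrier A \<Longrightarrow> y' \<in> carrier A \<Longrightarrow> g2 y y' \<in> carrier AA"
  by (rule TA.gen_closed)

lemma comult_term: "p \<in> B \<Longrightarrow> c \<odot>\<^bsub>AA\<^esub> g2 (x p) (x p) \<in> carrier AA"
  using TAA.NN.smult_closed[of c] g2_closed[OF x_closed x_closed] by simp

lemma \<Delta>_hom: "\<Delta> \<in> lhom A AA"
  unfolding \<Delta>_def by (rule lin_hom[OF TA.module_tensor comult_term])

lemma \<Delta>_x: "p \<in> B \<Longrightarrow> \<Delta> (x p) = inverse (e p) \<odot>\<^bsub>AA\<^esub> g2 (x p) (x p)"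
  unfolding \<Delta>_def by (rule lin_x[OF TA.module_tensor comult_term])

lemma lift_\<Delta>_x:
  assumes Q: "Module.module class_ring Q" and f: "TA.bilinear Q f" and p: "p \<in> B"
  shows "tensor_lift Q f (\<Delta> (x p)) = inverse (e p) \<odot>\<^bsub>Q\<^esub> f (x p) (x p)"
  unfolding \<Delta>_x[OF p] hom_smult[OF TA.lift_hom[OF Q f] g2_closed[OF x_closed[OF p] x_closed[OF p]]]
    TA.lift_gen[OF Q f x_closed[OF p] x_closed[OF p]] ..

lemma lift_\<Delta>_hom:
  assumes Q: "Module.module class_ring Q" and f: "TA.bilinear Q f"
  shows "(\<lambda>y. tensor_lift Q f (\<Delta> y)) \<in> lhom A Q"
  by (rule module_hom_comp[OF \<Delta>_hom TA.lift_hom[OF Q f]])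

lemma g2_hom: "y \<in> carrier A \<Longrightarrow> g2 y \<in> lhom A AA" "y \<in> carrier A \<Longrightarrow> (\<lambda>u. g2 u y) \<in> lhom A AA"
  using TA.gen_bilinear by (simp_all add: TA.bilinear_def)

lemma g3_hom: "y \<in> carrier A \<Longrightarrow> g3 y \<in> lhom AA AAA" "u \<in> carrier AA \<Longrightarrow> (\<lambda>y. g3 y u) \<in> lhom A AAA"
  using TAA.gen_bilinear by (simp_all add: TAA.bilinear_def)

lemma assoc_bilinear: "y \<in> carrier A \<Longrightarrow> TA.bilinear AAA (\<lambda>u v. g3 u (g2 v y))"
proof (rule TA.bilinearI)
  fix u assume "y \<in> carrier A" "u \<in> carrier A"
  then show "(\<lambda>v. g3 v (g2 u y)) \<in> lhom A AAA" by (intro g3_hom g2_closed)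
next
  fix u assume "y \<in> carrier A" "u \<in> carrier A"
  then show "(\<lambda>v. g3 u (g2 v y)) \<in> lhom A AAA" by (intro module_hom_comp[OF g2_hom(2) g3_hom(1)])
qed

text \<open>Both sides send \<open>x p\<close> to \<open>e(p)\<^sup>-\<^sup>2 x p \<otimes> (x p \<otimes> x p)\<close>. Most of the work lies in seeing that they are linear.\<close>

lemma comult_coassociative:
  assumes y: "y \<in> carrier A"
  shows "tensor_lift AAA (\<lambda>x1 x2. tensor_lift AAA (\<lambda>u v. g3 u (g2 v x2)) (\<Delta> x1)) (\<Delta> y)
    = tensor_lift AAA (\<lambda>x1 x2. g3 x1 (\<Delta> x2)) (\<Delta> y)"
proof -
  note Q = TAA.module_tensor
  have b1: "TA.bilinear AAA (\<lambda>x1 x2. tensor_lift AAA (\<lambda>u v. g3 u (g2 v x2)) (\<Delta> x1))"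
  proof (rule TA.bilinearI)
    fix x2 assume "x2 \<in> carrier A"
    then show "(\<lambda>x1. tensor_lift AAA (\<lambda>u v. g3 u (g2 v x2)) (\<Delta> x1)) \<in> lhom A AAA"
      by (rule lift_\<Delta>_hom[OF Q assoc_bilinear])
  next
    fix x1 assume x1: "x1 \<in> carrier A"
    show "(\<lambda>x2. tensor_lift AAA (\<lambda>u v. g3 u (g2 v x2)) (\<Delta> x1)) \<in> lhom A AAA"
      by (rule TA.lift_parameter[OF Q module_A assoc_bilinear module_hom_comp[OF g2_hom(1) g3_hom(1)] hom_closed[OF \<Delta>_hom x1]])
  qed
  have b2: "TA.bilinear AAA (\<lambda>x1 x2. g3 x1 (\<Delta> x2))"
    by (rule TA.bilinearI) (intro g3_hom(2) hom_closed[OF \<Delta>_hom] module_hom_comp[OF \<Delta>_hom g3_hom(1)]; assumption)+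
  show ?thesis
  proof (rule linear_ext[OF Q lift_\<Delta>_hom[OF Q b1] lift_\<Delta>_hom[OF Q b2] _ y])
    fix p assume p: "p \<in> B"
    note xp = x_closed[OF p]
    show "tensor_lift AAA (\<lambda>x1 x2. tensor_lift AAA (\<lambda>u v. g3 u (g2 v x2)) (\<Delta> x1)) (\<Delta> (x p))
      = tensor_lift AAA (\<lambda>x1 x2. g3 x1 (\<Delta> x2)) (\<Delta> (x p))"
      unfolding lift_\<Delta>_x[OF Q b1 p] lift_\<Delta>_x[OF Q b2 p] lift_\<Delta>_x[OF Q assoc_bilinear[OF xp] p]
      unfolding \<Delta>_x[OF p] hom_smult[OF g3_hom(1)[OF xp] g2_closed[OF xp xp]] ..
  qed
qed

lemma scale_bilinear:
  assumes f: "f \<in> lhom A CC"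
  shows "TA.bilinear A (\<lambda>x1 x2. f x1 \<odot>\<^bsub>A\<^esub> x2)" "TA.bilinear A (\<lambda>x1 x2. f x2 \<odot>\<^bsub>A\<^esub> x1)"
proof -
  have c: "(\<lambda>u. f u \<odot>\<^bsub>A\<^esub> y) \<in> lhom A A" if "y \<in> carrier A" for y
    using that f LinearCombinations.module_hom_add[OF f] hom_smult[OF f] AM.smult_l_distr[OF _ _ that] AM.smult_assoc1[OF _ _ that]
    unfolding LinearCombinations.module_hom_def by (auto simp: smult_closed_A)
  have r: "module.smult A k \<in> lhom A A" for k
    using AM.smult_r_distr[of k] AM.smult_assoc1[of k] AM.smult_assoc1[of _ k] unfolding LinearCombinations.module_hom_def
    by (auto simp: smult_closed_A mult.commute)
  show "TA.bilinear A (\<lambda>x1 x2. f x1 \<odot>\<^bsub>A\<^esub> x2)" "TA.bilinear A (\<lambda>x1 x2. f x2 \<odot>\<^bsub>A\<^esub> x1)"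
    by (rule TA.bilinearI; rule c r; assumption)+
qed

lemma e_inverse: "p \<in> B \<Longrightarrow> u \<in> carrier A \<Longrightarrow> inverse (e p) \<odot>\<^bsub>A\<^esub> (e p \<odot>\<^bsub>A\<^esub> u) = u"
  using AM.smult_assoc1[of "inverse (e p)" "e p" u] AM.smult_one[of u] e_nonzero[of p] by simp

lemma counit_axioms:
  assumes y: "y \<in> carrier A"
  shows "tensor_lift A (\<lambda>x1 x2. \<epsilon> x1 \<odot>\<^bsub>A\<^esub> x2) (\<Delta> y) = y" "tensor_lift A (\<lambda>x1 x2. \<epsilon> x2 \<odot>\<^bsub>A\<^esub> x1) (\<Delta> y) = y"
proof -
  note b = scale_bilinear[OF \<epsilon>_hom]
  show "tensor_lift A (\<lambda>x1 x2. \<epsilon> x1 \<odot>\<^bsub>A\<^esub> x2) (\<Delta> y) = y"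
    by (rule linear_ext[OF module_A lift_\<Delta>_hom[OF module_A b(1)] id_hom _ y])
      (simp add: lift_\<Delta>_x[OF module_A b(1)] \<epsilon>_x e_inverse x_closed)
  show "tensor_lift A (\<lambda>x1 x2. \<epsilon> x2 \<odot>\<^bsub>A\<^esub> x1) (\<Delta> y) = y"
    by (rule linear_ext[OF module_A lift_\<Delta>_hom[OF module_A b(2)] id_hom _ y])
      (simp add: lift_\<Delta>_x[OF module_A b(2)] \<epsilon>_x e_inverse x_closed)
qed

definition t where "t = (\<Oplus>\<^bsub>A\<^esub>p\<in>B. e p \<odot>\<^bsub>A\<^esub> x p)"

lemma t_closed: "t \<in> carrier A"
  unfolding t_def by (rule A.finsum_closed) (auto simp: smult_closed_A x_closed)

text \<open>The weights \<open>e p\<close> in \<open>t\<close> cancel the factors \<open>e(p)\<^sup>-\<^sup>1\<close> of \<open>\<Delta>\<close>, so that \<open>\<Delta> t = \<Sum> x p \<otimes> x p\<close>.\<close>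

lemma lift_\<Delta>_t:
  assumes Q: "Module.module class_ring Q" and f: "TA.bilinear Q f"
  shows "tensor_lift Q f (\<Delta> t) = (\<Oplus>\<^bsub>Q\<^esub>p\<in>B. f (x p) (x p))"
proof -
  interpret Q: Module.module class_ring Q by (rule Q)
  have fc: "f (x p) (x p) \<in> carrier Q" if "p \<in> B" for p
    using TA.bilinear_simps(1)[OF f x_closed[OF that] x_closed[OF that]] .
  have "tensor_lift Q f (\<Delta> t) = (\<Oplus>\<^bsub>Q\<^esub>p\<in>B. tensor_lift Q f (\<Delta> (e p \<odot>\<^bsub>A\<^esub> x p)))"
    unfolding t_def by (rule additive_map_finsum[OF A.abelian_group_axioms Q.abelian_group_axioms
        module_hom_additive[OF lift_\<Delta>_hom[OF Q f]]]) (rule smult_closed_A[OF x_closed])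
  also have "\<dots> = (\<Oplus>\<^bsub>Q\<^esub>p\<in>B. f (x p) (x p))"
  proof (rule Q.finsum_cong'[OF refl])
    fix p assume p: "p \<in> B"
    show "tensor_lift Q f (\<Delta> (e p \<odot>\<^bsub>A\<^esub> x p)) = f (x p) (x p)"
      unfolding hom_smult[OF lift_\<Delta>_hom[OF Q f] x_closed[OF p]] lift_\<Delta>_x[OF Q f p]
      using Q.smult_assoc1[of "e p" "inverse (e p)" "f (x p) (x p)"] Q.smult_one[of "f (x p) (x p)"] fc[OF p] e_nonzero[OF p] by simp
  qed (use fc in auto)
  finally show ?thesis .
qed

lemma K_hom: "p \<in> B \<Longrightarrow> K p \<in> lhom A CC"
  unfolding LinearCombinations.module_hom_def by (auto simp: K_add K_smult)

lemma \<phi>_hom: "\<phi> \<in> lhom A CC"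
  using K_hom[OF one_one_in_B] by (simp add: \<phi>_def[abs_def])

text \<open>The basis \<open>x (dual_index p)\<close> is dual to the basis \<open>x p\<close>, so it computes coordinates.\<close>

lemma K_pairing:
  assumes p: "p \<in> B" and y: "y \<in> carrier A" shows "K p y = \<phi> (y \<otimes>\<^bsub>A\<^esub> x (dual_index p))"
proof -
  note xs = x_closed[OF dual_index_B[OF p]]
  have "K p y = \<phi> (x (dual_index p) \<otimes>\<^bsub>A\<^esub> y)"
    by (rule linear_ext[OF module_CC K_hom[OF p] left_mult_hom[OF module_CC \<phi>_hom xs] _ y])
      (use p in \<open>auto simp: K_x pairing dual_index_B A.m_comm[OF xs x_closed] dual_index_dual_index\<close>)
  then show ?thesis using A.m_comm[OF xs y] by simp
qed

lemma dual_index_bij: "inj_on dual_index B" "dual_index ` B = B"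
proof -
  show "inj_on dual_index B" using dual_index_dual_index by (intro inj_onI) metis
  show "dual_index ` B = B" using dual_index_dual_index dual_index_B by force
qed

text \<open>Expand \<open>y\<close> in the basis \<open>x\<close>, apply \<open>S\<close>, and reindex by the involution.\<close>

lemma S_dual_bases:
  assumes y: "y \<in> carrier A" shows "S y = (\<Oplus>\<^bsub>A\<^esub>p\<in>B. \<phi> (x p \<otimes>\<^bsub>A\<^esub> y) \<odot>\<^bsub>A\<^esub> x p)"
proof -
  have "S y = (\<Oplus>\<^bsub>A\<^esub>p\<in>B. \<phi> (x (dual_index p) \<otimes>\<^bsub>A\<^esub> y) \<odot>\<^bsub>A\<^esub> x (dual_index p))"
    unfolding S_def lin_def
    by (rule A.finsum_cong'[OF refl])
      (auto simp: smult_closed_A x_closed dual_index_B K_pairing[OF _ y] A.m_comm[OF y x_closed[OF dual_index_B]])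
  also have "\<dots> = (\<Oplus>\<^bsub>A\<^esub>p\<in>dual_index ` B. \<phi> (x p \<otimes>\<^bsub>A\<^esub> y) \<odot>\<^bsub>A\<^esub> x p)"
    by (rule A.finsum_reindex[symmetric]) (use dual_index_bij in \<open>auto simp: smult_closed_A x_closed\<close>)
  finally show ?thesis unfolding dual_index_bij(2) .
qed

lemma \<phi>_mult_hom: "y \<in> carrier A \<Longrightarrow> (\<lambda>u. \<phi> (u \<otimes>\<^bsub>A\<^esub> y)) \<in> lhom A CC"
  using left_mult_hom[OF module_CC \<phi>_hom, of y]
  by (auto simp: LinearCombinations.module_hom_def A.l_distr smult_mult hom_smult[OF \<phi>_hom] LinearCombinations.module_hom_add[OF \<phi>_hom])

text \<open>An element orthogonal to everything has vanishing coordinates.\<close>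

lemma nondegenerate:
  assumes y: "y \<in> carrier A" and 0: "\<And>y'. y' \<in> carrier A \<Longrightarrow> \<phi> (y \<otimes>\<^bsub>A\<^esub> y') = 0"
  shows "y = \<zero>\<^bsub>A\<^esub>"
proof -
  have "y = (\<Oplus>\<^bsub>A\<^esub>p\<in>B. K p y \<odot>\<^bsub>A\<^esub> x p)" by (rule expand[OF y, symmetric])
  also have "\<dots> = (\<Oplus>\<^bsub>A\<^esub>p\<in>B. \<zero>\<^bsub>A\<^esub>)"
  proof (rule A.finsum_cong'[OF refl])
    fix p assume p: "p \<in> B"
    have "K p y = 0" using K_pairing[OF p y] 0[OF x_closed[OF dual_index_B[OF p]]] by simp
    then show "K p y \<odot>\<^bsub>A\<^esub> x p = \<zero>\<^bsub>A\<^esub>" using AM.smult_l_null[OF x_closed[OF p]] by simp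
  qed auto
  finally show ?thesis by simp
qed

lemma K_sum:
  assumes q: "q \<in> B" shows "K q (\<Oplus>\<^bsub>A\<^esub>p\<in>B. c p \<odot>\<^bsub>A\<^esub> x p) = c q"
proof -
  interpret CC: cring CC by (rule cring_CC)
  have "K q (\<Oplus>\<^bsub>A\<^esub>p\<in>B. c p \<odot>\<^bsub>A\<^esub> x p) = (\<Oplus>\<^bsub>CC\<^esub>p\<in>B. K q (c p \<odot>\<^bsub>A\<^esub> x p))"
    by (rule additive_map_finsum[OF A.abelian_group_axioms CC.abelian_group_axioms
        module_hom_additive[OF K_hom[OF q]]]) (rule smult_closed_A[OF x_closed])
  also have "\<dots> = K q (c q \<odot>\<^bsub>A\<^esub> x q)"
    by (rule CC.finsum_single[OF finite_B q]) (use q in \<open>auto simp: K_smult x_closed K_x\<close>)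
  finally show ?thesis using q by (simp add: K_smult x_closed K_x)
qed

text \<open>By \<open>lift_\<Delta>_t\<close> the map is \<open>f \<mapsto> \<Sum> f(x p) x p\<close>, which sends the coordinates of \<open>f\<close> in the dual basis to those in \<open>x\<close>.\<close>

lemma t_frobenius_coalgebra:
  "bij_betw (\<lambda>f. tensor_lift A (\<lambda>t1 t2. f t1 \<odot>\<^bsub>A\<^esub> t2) (\<Delta> t)) (dual_space class_ring A) (carrier A)"
proof -
  let ?\<Phi> = "\<lambda>f. \<Oplus>\<^bsub>A\<^esub>p\<in>B. f (x p) \<odot>\<^bsub>A\<^esub> x p"
  have eq: "tensor_lift A (\<lambda>t1 t2. f t1 \<odot>\<^bsub>A\<^esub> t2) (\<Delta> t) = ?\<Phi> f" if "f \<in> dual_space class_ring A" for f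
    by (rule lift_\<Delta>_t[OF module_A scale_bilinear(1)]) (use that in \<open>simp add: dual_space_def\<close>)
  have "inj_on ?\<Phi> (dual_space class_ring A)"
  proof (rule inj_onI)
    fix f g assume f: "f \<in> dual_space class_ring A" and g: "g \<in> dual_space class_ring A" and fg: "?\<Phi> f = ?\<Phi> g"
    have fx: "f (x p) = g (x p)" if "p \<in> B" for p
      using K_sum[OF that, of "\<lambda>p. f (x p)"] K_sum[OF that, of "\<lambda>p. g (x p)"] fg by simp
    have h: "f \<in> lhom A CC" "g \<in> lhom A CC" and ext: "f \<in> extensional (carrier A)" "g \<in> extensional (carrier A)"
      using f g by (auto simp: dual_space_def)
    show "f = g" by (rule extensionalityI[OF ext]) (rule linear_ext[OF module_CC h fx])
  qed
  moreover have "?\<Phi> ` dual_space class_ring A = carrier A"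
  proof
    show "?\<Phi> ` dual_space class_ring A \<subseteq> carrier A"
      by (intro image_subsetI A.finsum_closed) (auto simp: smult_closed_A x_closed)
    show "carrier A \<subseteq> ?\<Phi> ` dual_space class_ring A"
    proof
      fix y assume y: "y \<in> carrier A"
      let ?f = "restrict (lin CC (\<lambda>p. K p y)) (carrier A)"
      have h: "lin CC (\<lambda>p. K p y) \<in> lhom A CC" by (rule lin_hom[OF module_CC]) simp
      have f: "?f \<in> dual_space class_ring A"
        using h unfolding dual_space_def LinearCombinations.module_hom_def
        by (auto simp: smult_closed_A)
      have fx: "?f (x p) = K p y" if "p \<in> B" for p
        using lin_x[OF module_CC _ that, of "\<lambda>p. K p y"] x_closed[OF that] by simp
      have "?\<Phi> ?f = (\<Oplus>\<^bsub>A\<^esub>p\<in>B. K p y \<odot>\<^bsub>A\<^esub> x p)"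
        by (rule A.finsum_cong'[OF refl]) (use fx in \<open>auto simp: smult_closed_A x_closed\<close>)
      then have "y = ?\<Phi> ?f" using expand[OF y] by simp
      then show "y \<in> ?\<Phi> ` dual_space class_ring A" by (rule image_eqI[where f = ?\<Phi>]) (rule f)
    qed
  qed
  ultimately have "bij_betw ?\<Phi> (dual_space class_ring A) (carrier A)" by (simp add: bij_betw_def)
  then show ?thesis using eq by (simp cong: bij_betw_cong)
qed

lemma one_x: "\<one>\<^bsub>A\<^esub> = x (1, 1)" "e (1, 1) = 1"
  using v_one D_one w_one d_one Fc_simps by (simp_all add: x_def e_def)

text \<open>Both sides are \<open>e(p)\<^sup>-\<^sup>1 x (dual_index p) \<otimes> x (dual_index p)\<close> at \<open>x p\<close>, as \<open>e\<close> is invariant under \<open>dual_index\<close>.\<close>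

lemma S_anti_comult:
  assumes y: "y \<in> carrier A"
  shows "\<Delta> (S y) = tensor_lift AA (\<lambda>x1 x2. g2 (S x2) (S x1)) (\<Delta> y)"
proof -
  have b: "TA.bilinear AA (\<lambda>x1 x2. g2 (S x2) (S x1))"
    by (rule TA.bilinearI) (rule module_hom_comp[OF S_hom g2_hom(1)] module_hom_comp[OF S_hom g2_hom(2)]; rule S_closed)+
  show ?thesis
  proof (rule linear_ext[OF TA.module_tensor module_hom_comp[OF S_hom \<Delta>_hom] lift_\<Delta>_hom[OF TA.module_tensor b] _ y])
    fix p assume p: "p \<in> B"
    show "\<Delta> (S (x p)) = tensor_lift AA (\<lambda>x1 x2. g2 (S x2) (S x1)) (\<Delta> (x p))"
      unfolding lift_\<Delta>_x[OF TA.module_tensor b p] S_x[OF p] \<Delta>_x[OF dual_index_B[OF p]] e_dual_index[OF p] ..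
  qed
qed

theorem bi_frobenius: "bi_frobenius_algebra class_ring A \<Delta> \<epsilon> \<phi> t S"
proof unfold_locales
  show "AV.fin_dim" by (rule fin_dim_A)
  show "\<Delta> \<in> lhom A AA" by (rule \<Delta>_hom)
  show "\<epsilon> \<in> lhom A CC" by (rule \<epsilon>_hom)
  show "\<phi> \<in> lhom A CC" by (rule \<phi>_hom)
  show "S \<in> lhom A A" by (rule S_hom)
  show "t \<in> carrier A" by (rule t_closed)
  show "S \<one>\<^bsub>A\<^esub> = \<one>\<^bsub>A\<^esub>" by (rule S_one)
  show "\<epsilon> \<in> Ring.ring_hom A class_ring"
    by (rule ring_hom_memI) (simp_all add: \<epsilon>_add \<epsilon>_mult \<epsilon>_one)
  show "\<Delta> \<one>\<^bsub>A\<^esub> = g2 \<one>\<^bsub>A\<^esub> \<one>\<^bsub>A\<^esub>"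
    unfolding one_x(1) \<Delta>_x[OF one_one_in_B] one_x(2) using TAA.NN.smult_one[OF g2_closed[OF x_closed[OF one_one_in_B] x_closed[OF one_one_in_B]]] by simp
  show "bij_betw (\<lambda>f. tensor_lift A (\<lambda>t1 t2. f t1 \<odot>\<^bsub>A\<^esub> t2) (\<Delta> t)) (dual_space class_ring A) (carrier A)"
    by (rule t_frobenius_coalgebra)
next
  fix y assume y: "y \<in> carrier A"
  show "let AA = tensor class_ring A A; AAA = tensor class_ring A AA in
      tensor_lift AAA (\<lambda>x1 x2. tensor_lift AAA (\<lambda>u v. tensor_gen class_ring A AA u (g2 v x2)) (\<Delta> x1)) (\<Delta> y) =
      tensor_lift AAA (\<lambda>x1 x2. tensor_gen class_ring A AA x1 (\<Delta> x2)) (\<Delta> y)"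
    unfolding Let_def by (rule comult_coassociative[OF y])
  show "tensor_lift A (\<lambda>x1 x2. \<epsilon> x1 \<odot>\<^bsub>A\<^esub> x2) (\<Delta> y) = y" "tensor_lift A (\<lambda>x1 x2. \<epsilon> x2 \<odot>\<^bsub>A\<^esub> x1) (\<Delta> y) = y"
    by (rule counit_axioms[OF y])+
  show "S y = tensor_lift A (\<lambda>t1 t2. \<phi> (t1 \<otimes>\<^bsub>A\<^esub> y) \<odot>\<^bsub>A\<^esub> t2) (\<Delta> t)"
    unfolding lift_\<Delta>_t[OF module_A scale_bilinear(1)[OF \<phi>_mult_hom[OF y]]] by (rule S_dual_bases[OF y])
  show "\<Delta> (S y) = tensor_lift AA (\<lambda>x1 x2. g2 (S x2) (S x1)) (\<Delta> y)" by (rule S_anti_comult[OF y])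
  show "\<epsilon> (S y) = \<epsilon> y"
    by (rule linear_ext[OF module_CC module_hom_comp[OF S_hom \<epsilon>_hom] \<epsilon>_hom _ y]) (simp add: S_x \<epsilon>_x dual_index_B e_dual_index)
next
  fix y assume y: "y \<in> carrier A" and 0: "\<And>y'. y' \<in> carrier A \<Longrightarrow> \<phi> (y \<otimes>\<^bsub>A\<^esub> y') = \<zero>\<^bsub>class_ring\<^esub>"
  show "y = \<zero>\<^bsub>A\<^esub>" by (rule nondegenerate[OF y]) (use 0 in simp)
next
  fix y assume y: "y \<in> carrier A" and 0: "\<And>y'. y' \<in> carrier A \<Longrightarrow> \<phi> (y' \<otimes>\<^bsub>A\<^esub> y) = \<zero>\<^bsub>class_ring\<^esub>"
  show "y = \<zero>\<^bsub>A\<^esub>" by (rule nondegenerate[OF y]) (use 0 A.m_comm[OF y] in simp)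
next
  fix y y' assume y: "y \<in> carrier A" "y' \<in> carrier A"
  show "S (y \<otimes>\<^bsub>A\<^esub> y') = S y' \<otimes>\<^bsub>A\<^esub> S y" unfolding S_mult[OF y] by (rule A.m_comm[OF S_closed S_closed])
qed (auto simp: smult_mult mult_smult)

end

section \<open>The structure maps on monomials\<close>

text \<open>The ballot numbers: for \<open>1 \<le> k \<le> j / 2\<close> this equals \<open>(j choose k) - (j choose (k - 1))\<close>, and for \<open>j = 2 k\<close> the \<open>k\<close>-th Catalan number.
Truncated subtraction in the numerator gives the value \<open>0\<close> for \<open>2 k > j\<close>.\<close>

definition catalan_coef :: "nat \<Rightarrow> nat \<Rightarrow> complex" where
  "catalan_coef j k = complex_of_nat (j choose k) * (complex_of_nat (j + 1 - 2 * k) / complex_of_nat (j + 1 - k))"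

lemma catalan_coef_zero: "catalan_coef j 0 = 1"
  using of_nat_neq_0[of j, where 'a = complex] by (simp add: catalan_coef_def)

lemma catalan_coef_beyond: "j < 2 * k \<Longrightarrow> catalan_coef j k = 0"
  by (simp add: catalan_coef_def)

text \<open>The recursion of the ballot numbers. It breaks down at \<open>j = 2 k\<close>, where the Dickson index of the term in question is \<open>0\<close>.\<close>

lemma catalan_coef_Suc:
  assumes "2 * k < j"
  shows "catalan_coef (Suc j) (Suc k) = catalan_coef j (Suc k) + catalan_coef j k"
proof -
  obtain r where r: "j = 2 * k + 1 + r" using assms by (metis add.commute add.left_commute less_iff_Suc_add plus_1_eq_Suc)
  define C where "C = complex_of_nat (j choose k)"
  have nz: "complex_of_nat (Suc k) \<noteq> 0" "complex_of_nat (k + 1 + r) \<noteq> 0" "complex_of_nat (k + 2 + r) \<noteq> 0"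
    unfolding of_nat_eq_0_iff by simp_all
  have "Suc k * (j choose Suc k) = (j - k) * (j choose k)"
    using binomial_absorb_comp[of j k] binomial_absorption[of k "j"] by (metis binomial_absorption binomial_absorb_comp)
  then have "complex_of_nat (Suc k) * complex_of_nat (j choose Suc k) = complex_of_nat (k + 1 + r) * C"
    unfolding C_def of_nat_mult[symmetric] r by simp
  then have c1: "complex_of_nat (j choose Suc k) = C * complex_of_nat (k + 1 + r) / complex_of_nat (Suc k)"
    using nz by (simp add: field_simps)
  have c2: "complex_of_nat (Suc j choose Suc k) = C + C * complex_of_nat (k + 1 + r) / complex_of_nat (Suc k)"
    using c1 by (simp add: C_def)
  have d: "Suc j + 1 - 2 * Suc k = r + 1" "Suc j + 1 - Suc k = k + 2 + r" "j + 1 - 2 * Suc k = r" "j + 1 - Suc k = k + 1 + r"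
    "j + 1 - 2 * k = r + 2" "j + 1 - k = k + 2 + r" using r by simp_all
  have "catalan_coef (Suc j) (Suc k) = (C + C * of_nat (k + 1 + r) / of_nat (Suc k)) * (of_nat (r + 1) / of_nat (k + 2 + r))"
    unfolding catalan_coef_def d c2 ..
  also have "\<dots> = C * of_nat (k + 1 + r) / of_nat (Suc k) * (of_nat r / of_nat (k + 1 + r)) + C * (of_nat (r + 2) / of_nat (k + 2 + r))"
  proof -
    have alg: "(C + C * u / s) * (p / q) = C * u / s * (p' / u) + C * (p'' / q)"
      if "s \<noteq> 0" "u \<noteq> 0" "q \<noteq> 0" "(s + u) * p = p' * q + p'' * s" for s u p q p' p'' :: complex
    proof -
      have "(C + C * u / s) * (p / q) = C * ((s + u) * p) / (s * q)" using that(1-3) by (simp add: field_simps)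
      also have "\<dots> = C * u / s * (p' / u) + C * (p'' / q)" unfolding that(4) using that(1-3) by (simp add: field_simps)
      finally show ?thesis .
    qed
    show ?thesis by (rule alg[OF nz(1,2,3)]) (simp add: algebra_simps)
  qed
  also have "\<dots> = catalan_coef j (Suc k) + catalan_coef j k"
    unfolding catalan_coef_def d c1 C_def[symmetric] ..
  finally show ?thesis .
qed

context fusion_quotient
begin

text \<open>Multiplication by \<open>z\<close> moves the index \<open>j + 1 - 2 k\<close> one step up or, together with one application of \<open>\<tau>\<close>, one step down.\<close>

lemma monomial_step:
  assumes i: "i \<in> {1..m}"
  shows "z \<otimes>\<^bsub>A\<^esub> (catalan_coef j k \<odot>\<^bsub>A\<^esub> wD ((\<tau> ^^ k) i) (j + 1 - 2 * k)) =
    catalan_coef j k \<odot>\<^bsub>A\<^esub> wD ((\<tau> ^^ k) i) (j + 2 - 2 * k) \<oplus>\<^bsub>A\<^esub> catalan_coef j k \<odot>\<^bsub>A\<^esub> wD ((\<tau> ^^ Suc k) i) (j - 2 * k)"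
proof (cases "2 * k \<le> j")
  case True
  then have s: "j + 1 - 2 * k = Suc (j - 2 * k)" "j + 2 - 2 * k = Suc (Suc (j - 2 * k))" by simp_all
  note t = tau_pow_in[OF i, of k]
  show ?thesis
    unfolding s mult_smult[OF z_closed wD_closed[OF t]] z_wD[OF t]
    using AM.smult_r_distr[of "catalan_coef j k" "wD ((\<tau> ^^ k) i) (Suc (Suc (j - 2 * k)))" "wD (\<tau> ((\<tau> ^^ k) i)) (j - 2 * k)"]
      wD_closed[OF t] wD_closed[OF tau_in[OF t]] by simp
next
  case False
  have 0: "0 \<odot>\<^bsub>A\<^esub> wD ((\<tau> ^^ k) i) l = \<zero>\<^bsub>A\<^esub>" for k l
    using AM.smult_l_null[OF wD_closed[OF tau_pow_in[OF i]]] by simp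
  show ?thesis using False catalan_coef_beyond[of j k] 0 z_closed by (simp del: funpow.simps)
qed

text \<open>The range of \<open>k\<close> is larger than needed, with zero terms for \<open>2 k > j\<close>, because the induction then need not distinguish the
parities of \<open>j\<close>.\<close>

lemma monomial_expansion_long:
  assumes i: "i \<in> {1..m}"
  shows "vz i j = (\<Oplus>\<^bsub>A\<^esub>k\<in>{..j}. catalan_coef j k \<odot>\<^bsub>A\<^esub> wD ((\<tau> ^^ k) i) (j + 1 - 2 * k))"
proof (induction j)
  case 0
  have "w (v i) \<in> carrier A" by (rule w_closed[OF v_closed[OF i]])
  moreover have "catalan_coef 0 0 = 1" by (rule catalan_coef_zero)
  ultimately show ?case using AM.smult_one[of "w (v i)"] vz_power[OF i, of 0] by (simp add: wD_def D_one)
next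
  case (Suc j)
  let ?P = "\<lambda>k. catalan_coef j k \<odot>\<^bsub>A\<^esub> wD ((\<tau> ^^ k) i) (j + 2 - 2 * k)"
  let ?Q = "\<lambda>k. catalan_coef j k \<odot>\<^bsub>A\<^esub> wD ((\<tau> ^^ Suc k) i) (j - 2 * k)"
  let ?R = "\<lambda>k. catalan_coef (Suc j) k \<odot>\<^bsub>A\<^esub> wD ((\<tau> ^^ k) i) (Suc j + 1 - 2 * k)"
  have cl: "c \<odot>\<^bsub>A\<^esub> wD ((\<tau> ^^ k) i) l \<in> carrier A" for c k l by (rule smult_closed_A[OF wD_closed[OF tau_pow_in[OF i]]])
  have 0: "0 \<odot>\<^bsub>A\<^esub> wD ((\<tau> ^^ k) i) l = \<zero>\<^bsub>A\<^esub>" for k l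
    using AM.smult_l_null[OF wD_closed[OF tau_pow_in[OF i]]] by simp
  have wc: "w (v i) \<in> carrier A" by (rule w_closed[OF v_closed[OF i]])
  have step: "?R (Suc k) = ?P (Suc k) \<oplus>\<^bsub>A\<^esub> ?Q k" for k
  proof (cases "2 * k < j")
    case True
    have s: "Suc j + 1 - 2 * Suc k = j - 2 * k" "j + 2 - 2 * Suc k = j - 2 * k" by simp_all
    show ?thesis unfolding catalan_coef_Suc[OF True] s
      using AM.smult_l_distr[of "catalan_coef j (Suc k)" "catalan_coef j k" "wD ((\<tau> ^^ Suc k) i) (j - 2 * k)"]
        wD_closed[OF tau_pow_in[OF i, of "Suc k"]] by simp
  next
    case False
    have 1: "wD ((\<tau> ^^ Suc k) i) 0 = \<zero>\<^bsub>A\<^esub>" by (rule wD_boundary(1)[OF tau_pow_in[OF i]])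
    have s: "Suc j + 1 - 2 * Suc k = 0" "j + 2 - 2 * Suc k = 0" "j - 2 * k = 0" using False by simp_all
    show ?thesis unfolding s 1 using AM.smult_r_null by simp
  qed
  have "vz i (Suc j) = z \<otimes>\<^bsub>A\<^esub> vz i j" using i wc z_closed by (simp add: vz_power A.m_ac del: One_nat_def atLeastAtMost_iff)
  also have "\<dots> = (\<Oplus>\<^bsub>A\<^esub>k\<in>{..j}. z \<otimes>\<^bsub>A\<^esub> (catalan_coef j k \<odot>\<^bsub>A\<^esub> wD ((\<tau> ^^ k) i) (j + 1 - 2 * k)))"
    unfolding Suc by (rule A.finsum_rdistr) (use cl z_closed in auto)
  also have "\<dots> = (\<Oplus>\<^bsub>A\<^esub>k\<in>{..j}. ?P k \<oplus>\<^bsub>A\<^esub> ?Q k)" unfolding monomial_step[OF i] ..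
  also have "\<dots> = (\<Oplus>\<^bsub>A\<^esub>k\<in>{..j}. ?P k) \<oplus>\<^bsub>A\<^esub> (\<Oplus>\<^bsub>A\<^esub>k\<in>{..j}. ?Q k)"
    by (rule A.finsum_addf) (use cl in blast)+
  also have "(\<Oplus>\<^bsub>A\<^esub>k\<in>{..j}. ?P k) = (\<Oplus>\<^bsub>A\<^esub>k\<in>{..Suc j}. ?P k)"
    using A.finsum_Suc[of ?P j] A.finsum_closed[of ?P "{..j}"] cl 0 catalan_coef_beyond[of j "Suc j"] by (simp del: funpow.simps)
  also have "\<dots> = (\<Oplus>\<^bsub>A\<^esub>k\<in>{..j}. ?P (Suc k)) \<oplus>\<^bsub>A\<^esub> ?P 0"
    by (rule A.finsum_Suc2) (use cl in blast)
  also have "(\<Oplus>\<^bsub>A\<^esub>k\<in>{..j}. ?P (Suc k)) \<oplus>\<^bsub>A\<^esub> ?P 0 \<oplus>\<^bsub>A\<^esub> (\<Oplus>\<^bsub>A\<^esub>k\<in>{..j}. ?Q k) =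
      ((\<Oplus>\<^bsub>A\<^esub>k\<in>{..j}. ?P (Suc k)) \<oplus>\<^bsub>A\<^esub> (\<Oplus>\<^bsub>A\<^esub>k\<in>{..j}. ?Q k)) \<oplus>\<^bsub>A\<^esub> ?P 0"
  proof -
    have "(\<Oplus>\<^bsub>A\<^esub>k\<in>{..j}. ?P (Suc k)) \<in> carrier A" "(\<Oplus>\<^bsub>A\<^esub>k\<in>{..j}. ?Q k) \<in> carrier A" "?P 0 \<in> carrier A"
      by (rule A.finsum_closed, use cl in blast)+ (rule cl)
    note c = this
    show ?thesis unfolding A.a_assoc[OF c(1,3,2)] A.a_comm[OF c(3,2)] A.a_assoc[OF c(1,2,3)] ..
  qed
  also have "(\<Oplus>\<^bsub>A\<^esub>k\<in>{..j}. ?P (Suc k)) \<oplus>\<^bsub>A\<^esub> (\<Oplus>\<^bsub>A\<^esub>k\<in>{..j}. ?Q k) = (\<Oplus>\<^bsub>A\<^esub>k\<in>{..j}. ?R (Suc k))"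
    unfolding step by (rule A.finsum_addf[symmetric]) (use cl in blast)+
  also have "?P 0 = ?R 0" by (simp add: catalan_coef_zero)
  also have "(\<Oplus>\<^bsub>A\<^esub>k\<in>{..j}. ?R (Suc k)) \<oplus>\<^bsub>A\<^esub> ?R 0 = (\<Oplus>\<^bsub>A\<^esub>k\<in>{..Suc j}. ?R k)"
    by (rule A.finsum_Suc2[symmetric]) (use cl in blast)
  finally show ?case .
qed

lemma monomial_expansion:
  assumes i: "i \<in> {1..m}"
  shows "vz i j = (\<Oplus>\<^bsub>A\<^esub>k\<in>{0..j div 2}. catalan_coef j k \<odot>\<^bsub>A\<^esub> wD ((\<tau> ^^ k) i) (j + 1 - 2 * k))"
  unfolding monomial_expansion_long[OF i]
proof (rule A.add.finprod_mono_neutral_cong_right)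
  fix k assume "k \<in> {..j} - {0..j div 2}"
  then have "j < 2 * k" by auto
  then show "catalan_coef j k \<odot>\<^bsub>A\<^esub> wD ((\<tau> ^^ k) i) (j + 1 - 2 * k) = \<zero>\<^bsub>A\<^esub>"
    using catalan_coef_beyond AM.smult_l_null[OF wD_closed[OF tau_pow_in[OF i]]] by simp
qed (use smult_closed_A[OF wD_closed[OF tau_pow_in[OF i]]] in auto)

text \<open>The expansion of a monomial reduces the formulas for all structure maps to their values on the basis \<open>x\<close>.\<close>

lemma hom_monomial:
  assumes Q: "Module.module class_ring Q" and f: "f \<in> lhom A Q" and i: "i \<in> {1..m}"
  shows "f (vz i j) = (\<Oplus>\<^bsub>Q\<^esub>k\<in>{0..j div 2}. catalan_coef j k \<odot>\<^bsub>Q\<^esub> f (wD ((\<tau> ^^ k) i) (j + 1 - 2 * k)))"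
proof -
  interpret Q: Module.module class_ring Q by (rule Q)
  note cl = wD_closed[OF tau_pow_in[OF i]]
  show ?thesis
    unfolding monomial_expansion[OF i] hom_smult[OF f cl, symmetric]
    by (rule additive_map_finsum[OF A.abelian_group_axioms Q.abelian_group_axioms module_hom_additive[OF f] smult_closed_A[OF cl]])
qed

lemma index_in_B:
  assumes "i \<in> {1..m}" "j \<in> {0..n - 2}" "k \<in> {0..j div 2}"
  shows "((\<tau> ^^ k) i, j + 1 - 2 * k) \<in> B"
proof -
  have "j + 1 - 2 * k \<in> {1..n - 1}" using assms(2,3) n_ge by auto
  then show ?thesis using tau_pow_in[OF assms(1)] by (simp add: B_def)
qed

lemma \<Delta>_monomial:
  assumes i: "i \<in> {1..m}" and j: "j \<in> {0..n - 2}"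
  shows "\<Delta> (vz i j) = (\<Oplus>\<^bsub>AA\<^esub>k\<in>{0..j div 2}. (catalan_coef j k * (1 / (of_nat (d i) * Fc (j + 1 - 2 * k)))) \<odot>\<^bsub>AA\<^esub>
    g2 (wD ((\<tau> ^^ k) i) (j + 1 - 2 * k)) (wD ((\<tau> ^^ k) i) (j + 1 - 2 * k)))"
proof -
  interpret AA: Module.module class_ring AA
    by (rule tensor_modules.module_tensor[OF tensor_modules.intro[OF class_cring.is_cring module_A module_A]])
  show ?thesis unfolding hom_monomial[OF AA.module_axioms \<Delta>_hom i]
  proof (rule AA.finsum_cong'[OF refl])
    fix k assume k: "k \<in> {0..j div 2}"
    note p = index_in_B[OF i j k]
    let ?g = "g2 (wD ((\<tau> ^^ k) i) (j + 1 - 2 * k)) (wD ((\<tau> ^^ k) i) (j + 1 - 2 * k))"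
    have g: "?g \<in> carrier AA" by (intro g2_closed wD_closed tau_pow_in i)
    have "e ((\<tau> ^^ k) i, j + 1 - 2 * k) = of_nat (d i) * Fc (j + 1 - 2 * k)"
      using d_tau_pow[OF i, of k] by (simp add: e_def)
    then have \<Delta>: "\<Delta> (wD ((\<tau> ^^ k) i) (j + 1 - 2 * k)) = (1 / (of_nat (d i) * Fc (j + 1 - 2 * k))) \<odot>\<^bsub>AA\<^esub> ?g"
      using \<Delta>_x[OF p] unfolding x_wD by (simp only: inverse_eq_divide)
    show "catalan_coef j k \<odot>\<^bsub>AA\<^esub> \<Delta> (wD ((\<tau> ^^ k) i) (j + 1 - 2 * k)) =
      (catalan_coef j k * (1 / (of_nat (d i) * Fc (j + 1 - 2 * k)))) \<odot>\<^bsub>AA\<^esub> ?g"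
      unfolding \<Delta> using AA.smult_assoc1[of "catalan_coef j k" "1 / (of_nat (d i) * Fc (j + 1 - 2 * k))", OF _ _ g] by simp
  next
    show "(\<lambda>k. (catalan_coef j k * (1 / (of_nat (d i) * Fc (j + 1 - 2 * k)))) \<odot>\<^bsub>AA\<^esub>
      g2 (wD ((\<tau> ^^ k) i) (j + 1 - 2 * k)) (wD ((\<tau> ^^ k) i) (j + 1 - 2 * k))) \<in> {0..j div 2} \<rightarrow> carrier AA"
      by (intro Pi_I AA.smult_closed g2_closed wD_closed tau_pow_in i) simp
  qed
qed

lemma a_b_pow: "a [^] k \<otimes> b [^] k = \<one>" for k :: nat
  using R.nat_pow_distrib[OF a_closed b_closed, of k] a_b by simp

lemma int_pow_neg: "a [^] (- int k) = b [^] k"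
proof (cases k)
  case (Suc l)
  have "inv (a [^] k) = b [^] k"
    by (rule R.comm_inv_char) (use a_closed b_closed a_b_pow in auto)
  then show ?thesis using Suc unfolding int_pow_def2 by (simp del: of_nat_Suc R.nat_pow_Suc)
qed (simp add: int_pow_def2)

text \<open>The powers collected are \<open>a\<^bsup>-(j-2k)\<^esup>\<close> from \<open>S\<close> on \<open>F\<^sub>j\<^sub>+\<^sub>1\<^sub>-\<^sub>2\<^sub>k\<close> and \<open>a\<^bsup>-k\<^esup>\<close> from
the dual of \<open>\<tau>\<^sup>k\<close>, which together give \<open>a\<^bsup>k-j\<^esup>\<close>.\<close>

lemma S_monomial:
  assumes i: "i \<in> {1..m}" and j: "j \<in> {0..n - 2}"
  shows "S (vz i j) = (\<Oplus>\<^bsub>A\<^esub>k\<in>{0..j div 2}. catalan_coef j k \<odot>\<^bsub>A\<^esub>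
    (w (v (star i) \<otimes> a [^] (int k - int j)) \<otimes>\<^bsub>A\<^esub> D (j + 1 - 2 * k)))"
  unfolding hom_monomial[OF module_A S_hom i]
proof (rule A.finsum_cong'[OF refl])
  have bc: "b [^] l \<in> carrier R" for l :: nat using b_closed by simp
  have vs: "v (star i) \<in> carrier R" by (rule v_closed[OF star_in[OF i]])
  fix k assume k: "k \<in> {0..j div 2}"
  have t: "(\<tau> ^^ k) i \<in> {1..m}" by (rule tau_pow_in[OF i])
  have e: "int k - int j = - int (j - k)" using k by auto
  have "S (wD ((\<tau> ^^ k) i) (j + 1 - 2 * k)) = w (b [^] (j - 2 * k)) \<otimes>\<^bsub>A\<^esub> wD (star ((\<tau> ^^ k) i)) (j + 1 - 2 * k)"
    using S_wD[OF t, of "j + 1 - 2 * k"] j k n_ge by (auto simp: diff_diff_eq)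
  also have "\<dots> = w (b [^] (j - 2 * k) \<otimes> v (star ((\<tau> ^^ k) i))) \<otimes>\<^bsub>A\<^esub> D (j + 1 - 2 * k)"
    using v_closed[OF star_in[OF t]] bc by (simp add: wD_def w_mult A.m_assoc w_closed D_closed)
  also have "b [^] (j - 2 * k) \<otimes> v (star ((\<tau> ^^ k) i)) = b [^] (j - 2 * k) \<otimes> (b [^] k \<otimes> v (star i))"
    using star_tau_pow[OF i, of k] b_pow_v[OF star_in[OF i], of k] by simp
  also have "\<dots> = b [^] (j - k) \<otimes> v (star i)"
  proof -
    have "j - 2 * k + k = j - k" using k by auto
    then have "b [^] (j - 2 * k) \<otimes> b [^] k = b [^] (j - k)" using R.nat_pow_mult[OF b_closed, of "j - 2 * k" k] by simp
    then show ?thesis using R.m_assoc[OF bc[of "j - 2 * k"] bc[of k] vs] by simp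
  qed
  also have "\<dots> = v (star i) \<otimes> a [^] (int k - int j)"
    unfolding e int_pow_neg by (rule R.m_comm[OF bc vs])
  finally show "catalan_coef j k \<odot>\<^bsub>A\<^esub> S (wD ((\<tau> ^^ k) i) (j + 1 - 2 * k)) =
    catalan_coef j k \<odot>\<^bsub>A\<^esub> (w (v (star i) \<otimes> a [^] (int k - int j)) \<otimes>\<^bsub>A\<^esub> D (j + 1 - 2 * k))" by simp
next
  have "v (star i) \<otimes> a [^] (int k - int j) \<in> carrier R" if "k \<in> {0..j div 2}" for k
  proof -
    have e: "int k - int j = - int (j - k)" using that by auto
    show ?thesis unfolding e int_pow_neg using v_closed[OF star_in[OF i]] b_closed by simp
  qed
  then show "(\<lambda>k. catalan_coef j k \<odot>\<^bsub>A\<^esub> (w (v (star i) \<otimes> a [^] (int k - int j)) \<otimes>\<^bsub>A\<^esub> D (j + 1 - 2 * k)))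
      \<in> {0..j div 2} \<rightarrow> carrier A"
    by (intro Pi_I smult_closed_A A.m_closed w_closed D_closed)
qed

lemma v_eq_int_pow:
  assumes i: "i \<in> {1..m}" shows "v i = a [^] (- int h) \<longleftrightarrow> (\<tau> ^^ h) i = 1"
proof -
  have ac: "a [^] h \<in> carrier R" and bc: "b [^] h \<in> carrier R" and vc: "v i \<in> carrier R"
    using a_closed b_closed v_closed[OF i] by auto
  have "v i = b [^] h \<longleftrightarrow> a [^] h \<otimes> v i = \<one>"
  proof
    assume "v i = b [^] h" then show "a [^] h \<otimes> v i = \<one>" using a_b_pow by simp
  next
    assume 1: "a [^] h \<otimes> v i = \<one>"
    have "v i = (a [^] h \<otimes> b [^] h) \<otimes> v i" using a_b_pow vc by simp
    also have "\<dots> = b [^] h \<otimes> (a [^] h \<otimes> v i)" using ac bc vc by (simp add: R.m_ac)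
    finally show "v i = b [^] h" using 1 bc by simp
  qed
  then show ?thesis
    unfolding int_pow_neg a_pow_v[OF i] using v_eq_iff[OF tau_pow_in[OF i] one_in] v_one by simp
qed

text \<open>The only term containing the unit element has \<open>j + 1 - 2 k = 1\<close>, hence \<open>k = j / 2\<close>, and its coefficient is a Catalan number.\<close>

lemma \<phi>_monomial:
  assumes i: "i \<in> {1..m}" and j: "j \<in> {0..n - 2}"
  shows "\<phi> (vz i j) = (if even j \<and> v i = a [^] (- int (j div 2))
    then complex_of_nat (j choose (j div 2)) * (2 / complex_of_nat (j + 2)) else 0)"
proof -
  let ?c = "if even j \<and> (\<tau> ^^ (j div 2)) i = 1 then catalan_coef j (j div 2) else 0"
  have fs: "finsum CC f I = sum f I" for f :: "nat \<Rightarrow> complex" and I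
    by (simp add: self_module_def class_ring_simps)
  have "\<phi> (vz i j) = (\<Sum>k\<in>{0..j div 2}. catalan_coef j k * \<phi> (wD ((\<tau> ^^ k) i) (j + 1 - 2 * k)))"
    unfolding hom_monomial[OF module_CC \<phi>_hom i] fs by simp
  also have "\<dots> = (\<Sum>k\<in>{0..j div 2}. if k = j div 2 then ?c else 0)"
  proof (rule sum.cong[OF refl])
    fix k assume k: "k \<in> {0..j div 2}"
    have "\<phi> (wD ((\<tau> ^^ k) i) (j + 1 - 2 * k)) = (if (1, 1) = ((\<tau> ^^ k) i, j + 1 - 2 * k) then 1 else 0)"
      using K_x[OF one_one_in_B index_in_B[OF i j k]] unfolding x_wD \<phi>_def by simp
    moreover have "1 = j + 1 - 2 * k \<longleftrightarrow> even j \<and> k = j div 2" using k by (simp add: atLeastAtMost_iff) presburger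
    ultimately show "catalan_coef j k * \<phi> (wD ((\<tau> ^^ k) i) (j + 1 - 2 * k)) = (if k = j div 2 then ?c else 0)" by auto
  qed
  also have "\<dots> = ?c" by simp
  finally have "\<phi> (vz i j) = ?c" .
  moreover have "catalan_coef j (j div 2) = complex_of_nat (j choose (j div 2)) * (2 / complex_of_nat (j + 2))" if "even j"
  proof -
    from that obtain h where h: "j = 2 * h" by (rule evenE)
    have half: "1 / u = 2 / (2 * u)" for u :: complex by (cases "u = 0") (auto simp: field_simps)
    have "complex_of_nat (j + 1 - 2 * h) / complex_of_nat (j + 1 - h) = 1 / complex_of_nat (h + 1)" by (simp add: h)
    also have "\<dots> = 2 / complex_of_nat (2 * (h + 1))" unfolding of_nat_mult of_nat_numeral by (rule half)
    also have "2 * (h + 1) = j + 2" using h by simp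
    finally show ?thesis by (simp add: catalan_coef_def h)
  qed
  ultimately show ?thesis unfolding v_eq_int_pow[OF i] by auto
qed

lemma \<epsilon>_values: "i \<in> {1..m} \<Longrightarrow> \<epsilon> (vz i 0) = of_nat (d i)" "\<epsilon> z = two_cos"
proof -
  assume i: "i \<in> {1..m}"
  have "vz i 0 = wD i 1" using w_closed[OF v_closed[OF i]] vz_power[OF i, of 0] D_one by (simp add: wD_def)
  then show "\<epsilon> (vz i 0) = of_nat (d i)" using \<epsilon>_wD[OF i, of 1] n_ge Fc_simps by simp
next
  show "\<epsilon> z = two_cos" using \<epsilon>_z[OF A.one_closed] \<epsilon>_one z_closed by simp
qed

lemma rc_product: "r \<in> carrier R \<Longrightarrow> rc (poly_const R r \<otimes>\<^bsub>PR\<^esub> dickson_poly R a s) = w r \<otimes>\<^bsub>A\<^esub> D s"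
  using rc_mult[OF const_closed F_closed, of r s] by (simp add: w_def D_def F_def)

end

section \<open>The stable Green algebra\<close>

theorem proposition6p5:
  fixes G :: "('g, 'e) monoid_scheme"
    and \<chi> :: "'g \<Rightarrow> 'k::{alg_closed_field, field_char_0}"
    and g :: 'g and n m :: nat
    and V :: "nat \<Rightarrow> ('g, 'k) rep"
    and \<tau> star :: "nat \<Rightarrow> nat"
  assumes datum: "nilpotent_group_datum G \<chi> g n"
    and simples: "complete_simple_reps G m V"
    and trivial: "rep_iso G (V 1) trivial_rep"
    and tau: "bij_betw \<tau> {1..m} {1..m}"
      "\<And>i. i \<in> {1..m} \<Longrightarrow>
        rep_iso G (rep_tensor (char_rep (\<lambda>h. inverse (\<chi> h))) (V i)) (V (\<tau> i))"
    and star: "\<And>i. i \<in> {1..m} \<Longrightarrow> star i \<in> {1..m} \<and> rep_iso G (rep_dual G (V i)) (V (star i))"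
  shows "let
      R = cgreen_ring G;
      a = green_char G \<chi>;
      A = stable_green_algebra G \<chi> n;
      AA = tensor class_ring A A;
      v = \<lambda>i. cgreen_class G (V i);
      d = \<lambda>i. complex_of_nat (rep_dim G (V i));
      c = complex_of_real (2 * cos (pi / real n));
      z = residue_class G \<chi> n (poly_var R);
      vz = \<lambda>i j. residue_class G \<chi> n (up_ring.monom (UP R) (v i) j);
      rF = \<lambda>r s. residue_class G \<chi> n (poly_const R r \<otimes>\<^bsub>UP R\<^esub> dickson_poly R a s);
      Fc = dickson class_ring 1 c;
      b = \<lambda>(i, j). (d i * Fc j) \<odot>\<^bsub>A\<^esub> rF (v i) j;
      I = {1..m} \<times> {1..n - 1};
      coef = \<lambda>j k. complex_of_nat (j choose k)
                        * (complex_of_nat (j + 1 - 2 * k) / complex_of_nat (j + 1 - k))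
    in
    inj_on (\<lambda>(i, j). vz i j) ({1..m} \<times> {0..n - 2}) \<and>
    vectorspace.basis class_ring A ((\<lambda>(i, j). vz i j) ` ({1..m} \<times> {0..n - 2})) \<and>
    (\<exists>\<epsilon> \<phi> \<Delta> t S.
      bi_frobenius_algebra class_ring A \<Delta> \<epsilon> \<phi> t S \<and>
      (\<forall>i\<in>{1..m}. \<epsilon> (vz i 0) = d i) \<and> \<epsilon> z = c \<and>
      (\<forall>i\<in>{1..m}. \<forall>j\<in>{0..n - 2}.
        \<phi> (vz i j) =
          (if even j \<and> v i = a [^]\<^bsub>R\<^esub> (- int (j div 2))
           then complex_of_nat (j choose (j div 2)) * (2 / complex_of_nat (j + 2)) else 0)) \<and>
      (\<forall>i\<in>{1..m}. \<forall>j\<in>{0..n - 2}.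
        \<Delta> (vz i j) =
          (\<Oplus>\<^bsub>AA\<^esub>k\<in>{0..j div 2}.
             (coef j k * (1 / (d i * Fc (j + 1 - 2 * k)))) \<odot>\<^bsub>AA\<^esub>
             tensor_gen class_ring A A
               (rF (v ((\<tau> ^^ k) i)) (j + 1 - 2 * k)) (rF (v ((\<tau> ^^ k) i)) (j + 1 - 2 * k)))) \<and>
      t = finsum A b I \<and>
      (\<forall>i\<in>{1..m}. \<forall>j\<in>{0..n - 2}.
        S (vz i j) =
          (\<Oplus>\<^bsub>A\<^esub>k\<in>{0..j div 2}.
             coef j k \<odot>\<^bsub>A\<^esub>
             rF (v (star i) \<otimes>\<^bsub>R\<^esub> a [^]\<^bsub>R\<^esub> (int k - int j)) (j + 1 - 2 * k))))"
proof -
  interpret datum: nilpotent_group_datum G \<chi> g n by (rule datum)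
  interpret character_system G m V \<chi> \<tau> star
    by unfold_locales (use datum.finite_carrier simples datum.linear_character trivial tau star in auto)
  interpret BR: based_ring "cgreen_ring G :: (int, ('g, 'k) cgreen) module" scalar m cv coord
    by (rule based_ring_RC)
  \<comment> \<open>The structure of the algebra is governed by the fusion data of the group alone.\<close>
  interpret FQ: fusion_quotient "cgreen_ring G :: (int, ('g, 'k) cgreen) module" scalar m cv coord
      "green_char G \<chi>" n \<tau> star fusion "\<lambda>i. dm (V i)"
  proof unfold_locales
    show "green_char G \<chi> \<in> carrier RC"
      unfolding green_char_cv by (rule BR.v_closed[OF tau_in[OF one_in]])
    show "n \<ge> 2" by (rule datum.order_n(2))
    show "1 \<in> {1..m}" by (rule one_in)
    show "cv 1 = \<one>\<^bsub>RC\<^esub>" by (rule cv_one)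
    show "bij_betw \<tau> {1..m} {1..m}" by (rule tau_bij)
    show "star 1 = 1" by (rule star_one)
    show "dm (V 1) = 1" by (rule dim_V1)
    fix i assume i: "i \<in> {1..m}"
    show "green_char G \<chi> \<otimes>\<^bsub>RC\<^esub> cv i = cv (\<tau> i)" by (rule green_char_mult[OF i])
    show "star i \<in> {1..m}" "star (star i) = i" "\<tau> (star (\<tau> i)) = star i" "dm (V i) > 0" "dm (V (\<tau> i)) = dm (V i)" "dm (V (star i)) = dm (V i)"
      by (rule star_in[OF i] star_star[OF i] tau_star_tau[OF i] V_dim_pos[OF i] tau_dim[OF i] star_dim[OF i])+
    fix j assume j: "j \<in> {1..m}"
    show "cv i \<otimes>\<^bsub>RC\<^esub> cv j = (\<Oplus>\<^bsub>RC\<^esub>k\<in>{1..m}. scalar (of_nat (fusion i j k)) \<otimes>\<^bsub>RC\<^esub> cv k)" by (rule cv_mult[OF i j])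
    show "fusion i j 1 = (if j = star i then 1 else 0)" by (rule fusion_one[OF i j])
    show "dm (V i) * dm (V j) = (\<Sum>k\<in>{1..m}. fusion i j k * dm (V k))" by (rule fusion_dim[OF i j])
    fix k assume k: "k \<in> {1..m}"
    show "fusion (star i) (star j) (star k) = fusion i j k" by (rule fusion_star[OF i j k])
  qed
  have ideal: "dickson_ideal G \<chi> n = FQ.qI"
    by (simp add: dickson_ideal_def FQ.qI_def FQ.F_def)
  have res: "residue_class G \<chi> n = FQ.rc"
    by (rule ext) (simp add: residue_class_def FQ.rc_def ideal)
  have alg: "stable_green_algebra G \<chi> n = FQ.A"
    by (simp add: stable_green_algebra_def FQ.A_def ideal res Let_def)
  have z: "FQ.rc (poly_var RC) = FQ.z" by (simp add: FQ.z_def)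
  have vz: "FQ.rc (up_ring.monom (UP RC) (cv i) j) = FQ.vz i j" for i j by (simp add: FQ.vz_def)
  have Fc: "dickson class_ring 1 (complex_of_real (2 * cos (pi / real n))) = FQ.Fc"
    by (rule ext) (simp add: FQ.Fc_def FQ.two_cos_def)
  have two_cos: "complex_of_real (2 * cos (pi / real n)) = FQ.two_cos" by (simp add: FQ.two_cos_def)
  have coef: "complex_of_nat (j choose k) * (complex_of_nat (j + 1 - 2 * k) / complex_of_nat (j + 1 - k)) = catalan_coef j k" for j k
    by (simp add: catalan_coef_def)
  have rF: "FQ.rc (poly_const RC (cv i) \<otimes>\<^bsub>UP RC\<^esub> dickson_poly RC (green_char G \<chi>) s) = FQ.wD i s" if "i \<in> {1..m}" for i s
    unfolding FQ.wD_def by (rule FQ.rc_product[OF BR.v_closed[OF that]])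
  have power_closed: "green_char G \<chi> [^]\<^bsub>RC\<^esub> (int k - int j) \<in> carrier RC" if "k \<in> {0..j div 2}" for k j
  proof -
    have e: "int k - int j = - int (j - k)" using that by auto
    show ?thesis unfolding e FQ.int_pow_neg using FQ.b_closed by simp
  qed
  have t: "FQ.t = finsum FQ.A (\<lambda>(i, j). (complex_of_nat (dm (V i)) * FQ.Fc j) \<odot>\<^bsub>FQ.A\<^esub>
      FQ.rc (poly_const RC (cv i) \<otimes>\<^bsub>UP RC\<^esub> dickson_poly RC (green_char G \<chi>) j)) ({1..m} \<times> {1..n - 1})"
    unfolding FQ.t_def FQ.B_def
  proof (rule FQ.A.finsum_cong'[OF refl])
    fix p assume "p \<in> {1..m} \<times> {1..n - 1}"
    then obtain i j where p: "p = (i, j)" "i \<in> {1..m}" by auto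
    show "FQ.e p \<odot>\<^bsub>FQ.A\<^esub> FQ.x p = (case p of (i, j) \<Rightarrow> (complex_of_nat (dm (V i)) * FQ.Fc j) \<odot>\<^bsub>FQ.A\<^esub>
      FQ.rc (poly_const RC (cv i) \<otimes>\<^bsub>UP RC\<^esub> dickson_poly RC (green_char G \<chi>) j))"
      unfolding p(1) case_prod_conv rF[OF p(2)] FQ.x_wD FQ.e_def fst_conv snd_conv ..
  qed (auto simp: rF simp del: One_nat_def atLeastAtMost_iff intro!: FQ.smult_closed_A FQ.wD_closed)
  have \<Delta>: "FQ.\<Delta> (FQ.vz i j) = (\<Oplus>\<^bsub>FQ.AA\<^esub>k\<in>{0..j div 2}.
      (catalan_coef j k * (1 / (complex_of_nat (dm (V i)) * FQ.Fc (j + 1 - 2 * k)))) \<odot>\<^bsub>FQ.AA\<^esub>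
      tensor_gen class_ring FQ.A FQ.A
        (FQ.rc (poly_const RC (cv ((\<tau> ^^ k) i)) \<otimes>\<^bsub>UP RC\<^esub> dickson_poly RC (green_char G \<chi>) (j + 1 - 2 * k)))
        (FQ.rc (poly_const RC (cv ((\<tau> ^^ k) i)) \<otimes>\<^bsub>UP RC\<^esub> dickson_poly RC (green_char G \<chi>) (j + 1 - 2 * k))))"
    if "i \<in> {1..m}" "j \<in> {0..n - 2}" for i j
    unfolding rF[OF FQ.tau_pow_in[OF that(1)]] by (rule FQ.\<Delta>_monomial[OF that])
  have S: "FQ.S (FQ.vz i j) = (\<Oplus>\<^bsub>FQ.A\<^esub>k\<in>{0..j div 2}. catalan_coef j k \<odot>\<^bsub>FQ.A\<^esub>
      FQ.rc (poly_const RC (cv (star i) \<otimes>\<^bsub>RC\<^esub> green_char G \<chi> [^]\<^bsub>RC\<^esub> (int k - int j)) \<otimes>\<^bsub>UP RC\<^esub>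
        dickson_poly RC (green_char G \<chi>) (j + 1 - 2 * k)))"
    if i: "i \<in> {1..m}" and j: "j \<in> {0..n - 2}" for i j
  proof -
    have r: "cv (star i) \<otimes>\<^bsub>RC\<^esub> green_char G \<chi> [^]\<^bsub>RC\<^esub> (int k - int j) \<in> carrier RC" if "k \<in> {0..j div 2}" for k
      by (intro BR.R.m_closed BR.v_closed star_in i power_closed that)
    show ?thesis unfolding FQ.S_monomial[OF i j]
      by (rule FQ.A.finsum_cong'[OF refl])
        (auto simp: FQ.rc_product[OF r] FQ.rc_product intro!: FQ.smult_closed_A FQ.A.m_closed FQ.w_closed FQ.D_closed r simp del: One_nat_def)
  qed
  show ?thesis
    unfolding Let_def alg res z vz two_cos[symmetric] Fc coef
    by (intro conjI FQ.vz_inj FQ.vz_basis, rule exI[of _ FQ.\<epsilon>], rule exI[of _ FQ.\<phi>], rule exI[of _ FQ.\<Delta>],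
        rule exI[of _ FQ.t], rule exI[of _ FQ.S])
      (intro conjI ballI FQ.bi_frobenius FQ.\<epsilon>_values(1) FQ.\<epsilon>_values(2)[folded two_cos] FQ.\<phi>_monomial \<Delta> t S)
qed

end
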